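(* Let $\mathcal{C}$ be a bicategory equipped with a system of fibrant objects $(\mathfrak{W},Q,\eta)$, let $\mathbf{Ho}(\mathcal{C})$ be its homotopy bicategory, and let $I\colon\mathcal{C}\to\mathbf{Ho}(\mathcal{C})$ be the pseudofunctor induced by $Q$. Then for any bicategory $\mathcal{D}$, precomposition with $I$ induces an equivalence of bicategories $$[I,\mathcal{D}]\colon[\mathbf{Ho}(\mathcal{C}),\mathcal{D}]\longrightarrow[\mathcal{C},\mathcal{D}]_{\mathfrak{W}}.$$
   Context: For bicategories $\mathcal{C},\mathcal{D}$, $[\mathcal{C},\mathcal{D}]$ is the bicategory of pseudofunctors $\mathcal{C}\to\mathcal{D}$, pseudonatural transformations and modifications. An arrow $f\colon A\to B$ of a bicategory is an equivalence if there are $f'\colon B\to A$ and invertible 2-cells $f\circ f'\cong 1_B$ and $1_A\cong f'\circ f$. A pseudofunctor $F\colon\mathcal{C}\to\mathcal{D}$ is an equivalence of bicategories if there is a pseudofunctor $G\colon\mathcal{D}\to\mathcal{C}$ with maps $1_{\mathcal{C}}\to G\circ F$ and $F\circ G\to 1_{\mathcal{D}}$ that are equivalences in $[\mathcal{C},\mathcal{C}]$ and $[\mathcal{D},\mathcal{D}]$. The Axiom of Choice is assumed. For a class $\mathfrak{M}$ of arrows of $\mathcal{C}$ and an object $C$, write $\mathfrak{M}\pitchfork C$ if for all arrows $f\colon A\to B$ in $\mathfrak{M}$ and $h\colon A\to C$ there exist an arrow $l\colon B\to C$ and an invertible 2-cell $h\Rightarrow l\circ f$. A system of fibrant objects on a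 bicategory $\mathcal{C}$ consists of a collection $\mathfrak{W}$ of arrows of $\mathcal{C}$ (weak equivalences), a pseudofunctor $Q\colon\mathcal{C}\to\mathcal{C}$ (fibrant replacement) and a pseudonatural transformation $\eta\colon 1_{\mathcal{C}}\to Q$ such that: (Identities) all identity arrows are in $\mathfrak{W}$; (3-for-2) given arrows $f\colon A\to C$, $g\colon A\to B$, $h\colon B\to C$ and an invertible 2-cell $\gamma\colon f\Rightarrow h\circ g$, if any two of $f,g,h$ are in $\mathfrak{W}$ then so is the third; (Fibrant replacement) every component $\eta_A\colon A\to Q(A)$ is in $\mathfrak{W}$, and $\mathfrak{W}\pitchfork Q(A)$ for every object $A$. An object $A$ is fibrant when $\mathfrak{W}\pitchfork A$. The homotopy bicategory $\mathbf{Ho}(\mathcal{C})$ is the full sub-bicategory of $\mathcal{C}$ on the fibrant objects. Since each $Q(A)$ is fibrant, $Q$ factors as $Q=J\circ I$ with $J\colon\mathbf{Ho}(\mathcal{C})\to\mathcal{C}$ the inclusion; this defines $I$. $[\mathcal{C},\mathcal{D}]_{\mathfrak{W}}$ is the full sub-bicategory of $[\mathcal{C},\mathcal{D}]$ on those pseudofunctors which send every arrow of $\mathfrak{W}$ to an equivalence in $\mathcal{D}$. *)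

theory Defs
  imports "HOL-Library.FuncSet"
begin

section \<open>Bicategories\<close>

text \<open>
  A bicategory is given by sets of objects, arrows and 2-cells inside three types, with
  source and target maps. Both compositions are written in applicative order. They are total
  functions, constrained only on composable arguments.
\<close>

record ('o, 'm, 'c) bicat =
  Obj :: "'o set"
  Arr :: "'m set"
  Cell :: "'c set"
  src :: "'m \<Rightarrow> 'o"
  tgt :: "'m \<Rightarrow> 'o"
  Dom :: "'c \<Rightarrow> 'm"
  Cod :: "'c \<Rightarrow> 'm"
  one :: "'o \<Rightarrow> 'm"  ("\<one>\<index>")
  ocomp :: "'m \<Rightarrow> 'm \<Rightarrow> 'm"  (infixr "\<odot>\<index>" 75)
  idc :: "'m \<Rightarrow> 'c"
  vcomp :: "'c \<Rightarrow> 'c \<Rightarrow> 'c"  (infixr "\<cdot>\<index>" 70)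
  hcomp :: "'c \<Rightarrow> 'c \<Rightarrow> 'c"  (infixr "\<star>\<index>" 75)
  asc :: "'m \<Rightarrow> 'm \<Rightarrow> 'm \<Rightarrow> 'c"  \<comment> \<open>\<open>asc h g f : (h g) f \<Rightarrow> h (g f)\<close>\<close>
  lun :: "'m \<Rightarrow> 'c"  \<comment> \<open>\<open>lun f : 1 f \<Rightarrow> f\<close>\<close>
  run :: "'m \<Rightarrow> 'c"  \<comment> \<open>\<open>run f : f 1 \<Rightarrow> f\<close>\<close>

definition hom :: "('o, 'm, 'c) bicat \<Rightarrow> 'o \<Rightarrow> 'o \<Rightarrow> 'm set" where
  "hom C A B = {f \<in> Arr C. src C f = A \<and> tgt C f = B}"

definition cells :: "('o, 'm, 'c) bicat \<Rightarrow> 'm \<Rightarrow> 'm \<Rightarrow> 'c set" where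
  "cells C f g = {a \<in> Cell C. Dom C a = f \<and> Cod C a = g}"

definition composable :: "('o, 'm, 'c) bicat \<Rightarrow> 'm \<Rightarrow> 'm \<Rightarrow> bool" where
  "composable C g f \<longleftrightarrow> g \<in> Arr C \<and> f \<in> Arr C \<and> src C g = tgt C f"

definition inverse_cells :: "('o, 'm, 'c) bicat \<Rightarrow> 'c \<Rightarrow> 'c \<Rightarrow> bool" where
  "inverse_cells C a b \<longleftrightarrow>
     a \<in> cells C (Dom C a) (Cod C a) \<and> b \<in> cells C (Cod C a) (Dom C a) \<and>
     vcomp C b a = idc C (Dom C a) \<and> vcomp C a b = idc C (Cod C a)"

definition iso_cells :: "('o, 'm, 'c) bicat \<Rightarrow> 'm \<Rightarrow> 'm \<Rightarrow> 'c set" where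
  "iso_cells C f g = {a \<in> cells C f g. \<exists>b. inverse_cells C a b}"

definition inv_cell :: "('o, 'm, 'c) bicat \<Rightarrow> 'c \<Rightarrow> 'c" where
  "inv_cell C a = (THE b. inverse_cells C a b)"

locale bicategory =
  fixes C :: "('o, 'm, 'c) bicat" (structure)
  assumes arr_obj: "f \<in> Arr C \<Longrightarrow> src C f \<in> Obj C \<and> tgt C f \<in> Obj C"
    and cell_arr: "a \<in> Cell C \<Longrightarrow> Dom C a \<in> Arr C \<and> Cod C a \<in> Arr C"
    and cell_parallel: "a \<in> Cell C \<Longrightarrow>
      src C (Dom C a) = src C (Cod C a) \<and> tgt C (Dom C a) = tgt C (Cod C a)"
    and one_hom: "A \<in> Obj C \<Longrightarrow> \<one> A \<in> hom C A A"
    and ocomp_hom: "f \<in> hom C A B \<Longrightarrow> g \<in> hom C B E \<Longrightarrow> g \<odot> f \<in> hom C A E"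
    and idc_cells: "f \<in> Arr C \<Longrightarrow> idc C f \<in> cells C f f"
    and vcomp_cells: "a \<in> cells C f g \<Longrightarrow> b \<in> cells C g h \<Longrightarrow> b \<cdot> a \<in> cells C f h"
    and vcomp_assoc: "a \<in> cells C f g \<Longrightarrow> b \<in> cells C g h \<Longrightarrow> c \<in> cells C h k \<Longrightarrow>
      (c \<cdot> b) \<cdot> a = c \<cdot> (b \<cdot> a)"
    and vcomp_idc_left: "a \<in> cells C f g \<Longrightarrow> idc C g \<cdot> a = a"
    and vcomp_idc_right: "a \<in> cells C f g \<Longrightarrow> a \<cdot> idc C f = a"
    and hcomp_cells: "a \<in> cells C f f' \<Longrightarrow> b \<in> cells C g g' \<Longrightarrow> composable C g f \<Longrightarrow>
      b \<star> a \<in> cells C (g \<odot> f) (g' \<odot> f')"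
    and hcomp_idc: "composable C g f \<Longrightarrow> idc C g \<star> idc C f = idc C (g \<odot> f)"
    and interchange: "a \<in> cells C f f' \<Longrightarrow> a' \<in> cells C f' f'' \<Longrightarrow>
      b \<in> cells C g g' \<Longrightarrow> b' \<in> cells C g' g'' \<Longrightarrow> composable C g f \<Longrightarrow>
      (b' \<cdot> b) \<star> (a' \<cdot> a) = (b' \<star> a') \<cdot> (b \<star> a)"
    and asc_iso: "composable C h g \<Longrightarrow> composable C g f \<Longrightarrow>
      asc C h g f \<in> iso_cells C ((h \<odot> g) \<odot> f) (h \<odot> (g \<odot> f))"
    and asc_natural: "a \<in> cells C f f' \<Longrightarrow> b \<in> cells C g g' \<Longrightarrow> c \<in> cells C h h' \<Longrightarrow>
      composable C h g \<Longrightarrow> composable C g f \<Longrightarrow>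
      asc C h' g' f' \<cdot> ((c \<star> b) \<star> a) = (c \<star> (b \<star> a)) \<cdot> asc C h g f"
    and lun_iso: "f \<in> hom C A B \<Longrightarrow> lun C f \<in> iso_cells C (\<one> B \<odot> f) f"
    and lun_natural: "a \<in> cells C f f' \<Longrightarrow>
      lun C f' \<cdot> (idc C (\<one> (tgt C f)) \<star> a) = a \<cdot> lun C f"
    and run_iso: "f \<in> hom C A B \<Longrightarrow> run C f \<in> iso_cells C (f \<odot> \<one> A) f"
    and run_natural: "a \<in> cells C f f' \<Longrightarrow>
      run C f' \<cdot> (a \<star> idc C (\<one> (src C f))) = a \<cdot> run C f"
    and pentagon: "composable C k h \<Longrightarrow> composable C h g \<Longrightarrow> composable C g f \<Longrightarrow>
      asc C k h (g \<odot> f) \<cdot> asc C (k \<odot> h) g f =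
      (idc C k \<star> asc C h g f) \<cdot> asc C k (h \<odot> g) f \<cdot> (asc C k h g \<star> idc C f)"
    and triangle: "composable C g f \<Longrightarrow>
      (idc C g \<star> lun C f) \<cdot> asc C g (\<one> (tgt C f)) f = run C g \<star> idc C f"

definition equivalence_arrow :: "('o, 'm, 'c) bicat \<Rightarrow> 'm \<Rightarrow> bool" where
  "equivalence_arrow C f \<longleftrightarrow> f \<in> Arr C \<and>
     (\<exists>f' \<in> hom C (tgt C f) (src C f).
        iso_cells C (ocomp C f f') (one C (tgt C f)) \<noteq> {} \<and>
        iso_cells C (one C (src C f)) (ocomp C f' f) \<noteq> {})"

definition full_sub :: "('o, 'm, 'c) bicat \<Rightarrow> 'o set \<Rightarrow> ('o, 'm, 'c) bicat" where
  "full_sub C S = C\<lparr>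
     Obj := Obj C \<inter> S,
     Arr := {f \<in> Arr C. src C f \<in> S \<and> tgt C f \<in> S},
     Cell := {a \<in> Cell C. src C (Dom C a) \<in> S \<and> tgt C (Dom C a) \<in> S}\<rparr>"


section \<open>Pseudofunctors\<close>

text \<open>
  The maps making up a pseudofunctor, a pseudonatural transformation or a modification are
  required to take the value \<open>undefined\<close> outside their intended domain, so that HOL equality
  is equality of these structures. Domain and codomain of a pseudofunctor are not part of its data.
\<close>

record ('o, 'm, 'c, 'p, 'n, 'd) psf =
  ob_map :: "'o \<Rightarrow> 'p"
  ar_map :: "'m \<Rightarrow> 'n"
  ce_map :: "'c \<Rightarrow> 'd"
  pcomp :: "'m \<Rightarrow> 'm \<Rightarrow> 'd"  \<comment> \<open>\<open>pcomp F g f : F g \<odot> F f \<Rightarrow> F (g \<odot> f)\<close>\<close>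
  punit :: "'o \<Rightarrow> 'd"  \<comment> \<open>\<open>punit F A : 1 \<Rightarrow> F 1\<close>\<close>

locale pseudofunctor = C: bicategory C + D: bicategory D
  for C :: "('o, 'm, 'c) bicat" (structure) and D :: "('p, 'n, 'd) bicat" +
  fixes F :: "('o, 'm, 'c, 'p, 'n, 'd) psf"
  assumes ob_map_ext: "ob_map F \<in> extensional (Obj C)"
    and ar_map_ext: "ar_map F \<in> extensional (Arr C)"
    and ce_map_ext: "ce_map F \<in> extensional (Cell C)"
    and pcomp_ext: "\<not> composable C g f \<Longrightarrow> pcomp F g f = undefined"
    and punit_ext: "punit F \<in> extensional (Obj C)"
    and ob_map_obj: "A \<in> Obj C \<Longrightarrow> ob_map F A \<in> Obj D"
    and ar_map_hom: "f \<in> hom C A B \<Longrightarrow> ar_map F f \<in> hom D (ob_map F A) (ob_map F B)"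
    and ce_map_cells: "a \<in> cells C f g \<Longrightarrow> ce_map F a \<in> cells D (ar_map F f) (ar_map F g)"
    and ce_map_idc: "f \<in> Arr C \<Longrightarrow> ce_map F (idc C f) = idc D (ar_map F f)"
    and ce_map_vcomp: "a \<in> cells C f g \<Longrightarrow> b \<in> cells C g h \<Longrightarrow>
      ce_map F (b \<cdot> a) = ce_map F b \<cdot>\<^bsub>D\<^esub> ce_map F a"
    and pcomp_iso: "composable C g f \<Longrightarrow>
      pcomp F g f \<in> iso_cells D (ar_map F g \<odot>\<^bsub>D\<^esub> ar_map F f) (ar_map F (g \<odot> f))"
    and pcomp_natural: "a \<in> cells C f f' \<Longrightarrow> b \<in> cells C g g' \<Longrightarrow> composable C g f \<Longrightarrow>
      pcomp F g' f' \<cdot>\<^bsub>D\<^esub> (ce_map F b \<star>\<^bsub>D\<^esub> ce_map F a) = ce_map F (b \<star> a) \<cdot>\<^bsub>D\<^esub> pcomp F g f"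
    and punit_iso: "A \<in> Obj C \<Longrightarrow>
      punit F A \<in> iso_cells D (\<one>\<^bsub>D\<^esub> (ob_map F A)) (ar_map F (\<one> A))"
    and pcomp_asc: "composable C h g \<Longrightarrow> composable C g f \<Longrightarrow>
      ce_map F (asc C h g f) \<cdot>\<^bsub>D\<^esub> pcomp F (h \<odot> g) f \<cdot>\<^bsub>D\<^esub> (pcomp F h g \<star>\<^bsub>D\<^esub> idc D (ar_map F f)) =
      pcomp F h (g \<odot> f) \<cdot>\<^bsub>D\<^esub> (idc D (ar_map F h) \<star>\<^bsub>D\<^esub> pcomp F g f) \<cdot>\<^bsub>D\<^esub>
        asc D (ar_map F h) (ar_map F g) (ar_map F f)"
    and punit_left: "f \<in> hom C A B \<Longrightarrow>
      ce_map F (lun C f) \<cdot>\<^bsub>D\<^esub> pcomp F (\<one> B) f \<cdot>\<^bsub>D\<^esub> (punit F B \<star>\<^bsub>D\<^esub> idc D (ar_map F f)) =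
      lun D (ar_map F f)"
    and punit_right: "f \<in> hom C A B \<Longrightarrow>
      ce_map F (run C f) \<cdot>\<^bsub>D\<^esub> pcomp F f (\<one> A) \<cdot>\<^bsub>D\<^esub> (idc D (ar_map F f) \<star>\<^bsub>D\<^esub> punit F A) =
      run D (ar_map F f)"

definition id_psf :: "('o, 'm, 'c) bicat \<Rightarrow> ('o, 'm, 'c, 'o, 'm, 'c) psf" where
  "id_psf C = \<lparr>
     ob_map = (\<lambda>A\<in>Obj C. A),
     ar_map = (\<lambda>f\<in>Arr C. f),
     ce_map = (\<lambda>a\<in>Cell C. a),
     pcomp = (\<lambda>g f. if composable C g f then idc C (ocomp C g f) else undefined),
     punit = (\<lambda>A\<in>Obj C. idc C (one C A))\<rparr>"

text \<open>The inclusion of a full sub-bicategory has the same data as the identity pseudofunctor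
  of that sub-bicategory.\<close>

definition inclusion :: "('o, 'm, 'c) bicat \<Rightarrow> 'o set \<Rightarrow> ('o, 'm, 'c, 'o, 'm, 'c) psf" where
  "inclusion C S = id_psf (full_sub C S)"

text \<open>\<open>psf_comp C E G F\<close> is the composite \<open>G \<circ> F\<close>, where \<open>C\<close> is the domain of \<open>F\<close> and
  \<open>E\<close> is the codomain of \<open>G\<close>.\<close>

definition psf_comp ::
  "('o, 'm, 'c) bicat \<Rightarrow> ('q, 'l, 'e) bicat \<Rightarrow> ('p, 'n, 'd, 'q, 'l, 'e) psf \<Rightarrow>
   ('o, 'm, 'c, 'p, 'n, 'd) psf \<Rightarrow> ('o, 'm, 'c, 'q, 'l, 'e) psf" where
  "psf_comp C E G F = \<lparr>
     ob_map = (\<lambda>A\<in>Obj C. ob_map G (ob_map F A)),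
     ar_map = (\<lambda>f\<in>Arr C. ar_map G (ar_map F f)),
     ce_map = (\<lambda>a\<in>Cell C. ce_map G (ce_map F a)),
     pcomp = (\<lambda>g f. if composable C g f
       then vcomp E (ce_map G (pcomp F g f)) (pcomp G (ar_map F g) (ar_map F f)) else undefined),
     punit = (\<lambda>A\<in>Obj C. vcomp E (ce_map G (punit F A)) (punit G (ob_map F A)))\<rparr>"


section \<open>Pseudonatural transformations and modifications\<close>

record ('o, 'm, 'c, 'p, 'n, 'd) pnt =
  nsrc :: "('o, 'm, 'c, 'p, 'n, 'd) psf"
  ntgt :: "('o, 'm, 'c, 'p, 'n, 'd) psf"
  ncmp :: "'o \<Rightarrow> 'n"
  nnat :: "'m \<Rightarrow> 'd"
    \<comment> \<open>for \<open>\<alpha> : F \<Rightarrow> G\<close> and \<open>f : A \<rightarrow> B\<close>, \<open>nnat \<alpha> f : G f \<odot> \<alpha>\<^sub>A \<Rightarrow> \<alpha>\<^sub>B \<odot> F f\<close>\<close>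

locale pseudonatural = C: bicategory C + D: bicategory D
  for C :: "('o, 'm, 'c) bicat" (structure) and D :: "('p, 'n, 'd) bicat" +
  fixes \<alpha> :: "('o, 'm, 'c, 'p, 'n, 'd) pnt"
  assumes nsrc_psf: "pseudofunctor C D (nsrc \<alpha>)"
    and ntgt_psf: "pseudofunctor C D (ntgt \<alpha>)"
    and ncmp_ext: "ncmp \<alpha> \<in> extensional (Obj C)"
    and nnat_ext: "nnat \<alpha> \<in> extensional (Arr C)"
    and ncmp_hom: "A \<in> Obj C \<Longrightarrow>
      ncmp \<alpha> A \<in> hom D (ob_map (nsrc \<alpha>) A) (ob_map (ntgt \<alpha>) A)"
    and nnat_iso: "f \<in> hom C A B \<Longrightarrow>
      nnat \<alpha> f \<in> iso_cells D (ar_map (ntgt \<alpha>) f \<odot>\<^bsub>D\<^esub> ncmp \<alpha> A) (ncmp \<alpha> B \<odot>\<^bsub>D\<^esub> ar_map (nsrc \<alpha>) f)"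
    and nnat_natural: "f \<in> hom C A B \<Longrightarrow> a \<in> cells C f g \<Longrightarrow>
      nnat \<alpha> g \<cdot>\<^bsub>D\<^esub> (ce_map (ntgt \<alpha>) a \<star>\<^bsub>D\<^esub> idc D (ncmp \<alpha> A)) =
      (idc D (ncmp \<alpha> B) \<star>\<^bsub>D\<^esub> ce_map (nsrc \<alpha>) a) \<cdot>\<^bsub>D\<^esub> nnat \<alpha> f"
    and nnat_ocomp: "f \<in> hom C A B \<Longrightarrow> g \<in> hom C B E \<Longrightarrow>
      nnat \<alpha> (g \<odot> f) \<cdot>\<^bsub>D\<^esub> (pcomp (ntgt \<alpha>) g f \<star>\<^bsub>D\<^esub> idc D (ncmp \<alpha> A)) =
      (idc D (ncmp \<alpha> E) \<star>\<^bsub>D\<^esub> pcomp (nsrc \<alpha>) g f) \<cdot>\<^bsub>D\<^esub>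
      asc D (ncmp \<alpha> E) (ar_map (nsrc \<alpha>) g) (ar_map (nsrc \<alpha>) f) \<cdot>\<^bsub>D\<^esub>
      (nnat \<alpha> g \<star>\<^bsub>D\<^esub> idc D (ar_map (nsrc \<alpha>) f)) \<cdot>\<^bsub>D\<^esub>
      inv_cell D (asc D (ar_map (ntgt \<alpha>) g) (ncmp \<alpha> B) (ar_map (nsrc \<alpha>) f)) \<cdot>\<^bsub>D\<^esub>
      (idc D (ar_map (ntgt \<alpha>) g) \<star>\<^bsub>D\<^esub> nnat \<alpha> f) \<cdot>\<^bsub>D\<^esub>
      asc D (ar_map (ntgt \<alpha>) g) (ar_map (ntgt \<alpha>) f) (ncmp \<alpha> A)"
    and nnat_one: "A \<in> Obj C \<Longrightarrow>
      nnat \<alpha> (\<one> A) \<cdot>\<^bsub>D\<^esub> (punit (ntgt \<alpha>) A \<star>\<^bsub>D\<^esub> idc D (ncmp \<alpha> A)) =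
      (idc D (ncmp \<alpha> A) \<star>\<^bsub>D\<^esub> punit (nsrc \<alpha>) A) \<cdot>\<^bsub>D\<^esub>
      inv_cell D (run D (ncmp \<alpha> A)) \<cdot>\<^bsub>D\<^esub> lun D (ncmp \<alpha> A)"

record ('o, 'm, 'c, 'p, 'n, 'd) modif =
  msrc :: "('o, 'm, 'c, 'p, 'n, 'd) pnt"
  mtgt :: "('o, 'm, 'c, 'p, 'n, 'd) pnt"
  mcmp :: "'o \<Rightarrow> 'd"

locale modification = C: bicategory C + D: bicategory D
  for C :: "('o, 'm, 'c) bicat" (structure) and D :: "('p, 'n, 'd) bicat" +
  fixes \<mu> :: "('o, 'm, 'c, 'p, 'n, 'd) modif"
  assumes msrc_pnt: "pseudonatural C D (msrc \<mu>)"
    and mtgt_pnt: "pseudonatural C D (mtgt \<mu>)"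
    and parallel_src: "nsrc (msrc \<mu>) = nsrc (mtgt \<mu>)"
    and parallel_tgt: "ntgt (msrc \<mu>) = ntgt (mtgt \<mu>)"
    and mcmp_ext: "mcmp \<mu> \<in> extensional (Obj C)"
    and mcmp_cells: "A \<in> Obj C \<Longrightarrow> mcmp \<mu> A \<in> cells D (ncmp (msrc \<mu>) A) (ncmp (mtgt \<mu>) A)"
    and mcmp_natural: "f \<in> hom C A B \<Longrightarrow>
      (mcmp \<mu> B \<star>\<^bsub>D\<^esub> idc D (ar_map (nsrc (msrc \<mu>)) f)) \<cdot>\<^bsub>D\<^esub> nnat (msrc \<mu>) f =
      nnat (mtgt \<mu>) f \<cdot>\<^bsub>D\<^esub> (idc D (ar_map (ntgt (msrc \<mu>)) f) \<star>\<^bsub>D\<^esub> mcmp \<mu> A)"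


section \<open>The bicategory of pseudofunctors\<close>

definition id_pnt ::
  "('o, 'm, 'c) bicat \<Rightarrow> ('p, 'n, 'd) bicat \<Rightarrow> ('o, 'm, 'c, 'p, 'n, 'd) psf \<Rightarrow>
   ('o, 'm, 'c, 'p, 'n, 'd) pnt" where
  "id_pnt C D F = \<lparr>
     nsrc = F, ntgt = F,
     ncmp = (\<lambda>A\<in>Obj C. one D (ob_map F A)),
     nnat = (\<lambda>f\<in>Arr C. vcomp D (inv_cell D (lun D (ar_map F f))) (run D (ar_map F f)))\<rparr>"

definition pnt_comp ::
  "('o, 'm, 'c) bicat \<Rightarrow> ('p, 'n, 'd) bicat \<Rightarrow> ('o, 'm, 'c, 'p, 'n, 'd) pnt \<Rightarrow>
   ('o, 'm, 'c, 'p, 'n, 'd) pnt \<Rightarrow> ('o, 'm, 'c, 'p, 'n, 'd) pnt" where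
  "pnt_comp C D \<beta> \<alpha> = \<lparr>
     nsrc = nsrc \<alpha>, ntgt = ntgt \<beta>,
     ncmp = (\<lambda>A\<in>Obj C. ocomp D (ncmp \<beta> A) (ncmp \<alpha> A)),
     nnat = (\<lambda>f\<in>Arr C.
       let A = src C f; B = tgt C f;
           Ff = ar_map (nsrc \<alpha>) f; Gf = ar_map (ntgt \<alpha>) f; Hf = ar_map (ntgt \<beta>) f
       in inv_cell D (asc D (ncmp \<beta> B) (ncmp \<alpha> B) Ff) \<cdot>\<^bsub>D\<^esub>
          (idc D (ncmp \<beta> B) \<star>\<^bsub>D\<^esub> nnat \<alpha> f) \<cdot>\<^bsub>D\<^esub>
          asc D (ncmp \<beta> B) Gf (ncmp \<alpha> A) \<cdot>\<^bsub>D\<^esub>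
          (nnat \<beta> f \<star>\<^bsub>D\<^esub> idc D (ncmp \<alpha> A)) \<cdot>\<^bsub>D\<^esub>
          inv_cell D (asc D Hf (ncmp \<beta> A) (ncmp \<alpha> A)))\<rparr>"

definition functor_bicat ::
  "('o, 'm, 'c) bicat \<Rightarrow> ('p, 'n, 'd) bicat \<Rightarrow>
   (('o, 'm, 'c, 'p, 'n, 'd) psf, ('o, 'm, 'c, 'p, 'n, 'd) pnt,
    ('o, 'm, 'c, 'p, 'n, 'd) modif) bicat" where
  "functor_bicat C D = \<lparr>
     Obj = {F. pseudofunctor C D F},
     Arr = {\<alpha>. pseudonatural C D \<alpha>},
     Cell = {\<mu>. modification C D \<mu>},
     src = nsrc, tgt = ntgt, Dom = msrc, Cod = mtgt,
     one = id_pnt C D,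
     ocomp = pnt_comp C D,
     idc = (\<lambda>\<alpha>. \<lparr>msrc = \<alpha>, mtgt = \<alpha>, mcmp = (\<lambda>A\<in>Obj C. idc D (ncmp \<alpha> A))\<rparr>),
     vcomp = (\<lambda>\<nu> \<mu>. \<lparr>msrc = msrc \<mu>, mtgt = mtgt \<nu>,
       mcmp = (\<lambda>A\<in>Obj C. vcomp D (mcmp \<nu> A) (mcmp \<mu> A))\<rparr>),
     hcomp = (\<lambda>\<nu> \<mu>. \<lparr>msrc = pnt_comp C D (msrc \<nu>) (msrc \<mu>),
       mtgt = pnt_comp C D (mtgt \<nu>) (mtgt \<mu>),
       mcmp = (\<lambda>A\<in>Obj C. hcomp D (mcmp \<nu> A) (mcmp \<mu> A))\<rparr>),
     asc = (\<lambda>\<gamma> \<beta> \<alpha>. \<lparr>msrc = pnt_comp C D (pnt_comp C D \<gamma> \<beta>) \<alpha>,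
       mtgt = pnt_comp C D \<gamma> (pnt_comp C D \<beta> \<alpha>),
       mcmp = (\<lambda>A\<in>Obj C. asc D (ncmp \<gamma> A) (ncmp \<beta> A) (ncmp \<alpha> A))\<rparr>),
     lun = (\<lambda>\<alpha>. \<lparr>msrc = pnt_comp C D (id_pnt C D (ntgt \<alpha>)) \<alpha>, mtgt = \<alpha>,
       mcmp = (\<lambda>A\<in>Obj C. lun D (ncmp \<alpha> A))\<rparr>),
     run = (\<lambda>\<alpha>. \<lparr>msrc = pnt_comp C D \<alpha> (id_pnt C D (nsrc \<alpha>)), mtgt = \<alpha>,
       mcmp = (\<lambda>A\<in>Obj C. run D (ncmp \<alpha> A))\<rparr>)\<rparr>"

definition biequivalence ::
  "('o, 'm, 'c) bicat \<Rightarrow> ('p, 'n, 'd) bicat \<Rightarrow> ('o, 'm, 'c, 'p, 'n, 'd) psf \<Rightarrow> bool" where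
  "biequivalence C D F \<longleftrightarrow> pseudofunctor C D F \<and>
     (\<exists>G \<phi> \<psi>. pseudofunctor D C G \<and>
        \<phi> \<in> hom (functor_bicat C C) (id_psf C) (psf_comp C C G F) \<and>
        equivalence_arrow (functor_bicat C C) \<phi> \<and>
        \<psi> \<in> hom (functor_bicat D D) (psf_comp D D F G) (id_psf D) \<and>
        equivalence_arrow (functor_bicat D D) \<psi>)"


section \<open>Precomposition\<close>

definition pnt_whisker ::
  "('o, 'm, 'c) bicat \<Rightarrow> ('q, 'l, 'e) bicat \<Rightarrow> ('p, 'n, 'd, 'q, 'l, 'e) pnt \<Rightarrow>
   ('o, 'm, 'c, 'p, 'n, 'd) psf \<Rightarrow> ('o, 'm, 'c, 'q, 'l, 'e) pnt" where
  "pnt_whisker C E \<alpha> K = \<lparr>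
     nsrc = psf_comp C E (nsrc \<alpha>) K, ntgt = psf_comp C E (ntgt \<alpha>) K,
     ncmp = (\<lambda>A\<in>Obj C. ncmp \<alpha> (ob_map K A)),
     nnat = (\<lambda>f\<in>Arr C. nnat \<alpha> (ar_map K f))\<rparr>"

definition modif_whisker ::
  "('o, 'm, 'c) bicat \<Rightarrow> ('q, 'l, 'e) bicat \<Rightarrow> ('p, 'n, 'd, 'q, 'l, 'e) modif \<Rightarrow>
   ('o, 'm, 'c, 'p, 'n, 'd) psf \<Rightarrow> ('o, 'm, 'c, 'q, 'l, 'e) modif" where
  "modif_whisker C E \<mu> K = \<lparr>
     msrc = pnt_whisker C E (msrc \<mu>) K, mtgt = pnt_whisker C E (mtgt \<mu>) K,
     mcmp = (\<lambda>A\<in>Obj C. mcmp \<mu> (ob_map K A))\<rparr>"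

text \<open>\<open>precomp C B D K : [B, D] \<rightarrow> [C, D]\<close> is precomposition with \<open>K : C \<rightarrow> B\<close>. It preserves
  identities and composites of transformations on the nose, so its coherence cells are
  identities.\<close>

definition precomp ::
  "('o, 'm, 'c) bicat \<Rightarrow> ('p, 'n, 'd) bicat \<Rightarrow> ('q, 'l, 'e) bicat \<Rightarrow>
   ('o, 'm, 'c, 'p, 'n, 'd) psf \<Rightarrow>
   (('p, 'n, 'd, 'q, 'l, 'e) psf, ('p, 'n, 'd, 'q, 'l, 'e) pnt, ('p, 'n, 'd, 'q, 'l, 'e) modif,
    ('o, 'm, 'c, 'q, 'l, 'e) psf, ('o, 'm, 'c, 'q, 'l, 'e) pnt,
    ('o, 'm, 'c, 'q, 'l, 'e) modif) psf" where
  "precomp C B D K = \<lparr>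
     ob_map = (\<lambda>F\<in>Obj (functor_bicat B D). psf_comp C D F K),
     ar_map = (\<lambda>\<alpha>\<in>Arr (functor_bicat B D). pnt_whisker C D \<alpha> K),
     ce_map = (\<lambda>\<mu>\<in>Cell (functor_bicat B D). modif_whisker C D \<mu> K),
     pcomp = (\<lambda>\<beta> \<alpha>. if composable (functor_bicat B D) \<beta> \<alpha>
       then idc (functor_bicat C D) (pnt_whisker C D (pnt_comp B D \<beta> \<alpha>) K) else undefined),
     punit = (\<lambda>F\<in>Obj (functor_bicat B D).
       idc (functor_bicat C D) (id_pnt C D (psf_comp C D F K)))\<rparr>"


section \<open>Systems of fibrant objects\<close>

definition lifts_to :: "('o, 'm, 'c) bicat \<Rightarrow> 'm set \<Rightarrow> 'o \<Rightarrow> bool" where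
  "lifts_to C M X \<longleftrightarrow>
     (\<forall>f \<in> M. \<forall>h \<in> hom C (src C f) X.
        \<exists>l \<in> hom C (tgt C f) X. iso_cells C h (ocomp C l f) \<noteq> {})"

locale system_of_fibrant_objects = bicategory C
  for C :: "('o, 'm, 'c) bicat" (structure) +
  fixes W :: "'m set" and Q :: "('o, 'm, 'c, 'o, 'm, 'c) psf"
    and \<eta> :: "('o, 'm, 'c, 'o, 'm, 'c) pnt"
  assumes W_arr: "W \<subseteq> Arr C"
    and Q_psf: "pseudofunctor C C Q"
    and \<eta>_pnt: "\<eta> \<in> hom (functor_bicat C C) (id_psf C) Q"
    and identities: "A \<in> Obj C \<Longrightarrow> \<one> A \<in> W"
    and three_for_two:
      "f \<in> hom C A E \<Longrightarrow> g \<in> hom C A B \<Longrightarrow> h \<in> hom C B E \<Longrightarrow> \<gamma> \<in> iso_cells C f (h \<odot> g) \<Longrightarrow>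
       (g \<in> W \<and> h \<in> W \<longrightarrow> f \<in> W) \<and> (f \<in> W \<and> h \<in> W \<longrightarrow> g \<in> W) \<and> (f \<in> W \<and> g \<in> W \<longrightarrow> h \<in> W)"
    and \<eta>_weq: "A \<in> Obj C \<Longrightarrow> ncmp \<eta> A \<in> W"
    and Q_lifts: "A \<in> Obj C \<Longrightarrow> lifts_to C W (ob_map Q A)"

definition fibrant :: "('o, 'm, 'c) bicat \<Rightarrow> 'm set \<Rightarrow> 'o set" where
  "fibrant C W = {A \<in> Obj C. lifts_to C W A}"

definition Ho :: "('o, 'm, 'c) bicat \<Rightarrow> 'm set \<Rightarrow> ('o, 'm, 'c) bicat" where
  "Ho C W = full_sub C (fibrant C W)"

definition induced ::
  "('o, 'm, 'c) bicat \<Rightarrow> 'm set \<Rightarrow> ('o, 'm, 'c, 'o, 'm, 'c) psf \<Rightarrow>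
   ('o, 'm, 'c, 'o, 'm, 'c) psf" where
  "induced C W Q =
     (THE K. pseudofunctor C (Ho C W) K \<and> psf_comp C C (inclusion C (fibrant C W)) K = Q)"

definition functor_bicat_inv ::
  "('o, 'm, 'c) bicat \<Rightarrow> ('p, 'n, 'd) bicat \<Rightarrow> 'm set \<Rightarrow>
   (('o, 'm, 'c, 'p, 'n, 'd) psf, ('o, 'm, 'c, 'p, 'n, 'd) pnt,
    ('o, 'm, 'c, 'p, 'n, 'd) modif) bicat" where
  "functor_bicat_inv C D W =
     full_sub (functor_bicat C D) {F. \<forall>w \<in> W. equivalence_arrow D (ar_map F w)}"


section \<open>The pseudofunctor induced by fibrant replacement\<close>

lemma full_sub_sel:
  "src (full_sub C S) = src C" "tgt (full_sub C S) = tgt C"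
  "Dom (full_sub C S) = Dom C" "Cod (full_sub C S) = Cod C"
  "one (full_sub C S) = one C" "ocomp (full_sub C S) = ocomp C"
  "idc (full_sub C S) = idc C" "vcomp (full_sub C S) = vcomp C"
  "hcomp (full_sub C S) = hcomp C" "asc (full_sub C S) = asc C"
  "lun (full_sub C S) = lun C" "run (full_sub C S) = run C"
  "Obj (full_sub C S) = Obj C \<inter> S"
  "Arr (full_sub C S) = {f \<in> Arr C. src C f \<in> S \<and> tgt C f \<in> S}"
  "Cell (full_sub C S) = {a \<in> Cell C. src C (Dom C a) \<in> S \<and> tgt C (Dom C a) \<in> S}"
  by (simp_all add: full_sub_def)

lemma hom_full_sub: "f \<in> hom (full_sub C S) A B \<longleftrightarrow> f \<in> hom C A B \<and> A \<in> S \<and> B \<in> S"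
  by (auto simp: hom_def full_sub_sel)

lemma cells_full_sub:
  "a \<in> cells (full_sub C S) f g \<longleftrightarrow> a \<in> cells C f g \<and> src C f \<in> S \<and> tgt C f \<in> S"
  by (auto simp: cells_def full_sub_sel)

lemma composable_full_sub:
  "composable (full_sub C S) g f \<longleftrightarrow>
     composable C g f \<and> src C f \<in> S \<and> tgt C f \<in> S \<and> tgt C g \<in> S"
  by (auto simp: composable_def full_sub_sel)

context bicategory
begin

lemma cells_parallel:
  assumes "a \<in> cells C f g"
  shows "src C f = src C g" "tgt C f = tgt C g" "f \<in> Arr C" "g \<in> Arr C"
  using assms cell_parallel cell_arr by (auto simp: cells_def)

lemma iso_cells_full_sub:
  "a \<in> iso_cells (full_sub C S) f g \<longleftrightarrow>
     a \<in> iso_cells C f g \<and> src C f \<in> S \<and> tgt C f \<in> S"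
proof -
  have "inverse_cells (full_sub C S) a b \<longleftrightarrow> inverse_cells C a b"
    if "a \<in> cells C f g" "src C f \<in> S" "tgt C f \<in> S" for b
  proof -
    have "Dom C a = f" "Cod C a = g"
      using that by (auto simp: cells_def)
    with that cells_parallel[OF that(1)] show ?thesis
      by (simp add: inverse_cells_def cells_full_sub full_sub_sel)
  qed
  then show ?thesis
    by (auto simp: iso_cells_def cells_full_sub)
qed

end

lemma bicategory_full_sub:
  assumes "bicategory C"
  shows "bicategory (full_sub C S)"
proof -
  interpret bicategory C by fact
  note sel = full_sub_sel and hom = hom_full_sub and cell = cells_full_sub
    and cmp = composable_full_sub and iso = iso_cells_full_sub
  have par: "src C f = src C g \<and> tgt C f = tgt C g" if "a \<in> cells C f g" for a f g
    using cells_parallel[OF that] by simp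
  have comp_st: "ocomp C g f \<in> hom C (src C f) (tgt C g)" if "composable C g f" for g f
    using that ocomp_hom by (auto simp: composable_def hom_def)
  show ?thesis
  proof (unfold_locales, goal_cases)
    case 1 then show ?case using arr_obj by (simp add: sel)
  next case 2 then show ?case using cell_arr cell_parallel by (auto simp: sel)
  next case 3 then show ?case using cell_parallel by (auto simp: sel)
  next case 4 then show ?case using one_hom by (auto simp: sel hom)
  next case 5 then show ?case using ocomp_hom by (auto simp: sel hom)
  next case 6 then show ?case using idc_cells by (auto simp: sel cell)
  next case 7 then show ?case using vcomp_cells by (auto simp: sel cell)
  next case 8 then show ?case using vcomp_assoc by (auto simp: sel cell)
  next case 9 then show ?case using vcomp_idc_left by (auto simp: sel cell)
  next case 10 then show ?case using vcomp_idc_right by (auto simp: sel cell)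
  next case 11 then show ?case
      using hcomp_cells comp_st by (fastforce simp: sel cell cmp hom_def)
  next case 12 then show ?case using hcomp_idc by (auto simp: sel cmp)
  next case 13 then show ?case unfolding sel cmp cell by (elim conjE) (rule interchange)
  next case 14
    then show ?case using asc_iso comp_st by (fastforce simp: sel iso cmp hom_def composable_def)
  next case 15 then show ?case unfolding sel cmp cell by (elim conjE) (rule asc_natural)
  next case 16 then show ?case
      using lun_iso ocomp_hom one_hom arr_obj by (fastforce simp: sel iso hom hom_def)
  next case 17 then show ?case using lun_natural by (auto simp: sel cell)
  next case 18 then show ?case
      using run_iso ocomp_hom one_hom arr_obj by (fastforce simp: sel iso hom hom_def)
  next case 19 then show ?case using run_natural by (auto simp: sel cell)
  next case 20 then show ?case unfolding sel cmp by (elim conjE) (rule pentagon)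
  next case 21 then show ?case unfolding sel cmp by (elim conjE) (rule triangle)
  qed
qed

text \<open>
  The description defining \<open>induced\<close> is satisfied by exactly one pseudofunctor:
  \<open>Q\<close> takes values in the fibrant objects, and since the codomain is not part of the data of a
  pseudofunctor, the unique \<open>I\<close> with \<open>J \<circ> I = Q\<close> has the same data as \<open>Q\<close>.
\<close>

lemma pseudofunctor_full_sub:
  assumes "pseudofunctor C E F" and ob: "\<And>A. A \<in> Obj C \<Longrightarrow> ob_map F A \<in> S"
  shows "pseudofunctor C (full_sub E S) F"
proof -
  interpret pseudofunctor C E F by fact
  interpret H: bicategory "full_sub E S"
    by (rule bicategory_full_sub) unfold_locales
  have arS: "src E (ar_map F f) \<in> S \<and> tgt E (ar_map F f) \<in> S" if "f \<in> Arr C" for f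
  proof -
    have "f \<in> hom C (src C f) (tgt C f)" using that by (simp add: hom_def)
    from ar_map_hom[OF this] ob C.arr_obj[OF that] show ?thesis by (auto simp: hom_def)
  qed
  have cmpE: "composable E (ar_map F g) (ar_map F f)" if "composable C g f" for g f
  proof -
    have "f \<in> hom C (src C f) (src C g)" "g \<in> hom C (src C g) (tgt C g)"
      using that by (auto simp: composable_def hom_def)
    from this[THEN ar_map_hom] show ?thesis by (auto simp: composable_def hom_def)
  qed
  have comp_st: "ar_map F g \<odot>\<^bsub>E\<^esub> ar_map F f \<in> hom E (src E (ar_map F f)) (tgt E (ar_map F g))"
    if "composable C g f" for g f
    using cmpE[OF that] D.ocomp_hom by (auto simp: composable_def hom_def)
  show ?thesis
  proof (unfold_locales, goal_cases)
    case 1 show ?case by (rule ob_map_ext)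
  next case 2 show ?case by (rule ar_map_ext)
  next case 3 show ?case by (rule ce_map_ext)
  next case 4 then show ?case by (rule pcomp_ext)
  next case 5 show ?case by (rule punit_ext)
  next case 6 then show ?case using ob_map_obj ob by (simp add: full_sub_sel)
  next case 7 then show ?case
      using ar_map_hom ob C.arr_obj by (auto simp: hom_full_sub) (auto simp: hom_def)
  next case 8 then show ?case
      using ce_map_cells arS C.cells_parallel by (simp add: cells_full_sub)
  next case 9 then show ?case by (simp add: full_sub_sel ce_map_idc)
  next case 10 then show ?case unfolding full_sub_sel by (rule ce_map_vcomp)
  next case (11 g f)
    then have "f \<in> Arr C" "g \<in> Arr C" by (auto simp: composable_def)
    with 11 comp_st[OF 11] arS show ?case
      by (simp add: full_sub_sel D.iso_cells_full_sub pcomp_iso hom_def)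
  next case 12 then show ?case unfolding full_sub_sel by (rule pcomp_natural)
  next case (13 A)
    then show ?case using D.one_hom[OF ob_map_obj[OF 13]] ob
      by (simp add: full_sub_sel D.iso_cells_full_sub punit_iso hom_def)
  next case 14 then show ?case unfolding full_sub_sel by (rule pcomp_asc)
  next case 15 then show ?case unfolding full_sub_sel by (rule punit_left)
  next case 16 then show ?case unfolding full_sub_sel by (rule punit_right)
  qed
qed

lemma inclusion_comp:
  assumes "bicategory E" "pseudofunctor C (full_sub E S) K"
  shows "psf_comp C E (inclusion E S) K = K"
proof -
  interpret E: bicategory E by fact
  interpret pseudofunctor C "full_sub E S" K by fact
  have "ob_map (psf_comp C E (inclusion E S) K) = ob_map K"
    by (rule extensionalityI[of _ "Obj C"])
      (use ob_map_ext ob_map_obj in \<open>auto simp: psf_comp_def inclusion_def id_psf_def\<close>)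
  moreover have "ar_map (psf_comp C E (inclusion E S) K) = ar_map K"
  proof (rule extensionalityI[of _ "Arr C"])
    fix f assume f: "f \<in> Arr C"
    then have "f \<in> hom C (src C f) (tgt C f)" by (simp add: hom_def)
    from ar_map_hom[OF this] f
    show "ar_map (psf_comp C E (inclusion E S) K) f = ar_map K f"
      by (auto simp: psf_comp_def inclusion_def id_psf_def hom_def)
  qed (use ar_map_ext in \<open>auto simp: psf_comp_def\<close>)
  moreover have "ce_map (psf_comp C E (inclusion E S) K) = ce_map K"
  proof (rule extensionalityI[of _ "Cell C"])
    fix a assume a: "a \<in> Cell C"
    then have "a \<in> cells C (Dom C a) (Cod C a)" by (simp add: cells_def)
    from ce_map_cells[OF this] a
    show "ce_map (psf_comp C E (inclusion E S) K) a = ce_map K a"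
      by (auto simp: psf_comp_def inclusion_def id_psf_def cells_def)
  qed (use ce_map_ext in \<open>auto simp: psf_comp_def\<close>)
  moreover have "pcomp (psf_comp C E (inclusion E S) K) g f = pcomp K g f" for g f
  proof (cases "composable C g f")
    case True
    have "f \<in> hom C (src C f) (src C g)" "g \<in> hom C (src C g) (tgt C g)"
      using True by (auto simp: composable_def hom_def)
    from this[THEN ar_map_hom]
    have "composable (full_sub E S) (ar_map K g) (ar_map K f)"
      by (auto simp: composable_def hom_def)
    moreover have cell: "pcomp K g f \<in> cells (full_sub E S) (ar_map K g \<odot>\<^bsub>E\<^esub> ar_map K f) (ar_map K (g \<odot>\<^bsub>C\<^esub> f))"
      using pcomp_iso[OF True] by (simp add: iso_cells_def full_sub_sel)
    ultimately show ?thesis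
      using True D.vcomp_idc_right[OF cell]
      by (auto simp: psf_comp_def inclusion_def id_psf_def cells_def full_sub_sel)
  qed (simp add: psf_comp_def pcomp_ext)
  moreover have "punit (psf_comp C E (inclusion E S) K) = punit K"
  proof (rule extensionalityI[of _ "Obj C"])
    fix A assume A: "A \<in> Obj C"
    have cell: "punit K A \<in> cells (full_sub E S) (\<one>\<^bsub>E\<^esub> (ob_map K A)) (ar_map K (\<one>\<^bsub>C\<^esub> A))"
      using punit_iso[OF A] by (simp add: iso_cells_def full_sub_sel)
    with A ob_map_obj[OF A] D.vcomp_idc_right[OF cell]
    show "punit (psf_comp C E (inclusion E S) K) A = punit K A"
      by (auto simp: psf_comp_def inclusion_def id_psf_def cells_def full_sub_sel)
  qed (use punit_ext in \<open>auto simp: psf_comp_def\<close>)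
  ultimately show ?thesis
    by (intro psf.equality ext) simp_all
qed

lemma induced_eq:
  assumes "system_of_fibrant_objects C W Q \<eta>"
  shows "pseudofunctor C (Ho C W) Q" "induced C W Q = Q"
proof -
  interpret system_of_fibrant_objects C W Q \<eta> by fact
  interpret Q: pseudofunctor C C Q by (rule Q_psf)
  show Q: "pseudofunctor C (Ho C W) Q"
    unfolding Ho_def using Q_psf Q_lifts Q.ob_map_obj
    by (intro pseudofunctor_full_sub) (auto simp: fibrant_def)
  have "psf_comp C C (inclusion C (fibrant C W)) K = K" if "pseudofunctor C (Ho C W) K" for K
    using that bicategory_axioms unfolding Ho_def by (intro inclusion_comp)
  with Q show "induced C W Q = Q"
    unfolding induced_def by (intro the_equality) auto
qed

end

theory Submission
  imports Defs
begin

text \<open>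
  Let \<open>J : Ho(C) \<rightarrow> C\<close> be the inclusion. Lifting a weak equivalence between fibrant objects against
  identities twice, with 3-for-2 in between, shows that it is an equivalence; hence \<open>[I, D]\<close> lands in
  \<open>[C, D]\<^sub>W\<close>. Restriction along \<open>J\<close> is the inverse: \<open>[J, D] \<circ> [I, D]\<close> and \<open>[I, D] \<circ> [J, D]\<close> are precomposition
  with \<open>I J\<close> and \<open>J I = Q\<close>, and whiskering with \<open>\<eta>\<close> gives transformations from the identities to them
  whose components \<open>F \<eta>\<close> are equivalences in each component. It remains to know that a pseudonatural
  transformation with such components is an equivalence, which is used once for the values \<open>F \<eta>\<close> and
  once between functor bicategories.

  Coherence is handled by a Cayley representation. A cell \<open>a\<close> of \<open>D\<close> is determined by the whiskered
  cells \<open>a \<lhd> X\<close>, and the arrows of \<open>D\<close> act on the arrows \<open>X\<close> by composition. Transported to iterated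
  applications \<open>g (f X)\<close>, associators and unitors become identities, so that every equation to be
  checked becomes one of strict 2-categories.
\<close>

section \<open>Calculus of cells in a bicategory\<close>

text \<open>The composites \<open>[J, D] \<circ> [I, D]\<close> and
  \<open>[I, D] \<circ> [J, D]\<close> both have to be compared with an identity, and one lemma,
  \<open>unit_whisker_equivalence\<close>, serves for the two. It concerns a full sub-bicategory
  \<open>P\<close> of a functor bicategory and an endo-pseudofunctor \<open>T\<close> of
  \<open>P\<close> that acts by precomposition with the target of a transformation \<eta> out of the
  identity and has identities as coherence cells. Both composites have this form because restriction
  commutes strictly with all operations and composition of pseudofunctors is strictly associative.

  The representation is set up for actions, not for a single bicategory, because \<eta> satisfies
  its axioms in its own bicategory while F \<eta> must satisfy them in \<open>D\<close>: the action
  of \<open>D\<close> on itself decides equations of \<open>D\<close>, and the action along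
  \<open>F\<close> carries equations of the domain over to \<open>D\<close>.

  Equivalences are obtained from one-sided inverses. An arrow with a right inverse that has a right
  inverse in turn is an equivalence, so a construction of right inverses can simply be
  iterated.\<close>

abbreviation lwhisk :: "('o, 'm, 'c) bicat \<Rightarrow> 'm \<Rightarrow> 'c \<Rightarrow> 'c" (infixr "\<rhd>\<index>" 75) where
  "lwhisk C f a \<equiv> hcomp C (idc C f) a"

abbreviation rwhisk :: "('o, 'm, 'c) bicat \<Rightarrow> 'c \<Rightarrow> 'm \<Rightarrow> 'c" (infixl "\<lhd>\<index>" 75) where
  "rwhisk C a f \<equiv> hcomp C a (idc C f)"

text \<open>Invertibility is kept apart from the boundary of a cell, so that \<open>Dom\<close> and
  \<open>Cod\<close> are left to rewriting and composites of invertible cells are recognised by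
  simplification.\<close>

definition isoc :: "('o, 'm, 'c) bicat \<Rightarrow> 'c \<Rightarrow> bool" where
  "isoc C a \<longleftrightarrow> a \<in> iso_cells C (Dom C a) (Cod C a)"

lemma isoc_iff: "isoc C a \<longleftrightarrow> (\<exists>b. inverse_cells C a b)"
  by (auto simp: isoc_def iso_cells_def inverse_cells_def)

lemma iso_cells_iff: "a \<in> iso_cells C f g \<longleftrightarrow> isoc C a \<and> Dom C a = f \<and> Cod C a = g"
  by (auto simp: isoc_def iso_cells_def cells_def)

lemma isoc_Cell [simp]: "isoc C a \<Longrightarrow> a \<in> Cell C"
  by (auto simp: isoc_def iso_cells_def cells_def)

lemma inverse_cells_sym: "inverse_cells C a b \<Longrightarrow> inverse_cells C b a"
  by (auto simp: inverse_cells_def cells_def)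

context bicategory
begin

lemma src_Obj [simp]: "f \<in> Arr C \<Longrightarrow> src C f \<in> Obj C"
  and tgt_Obj [simp]: "f \<in> Arr C \<Longrightarrow> tgt C f \<in> Obj C"
  using arr_obj by auto

lemma Dom_Arr [simp]: "a \<in> Cell C \<Longrightarrow> Dom C a \<in> Arr C"
  and Cod_Arr [simp]: "a \<in> Cell C \<Longrightarrow> Cod C a \<in> Arr C"
  and src_Cod [simp]: "a \<in> Cell C \<Longrightarrow> src C (Cod C a) = src C (Dom C a)"
  and tgt_Cod [simp]: "a \<in> Cell C \<Longrightarrow> tgt C (Cod C a) = tgt C (Dom C a)"
  using cell_arr cell_parallel by auto

lemma one_simps [simp]:
  assumes "A \<in> Obj C"
  shows "\<one> A \<in> Arr C" "src C (\<one> A) = A" "tgt C (\<one> A) = A"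
  using one_hom[OF assms] by (auto simp: hom_def)

lemma ocomp_simps [simp]:
  assumes "g \<in> Arr C" "f \<in> Arr C" "src C g = tgt C f"
  shows "g \<odot> f \<in> Arr C" "src C (g \<odot> f) = src C f" "tgt C (g \<odot> f) = tgt C g"
  using ocomp_hom[of f "src C f" "tgt C f" g "tgt C g"] assms by (auto simp: hom_def)

lemma idc_simps [simp]:
  assumes "f \<in> Arr C"
  shows "idc C f \<in> Cell C" "Dom C (idc C f) = f" "Cod C (idc C f) = f"
  using idc_cells[OF assms] by (auto simp: cells_def)

lemma vcomp_simps [simp]:
  assumes "b \<in> Cell C" "a \<in> Cell C" "Dom C b = Cod C a"
  shows "b \<cdot> a \<in> Cell C" "Dom C (b \<cdot> a) = Dom C a" "Cod C (b \<cdot> a) = Cod C b"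
  using vcomp_cells[of a "Dom C a" "Cod C a" b "Cod C b"] assms by (auto simp: cells_def)

lemma hcomp_simps [simp]:
  assumes "b \<in> Cell C" "a \<in> Cell C" "src C (Dom C b) = tgt C (Dom C a)"
  shows "b \<star> a \<in> Cell C" "Dom C (b \<star> a) = Dom C b \<odot> Dom C a" "Cod C (b \<star> a) = Cod C b \<odot> Cod C a"
  using hcomp_cells[of a "Dom C a" "Cod C a" b "Dom C b" "Cod C b"] assms
  by (auto simp: cells_def composable_def)

lemma vcomp_assoc' [simp]:
  assumes "c \<in> Cell C" "b \<in> Cell C" "a \<in> Cell C" "Dom C c = Cod C b" "Dom C b = Cod C a"
  shows "(c \<cdot> b) \<cdot> a = c \<cdot> (b \<cdot> a)"
  using vcomp_assoc[of a "Dom C a" "Cod C a" b "Cod C b" c "Cod C c"] assms by (auto simp: cells_def)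

lemma vcomp_id [simp]:
  assumes "a \<in> Cell C"
  shows "Cod C a = g \<Longrightarrow> idc C g \<cdot> a = a" "Dom C a = f \<Longrightarrow> a \<cdot> idc C f = a"
  using vcomp_idc_left[of a "Dom C a" "Cod C a"] vcomp_idc_right[of a "Dom C a" "Cod C a"] assms
  by (auto simp: cells_def)

lemma hcomp_id [simp]:
  "g \<in> Arr C \<Longrightarrow> f \<in> Arr C \<Longrightarrow> src C g = tgt C f \<Longrightarrow> idc C g \<star> idc C f = idc C (g \<odot> f)"
  using hcomp_idc by (auto simp: composable_def)

lemma interchange':
  assumes "b' \<in> Cell C" "b \<in> Cell C" "a' \<in> Cell C" "a \<in> Cell C" "Dom C b' = Cod C b"
    "Dom C a' = Cod C a" "src C (Dom C b) = tgt C (Dom C a)"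
  shows "(b' \<star> a') \<cdot> (b \<star> a) = (b' \<cdot> b) \<star> (a' \<cdot> a)"
  using interchange[of a "Dom C a" "Cod C a" a' "Cod C a'" b "Dom C b" "Cod C b" b' "Cod C b'"] assms
  by (auto simp: cells_def composable_def)

lemma lwhisk_vcomp:
  assumes "f \<in> Arr C" "b \<in> Cell C" "a \<in> Cell C" "Dom C b = Cod C a" "src C f = tgt C (Dom C a)"
  shows "f \<rhd> (b \<cdot> a) = (f \<rhd> b) \<cdot> (f \<rhd> a)"
  using assms by (simp add: interchange')

lemma rwhisk_vcomp:
  assumes "f \<in> Arr C" "b \<in> Cell C" "a \<in> Cell C" "Dom C b = Cod C a" "src C (Dom C a) = tgt C f"
  shows "(b \<cdot> a) \<lhd> f = (b \<lhd> f) \<cdot> (a \<lhd> f)"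
  using assms by (simp add: interchange')

lemma whisk_exchange:
  assumes "b \<in> Cell C" "a \<in> Cell C" "src C (Dom C b) = tgt C (Dom C a)" "Dom C b = g" "Cod C b = g'"
    "Dom C a = f" "Cod C a = f'"
  shows "(b \<lhd> f') \<cdot> (g \<rhd> a) = (g' \<rhd> a) \<cdot> (b \<lhd> f)"
  using assms by (auto simp: interchange')

lemma hcomp_whisk:
  assumes "b \<in> Cell C" "a \<in> Cell C" "src C (Dom C b) = tgt C (Dom C a)"
  shows "b \<star> a = (b \<lhd> Cod C a) \<cdot> (Dom C b \<rhd> a)"
  using assms by (simp add: interchange')

declare lwhisk_vcomp [simp] rwhisk_vcomp [simp]

text \<open>Used in the form \<open>vcomp_eq[OF e]\<close> to apply the equation \<open>e\<close> in the middle of a composite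
  bracketed to the right.\<close>

lemma vcomp_eq:
  assumes "b \<cdot> a = d \<cdot> c"
    "b \<in> Cell C" "a \<in> Cell C" "d \<in> Cell C" "c \<in> Cell C" "z \<in> Cell C"
    "Dom C b = Cod C a" "Dom C d = Cod C c" "Dom C a = Cod C z" "Dom C c = Cod C z"
  shows "b \<cdot> (a \<cdot> z) = d \<cdot> (c \<cdot> z)"
  using assms vcomp_assoc'[of b a z] vcomp_assoc'[of d c z] by metis

subsection \<open>Inverses\<close>

lemma inverse_unique:
  assumes "inverse_cells C a b" "inverse_cells C a b'"
  shows "b = b'"
proof -
  have t: "a \<in> Cell C" "b \<in> Cell C" "b' \<in> Cell C" "Dom C b = Cod C a" "Cod C b = Dom C a"
      "Dom C b' = Cod C a" "Cod C b' = Dom C a" "b \<cdot> a = idc C (Dom C a)" "a \<cdot> b' = idc C (Cod C a)"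
    using assms by (auto simp: inverse_cells_def cells_def)
  have "b = b \<cdot> (a \<cdot> b')" using t by simp
  also have "\<dots> = (b \<cdot> a) \<cdot> b'" using t(1-7) by (subst vcomp_assoc') auto
  also have "\<dots> = b'" using t by simp
  finally show ?thesis .
qed

lemma inv_cell_eq: "inverse_cells C a b \<Longrightarrow> inv_cell C a = b"
  unfolding inv_cell_def by (rule the_equality) (auto intro: inverse_unique)

lemma inverse_inv: "isoc C a \<Longrightarrow> inverse_cells C a (inv_cell C a)"
  using inv_cell_eq by (metis isoc_iff)

lemma inv_simps [simp]:
  assumes "isoc C a"
  shows "inv_cell C a \<in> Cell C" "Dom C (inv_cell C a) = Cod C a" "Cod C (inv_cell C a) = Dom C a"
    "inv_cell C a \<cdot> a = idc C (Dom C a)" "a \<cdot> inv_cell C a = idc C (Cod C a)"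
    "isoc C (inv_cell C a)" "inv_cell C (inv_cell C a) = a"
proof -
  have i: "inverse_cells C a (inv_cell C a)" using assms by (rule inverse_inv)
  then show "inv_cell C a \<in> Cell C" "Dom C (inv_cell C a) = Cod C a" "Cod C (inv_cell C a) = Dom C a"
    "inv_cell C a \<cdot> a = idc C (Dom C a)" "a \<cdot> inv_cell C a = idc C (Cod C a)"
    by (auto simp: inverse_cells_def cells_def)
  show "isoc C (inv_cell C a)" "inv_cell C (inv_cell C a) = a"
    using inverse_cells_sym[OF i] by (auto simp: isoc_iff inv_cell_eq)
qed

lemma inv_vcomp_cancel [simp]:
  assumes "isoc C a" "z \<in> Cell C"
  shows "Cod C z = Dom C a \<Longrightarrow> inv_cell C a \<cdot> (a \<cdot> z) = z"
    "Cod C z = Cod C a \<Longrightarrow> a \<cdot> (inv_cell C a \<cdot> z) = z"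
  using assms vcomp_assoc'[of "inv_cell C a" a z] vcomp_assoc'[of a "inv_cell C a" z]
  by (simp_all del: vcomp_assoc')

lemma iso_cancel_left:
  assumes "isoc C c" "a \<in> Cell C" "b \<in> Cell C" "Cod C a = Dom C c" "Cod C b = Dom C c"
    "c \<cdot> a = c \<cdot> b"
  shows "a = b"
  using assms inv_vcomp_cancel(1) by metis

lemma iso_cancel_right:
  assumes "isoc C c" "a \<in> Cell C" "b \<in> Cell C" "Dom C a = Cod C c" "Dom C b = Cod C c"
    "a \<cdot> c = b \<cdot> c"
  shows "a = b"
proof -
  have "(a \<cdot> c) \<cdot> inv_cell C c = (b \<cdot> c) \<cdot> inv_cell C c" using assms by simp
  then show ?thesis using assms(1-5) by simp
qed

lemma inverse_cellsI:
  assumes "a \<in> Cell C" "b \<in> Cell C" "Dom C b = Cod C a" "Cod C b = Dom C a"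
    "b \<cdot> a = idc C (Dom C a)" "a \<cdot> b = idc C (Cod C a)"
  shows "inverse_cells C a b"
  using assms by (auto simp: inverse_cells_def cells_def)

lemma isoc_idc [simp]:
  assumes "f \<in> Arr C"
  shows "isoc C (idc C f)" "inv_cell C (idc C f) = idc C f"
proof -
  have "inverse_cells C (idc C f) (idc C f)"
    using assms by (intro inverse_cellsI) auto
  then show "isoc C (idc C f)" "inv_cell C (idc C f) = idc C f"
    by (auto simp: isoc_iff inv_cell_eq)
qed

lemma isoc_vcomp [simp]:
  assumes "isoc C b" "isoc C a" "Dom C b = Cod C a"
  shows "isoc C (b \<cdot> a)" "inv_cell C (b \<cdot> a) = inv_cell C a \<cdot> inv_cell C b"
proof -
  have "inverse_cells C (b \<cdot> a) (inv_cell C a \<cdot> inv_cell C b)"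
    using assms by (intro inverse_cellsI) auto
  then show "isoc C (b \<cdot> a)" "inv_cell C (b \<cdot> a) = inv_cell C a \<cdot> inv_cell C b"
    by (auto simp: isoc_iff inv_cell_eq)
qed

lemma isoc_hcomp [simp]:
  assumes "isoc C b" "isoc C a" "src C (Dom C b) = tgt C (Dom C a)"
  shows "isoc C (b \<star> a)" "inv_cell C (b \<star> a) = inv_cell C b \<star> inv_cell C a"
proof -
  have "inverse_cells C (b \<star> a) (inv_cell C b \<star> inv_cell C a)"
    using assms by (intro inverse_cellsI) (auto simp: interchange' simp del: lwhisk_vcomp rwhisk_vcomp)
  then show "isoc C (b \<star> a)" "inv_cell C (b \<star> a) = inv_cell C b \<star> inv_cell C a"
    by (auto simp: isoc_iff inv_cell_eq)
qed

lemma isoc_move_left: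
  assumes "isoc C c" "a \<in> Cell C" "b \<in> Cell C" "Cod C a = Dom C c" "c \<cdot> a = b"
  shows "a = inv_cell C c \<cdot> b"
  using assms by auto

lemma inv_natural:
  assumes "isoc C b" "isoc C b'" "a \<in> Cell C" "a' \<in> Cell C"
    "Dom C b' = Cod C a" "Dom C a' = Cod C b" "Dom C b = Dom C a" "Cod C b' = Cod C a'"
    "b' \<cdot> a = a' \<cdot> b"
  shows "a \<cdot> inv_cell C b = inv_cell C b' \<cdot> a'"
proof (rule iso_cancel_left[of b'])
  have "b' \<cdot> (a \<cdot> inv_cell C b) = (b' \<cdot> a) \<cdot> inv_cell C b"
    using assms(1-8) by simp
  also have "\<dots> = a'" using assms(1-8) by (simp add: assms(9))
  finally show "b' \<cdot> (a \<cdot> inv_cell C b) = b' \<cdot> (inv_cell C b' \<cdot> a')"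
    using assms(1-8) by simp
qed (use assms(1-8) in auto)

subsection \<open>Structure cells\<close>

lemma asc_simps [simp]:
  assumes "h \<in> Arr C" "g \<in> Arr C" "f \<in> Arr C" "src C h = tgt C g" "src C g = tgt C f"
  shows "isoc C (asc C h g f)" "asc C h g f \<in> Cell C" "Dom C (asc C h g f) = (h \<odot> g) \<odot> f"
    "Cod C (asc C h g f) = h \<odot> (g \<odot> f)"
  using asc_iso[of h g f] assms by (auto simp: composable_def iso_cells_iff)

lemma lun_simps [simp]:
  assumes "f \<in> Arr C"
  shows "isoc C (lun C f)" "lun C f \<in> Cell C" "Dom C (lun C f) = \<one> (tgt C f) \<odot> f" "Cod C (lun C f) = f"
  using lun_iso[of f] assms by (auto simp: hom_def iso_cells_iff)

lemma run_simps [simp]: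
  assumes "f \<in> Arr C"
  shows "isoc C (run C f)" "run C f \<in> Cell C" "Dom C (run C f) = f \<odot> \<one> (src C f)" "Cod C (run C f) = f"
  using run_iso[of f] assms by (auto simp: hom_def iso_cells_iff)

lemma asc_natural':
  assumes "c \<in> Cell C" "b \<in> Cell C" "a \<in> Cell C" "src C (Dom C c) = tgt C (Dom C b)"
    "src C (Dom C b) = tgt C (Dom C a)" "Dom C c = h" "Cod C c = h'" "Dom C b = g" "Cod C b = g'"
    "Dom C a = f" "Cod C a = f'"
  shows "asc C h' g' f' \<cdot> ((c \<star> b) \<star> a) = (c \<star> (b \<star> a)) \<cdot> asc C h g f"
  using asc_natural[of a f f' b g g' c h h'] assms by (auto simp: cells_def composable_def)

lemma lun_natural':
  assumes "a \<in> Cell C" "tgt C (Dom C a) = B"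
  shows "lun C (Cod C a) \<cdot> (\<one> B \<rhd> a) = a \<cdot> lun C (Dom C a)"
  using lun_natural[of a "Dom C a" "Cod C a"] assms by (auto simp: cells_def)

lemma run_natural':
  assumes "a \<in> Cell C" "src C (Dom C a) = B"
  shows "run C (Cod C a) \<cdot> (a \<lhd> \<one> B) = a \<cdot> run C (Dom C a)"
  using run_natural[of a "Dom C a" "Cod C a"] assms by (auto simp: cells_def)

lemma asc_inv_natural:
  assumes "c \<in> Cell C" "b \<in> Cell C" "a \<in> Cell C" "src C (Dom C c) = tgt C (Dom C b)"
    "src C (Dom C b) = tgt C (Dom C a)" "Dom C c = h" "Cod C c = h'" "Dom C b = g" "Cod C b = g'"
    "Dom C a = f" "Cod C a = f'"
  shows "inv_cell C (asc C h' g' f') \<cdot> (c \<star> (b \<star> a)) = ((c \<star> b) \<star> a) \<cdot> inv_cell C (asc C h g f)"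
  by (rule inv_natural[symmetric]) (use assms in \<open>auto simp: asc_natural'\<close>)

lemmas asc_inv_nat = asc_inv_natural[OF _ _ _ _ _ refl refl refl refl refl refl]

lemma lun_inv_natural:
  assumes "a \<in> Cell C" "tgt C (Dom C a) = B"
  shows "(\<one> B \<rhd> a) \<cdot> inv_cell C (lun C (Dom C a)) = inv_cell C (lun C (Cod C a)) \<cdot> a"
  by (rule inv_natural) (use assms in \<open>auto simp: lun_natural'\<close>)

text \<open>The right unitor is a natural isomorphism from whiskering by an identity to doing
  nothing, so it cancels. Faithfulness of the whole Cayley representation rests on this.\<close>

lemma rwhisk_one_faithful:
  assumes "a \<in> Cell C" "b \<in> Cell C" "Dom C a = Dom C b" "Cod C a = Cod C b" "src C (Dom C a) = A"
    and e: "a \<lhd> \<one> A = b \<lhd> \<one> A"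
  shows "a = b"
proof (rule iso_cancel_right[of "run C (Dom C a)"])
  have "run C (Cod C a) \<cdot> (a \<lhd> \<one> A) = run C (Cod C b) \<cdot> (b \<lhd> \<one> A)"
    using assms(4) e by simp
  then show "a \<cdot> run C (Dom C a) = b \<cdot> run C (Dom C a)"
    using assms(1-5) run_natural'[of a A] run_natural'[of b A] by simp
qed (use assms(1-5) in auto)

lemma lwhisk_one_faithful:
  assumes "a \<in> Cell C" "b \<in> Cell C" "Dom C a = Dom C b" "Cod C a = Cod C b" "tgt C (Dom C a) = A"
    and e: "\<one> A \<rhd> a = \<one> A \<rhd> b"
  shows "a = b"
proof (rule iso_cancel_right[of "lun C (Dom C a)"])
  have "lun C (Cod C a) \<cdot> (\<one> A \<rhd> a) = lun C (Cod C b) \<cdot> (\<one> A \<rhd> b)"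
    using assms(4) e by simp
  then show "a \<cdot> lun C (Dom C a) = b \<cdot> lun C (Dom C a)"
    using assms(1-5) lun_natural'[of a A] lun_natural'[of b A] by simp
qed (use assms(1-5) in auto)

lemma pentagon':
  assumes "k \<in> Arr C" "h \<in> Arr C" "g \<in> Arr C" "f \<in> Arr C"
    "src C k = tgt C h" "src C h = tgt C g" "src C g = tgt C f"
  shows "(k \<rhd> asc C h g f) \<cdot> (asc C k (h \<odot> g) f \<cdot> (asc C k h g \<lhd> f)) =
    asc C k h (g \<odot> f) \<cdot> asc C (k \<odot> h) g f"
  using pentagon[of k h g f] assms by (auto simp: composable_def)

lemma triangle':
  assumes "g \<in> Arr C" "f \<in> Arr C" "src C g = B" "tgt C f = B"
  shows "(g \<rhd> lun C f) \<cdot> asc C g (\<one> B) f = run C g \<lhd> f"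
  using triangle[of g f] assms by (auto simp: composable_def)

text \<open>Kelly's argument: it suffices to compare the two sides after whiskering by an identity.\<close>

lemma lun_ocomp:
  assumes "g \<in> Arr C" "f \<in> Arr C" "src C g = tgt C f" "tgt C g = B"
  shows "lun C (g \<odot> f) \<cdot> asc C (\<one> B) g f = lun C g \<lhd> f"
proof (rule lwhisk_one_faithful[of _ _ B])
  have B: "B \<in> Obj C" using assms by auto
  let ?u = "\<one> B"
  have "(?u \<rhd> (lun C g \<lhd> f)) \<cdot> (asc C ?u (?u \<odot> g) f \<cdot> (asc C ?u ?u g \<lhd> f)) =
    asc C ?u g f \<cdot> (((?u \<rhd> lun C g) \<lhd> f) \<cdot> (asc C ?u ?u g \<lhd> f))"
    using assms B
    by (intro vcomp_eq) (auto simp: asc_natural'[of "idc C ?u" "lun C g" "idc C f"])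
  also have "\<dots> = asc C ?u g f \<cdot> (((?u \<rhd> lun C g) \<cdot> asc C ?u ?u g) \<lhd> f)"
    using assms B by simp
  also have "\<dots> = asc C ?u g f \<cdot> ((run C ?u \<lhd> g) \<lhd> f)"
    using assms B triangle'[of ?u g B] by (simp del: rwhisk_vcomp)
  also have "\<dots> = (run C ?u \<lhd> (g \<odot> f)) \<cdot> asc C (?u \<odot> ?u) g f"
    using assms B by (simp add: asc_natural'[of "run C ?u" "idc C g" "idc C f"])
  also have "\<dots> = ((?u \<rhd> lun C (g \<odot> f)) \<cdot> asc C ?u ?u (g \<odot> f)) \<cdot> asc C (?u \<odot> ?u) g f"
    using assms B triangle'[of ?u "g \<odot> f" B] by simp
  also have "\<dots> = (?u \<rhd> lun C (g \<odot> f)) \<cdot> (asc C ?u ?u (g \<odot> f) \<cdot> asc C (?u \<odot> ?u) g f)"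
    using assms B by simp
  also have "asc C ?u ?u (g \<odot> f) \<cdot> asc C (?u \<odot> ?u) g f =
    (?u \<rhd> asc C ?u g f) \<cdot> (asc C ?u (?u \<odot> g) f \<cdot> (asc C ?u ?u g \<lhd> f))"
    using assms B by (simp add: pentagon')
  finally have "(?u \<rhd> (lun C g \<lhd> f)) \<cdot> (asc C ?u (?u \<odot> g) f \<cdot> (asc C ?u ?u g \<lhd> f)) =
    (?u \<rhd> (lun C (g \<odot> f) \<cdot> asc C ?u g f)) \<cdot> (asc C ?u (?u \<odot> g) f \<cdot> (asc C ?u ?u g \<lhd> f))"
    using assms B by simp
  from iso_cancel_right[OF _ _ _ _ _ this] show "?u \<rhd> (lun C (g \<odot> f) \<cdot> asc C ?u g f) = ?u \<rhd> (lun C g \<lhd> f)"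
    using assms B by simp
qed (use assms in auto)

end

section \<open>Strictification by the Cayley representation\<close>

text \<open>An arrow does not determine a bracketing of itself, so strict forms of cells are taken
  with respect to chosen trees for source and target. \<open>At\<close> accepts any arrow,
  composites included, and stops the unfolding there.\<close>

datatype ('o, 'm) tm = One 'o | At 'm | Cm "('o, 'm) tm" "('o, 'm) tm"

primrec ev :: "('o, 'm, 'c) bicat \<Rightarrow> ('o, 'm) tm \<Rightarrow> 'm" where
  "ev C (One A) = one C A"
| "ev C (At f) = f"
| "ev C (Cm t s) = ocomp C (ev C t) (ev C s)"

primrec wft :: "('o, 'm, 'c) bicat \<Rightarrow> ('o, 'm) tm \<Rightarrow> bool" where
  "wft C (One A) \<longleftrightarrow> A \<in> Obj C"
| "wft C (At f) \<longleftrightarrow> f \<in> Arr C"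
| "wft C (Cm t s) \<longleftrightarrow> wft C t \<and> wft C s \<and> src C (ev C t) = tgt C (ev C s)"

lemma (in bicategory) ev_Arr [simp]: "wft C t \<Longrightarrow> ev C t \<in> Arr C"
  by (induction t) auto

text \<open>
  An arrow \<open>f\<close> of \<open>C\<close> acts on the arrows \<open>X\<close> of \<open>D\<close> into \<open>ob (src f)\<close> by \<open>X \<mapsto> ar f \<odot> X\<close>. The cells
  \<open>P g f X : g \<cdot> (f \<cdot> X) \<Rightarrow> (g f) \<cdot> X\<close> and \<open>U A X : X \<Rightarrow> 1 \<cdot> X\<close> make this action coherent; the axioms contain
  no structure cells of \<open>D\<close>. Every bicategory acts on itself, and a pseudofunctor lets its domain act
  on its codomain.
\<close>

locale action = C: bicategory C + D: bicategory D
  for C :: "('o, 'm, 'c) bicat" and D :: "('p, 'n, 'd) bicat" (structure) +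
  fixes ob :: "'o \<Rightarrow> 'p" and ar :: "'m \<Rightarrow> 'n" and ce :: "'c \<Rightarrow> 'd"
    and P :: "'m \<Rightarrow> 'm \<Rightarrow> 'n \<Rightarrow> 'd" and U :: "'o \<Rightarrow> 'n \<Rightarrow> 'd"
  assumes ob_Obj: "A \<in> Obj C \<Longrightarrow> ob A \<in> Obj D"
    and ar_simps: "f \<in> Arr C \<Longrightarrow> ar f \<in> Arr D"
      "f \<in> Arr C \<Longrightarrow> src D (ar f) = ob (src C f)" "f \<in> Arr C \<Longrightarrow> tgt D (ar f) = ob (tgt C f)"
    and ce_simps: "a \<in> Cell C \<Longrightarrow> ce a \<in> Cell D"
      "a \<in> Cell C \<Longrightarrow> Dom D (ce a) = ar (Dom C a)" "a \<in> Cell C \<Longrightarrow> Cod D (ce a) = ar (Cod C a)"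
    and ce_idc: "f \<in> Arr C \<Longrightarrow> ce (idc C f) = idc D (ar f)"
    and ce_vcomp: "a \<in> Cell C \<Longrightarrow> b \<in> Cell C \<Longrightarrow> Dom C b = Cod C a \<Longrightarrow>
      ce (vcomp C b a) = ce b \<cdot> ce a"
    and P_iso: "g \<in> Arr C \<Longrightarrow> f \<in> Arr C \<Longrightarrow> X \<in> Arr D \<Longrightarrow> src C g = tgt C f \<Longrightarrow>
      tgt D X = ob (src C f) \<Longrightarrow> isoc D (P g f X)"
    and P_Dom: "g \<in> Arr C \<Longrightarrow> f \<in> Arr C \<Longrightarrow> X \<in> Arr D \<Longrightarrow> src C g = tgt C f \<Longrightarrow>
      tgt D X = ob (src C f) \<Longrightarrow> Dom D (P g f X) = ar g \<odot> (ar f \<odot> X)"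
    and P_Cod: "g \<in> Arr C \<Longrightarrow> f \<in> Arr C \<Longrightarrow> X \<in> Arr D \<Longrightarrow> src C g = tgt C f \<Longrightarrow>
      tgt D X = ob (src C f) \<Longrightarrow> Cod D (P g f X) = ar (ocomp C g f) \<odot> X"
    and P_arg: "g \<in> Arr C \<Longrightarrow> f \<in> Arr C \<Longrightarrow> c \<in> Cell D \<Longrightarrow> src C g = tgt C f \<Longrightarrow>
      tgt D (Dom D c) = ob (src C f) \<Longrightarrow>
      P g f (Cod D c) \<cdot> (ar g \<rhd> (ar f \<rhd> c)) = (ar (ocomp C g f) \<rhd> c) \<cdot> P g f (Dom D c)"
    and P_natural: "b \<in> Cell C \<Longrightarrow> a \<in> Cell C \<Longrightarrow> X \<in> Arr D \<Longrightarrow> src C (Dom C b) = tgt C (Dom C a) \<Longrightarrow>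
      tgt D X = ob (src C (Dom C a)) \<Longrightarrow>
      P (Cod C b) (Cod C a) X \<cdot> ((ce b \<lhd> (ar (Cod C a) \<odot> X)) \<cdot> (ar (Dom C b) \<rhd> (ce a \<lhd> X))) =
      (ce (hcomp C b a) \<lhd> X) \<cdot> P (Dom C b) (Dom C a) X"
    and U_iso: "A \<in> Obj C \<Longrightarrow> X \<in> Arr D \<Longrightarrow> tgt D X = ob A \<Longrightarrow> isoc D (U A X)"
    and U_Dom: "A \<in> Obj C \<Longrightarrow> X \<in> Arr D \<Longrightarrow> tgt D X = ob A \<Longrightarrow> Dom D (U A X) = X"
    and U_Cod: "A \<in> Obj C \<Longrightarrow> X \<in> Arr D \<Longrightarrow> tgt D X = ob A \<Longrightarrow>
      Cod D (U A X) = ar (one C A) \<odot> X"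
    and U_arg: "A \<in> Obj C \<Longrightarrow> c \<in> Cell D \<Longrightarrow> tgt D (Dom D c) = ob A \<Longrightarrow>
      U A (Cod D c) \<cdot> c = (ar (one C A) \<rhd> c) \<cdot> U A (Dom D c)"
    and P_asc: "h \<in> Arr C \<Longrightarrow> g \<in> Arr C \<Longrightarrow> f \<in> Arr C \<Longrightarrow> X \<in> Arr D \<Longrightarrow>
      src C h = tgt C g \<Longrightarrow> src C g = tgt C f \<Longrightarrow> tgt D X = ob (src C f) \<Longrightarrow>
      (ce (asc C h g f) \<lhd> X) \<cdot> (P (ocomp C h g) f X \<cdot> P h g (ar f \<odot> X)) =
      P h (ocomp C g f) X \<cdot> (ar h \<rhd> P g f X)"
    and U_left: "f \<in> Arr C \<Longrightarrow> X \<in> Arr D \<Longrightarrow> tgt D X = ob (src C f) \<Longrightarrow>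
      (ce (lun C f) \<lhd> X) \<cdot> (P (one C (tgt C f)) f X \<cdot> U (tgt C f) (ar f \<odot> X)) = idc D (ar f \<odot> X)"
    and U_right: "f \<in> Arr C \<Longrightarrow> X \<in> Arr D \<Longrightarrow> tgt D X = ob (src C f) \<Longrightarrow>
      (ce (run C f) \<lhd> X) \<cdot> (P f (one C (src C f)) X \<cdot> (ar f \<rhd> U (src C f) X)) = idc D (ar f \<odot> X)"
begin

context
  notes ob_Obj [simp] ar_simps [simp] ce_simps [simp] ce_idc [simp] P_iso [simp] P_Dom [simp] P_Cod [simp]
    U_iso [simp] U_Dom [simp] U_Cod [simp]
begin

lemma ce_iso:
  assumes "isoc C a"
  shows "isoc D (ce a)" "ce (inv_cell C a) = inv_cell D (ce a)"
proof -
  have "inverse_cells D (ce a) (ce (inv_cell C a))"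
    using assms by (intro D.inverse_cellsI) (auto simp flip: ce_vcomp)
  then show "isoc D (ce a)" "ce (inv_cell C a) = inv_cell D (ce a)"
    by (auto simp: isoc_iff D.inv_cell_eq)
qed

end

primrec ap :: "('o, 'm) tm \<Rightarrow> 'n \<Rightarrow> 'n" where
  "ap (One A) X = X"
| "ap (At f) X = ar f \<odot> X"
| "ap (Cm t s) X = ap t (ap s X)"

primrec apc :: "('o, 'm) tm \<Rightarrow> 'd \<Rightarrow> 'd" where
  "apc (One A) c = c"
| "apc (At f) c = ar f \<rhd> c"
| "apc (Cm t s) c = apc t (apc s c)"

text \<open>The canonical cell from the iterated application \<open>ap t X\<close> to
  \<open>ar (ev C t) \<odot> X\<close>: for a composite, the inner tree is collapsed under the outer
  one, then the outer tree is collapsed, and \<open>P\<close> joins the two.\<close>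

primrec K :: "('o, 'm) tm \<Rightarrow> 'n \<Rightarrow> 'd" where
  "K (One A) X = U A X"
| "K (At f) X = idc D (ar f \<odot> X)"
| "K (Cm t s) X = P (ev C t) (ev C s) X \<cdot> (K t (ar (ev C s) \<odot> X) \<cdot> apc t (K s X))"

text \<open>The strict form of a cell \<open>a : ev s \<Rightarrow> ev t\<close>: its action on \<open>X\<close>, transported along the
  canonical isomorphisms \<open>K\<close> to a cell between iterated applications. All structure cells become
  identities.\<close>

definition st :: "('o, 'm) tm \<Rightarrow> ('o, 'm) tm \<Rightarrow> 'c \<Rightarrow> 'n \<Rightarrow> 'd" where
  "st s t a X = inv_cell D (K t X) \<cdot> ((ce a \<lhd> X) \<cdot> K s X)"

context
  notes ob_Obj [simp] ar_simps [simp] ce_simps [simp] ce_idc [simp] ce_iso [simp] P_iso [simp] P_Dom [simp]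
    P_Cod [simp] U_iso [simp] U_Dom [simp] U_Cod [simp]
begin

lemma ap_simps [simp]:
  assumes "wft C t" "X \<in> Arr D" "tgt D X = ob (src C (ev C t))"
  shows "ap t X \<in> Arr D" "src D (ap t X) = src D X" "tgt D (ap t X) = ob (tgt C (ev C t))"
proof -
  have "ap t X \<in> Arr D \<and> src D (ap t X) = src D X \<and> tgt D (ap t X) = ob (tgt C (ev C t))"
    using assms by (induction t arbitrary: X) auto
  then show "ap t X \<in> Arr D" "src D (ap t X) = src D X" "tgt D (ap t X) = ob (tgt C (ev C t))"
    by auto
qed

lemma apc_simps [simp]:
  assumes "wft C t" "c \<in> Cell D" "tgt D (Dom D c) = ob (src C (ev C t))"
  shows "apc t c \<in> Cell D" "Dom D (apc t c) = ap t (Dom D c)" "Cod D (apc t c) = ap t (Cod D c)"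
proof -
  have "apc t c \<in> Cell D \<and> Dom D (apc t c) = ap t (Dom D c) \<and> Cod D (apc t c) = ap t (Cod D c)"
    using assms by (induction t arbitrary: c) auto
  then show "apc t c \<in> Cell D" "Dom D (apc t c) = ap t (Dom D c)" "Cod D (apc t c) = ap t (Cod D c)"
    by auto
qed

lemma apc_idc [simp]:
  assumes "wft C t" "X \<in> Arr D" "tgt D X = ob (src C (ev C t))"
  shows "apc t (idc D X) = idc D (ap t X)"
  using assms by (induction t arbitrary: X) auto

lemma apc_vcomp [simp]:
  assumes "wft C t" "b \<in> Cell D" "a \<in> Cell D" "Dom D b = Cod D a" "tgt D (Dom D a) = ob (src C (ev C t))"
  shows "apc t (b \<cdot> a) = apc t b \<cdot> apc t a"
  using assms by (induction t arbitrary: b a) auto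

lemma apc_iso [simp]:
  assumes "wft C t" "isoc D c" "tgt D (Dom D c) = ob (src C (ev C t))"
  shows "isoc D (apc t c)" "inv_cell D (apc t c) = apc t (inv_cell D c)"
proof -
  have "isoc D (apc t c) \<and> inv_cell D (apc t c) = apc t (inv_cell D c)"
    using assms by (induction t arbitrary: c) auto
  then show "isoc D (apc t c)" "inv_cell D (apc t c) = apc t (inv_cell D c)" by auto
qed

lemma K_simps [simp]:
  assumes "wft C t" "X \<in> Arr D" "tgt D X = ob (src C (ev C t))"
  shows "isoc D (K t X)" "Dom D (K t X) = ap t X" "Cod D (K t X) = ar (ev C t) \<odot> X"
proof -
  have "isoc D (K t X) \<and> Dom D (K t X) = ap t X \<and> Cod D (K t X) = ar (ev C t) \<odot> X"
    using assms by (induction t arbitrary: X) auto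
  then show "isoc D (K t X)" "Dom D (K t X) = ap t X" "Cod D (K t X) = ar (ev C t) \<odot> X"
    by auto
qed

text \<open>Induction on the tree: the induction hypotheses push \<open>c\<close> through the two
  collapsed subtrees, and \<open>P_arg\<close> pushes it through \<open>P\<close>.\<close>

lemma K_natural:
  assumes "wft C t" "c \<in> Cell D" "tgt D (Dom D c) = ob (src C (ev C t))"
  shows "K t (Cod D c) \<cdot> apc t c = (ar (ev C t) \<rhd> c) \<cdot> K t (Dom D c)"
  using assms
proof (induction t arbitrary: c)
  case (One A)
  then show ?case by (simp add: U_arg)
next
  case (At f)
  then show ?case by simp
next
  case (Cm t s)
  let ?g = "ev C t" and ?f = "ev C s" and ?x = "Dom D c" and ?y = "Cod D c"
  have "K (Cm t s) ?y \<cdot> apc (Cm t s) c =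
    P ?g ?f ?y \<cdot> (K t (ar ?f \<odot> ?y) \<cdot> apc t (K s ?y \<cdot> apc s c))"
    using Cm.prems by simp
  also have "\<dots> = P ?g ?f ?y \<cdot> (K t (ar ?f \<odot> ?y) \<cdot> apc t ((ar ?f \<rhd> c) \<cdot> K s ?x))"
    using Cm.prems Cm.IH(2)[of c] by simp
  also have "\<dots> = P ?g ?f ?y \<cdot> ((K t (ar ?f \<odot> ?y) \<cdot> apc t (ar ?f \<rhd> c)) \<cdot> apc t (K s ?x))"
    using Cm.prems by simp
  also have "K t (ar ?f \<odot> ?y) \<cdot> apc t (ar ?f \<rhd> c) = (ar ?g \<rhd> (ar ?f \<rhd> c)) \<cdot> K t (ar ?f \<odot> ?x)"
    using Cm.prems Cm.IH(1)[of "ar ?f \<rhd> c"] by simp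
  also have "P ?g ?f ?y \<cdot> (\<dots> \<cdot> apc t (K s ?x)) =
    P ?g ?f ?y \<cdot> ((ar ?g \<rhd> (ar ?f \<rhd> c)) \<cdot> (K t (ar ?f \<odot> ?x) \<cdot> apc t (K s ?x)))"
    using Cm.prems by simp
  also have "\<dots> = (ar (ocomp C ?g ?f) \<rhd> c) \<cdot> (P ?g ?f ?x \<cdot> (K t (ar ?f \<odot> ?x) \<cdot> apc t (K s ?x)))"
    using Cm.prems by (intro D.vcomp_eq P_arg) auto
  finally show ?case by simp
qed

lemma st_simps [simp]:
  assumes "wft C s" "wft C t" "a \<in> Cell C" "Dom C a = ev C s" "Cod C a = ev C t"
    "X \<in> Arr D" "tgt D X = ob (src C (ev C s))"
  shows "st s t a X \<in> Cell D" "Dom D (st s t a X) = ap s X" "Cod D (st s t a X) = ap t X"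
proof -
  have "src C (ev C t) = src C (ev C s)" using assms(3-5) C.src_Cod[of a] by simp
  then show "st s t a X \<in> Cell D" "Dom D (st s t a X) = ap s X" "Cod D (st s t a X) = ap t X"
    using assms unfolding st_def by simp_all
qed

lemma K_st:
  assumes "wft C s" "wft C t" "a \<in> Cell C" "Dom C a = ev C s" "Cod C a = ev C t"
    "X \<in> Arr D" "tgt D X = ob (src C (ev C s))"
  shows "K t X \<cdot> st s t a X = (ce a \<lhd> X) \<cdot> K s X"
proof -
  have "src C (ev C t) = src C (ev C s)" using assms(3-5) C.src_Cod[of a] by simp
  then show ?thesis using assms unfolding st_def by simp
qed

text \<open>\<open>K t X\<close> is invertible, so the strict form is the only \<open>w\<close> that
  closes the square. The evaluations of \<open>st\<close> on composites and structure cells check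
  this square instead of computing with inverses.\<close>

lemma st_eqI:
  assumes "wft C s" "wft C t" "a \<in> Cell C" "Dom C a = ev C s" "Cod C a = ev C t"
    "X \<in> Arr D" "tgt D X = ob (src C (ev C s))"
    "w \<in> Cell D" "Cod D w = ap t X" "K t X \<cdot> w = (ce a \<lhd> X) \<cdot> K s X"
  shows "st s t a X = w"
proof -
  have e: "src C (ev C t) = src C (ev C s)" using assms(3-5) C.src_Cod[of a] by simp
  show ?thesis
  proof (rule D.iso_cancel_left[of "K t X"])
    show "K t X \<cdot> st s t a X = K t X \<cdot> w"
      using K_st[OF assms(1-7)] assms(10) by (rule trans[OF _ sym])
  qed (use e assms(1-9) in auto)
qed

text \<open>The factors \<open>K t X\<close> at the middle tree cancel. That tree cannot be read off
  from the two cells, which is why later uses instantiate \<open>t\<close> by hand.\<close>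

lemma st_vcomp:
  assumes "wft C s" "wft C t" "wft C u" "b \<in> Cell C" "a \<in> Cell C" "Dom C a = ev C s"
    "Cod C a = ev C t" "Dom C b = ev C t" "Cod C b = ev C u"
    "X \<in> Arr D" "tgt D X = ob (src C (ev C s))"
  shows "st s u (vcomp C b a) X = st t u b X \<cdot> st s t a X"
proof -
  have e: "src C (ev C t) = src C (ev C s)" "src C (ev C u) = src C (ev C s)"
    using assms C.src_Cod[of a] C.src_Cod[of b] by auto
  show ?thesis
  proof (rule st_eqI)
    have "K u X \<cdot> (st t u b X \<cdot> st s t a X) = (ce b \<lhd> X) \<cdot> (K t X \<cdot> st s t a X)"
      by (rule D.vcomp_eq[OF K_st]) (use e assms in auto)
    also have "\<dots> = (ce (vcomp C b a) \<lhd> X) \<cdot> K s X"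
      using e assms by (simp add: K_st ce_vcomp)
    finally show "K u X \<cdot> (st t u b X \<cdot> st s t a X) = (ce (vcomp C b a) \<lhd> X) \<cdot> K s X" .
  qed (use e assms in auto)
qed

lemma st_idc [simp]:
  assumes "wft C s" "X \<in> Arr D" "tgt D X = ob (src C (ev C s))" "f = ev C s"
  shows "st s s (idc C f) X = idc D (ap s X)"
  by (rule st_eqI) (use assms in auto)

lemma st_At [simp]:
  assumes "a \<in> Cell C" "X \<in> Arr D" "tgt D X = ob (src C (Dom C a))" "Dom C a = f" "Cod C a = g"
  shows "st (At f) (At g) a X = ce a \<lhd> X"
  by (rule st_eqI) (use assms C.src_Cod[of a] C.Cod_Arr[of a] in \<open>auto simp del: C.src_Cod C.Cod_Arr\<close>)

lemma st_iso [simp]: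
  assumes "wft C s" "wft C t" "isoc C a" "Dom C a = ev C s" "Cod C a = ev C t"
    "X \<in> Arr D" "tgt D X = ob (src C (ev C s))"
  shows "isoc D (st s t a X)" "st t s (inv_cell C a) X = inv_cell D (st s t a X)"
proof -
  have e: "src C (ev C t) = src C (ev C s)" using assms(3-5) C.src_Cod[of a] by simp
  have "inverse_cells D (st s t a X) (st t s (inv_cell C a) X)"
    using assms e by (intro D.inverse_cellsI) (auto simp flip: st_vcomp)
  then show "isoc D (st s t a X)" "st t s (inv_cell C a) X = inv_cell D (st s t a X)"
    by (auto simp: isoc_iff D.inv_cell_eq)
qed

text \<open>The interchange law in strict form: \<open>K_natural\<close> for both trees, combined
  with the exchange of \<open>ce a\<close> and a cell between the arguments.\<close>

lemma st_natural:
  assumes "wft C s" "wft C t" "a \<in> Cell C" "Dom C a = ev C s" "Cod C a = ev C t"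
    "c \<in> Cell D" "tgt D (Dom D c) = ob (src C (ev C s))" "Dom D c = X" "Cod D c = Y"
  shows "st s t a Y \<cdot> apc s c = apc t c \<cdot> st s t a X"
proof (rule D.iso_cancel_left[of "K t Y"])
  have e: "src C (ev C t) = src C (ev C s)" using assms(3-5) C.src_Cod[of a] by simp
  have X: "X \<in> Arr D" "Y \<in> Arr D" "tgt D X = ob (src C (ev C s))" "tgt D Y = ob (src C (ev C s))"
    using assms(6-9) by auto
  have "K t Y \<cdot> (st s t a Y \<cdot> apc s c) = (ce a \<lhd> Y) \<cdot> (K s Y \<cdot> apc s c)"
    by (rule D.vcomp_eq[OF K_st]) (use e X assms in auto)
  also have "K s Y \<cdot> apc s c = (ar (ev C s) \<rhd> c) \<cdot> K s X"
    using K_natural[of s c] assms by simp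
  also have "(ce a \<lhd> Y) \<cdot> \<dots> = (ar (ev C t) \<rhd> c) \<cdot> ((ce a \<lhd> X) \<cdot> K s X)"
    by (rule D.vcomp_eq[OF D.whisk_exchange]) (use e X assms in auto)
  also have "(ce a \<lhd> X) \<cdot> K s X = K t X \<cdot> st s t a X"
    by (rule K_st[symmetric]) (use e X assms in auto)
  also have "(ar (ev C t) \<rhd> c) \<cdot> \<dots> = K t Y \<cdot> (apc t c \<cdot> st s t a X)"
    by (rule D.vcomp_eq[OF K_natural[symmetric, of t c, unfolded assms(8,9)]]) (use e X assms in auto)
  finally show "K t Y \<cdot> (st s t a Y \<cdot> apc s c) = K t Y \<cdot> (apc t c \<cdot> st s t a X)" .
qed (use assms C.src_Cod[of a] D.Dom_Arr[of c] D.Cod_Arr[of c] D.tgt_Cod[of c]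
  in \<open>auto simp del: C.src_Cod D.Dom_Arr D.Cod_Arr D.tgt_Cod\<close>)

text \<open>In strict form a horizontal composite is a vertical one, with \<open>a\<close> acting
  first under the tree \<open>t\<close> and \<open>b\<close> afterwards. \<open>P_natural\<close>
  supplies the compatibility of \<open>P\<close> with both cells.\<close>

lemma st_hcomp:
  assumes w: "wft C t" "wft C t'" "wft C s" "wft C s'" "b \<in> Cell C" "a \<in> Cell C" "Dom C a = ev C s"
    "Cod C a = ev C s'" "Dom C b = ev C t" "Cod C b = ev C t'" "src C (ev C t) = tgt C (ev C s)"
    "X \<in> Arr D" "tgt D X = ob (src C (ev C s))"
  shows "st (Cm t s) (Cm t' s') (hcomp C b a) X = st t t' b (ap s' X) \<cdot> apc t (st s s' a X)"
proof -
  let ?g = "ev C t" and ?g' = "ev C t'" and ?f = "ev C s" and ?f' = "ev C s'"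
  have e: "src C ?f' = src C ?f" "src C ?g' = src C ?g" "tgt C ?f' = tgt C ?f" "tgt C ?g' = tgt C ?g"
    using w C.src_Cod[of a] C.tgt_Cod[of a] C.src_Cod[of b] C.tgt_Cod[of b] by auto
  show ?thesis
  proof (rule st_eqI)
    have "K (Cm t' s') X \<cdot> (st t t' b (ap s' X) \<cdot> apc t (st s s' a X)) =
      P ?g' ?f' X \<cdot> (K t' (ar ?f' \<odot> X) \<cdot> (apc t' (K s' X) \<cdot> (st t t' b (ap s' X) \<cdot> apc t (st s s' a X))))"
      using w e by simp
    also have "apc t' (K s' X) \<cdot> (st t t' b (ap s' X) \<cdot> apc t (st s s' a X)) =
      st t t' b (ar ?f' \<odot> X) \<cdot> (apc t (K s' X) \<cdot> apc t (st s s' a X))"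
      by (rule D.vcomp_eq[OF st_natural[symmetric]]) (use w e in auto)
    also have "apc t (K s' X) \<cdot> apc t (st s s' a X) = apc t ((ce a \<lhd> X) \<cdot> K s X)"
      using w e by (simp flip: apc_vcomp add: K_st)
    also have "K t' (ar ?f' \<odot> X) \<cdot> (st t t' b (ar ?f' \<odot> X) \<cdot> \<dots>) =
      (ce b \<lhd> (ar ?f' \<odot> X)) \<cdot> (K t (ar ?f' \<odot> X) \<cdot> apc t ((ce a \<lhd> X) \<cdot> K s X))"
      by (rule D.vcomp_eq[OF K_st]) (use w e in auto)
    also have "\<dots> = (ce b \<lhd> (ar ?f' \<odot> X)) \<cdot> (K t (ar ?f' \<odot> X) \<cdot> (apc t (ce a \<lhd> X) \<cdot> apc t (K s X)))"
      using w e by simp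
    also have "K t (ar ?f' \<odot> X) \<cdot> (apc t (ce a \<lhd> X) \<cdot> apc t (K s X)) =
      (ar ?g \<rhd> (ce a \<lhd> X)) \<cdot> (K t (ar ?f \<odot> X) \<cdot> apc t (K s X))"
      using w e K_natural[of t "ce a \<lhd> X"] by (intro D.vcomp_eq) auto
    also have "P ?g' ?f' X \<cdot> ((ce b \<lhd> (ar ?f' \<odot> X)) \<cdot> \<dots>) =
      (P ?g' ?f' X \<cdot> ((ce b \<lhd> (ar ?f' \<odot> X)) \<cdot> (ar ?g \<rhd> (ce a \<lhd> X)))) \<cdot> (K t (ar ?f \<odot> X) \<cdot> apc t (K s X))"
      using w e by simp
    also have "P ?g' ?f' X \<cdot> ((ce b \<lhd> (ar ?f' \<odot> X)) \<cdot> (ar ?g \<rhd> (ce a \<lhd> X))) =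
      (ce (hcomp C b a) \<lhd> X) \<cdot> P ?g ?f X"
      using w e P_natural[of b a X] by simp
    finally show "K (Cm t' s') X \<cdot> (st t t' b (ap s' X) \<cdot> apc t (st s s' a X)) =
      (ce (hcomp C b a) \<lhd> X) \<cdot> K (Cm t s) X"
      using w e by simp
  qed (use w e in auto)
qed

text \<open>The two bracketings send \<open>X\<close> to the same iterated application, and
  \<open>P_asc\<close> says that their canonical cells \<open>K\<close> differ exactly by the action
  of the associator. \<open>U_left\<close> and \<open>U_right\<close> do the same for the
  unitors.\<close>

lemma st_asc [simp]:
  assumes w: "wft C u" "wft C t" "wft C s" "src C (ev C u) = tgt C (ev C t)"
    "src C (ev C t) = tgt C (ev C s)" "X \<in> Arr D" "tgt D X = ob (src C (ev C s))"
    "h = ev C u" "g = ev C t" "f = ev C s"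
  shows "st (Cm (Cm u t) s) (Cm u (Cm t s)) (asc C h g f) X = idc D (ap u (ap t (ap s X)))"
proof (rule st_eqI)
  let ?s = "apc u (apc t (K s X))" and ?t = "apc u (K t (ar f \<odot> X))" and ?u = "K u (ar g \<odot> (ar f \<odot> X))"
  have "(ce (asc C h g f) \<lhd> X) \<cdot> K (Cm (Cm u t) s) X =
    ((ce (asc C h g f) \<lhd> X) \<cdot> (P (ocomp C h g) f X \<cdot> P h g (ar f \<odot> X))) \<cdot> (?u \<cdot> (?t \<cdot> ?s))"
    using w by simp
  also have "\<dots> = (P h (ocomp C g f) X \<cdot> (ar h \<rhd> P g f X)) \<cdot> (?u \<cdot> (?t \<cdot> ?s))"
    using w by (subst P_asc) auto
  also have "\<dots> = P h (ocomp C g f) X \<cdot> ((ar h \<rhd> P g f X) \<cdot> (?u \<cdot> (?t \<cdot> ?s)))"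
    using w by simp
  also have "(ar h \<rhd> P g f X) \<cdot> (?u \<cdot> (?t \<cdot> ?s)) =
    K u (ar (ocomp C g f) \<odot> X) \<cdot> (apc u (P g f X) \<cdot> (?t \<cdot> ?s))"
    using w K_natural[of u "P g f X"] by (intro D.vcomp_eq) auto
  finally show "K (Cm u (Cm t s)) X \<cdot> idc D (ap u (ap t (ap s X))) =
    (ce (asc C h g f) \<lhd> X) \<cdot> K (Cm (Cm u t) s) X"
    using w by simp
qed (use w in auto)

lemma st_lun [simp]:
  assumes w: "wft C s" "X \<in> Arr D" "tgt D X = ob (src C (ev C s))" "f = ev C s" "B = tgt C (ev C s)"
  shows "st (Cm (One B) s) s (lun C f) X = idc D (ap s X)"
proof (rule st_eqI)
  have "(ce (lun C f) \<lhd> X) \<cdot> K (Cm (One B) s) X =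
    ((ce (lun C f) \<lhd> X) \<cdot> (P (one C (tgt C f)) f X \<cdot> U (tgt C f) (ar f \<odot> X))) \<cdot> K s X"
    using w by simp
  also have "\<dots> = K s X" using w by (subst U_left) auto
  finally show "K s X \<cdot> idc D (ap s X) = (ce (lun C f) \<lhd> X) \<cdot> K (Cm (One B) s) X"
    using w by simp
qed (use w in auto)

lemma st_run [simp]:
  assumes w: "wft C s" "X \<in> Arr D" "tgt D X = ob (src C (ev C s))" "f = ev C s" "A = src C (ev C s)"
  shows "st (Cm s (One A)) s (run C f) X = idc D (ap s X)"
proof (rule st_eqI)
  have "(ce (run C f) \<lhd> X) \<cdot> K (Cm s (One A)) X =
    (ce (run C f) \<lhd> X) \<cdot> (P f (one C A) X \<cdot> (K s (ar (one C A) \<odot> X) \<cdot> apc s (U A X)))"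
    using w by simp
  also have "K s (ar (one C A) \<odot> X) \<cdot> apc s (U A X) = (ar f \<rhd> U A X) \<cdot> K s X"
    using w K_natural[of s "U A X"] by simp
  also have "(ce (run C f) \<lhd> X) \<cdot> (P f (one C A) X \<cdot> \<dots>) =
    ((ce (run C f) \<lhd> X) \<cdot> (P f (one C (src C f)) X \<cdot> (ar f \<rhd> U (src C f) X))) \<cdot> K s X"
    using w by simp
  also have "\<dots> = K s X" using w by (subst U_right) auto
  finally show "K s X \<cdot> idc D (ap s X) = (ce (run C f) \<lhd> X) \<cdot> K (Cm s (One A)) X"
    using w by simp
qed (use w in auto)

end

end

text \<open>Left multiplication, with the inverse associator as \<open>P\<close> and the inverse
  left unitor as \<open>U\<close>. Then \<open>P_asc\<close> comes from the inverted pentagon,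
  \<open>U_right\<close> from the inverted triangle, and \<open>U_left\<close> from the derived
  identity \<open>lun_ocomp\<close>.\<close>

sublocale bicategory \<subseteq> self: action C C "\<lambda>A. A" "\<lambda>f. f" "\<lambda>a. a"
  "\<lambda>g f X. inv_cell C (asc C g f X)" "\<lambda>A X. inv_cell C (lun C X)"
proof (unfold_locales, goal_cases)
  case (13 g f c)
  then show ?case
    using asc_inv_nat[of "idc C g" "idc C f" c] by simp
next
  case (14 b a X)
  then show ?case
    using asc_inv_nat[of b a "idc C X"] by (simp add: hcomp_whisk[of b "a \<lhd> X"])
next
  case (18 A c)
  then show ?case by (simp add: lun_inv_natural)
next
  case (19 h g f X)
  show ?case
  proof (rule iso_cancel_left[of "asc C h (g \<odot> f) X"], goal_cases)
    case 6
    let ?x = "inv_cell C (asc C (h \<odot> g) f X) \<cdot> inv_cell C (asc C h g (f \<odot> X))"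
    have "?x = inv_cell C (asc C h g (f \<odot> X) \<cdot> asc C (h \<odot> g) f X)"
      using 19 by simp
    also have "\<dots> = inv_cell C ((h \<rhd> asc C g f X) \<cdot> (asc C h (g \<odot> f) X \<cdot> (asc C h g f \<lhd> X)))"
      using 19 by (subst pentagon') auto
    also have "\<dots> = (inv_cell C (asc C h g f) \<lhd> X) \<cdot> (inv_cell C (asc C h (g \<odot> f) X) \<cdot> (h \<rhd> inv_cell C (asc C g f X)))"
      using 19 by simp
    finally have x: "?x = (inv_cell C (asc C h g f) \<lhd> X) \<cdot>
      (inv_cell C (asc C h (g \<odot> f) X) \<cdot> (h \<rhd> inv_cell C (asc C g f X)))" .
    have "inv_cell C (asc C h g f \<lhd> X) = inv_cell C (asc C h g f) \<lhd> X"
      using 19 by simp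
    then show ?case unfolding x
      using 19 inv_vcomp_cancel(2)[of "asc C h g f \<lhd> X"
        "inv_cell C (asc C h (g \<odot> f) X) \<cdot> (h \<rhd> inv_cell C (asc C g f X))"]
      by simp
  qed (use 19 in auto)
next
  case (20 f X)
  have "inv_cell C (asc C (\<one> (tgt C f)) f X) \<cdot> inv_cell C (lun C (f \<odot> X)) =
    inv_cell C (lun C (f \<odot> X) \<cdot> asc C (\<one> (tgt C f)) f X)"
    using 20 by simp
  also have "\<dots> = inv_cell C (lun C f \<lhd> X)"
    using 20 by (subst lun_ocomp) auto
  finally show ?case using 20 inv_simps(5)[of "lun C f \<lhd> X"] by simp
next
  case (21 f X)
  have "inv_cell C (asc C f (\<one> (src C f)) X) \<cdot> (f \<rhd> inv_cell C (lun C X)) =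
    inv_cell C ((f \<rhd> lun C X) \<cdot> asc C f (\<one> (src C f)) X)"
    using 21 by simp
  also have "\<dots> = inv_cell C (run C f \<lhd> X)"
    using 21 by (subst triangle') auto
  finally show ?case using 21 inv_simps(5)[of "run C f \<lhd> X"] by simp
qed auto

text \<open>With the identity of the source as \<open>X\<close>, the cells \<open>K\<close> cancel
  from the two strict forms and leave \<open>a\<close> and \<open>b\<close> whiskered by that
  identity.\<close>

lemma (in bicategory) self_faithful:
  assumes "wft C s" "wft C t" "a \<in> Cell C" "Dom C a = ev C s" "Cod C a = ev C t"
    "b \<in> Cell C" "Dom C b = ev C s" "Cod C b = ev C t"
    and e: "\<And>X. X \<in> Arr C \<Longrightarrow> tgt C X = src C (ev C s) \<Longrightarrow> self.st s t a X = self.st s t b X"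
  shows "a = b"
proof (rule rwhisk_one_faithful[of _ _ "src C (ev C s)"])
  let ?X = "\<one> (src C (ev C s))"
  have X: "?X \<in> Arr C" "tgt C ?X = src C (ev C s)" using assms(1) by auto
  have "(a \<lhd> ?X) \<cdot> self.K s ?X = self.K t ?X \<cdot> self.st s t a ?X"
    by (rule self.K_st[OF assms(1-5) X, symmetric])
  also have "\<dots> = self.K t ?X \<cdot> self.st s t b ?X" by (simp only: e[OF X])
  also have "\<dots> = (b \<lhd> ?X) \<cdot> self.K s ?X"
    by (rule self.K_st[OF assms(1,2,6-8) X])
  finally have "(a \<lhd> ?X) \<cdot> self.K s ?X = (b \<lhd> ?X) \<cdot> self.K s ?X" .
  then show "a \<lhd> ?X = b \<lhd> ?X"
    by (rule iso_cancel_right[rotated -1]) (use X assms(1-8) in auto)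
qed (use assms(1-8) in auto)

section \<open>Pseudofunctors\<close>

lemma pseudofunctorI:
  assumes "bicategory C" "bicategory D"
    and "ob_map F \<in> extensional (Obj C)" "ar_map F \<in> extensional (Arr C)"
      "ce_map F \<in> extensional (Cell C)" "\<And>g f. \<not> composable C g f \<Longrightarrow> pcomp F g f = undefined"
      "punit F \<in> extensional (Obj C)"
    and "\<And>A. A \<in> Obj C \<Longrightarrow> ob_map F A \<in> Obj D"
    and "\<And>f. f \<in> Arr C \<Longrightarrow> ar_map F f \<in> Arr D"
      "\<And>f. f \<in> Arr C \<Longrightarrow> src D (ar_map F f) = ob_map F (src C f)"
      "\<And>f. f \<in> Arr C \<Longrightarrow> tgt D (ar_map F f) = ob_map F (tgt C f)"
    and "\<And>a. a \<in> Cell C \<Longrightarrow> ce_map F a \<in> Cell D"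
      "\<And>a. a \<in> Cell C \<Longrightarrow> Dom D (ce_map F a) = ar_map F (Dom C a)"
      "\<And>a. a \<in> Cell C \<Longrightarrow> Cod D (ce_map F a) = ar_map F (Cod C a)"
    and "\<And>f. f \<in> Arr C \<Longrightarrow> ce_map F (idc C f) = idc D (ar_map F f)"
    and "\<And>b a. b \<in> Cell C \<Longrightarrow> a \<in> Cell C \<Longrightarrow> Dom C b = Cod C a \<Longrightarrow>
      ce_map F (vcomp C b a) = vcomp D (ce_map F b) (ce_map F a)"
    and "\<And>g f. g \<in> Arr C \<Longrightarrow> f \<in> Arr C \<Longrightarrow> src C g = tgt C f \<Longrightarrow> isoc D (pcomp F g f) \<and>
      Dom D (pcomp F g f) = ocomp D (ar_map F g) (ar_map F f) \<and>
      Cod D (pcomp F g f) = ar_map F (ocomp C g f)"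
    and "\<And>b a. b \<in> Cell C \<Longrightarrow> a \<in> Cell C \<Longrightarrow> src C (Dom C b) = tgt C (Dom C a) \<Longrightarrow>
      vcomp D (pcomp F (Cod C b) (Cod C a)) (hcomp D (ce_map F b) (ce_map F a)) =
      vcomp D (ce_map F (hcomp C b a)) (pcomp F (Dom C b) (Dom C a))"
    and "\<And>A. A \<in> Obj C \<Longrightarrow> isoc D (punit F A) \<and> Dom D (punit F A) = one D (ob_map F A) \<and>
      Cod D (punit F A) = ar_map F (one C A)"
    and "\<And>h g f. h \<in> Arr C \<Longrightarrow> g \<in> Arr C \<Longrightarrow> f \<in> Arr C \<Longrightarrow> src C h = tgt C g \<Longrightarrow> src C g = tgt C f \<Longrightarrow>
      vcomp D (ce_map F (asc C h g f)) (vcomp D (pcomp F (ocomp C h g) f)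
        (hcomp D (pcomp F h g) (idc D (ar_map F f)))) =
      vcomp D (pcomp F h (ocomp C g f)) (vcomp D (hcomp D (idc D (ar_map F h)) (pcomp F g f))
        (asc D (ar_map F h) (ar_map F g) (ar_map F f)))"
    and "\<And>f. f \<in> Arr C \<Longrightarrow> vcomp D (ce_map F (lun C f)) (vcomp D (pcomp F (one C (tgt C f)) f)
        (hcomp D (punit F (tgt C f)) (idc D (ar_map F f)))) = lun D (ar_map F f)"
    and "\<And>f. f \<in> Arr C \<Longrightarrow> vcomp D (ce_map F (run C f)) (vcomp D (pcomp F f (one C (src C f)))
        (hcomp D (idc D (ar_map F f)) (punit F (src C f)))) = run D (ar_map F f)"
  shows "pseudofunctor C D F"
proof -
  interpret C: bicategory C by fact
  interpret D: bicategory D by fact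
  show ?thesis
    by unfold_locales (use assms in \<open>auto simp: hom_def cells_def composable_def iso_cells_iff\<close>)
qed

context pseudofunctor
begin

lemma ob_map_Obj [simp]: "A \<in> Obj C \<Longrightarrow> ob_map F A \<in> Obj D"
  by (rule ob_map_obj)

lemma ar_map_simps [simp]:
  assumes "f \<in> Arr C"
  shows "ar_map F f \<in> Arr D" "src D (ar_map F f) = ob_map F (src C f)"
    "tgt D (ar_map F f) = ob_map F (tgt C f)"
  using ar_map_hom[of f "src C f" "tgt C f"] assms by (auto simp: hom_def)

lemma ce_map_simps [simp]:
  assumes "a \<in> Cell C"
  shows "ce_map F a \<in> Cell D" "Dom D (ce_map F a) = ar_map F (Dom C a)"
    "Cod D (ce_map F a) = ar_map F (Cod C a)"
  using ce_map_cells[of a "Dom C a" "Cod C a"] assms by (auto simp: cells_def)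

lemma pcomp_simps [simp]:
  assumes "g \<in> Arr C" "f \<in> Arr C" "src C g = tgt C f"
  shows "isoc D (pcomp F g f)" "Dom D (pcomp F g f) = ar_map F g \<odot>\<^bsub>D\<^esub> ar_map F f"
    "Cod D (pcomp F g f) = ar_map F (g \<odot> f)"
  using pcomp_iso[of g f] assms by (auto simp: iso_cells_iff composable_def)

lemma punit_simps [simp]:
  assumes "A \<in> Obj C"
  shows "isoc D (punit F A)" "Dom D (punit F A) = \<one>\<^bsub>D\<^esub> (ob_map F A)"
    "Cod D (punit F A) = ar_map F (\<one> A)"
  using punit_iso[of A] assms by (auto simp: iso_cells_iff)

lemma ce_map_idc' [simp]: "f \<in> Arr C \<Longrightarrow> ce_map F (idc C f) = idc D (ar_map F f)"
  by (rule ce_map_idc)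

lemma ce_map_vcomp':
  assumes "b \<in> Cell C" "a \<in> Cell C" "Dom C b = Cod C a"
  shows "ce_map F (b \<cdot> a) = ce_map F b \<cdot>\<^bsub>D\<^esub> ce_map F a"
  using ce_map_vcomp[of a "Dom C a" "Cod C a" b "Cod C b"] assms by (auto simp: cells_def)

lemma pcomp_natural':
  assumes "b \<in> Cell C" "a \<in> Cell C" "src C (Dom C b) = tgt C (Dom C a)"
    "Dom C b = g" "Cod C b = g'" "Dom C a = f" "Cod C a = f'"
  shows "pcomp F g' f' \<cdot>\<^bsub>D\<^esub> (ce_map F b \<star>\<^bsub>D\<^esub> ce_map F a) = ce_map F (b \<star> a) \<cdot>\<^bsub>D\<^esub> pcomp F g f"
  using pcomp_natural[of a f f' b g g'] assms by (auto simp: cells_def composable_def)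

lemma pcomp_asc':
  assumes "h \<in> Arr C" "g \<in> Arr C" "f \<in> Arr C" "src C h = tgt C g" "src C g = tgt C f"
  shows "ce_map F (asc C h g f) \<cdot>\<^bsub>D\<^esub> (pcomp F (h \<odot> g) f \<cdot>\<^bsub>D\<^esub> (pcomp F h g \<lhd>\<^bsub>D\<^esub> ar_map F f)) =
    pcomp F h (g \<odot> f) \<cdot>\<^bsub>D\<^esub> ((ar_map F h \<rhd>\<^bsub>D\<^esub> pcomp F g f) \<cdot>\<^bsub>D\<^esub>
      asc D (ar_map F h) (ar_map F g) (ar_map F f))"
  using pcomp_asc[of h g f] assms by (auto simp: composable_def)

lemma punit_left':
  assumes "f \<in> Arr C" "tgt C f = B"
  shows "ce_map F (lun C f) \<cdot>\<^bsub>D\<^esub> (pcomp F (\<one> B) f \<cdot>\<^bsub>D\<^esub> (punit F B \<lhd>\<^bsub>D\<^esub> ar_map F f)) =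
      lun D (ar_map F f)"
  using punit_left[of f "src C f" B] assms by (auto simp: hom_def)

lemma punit_right':
  assumes "f \<in> Arr C" "src C f = A"
  shows "ce_map F (run C f) \<cdot>\<^bsub>D\<^esub> (pcomp F f (\<one> A) \<cdot>\<^bsub>D\<^esub> (ar_map F f \<rhd>\<^bsub>D\<^esub> punit F A)) =
      run D (ar_map F f)"
  using punit_right[of f A "tgt C f"] assms by (auto simp: hom_def)

definition pact :: "'m \<Rightarrow> 'm \<Rightarrow> 'n \<Rightarrow> 'd" where
  "pact g f X = (pcomp F g f \<lhd>\<^bsub>D\<^esub> X) \<cdot>\<^bsub>D\<^esub> inv_cell D (asc D (ar_map F g) (ar_map F f) X)"

definition uact :: "'o \<Rightarrow> 'n \<Rightarrow> 'd" where
  "uact A X = (punit F A \<lhd>\<^bsub>D\<^esub> X) \<cdot>\<^bsub>D\<^esub> inv_cell D (lun D X)"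

text \<open>Each coherence law is an axiom of \<open>F\<close> whiskered by \<open>X\<close>,
  composed with the same law of the self-action of \<open>D\<close>. Naturality of the associator
  moves \<open>pcomp F\<close> and \<open>punit F\<close> past it, so that the two can be applied
  separately.\<close>

sublocale act: action C D "ob_map F" "ar_map F" "ce_map F" pact uact
proof (unfold_locales, goal_cases)
  case (13 g f c)
  let ?g = "ar_map F g" and ?f = "ar_map F f"
  have n: "inv_cell D (asc D ?g ?f (Cod D c)) \<cdot>\<^bsub>D\<^esub> (?g \<rhd>\<^bsub>D\<^esub> (?f \<rhd>\<^bsub>D\<^esub> c)) =
    ((?g \<odot>\<^bsub>D\<^esub> ?f) \<rhd>\<^bsub>D\<^esub> c) \<cdot>\<^bsub>D\<^esub> inv_cell D (asc D ?g ?f (Dom D c))"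
    using 13 D.self.P_arg[of ?g ?f c] by simp
  have "pact g f (Cod D c) \<cdot>\<^bsub>D\<^esub> (?g \<rhd>\<^bsub>D\<^esub> (?f \<rhd>\<^bsub>D\<^esub> c)) = (pcomp F g f \<lhd>\<^bsub>D\<^esub> Cod D c) \<cdot>\<^bsub>D\<^esub>
    (((?g \<odot>\<^bsub>D\<^esub> ?f) \<rhd>\<^bsub>D\<^esub> c) \<cdot>\<^bsub>D\<^esub> inv_cell D (asc D ?g ?f (Dom D c)))"
    using 13 by (simp add: pact_def n)
  also have "\<dots> = (ar_map F (g \<odot> f) \<rhd>\<^bsub>D\<^esub> c) \<cdot>\<^bsub>D\<^esub> ((pcomp F g f \<lhd>\<^bsub>D\<^esub> Dom D c) \<cdot>\<^bsub>D\<^esub>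
    inv_cell D (asc D ?g ?f (Dom D c)))"
    by (rule D.vcomp_eq[OF D.whisk_exchange]) (use 13 in auto)
  finally show ?case by (simp add: pact_def)
next
  case (14 b a X)
  let ?b = "ce_map F b" and ?a = "ce_map F a"
  have "pact (Cod C b) (Cod C a) X \<cdot>\<^bsub>D\<^esub> ((?b \<lhd>\<^bsub>D\<^esub> (ar_map F (Cod C a) \<odot>\<^bsub>D\<^esub> X)) \<cdot>\<^bsub>D\<^esub>
      (ar_map F (Dom C b) \<rhd>\<^bsub>D\<^esub> (?a \<lhd>\<^bsub>D\<^esub> X))) =
    (pcomp F (Cod C b) (Cod C a) \<lhd>\<^bsub>D\<^esub> X) \<cdot>\<^bsub>D\<^esub>
      (inv_cell D (asc D (ar_map F (Cod C b)) (ar_map F (Cod C a)) X) \<cdot>\<^bsub>D\<^esub> (?b \<star>\<^bsub>D\<^esub> (?a \<lhd>\<^bsub>D\<^esub> X)))"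
    using 14 by (simp add: pact_def D.hcomp_whisk[of ?b "?a \<lhd>\<^bsub>D\<^esub> X"])
  also have "\<dots> = (pcomp F (Cod C b) (Cod C a) \<lhd>\<^bsub>D\<^esub> X) \<cdot>\<^bsub>D\<^esub>
      (((?b \<star>\<^bsub>D\<^esub> ?a) \<lhd>\<^bsub>D\<^esub> X) \<cdot>\<^bsub>D\<^esub> inv_cell D (asc D (ar_map F (Dom C b)) (ar_map F (Dom C a)) X))"
    using 14 by (simp add: D.asc_inv_natural[of ?b ?a "idc D X"])
  also have "\<dots> = (ce_map F (b \<star> a) \<lhd>\<^bsub>D\<^esub> X) \<cdot>\<^bsub>D\<^esub> ((pcomp F (Dom C b) (Dom C a) \<lhd>\<^bsub>D\<^esub> X) \<cdot>\<^bsub>D\<^esub>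
      inv_cell D (asc D (ar_map F (Dom C b)) (ar_map F (Dom C a)) X))"
    by (rule D.vcomp_eq) (use 14 in \<open>auto simp: pcomp_natural' simp flip: D.rwhisk_vcomp\<close>)
  finally show ?case by (simp add: pact_def)
next
  case (18 A c)
  let ?o = "\<one>\<^bsub>D\<^esub> (ob_map F A)"
  have "uact A (Cod D c) \<cdot>\<^bsub>D\<^esub> c =
    (punit F A \<lhd>\<^bsub>D\<^esub> Cod D c) \<cdot>\<^bsub>D\<^esub> ((?o \<rhd>\<^bsub>D\<^esub> c) \<cdot>\<^bsub>D\<^esub> inv_cell D (lun D (Dom D c)))"
    using 18 by (simp add: uact_def D.lun_inv_natural)
  also have "\<dots> = (ar_map F (\<one> A) \<rhd>\<^bsub>D\<^esub> c) \<cdot>\<^bsub>D\<^esub> ((punit F A \<lhd>\<^bsub>D\<^esub> Dom D c) \<cdot>\<^bsub>D\<^esub>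
    inv_cell D (lun D (Dom D c)))"
    by (rule D.vcomp_eq[OF D.whisk_exchange]) (use 18 in auto)
  finally show ?case by (simp add: uact_def)
next
  case (19 h g f X)
  let ?h = "ar_map F h" and ?g = "ar_map F g" and ?f = "ar_map F f"
  let ?x = "inv_cell D (asc D (?h \<odot>\<^bsub>D\<^esub> ?g) ?f X) \<cdot>\<^bsub>D\<^esub> inv_cell D (asc D ?h ?g (?f \<odot>\<^bsub>D\<^esub> X))"
  have n1: "inv_cell D (asc D (ar_map F (h \<odot> g)) ?f X) \<cdot>\<^bsub>D\<^esub> (pcomp F h g \<lhd>\<^bsub>D\<^esub> (?f \<odot>\<^bsub>D\<^esub> X)) =
    ((pcomp F h g \<lhd>\<^bsub>D\<^esub> ?f) \<lhd>\<^bsub>D\<^esub> X) \<cdot>\<^bsub>D\<^esub> inv_cell D (asc D (?h \<odot>\<^bsub>D\<^esub> ?g) ?f X)"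
    using 19 D.asc_inv_nat[of "pcomp F h g" "idc D ?f" "idc D X"] by simp
  have n2: "inv_cell D (asc D ?h (ar_map F (g \<odot> f)) X) \<cdot>\<^bsub>D\<^esub> (?h \<rhd>\<^bsub>D\<^esub> (pcomp F g f \<lhd>\<^bsub>D\<^esub> X)) =
    ((?h \<rhd>\<^bsub>D\<^esub> pcomp F g f) \<lhd>\<^bsub>D\<^esub> X) \<cdot>\<^bsub>D\<^esub> inv_cell D (asc D ?h (?g \<odot>\<^bsub>D\<^esub> ?f) X)"
    using 19 D.asc_inv_nat[of "idc D ?h" "pcomp F g f" "idc D X"] by simp
  have "(ce_map F (asc C h g f) \<lhd>\<^bsub>D\<^esub> X) \<cdot>\<^bsub>D\<^esub> (pact (h \<odot> g) f X \<cdot>\<^bsub>D\<^esub> pact h g (?f \<odot>\<^bsub>D\<^esub> X)) =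
    (ce_map F (asc C h g f) \<lhd>\<^bsub>D\<^esub> X) \<cdot>\<^bsub>D\<^esub> ((pcomp F (h \<odot> g) f \<lhd>\<^bsub>D\<^esub> X) \<cdot>\<^bsub>D\<^esub>
      (((pcomp F h g \<lhd>\<^bsub>D\<^esub> ?f) \<lhd>\<^bsub>D\<^esub> X) \<cdot>\<^bsub>D\<^esub> ?x))"
    using 19 by (simp add: pact_def D.vcomp_eq[OF n1])
  also have "\<dots> = ((ce_map F (asc C h g f) \<cdot>\<^bsub>D\<^esub> (pcomp F (h \<odot> g) f \<cdot>\<^bsub>D\<^esub> (pcomp F h g \<lhd>\<^bsub>D\<^esub> ?f))) \<lhd>\<^bsub>D\<^esub> X) \<cdot>\<^bsub>D\<^esub> ?x"
    using 19 by simp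
  also have "\<dots> = (pcomp F h (g \<odot> f) \<lhd>\<^bsub>D\<^esub> X) \<cdot>\<^bsub>D\<^esub> (((?h \<rhd>\<^bsub>D\<^esub> pcomp F g f) \<lhd>\<^bsub>D\<^esub> X) \<cdot>\<^bsub>D\<^esub>
      ((asc D ?h ?g ?f \<lhd>\<^bsub>D\<^esub> X) \<cdot>\<^bsub>D\<^esub> ?x))"
    using 19 by (subst pcomp_asc') auto
  also have "(asc D ?h ?g ?f \<lhd>\<^bsub>D\<^esub> X) \<cdot>\<^bsub>D\<^esub> ?x = inv_cell D (asc D ?h (?g \<odot>\<^bsub>D\<^esub> ?f) X) \<cdot>\<^bsub>D\<^esub>
      (?h \<rhd>\<^bsub>D\<^esub> inv_cell D (asc D ?g ?f X))"
    using D.self.P_asc[of ?h ?g ?f X] 19 by simp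
  finally show ?case
    using 19 by (simp add: pact_def D.vcomp_eq[OF n2])
next
  case (20 f X)
  let ?f = "ar_map F f" and ?B = "tgt C f"
  have n: "inv_cell D (asc D (ar_map F (\<one> ?B)) ?f X) \<cdot>\<^bsub>D\<^esub> (punit F ?B \<lhd>\<^bsub>D\<^esub> (?f \<odot>\<^bsub>D\<^esub> X)) =
    ((punit F ?B \<lhd>\<^bsub>D\<^esub> ?f) \<lhd>\<^bsub>D\<^esub> X) \<cdot>\<^bsub>D\<^esub> inv_cell D (asc D (\<one>\<^bsub>D\<^esub> (ob_map F ?B)) ?f X)"
    using 20 D.asc_inv_nat[of "punit F ?B" "idc D ?f" "idc D X"] by simp
  have "(ce_map F (lun C f) \<lhd>\<^bsub>D\<^esub> X) \<cdot>\<^bsub>D\<^esub> (pact (\<one> ?B) f X \<cdot>\<^bsub>D\<^esub> uact ?B (?f \<odot>\<^bsub>D\<^esub> X)) =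
    ((ce_map F (lun C f) \<cdot>\<^bsub>D\<^esub> (pcomp F (\<one> ?B) f \<cdot>\<^bsub>D\<^esub> (punit F ?B \<lhd>\<^bsub>D\<^esub> ?f))) \<lhd>\<^bsub>D\<^esub> X) \<cdot>\<^bsub>D\<^esub>
    (inv_cell D (asc D (\<one>\<^bsub>D\<^esub> (ob_map F ?B)) ?f X) \<cdot>\<^bsub>D\<^esub> inv_cell D (lun D (?f \<odot>\<^bsub>D\<^esub> X)))"
    using 20 by (simp add: pact_def uact_def D.vcomp_eq[OF n])
  also have "\<dots> = idc D (?f \<odot>\<^bsub>D\<^esub> X)"
    using 20 D.self.U_left[of ?f X] by (subst punit_left') auto
  finally show ?case .
next
  case (21 f X)
  let ?f = "ar_map F f" and ?A = "src C f"
  have n: "inv_cell D (asc D ?f (ar_map F (\<one> ?A)) X) \<cdot>\<^bsub>D\<^esub> (?f \<rhd>\<^bsub>D\<^esub> (punit F ?A \<lhd>\<^bsub>D\<^esub> X)) =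
    ((?f \<rhd>\<^bsub>D\<^esub> punit F ?A) \<lhd>\<^bsub>D\<^esub> X) \<cdot>\<^bsub>D\<^esub> inv_cell D (asc D ?f (\<one>\<^bsub>D\<^esub> (ob_map F ?A)) X)"
    using 21 D.asc_inv_nat[of "idc D ?f" "punit F ?A" "idc D X"] by simp
  have "(ce_map F (run C f) \<lhd>\<^bsub>D\<^esub> X) \<cdot>\<^bsub>D\<^esub> (pact f (\<one> ?A) X \<cdot>\<^bsub>D\<^esub> (?f \<rhd>\<^bsub>D\<^esub> uact ?A X)) =
    ((ce_map F (run C f) \<cdot>\<^bsub>D\<^esub> (pcomp F f (\<one> ?A) \<cdot>\<^bsub>D\<^esub> (?f \<rhd>\<^bsub>D\<^esub> punit F ?A))) \<lhd>\<^bsub>D\<^esub> X) \<cdot>\<^bsub>D\<^esub>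
    (inv_cell D (asc D ?f (\<one>\<^bsub>D\<^esub> (ob_map F ?A)) X) \<cdot>\<^bsub>D\<^esub> (?f \<rhd>\<^bsub>D\<^esub> inv_cell D (lun D X)))"
    using 21 by (simp add: pact_def uact_def D.vcomp_eq[OF n])
  also have "\<dots> = idc D (?f \<odot>\<^bsub>D\<^esub> X)"
    using 21 D.self.U_right[of ?f X] by (subst punit_right') auto
  finally show ?case .
qed (auto simp: pact_def uact_def ce_map_vcomp')

end

text \<open>Being an equivalence, it yields the lemmas \<open>strict_natural_iff\<close> to
  \<open>strict_modif_iff\<close>, which are rewritten in goals to prove an axiom and in assumptions
  to use one.\<close>

lemma (in bicategory) self_eq_iff:
  assumes "wft C s" "wft C t" "a \<in> Cell C" "Dom C a = ev C s" "Cod C a = ev C t"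
    "b \<in> Cell C" "Dom C b = ev C s" "Cod C b = ev C t"
  shows "a = b \<longleftrightarrow> (\<forall>X \<in> Arr C. tgt C X = src C (ev C s) \<longrightarrow> self.st s t a X = self.st s t b X)"
  using self_faithful[OF assms] by blast

declare (in pseudofunctor) act.P_iso [simp] act.P_Dom [simp] act.P_Cod [simp]
  act.U_iso [simp] act.U_Dom [simp] act.U_Cod [simp] act.ce_iso [simp]

text \<open>In the self-action of \<open>D\<close>, \<open>K\<close> is the inverse associator for
  two atoms and an identity for one; so strictifying \<open>pcomp F g f\<close> gives the very cell
  by which \<open>F\<close> acts.\<close>

lemma (in pseudofunctor) st_pcomp:
  assumes "g \<in> Arr C" "f \<in> Arr C" "src C g = tgt C f" "X \<in> Arr D" "tgt D X = ob_map F (src C f)"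
    "a = ar_map F g" "b = ar_map F f" "c = ar_map F (g \<odot> f)"
  shows "D.self.st (Cm (At a) (At b)) (At c) (pcomp F g f) X = pact g f X"
  by (rule D.self.st_eqI) (use assms in \<open>auto simp: pact_def\<close>)

lemma (in pseudofunctor) st_punit:
  assumes "A \<in> Obj C" "X \<in> Arr D" "tgt D X = ob_map F A" "B = ob_map F A" "c = ar_map F (\<one> A)"
  shows "D.self.st (One B) (At c) (punit F A) X = uact A X"
  by (rule D.self.st_eqI) (use assms in \<open>auto simp: uact_def\<close>)

section \<open>Strict forms of the axioms for transformations and modifications\<close>

context action
begin

context
  notes ob_Obj [simp] ar_simps [simp] ce_simps [simp] ce_idc [simp] ce_iso [simp] P_iso [simp] P_Dom [simp]
    P_Cod [simp] U_iso [simp] U_Dom [simp] U_Cod [simp]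
begin

text \<open>The two sides of an axiom are evaluated separately and for an arbitrary action. For the
  self-action this yields the strict axioms; for the action along a pseudofunctor it transports the
  axioms of a transformation to another bicategory.\<close>

lemma st_natural_sides:
  assumes w: "wft C cA" "wft C cB" "b \<in> Cell C" "a \<in> Cell C" "n \<in> Cell C" "n' \<in> Cell C"
    "src C (Dom C a) = src C (ev C cA)" "tgt C (Dom C a) = src C (ev C cB)"
    "src C (Dom C b) = tgt C (ev C cA)" "tgt C (Dom C b) = tgt C (ev C cB)"
    "Dom C a = f" "Cod C a = f'" "Dom C b = g" "Cod C b = g'"
    "Dom C n = ocomp C g (ev C cA)" "Cod C n = ocomp C (ev C cB) f"
    "Dom C n' = ocomp C g' (ev C cA)" "Cod C n' = ocomp C (ev C cB) f'"
    and X: "X \<in> Arr D" "tgt D X = ob (src C (ev C cA))"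
  shows "st (Cm (At g) cA) (Cm cB (At f')) (n' \<cdot>\<^bsub>C\<^esub> (b \<lhd>\<^bsub>C\<^esub> ev C cA)) X =
      st (Cm (At g') cA) (Cm cB (At f')) n' X \<cdot> (ce b \<lhd> ap cA X)" (is ?L)
    and "st (Cm (At g) cA) (Cm cB (At f')) ((ev C cB \<rhd>\<^bsub>C\<^esub> a) \<cdot>\<^bsub>C\<^esub> n) X =
      apc cB (ce a \<lhd> X) \<cdot> st (Cm (At g) cA) (Cm cB (At f)) n X" (is ?R)
proof -
  have A: "f \<in> Arr C" "f' \<in> Arr C" "g \<in> Arr C" "g' \<in> Arr C" "src C f' = src C f" "tgt C f' = tgt C f"
    "src C g' = src C g" "tgt C g' = tgt C g"
    "src C f = src C (ev C cA)" "tgt C f = src C (ev C cB)"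
    "src C g = tgt C (ev C cA)" "tgt C g = tgt C (ev C cB)"
    using w(3,4) w(7-14) C.Dom_Arr[of a] C.Dom_Arr[of b] C.Cod_Arr[of a] C.Cod_Arr[of b]
      C.src_Cod[of a] C.src_Cod[of b] C.tgt_Cod[of a] C.tgt_Cod[of b]
    by (simp_all del: C.Dom_Arr C.Cod_Arr C.src_Cod C.tgt_Cod)
  show ?L
    using X w A by (subst st_vcomp[where t = "Cm (At g') cA"]) (auto simp: st_hcomp)
  show ?R
    using X w A by (subst st_vcomp[where t = "Cm cB (At f)"]) (auto simp: st_hcomp)
qed

lemma st_ocomp_sides:
  assumes w: "wft C cA" "wft C cB" "wft C cE" "f1 \<in> Arr C" "f2 \<in> Arr C" "g1 \<in> Arr C" "g2 \<in> Arr C"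
    "src C f1 = src C (ev C cA)" "tgt C f1 = src C (ev C cB)"
    "src C f2 = src C (ev C cB)" "tgt C f2 = src C (ev C cE)"
    "src C g1 = tgt C (ev C cA)" "tgt C g1 = tgt C (ev C cB)"
    "src C g2 = tgt C (ev C cB)" "tgt C g2 = tgt C (ev C cE)"
    "pF \<in> Cell C" "Dom C pF = ocomp C f2 f1" "Cod C pF = f21"
    "pG \<in> Cell C" "Dom C pG = ocomp C g2 g1" "Cod C pG = g21"
    "n1 \<in> Cell C" "n2 \<in> Cell C" "n21 \<in> Cell C"
    "Dom C n1 = ocomp C g1 (ev C cA)" "Cod C n1 = ocomp C (ev C cB) f1"
    "Dom C n2 = ocomp C g2 (ev C cB)" "Cod C n2 = ocomp C (ev C cE) f2"
    "Dom C n21 = ocomp C g21 (ev C cA)" "Cod C n21 = ocomp C (ev C cE) f21"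
    and X: "X \<in> Arr D" "tgt D X = ob (src C (ev C cA))"
  shows "st (Cm (Cm (At g2) (At g1)) cA) (Cm cE (At f21)) (n21 \<cdot>\<^bsub>C\<^esub> (pG \<lhd>\<^bsub>C\<^esub> ev C cA)) X =
      st (Cm (At g21) cA) (Cm cE (At f21)) n21 X \<cdot> st (Cm (At g2) (At g1)) (At g21) pG (ap cA X)" (is ?L)
    and "st (Cm (Cm (At g2) (At g1)) cA) (Cm cE (At f21)) ((ev C cE \<rhd>\<^bsub>C\<^esub> pF) \<cdot>\<^bsub>C\<^esub> (asc C (ev C cE) f2 f1 \<cdot>\<^bsub>C\<^esub>
      ((n2 \<lhd>\<^bsub>C\<^esub> f1) \<cdot>\<^bsub>C\<^esub> (inv_cell C (asc C g2 (ev C cB) f1) \<cdot>\<^bsub>C\<^esub> ((g2 \<rhd>\<^bsub>C\<^esub> n1) \<cdot>\<^bsub>C\<^esub> asc C g2 g1 (ev C cA)))))) X =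
      apc cE (st (Cm (At f2) (At f1)) (At f21) pF X) \<cdot>
      (st (Cm (At g2) cB) (Cm cE (At f2)) n2 (ar f1 \<odot> X) \<cdot>
        (ar g2 \<rhd> st (Cm (At g1) cA) (Cm cB (At f1)) n1 X))" (is ?R)
proof -
  have A: "f21 \<in> Arr C" "g21 \<in> Arr C" "src C f21 = src C f1" "tgt C f21 = tgt C f2"
    "src C g21 = src C g1" "tgt C g21 = tgt C g2"
    using w C.Cod_Arr[of pF] C.Cod_Arr[of pG] C.src_Cod[of pF] C.src_Cod[of pG] C.tgt_Cod[of pF] C.tgt_Cod[of pG]
    by (simp_all del: C.Dom_Arr C.Cod_Arr C.src_Cod C.tgt_Cod)
  show ?L
    using X w A by (subst st_vcomp[where t = "Cm (At g21) cA"]) (auto simp: st_hcomp)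
  let ?s = "Cm (Cm (At g2) (At g1)) cA" and ?t1 = "Cm (At g2) (Cm (At g1) cA)"
    and ?t2 = "Cm (At g2) (Cm cB (At f1))" and ?t3 = "Cm (Cm (At g2) cB) (At f1)"
    and ?t4 = "Cm (Cm cE (At f2)) (At f1)" and ?t5 = "Cm cE (Cm (At f2) (At f1))"
  let ?n1 = "(g2 \<rhd>\<^bsub>C\<^esub> n1) \<cdot>\<^bsub>C\<^esub> asc C g2 g1 (ev C cA)"
  let ?n2 = "inv_cell C (asc C g2 (ev C cB) f1) \<cdot>\<^bsub>C\<^esub> ?n1"
  let ?n3 = "(n2 \<lhd>\<^bsub>C\<^esub> f1) \<cdot>\<^bsub>C\<^esub> ?n2"
  let ?n4 = "asc C (ev C cE) f2 f1 \<cdot>\<^bsub>C\<^esub> ?n3"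
  let ?r1 = "ar g2 \<rhd> st (Cm (At g1) cA) (Cm cB (At f1)) n1 X"
  let ?r2 = "st (Cm (At g2) cB) (Cm cE (At f2)) n2 (ar f1 \<odot> X) \<cdot> ?r1"
  \<comment> \<open>The factors are attached one at a time. An associator leaves the value
    unchanged, since its strict form is an identity; only \<open>n1\<close>, \<open>n2\<close> and
    \<open>pF\<close> contribute.\<close>
  have "st ?s ?t2 ?n1 X = ?r1"
    using X w A by (subst st_vcomp[where t = ?t1]) (auto simp: st_hcomp)
  then have "st ?s ?t3 ?n2 X = ?r1"
    using X w A by (subst st_vcomp[where t = ?t2]) auto
  then have "st ?s ?t4 ?n3 X = ?r2"
    using X w A by (subst st_vcomp[where t = ?t3]) (auto simp: st_hcomp)
  then have "st ?s ?t5 ?n4 X = ?r2"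
    using X w A by (subst st_vcomp[where t = ?t4]) auto
  then show ?R
    using X w A by (subst st_vcomp[where t = ?t5]) (auto simp: st_hcomp)
qed

lemma st_one_sides:
  assumes w: "wft C c" "A = src C (ev C c)" "B = tgt C (ev C c)"
    "uF \<in> Cell C" "Dom C uF = one C A" "Cod C uF = f" "uG \<in> Cell C" "Dom C uG = one C B" "Cod C uG = g"
    "n \<in> Cell C" "Dom C n = ocomp C g (ev C c)" "Cod C n = ocomp C (ev C c) f"
    and X: "X \<in> Arr D" "tgt D X = ob A"
  shows "st (Cm (One B) c) (Cm c (At f)) (n \<cdot>\<^bsub>C\<^esub> (uG \<lhd>\<^bsub>C\<^esub> ev C c)) X =
      st (Cm (At g) c) (Cm c (At f)) n X \<cdot> st (One B) (At g) uG (ap c X)" (is ?L)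
    and "st (Cm (One B) c) (Cm c (At f))
      ((ev C c \<rhd>\<^bsub>C\<^esub> uF) \<cdot>\<^bsub>C\<^esub> (inv_cell C (run C (ev C c)) \<cdot>\<^bsub>C\<^esub> lun C (ev C c))) X =
      apc c (st (One A) (At f) uF X)" (is ?R)
proof -
  have O: "A \<in> Obj C" "B \<in> Obj C" using w by auto
  have A: "f \<in> Arr C" "g \<in> Arr C" "src C f = A" "tgt C f = A" "src C g = B" "tgt C g = B"
    using w(4-9) O C.Cod_Arr[of uF] C.Cod_Arr[of uG] C.src_Cod[of uF] C.src_Cod[of uG] C.tgt_Cod[of uF] C.tgt_Cod[of uG]
    by (simp_all del: C.Dom_Arr C.Cod_Arr C.src_Cod C.tgt_Cod)
  show ?L
    using X w A O by (subst st_vcomp[where t = "Cm (At g) c"]) (auto simp: st_hcomp)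
  have "st (Cm (One B) c) (Cm c (One A)) (inv_cell C (run C (ev C c)) \<cdot>\<^bsub>C\<^esub> lun C (ev C c)) X = idc D (ap c X)"
    using X w A O by (subst st_vcomp[where t = c]) auto
  then show ?R
    using X w A O by (subst st_vcomp[where t = "Cm c (One A)"]) (auto simp: st_hcomp)
qed

end

end

context bicategory
begin

lemma strict_natural_iff:
  assumes w: "wft C cA" "wft C cB" "b \<in> Cell C" "a \<in> Cell C" "n \<in> Cell C" "n' \<in> Cell C"
    "src C (Dom C a) = src C (ev C cA)" "tgt C (Dom C a) = src C (ev C cB)"
    "src C (Dom C b) = tgt C (ev C cA)" "tgt C (Dom C b) = tgt C (ev C cB)"
    "Dom C a = f" "Cod C a = f'" "Dom C b = g" "Cod C b = g'"
    "Dom C n = g \<odot> ev C cA" "Cod C n = ev C cB \<odot> f" "Dom C n' = g' \<odot> ev C cA" "Cod C n' = ev C cB \<odot> f'"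
  shows "n' \<cdot> (b \<lhd> ev C cA) = (ev C cB \<rhd> a) \<cdot> n \<longleftrightarrow>
    (\<forall>X \<in> Arr C. tgt C X = src C (ev C cA) \<longrightarrow>
      self.st (Cm (At g') cA) (Cm cB (At f')) n' X \<cdot> (b \<lhd> self.ap cA X) =
      self.apc cB (a \<lhd> X) \<cdot> self.st (Cm (At g) cA) (Cm cB (At f)) n X)"
proof -
  have A: "f \<in> Arr C" "f' \<in> Arr C" "g \<in> Arr C" "g' \<in> Arr C" "src C f' = src C f" "tgt C f' = tgt C f"
    "src C g' = src C g" "tgt C g' = tgt C g"
    "src C f = src C (ev C cA)" "tgt C f = src C (ev C cB)"
    "src C g = tgt C (ev C cA)" "tgt C g = tgt C (ev C cB)"
    using w(3,4) w(7-14) Dom_Arr[of a] Dom_Arr[of b] Cod_Arr[of a] Cod_Arr[of b]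
      src_Cod[of a] src_Cod[of b] tgt_Cod[of a] tgt_Cod[of b]
    by (simp_all del: Dom_Arr Cod_Arr src_Cod tgt_Cod)
  let ?s = "Cm (At g) cA" and ?t = "Cm cB (At f')"
  show ?thesis
  proof (subst self_eq_iff[of ?s ?t], goal_cases)
    case 9
    then show ?case using self.st_natural_sides[OF w] w A by simp
  qed (use w A in auto)
qed

lemma strict_ocomp_iff:
  assumes w: "wft C cA" "wft C cB" "wft C cE" "f1 \<in> Arr C" "f2 \<in> Arr C" "g1 \<in> Arr C" "g2 \<in> Arr C"
    "src C f1 = src C (ev C cA)" "tgt C f1 = src C (ev C cB)"
    "src C f2 = src C (ev C cB)" "tgt C f2 = src C (ev C cE)"
    "src C g1 = tgt C (ev C cA)" "tgt C g1 = tgt C (ev C cB)"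
    "src C g2 = tgt C (ev C cB)" "tgt C g2 = tgt C (ev C cE)"
    "pF \<in> Cell C" "Dom C pF = f2 \<odot> f1" "Cod C pF = f21" "pG \<in> Cell C" "Dom C pG = g2 \<odot> g1" "Cod C pG = g21"
    "n1 \<in> Cell C" "n2 \<in> Cell C" "n21 \<in> Cell C"
    "Dom C n1 = g1 \<odot> ev C cA" "Cod C n1 = ev C cB \<odot> f1"
    "Dom C n2 = g2 \<odot> ev C cB" "Cod C n2 = ev C cE \<odot> f2"
    "Dom C n21 = g21 \<odot> ev C cA" "Cod C n21 = ev C cE \<odot> f21"
  shows "n21 \<cdot> (pG \<lhd> ev C cA) = (ev C cE \<rhd> pF) \<cdot> (asc C (ev C cE) f2 f1 \<cdot> ((n2 \<lhd> f1) \<cdot>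
      (inv_cell C (asc C g2 (ev C cB) f1) \<cdot> ((g2 \<rhd> n1) \<cdot> asc C g2 g1 (ev C cA))))) \<longleftrightarrow>
    (\<forall>X \<in> Arr C. tgt C X = src C (ev C cA) \<longrightarrow>
      self.st (Cm (At g21) cA) (Cm cE (At f21)) n21 X \<cdot>
        self.st (Cm (At g2) (At g1)) (At g21) pG (self.ap cA X) =
      self.apc cE (self.st (Cm (At f2) (At f1)) (At f21) pF X) \<cdot>
      (self.st (Cm (At g2) cB) (Cm cE (At f2)) n2 (f1 \<odot> X) \<cdot>
        (g2 \<rhd> self.st (Cm (At g1) cA) (Cm cB (At f1)) n1 X)))" (is "?l = ?r \<longleftrightarrow> ?rhs")
proof -
  have A: "f21 \<in> Arr C" "g21 \<in> Arr C" "src C f21 = src C f1" "tgt C f21 = tgt C f2"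
    "src C g21 = src C g1" "tgt C g21 = tgt C g2"
    using w Cod_Arr[of pF] Cod_Arr[of pG] src_Cod[of pF] src_Cod[of pG] tgt_Cod[of pF] tgt_Cod[of pG]
    by (simp_all del: Dom_Arr Cod_Arr src_Cod tgt_Cod)
  let ?s = "Cm (Cm (At g2) (At g1)) cA" and ?t = "Cm cE (At f21)"
  show ?thesis
  proof (subst self_eq_iff[of ?s ?t], goal_cases)
    case 9
    have "src C (ev C ?s) = src C (ev C cA)" using w by simp
    with self.st_ocomp_sides[OF w] show ?case by simp
  qed (use w A in auto)
qed

lemma strict_one_iff:
  assumes w: "wft C c" "A = src C (ev C c)" "B = tgt C (ev C c)"
    "uF \<in> Cell C" "Dom C uF = \<one> A" "Cod C uF = f" "uG \<in> Cell C" "Dom C uG = \<one> B" "Cod C uG = g"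
    "n \<in> Cell C" "Dom C n = g \<odot> ev C c" "Cod C n = ev C c \<odot> f"
  shows "n \<cdot> (uG \<lhd> ev C c) = (ev C c \<rhd> uF) \<cdot> (inv_cell C (run C (ev C c)) \<cdot> lun C (ev C c)) \<longleftrightarrow>
    (\<forall>X \<in> Arr C. tgt C X = A \<longrightarrow>
      self.st (Cm (At g) c) (Cm c (At f)) n X \<cdot> self.st (One B) (At g) uG (self.ap c X) =
      self.apc c (self.st (One A) (At f) uF X))" (is "?l = ?r \<longleftrightarrow> ?rhs")
proof -
  have O: "A \<in> Obj C" "B \<in> Obj C" using w by auto
  have A: "f \<in> Arr C" "g \<in> Arr C" "src C f = A" "tgt C f = A" "src C g = B" "tgt C g = B"
    using w(4-9) O Cod_Arr[of uF] Cod_Arr[of uG] src_Cod[of uF] src_Cod[of uG] tgt_Cod[of uF] tgt_Cod[of uG]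
    by (simp_all del: Dom_Arr Cod_Arr src_Cod tgt_Cod)
  let ?s = "Cm (One B) c" and ?t = "Cm c (At f)"
  show ?thesis
  proof (subst self_eq_iff[of ?s ?t], goal_cases)
    case 9
    have "src C (ev C ?s) = src C (ev C c)" using w O by simp
    with self.st_one_sides[OF w] show ?case unfolding w(2) by simp
  qed (use w A O in auto)
qed

lemma strict_modif_iff:
  assumes w: "wft C cA" "wft C cB" "wft C dA" "wft C dB" "f \<in> Arr C" "g \<in> Arr C"
    "src C f = src C (ev C cA)" "tgt C f = src C (ev C cB)"
    "src C g = tgt C (ev C cA)" "tgt C g = tgt C (ev C cB)"
    "m \<in> Cell C" "Dom C m = ev C cA" "Cod C m = ev C dA"
    "m' \<in> Cell C" "Dom C m' = ev C cB" "Cod C m' = ev C dB"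
    "n \<in> Cell C" "n' \<in> Cell C" "Dom C n = g \<odot> ev C cA" "Cod C n = ev C cB \<odot> f"
    "Dom C n' = g \<odot> ev C dA" "Cod C n' = ev C dB \<odot> f"
  shows "(m' \<lhd> f) \<cdot> n = n' \<cdot> (g \<rhd> m) \<longleftrightarrow>
    (\<forall>X \<in> Arr C. tgt C X = src C (ev C cA) \<longrightarrow>
      self.st cB dB m' (f \<odot> X) \<cdot> self.st (Cm (At g) cA) (Cm cB (At f)) n X =
      self.st (Cm (At g) dA) (Cm dB (At f)) n' X \<cdot> (g \<rhd> self.st cA dA m X))"
proof -
  have A: "src C (ev C dA) = src C (ev C cA)" "tgt C (ev C dA) = tgt C (ev C cA)"
    "src C (ev C dB) = src C (ev C cB)" "tgt C (ev C dB) = tgt C (ev C cB)"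
    using w(11-16) src_Cod[of m] src_Cod[of m'] tgt_Cod[of m] tgt_Cod[of m']
    by (simp_all del: src_Cod tgt_Cod)
  let ?s = "Cm (At g) cA" and ?t = "Cm dB (At f)"
  show ?thesis
  proof (subst self_eq_iff[of ?s ?t], goal_cases)
    case 9
    have l: "self.st ?s ?t ((m' \<lhd> f) \<cdot> n) X =
      self.st cB dB m' (f \<odot> X) \<cdot> self.st (Cm (At g) cA) (Cm cB (At f)) n X"
      if X: "X \<in> Arr C" "tgt C X = src C (ev C cA)" for X
      using X w A
      by (subst self.st_vcomp[where t = "Cm cB (At f)"]) (auto simp: self.st_hcomp)
    have r: "self.st ?s ?t (n' \<cdot> (g \<rhd> m)) X =
      self.st (Cm (At g) dA) (Cm dB (At f)) n' X \<cdot> (g \<rhd> self.st cA dA m X)"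
      if X: "X \<in> Arr C" "tgt C X = src C (ev C cA)" for X
      using X w A
      by (subst self.st_vcomp[where t = "Cm (At g) dA"]) (auto simp: self.st_hcomp)
    have "src C (ev C ?s) = src C (ev C cA)" using w by simp
    with l r show ?case by simp
  qed (use w A in auto)
qed

end

section \<open>Strict form of transformations and modifications\<close>

locale bicat_pair = C: bicategory C + D: bicategory D
  for C :: "('o, 'm, 'c) bicat" and D :: "('p, 'n, 'd) bicat" (structure)
begin

abbreviation pact :: "('o, 'm, 'c, 'p, 'n, 'd) psf \<Rightarrow> 'm \<Rightarrow> 'm \<Rightarrow> 'n \<Rightarrow> 'd" where
  "pact F \<equiv> pseudofunctor.pact D F"

abbreviation uact :: "('o, 'm, 'c, 'p, 'n, 'd) psf \<Rightarrow> 'o \<Rightarrow> 'n \<Rightarrow> 'd" where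
  "uact F \<equiv> pseudofunctor.uact D F"

text \<open>\<open>nst c \<alpha> f X : G f \<cdot> (c A \<cdot> X) \<Rightarrow> c B \<cdot> (F f \<cdot> X)\<close> for \<open>\<alpha> : F \<Rightarrow> G\<close>, where the tree \<open>c A\<close> evaluates to
  the component \<open>\<alpha>\<^sub>A\<close>. Choosing for \<open>c\<close> the evident composite trees removes all structure cells from the
  verification that composites of transformations are again pseudonatural.\<close>

definition nst :: "('o \<Rightarrow> ('p, 'n) tm) \<Rightarrow> ('o, 'm, 'c, 'p, 'n, 'd) pnt \<Rightarrow> 'm \<Rightarrow> 'n \<Rightarrow> 'd" where
  "nst c \<alpha> f X = D.self.st (Cm (At (ar_map (ntgt \<alpha>) f)) (c (src C f)))
     (Cm (c (tgt C f)) (At (ar_map (nsrc \<alpha>) f))) (nnat \<alpha> f) X"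

text \<open>A given transformation is used through this form, with each component a single atom;
  composite trees serve to build new transformations.\<close>

definition N :: "('o, 'm, 'c, 'p, 'n, 'd) pnt \<Rightarrow> 'm \<Rightarrow> 'n \<Rightarrow> 'd" where
  "N \<alpha> = nst (\<lambda>A. At (ncmp \<alpha> A)) \<alpha>"

lemma pseudonaturalI:
  assumes F: "pseudofunctor C D (nsrc \<alpha>)" and G: "pseudofunctor C D (ntgt \<alpha>)"
    and ext: "ncmp \<alpha> \<in> extensional (Obj C)" "nnat \<alpha> \<in> extensional (Arr C)"
    and c: "\<And>A. A \<in> Obj C \<Longrightarrow> wft D (c A)" "\<And>A. A \<in> Obj C \<Longrightarrow> ev D (c A) = ncmp \<alpha> A"
      "\<And>A. A \<in> Obj C \<Longrightarrow> src D (ncmp \<alpha> A) = ob_map (nsrc \<alpha>) A"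
      "\<And>A. A \<in> Obj C \<Longrightarrow> tgt D (ncmp \<alpha> A) = ob_map (ntgt \<alpha>) A"
    and n: "\<And>f. f \<in> Arr C \<Longrightarrow> isoc D (nnat \<alpha> f)"
      "\<And>f. f \<in> Arr C \<Longrightarrow> Dom D (nnat \<alpha> f) = ar_map (ntgt \<alpha>) f \<odot> ncmp \<alpha> (src C f)"
      "\<And>f. f \<in> Arr C \<Longrightarrow> Cod D (nnat \<alpha> f) = ncmp \<alpha> (tgt C f) \<odot> ar_map (nsrc \<alpha>) f"
    and nat: "\<And>a X. a \<in> Cell C \<Longrightarrow> X \<in> Arr D \<Longrightarrow> tgt D X = ob_map (nsrc \<alpha>) (src C (Dom C a)) \<Longrightarrow>
      nst c \<alpha> (Cod C a) X \<cdot> (ce_map (ntgt \<alpha>) a \<lhd> D.self.ap (c (src C (Dom C a))) X) =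
      D.self.apc (c (tgt C (Dom C a))) (ce_map (nsrc \<alpha>) a \<lhd> X) \<cdot> nst c \<alpha> (Dom C a) X"
    and ocp: "\<And>g f X. g \<in> Arr C \<Longrightarrow> f \<in> Arr C \<Longrightarrow> src C g = tgt C f \<Longrightarrow> X \<in> Arr D \<Longrightarrow>
      tgt D X = ob_map (nsrc \<alpha>) (src C f) \<Longrightarrow>
      nst c \<alpha> (ocomp C g f) X \<cdot> pact (ntgt \<alpha>) g f (D.self.ap (c (src C f)) X) =
      D.self.apc (c (tgt C g)) (pact (nsrc \<alpha>) g f X) \<cdot>
      (nst c \<alpha> g (ar_map (nsrc \<alpha>) f \<odot> X) \<cdot> (ar_map (ntgt \<alpha>) g \<rhd> nst c \<alpha> f X))"
    and one: "\<And>A X. A \<in> Obj C \<Longrightarrow> X \<in> Arr D \<Longrightarrow> tgt D X = ob_map (nsrc \<alpha>) A \<Longrightarrow>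
      nst c \<alpha> (one C A) X \<cdot> uact (ntgt \<alpha>) A (D.self.ap (c A) X) =
      D.self.apc (c A) (uact (nsrc \<alpha>) A X)"
  shows "pseudonatural C D \<alpha>"
proof -
  interpret F: pseudofunctor C D "nsrc \<alpha>" by fact
  interpret G: pseudofunctor C D "ntgt \<alpha>" by fact
  have cA: "ncmp \<alpha> A \<in> Arr D" if "A \<in> Obj C" for A using c(1,2)[OF that] by (metis D.ev_Arr)
  note [simp] = c n cA
  show ?thesis
  proof (intro pseudonatural.intro[OF C.bicategory_axioms D.bicategory_axioms] pseudonatural_axioms.intro, goal_cases)
    case 1 show ?case by (rule F)
  next case 2 show ?case by (rule G)
  next case 3 show ?case by (rule ext)
  next case 4 show ?case by (rule ext)
  next case 5 then show ?case by (simp add: hom_def)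
  next case 6 then show ?case by (auto simp: iso_cells_iff hom_def)
  next
    case (7 f A B a g)
    then have h: "a \<in> Cell C" "f = Dom C a" "g = Cod C a" "A = src C (Dom C a)" "B = tgt C (Dom C a)"
      by (auto simp: hom_def cells_def)
    have "nnat \<alpha> g \<cdot> (ce_map (ntgt \<alpha>) a \<lhd> ev D (c A)) = (ev D (c B) \<rhd> ce_map (nsrc \<alpha>) a) \<cdot> nnat \<alpha> f"
      unfolding h
      by (subst D.strict_natural_iff) (use h(1) nat[OF h(1)] in \<open>auto simp: nst_def\<close>)
    then show ?case using h by simp
  next
    case (8 f A B g E)
    then have h: "f \<in> Arr C" "g \<in> Arr C" "A = src C f" "B = tgt C f" "E = tgt C g" "src C g = tgt C f"
      by (auto simp: hom_def)
    have "nnat \<alpha> (ocomp C g f) \<cdot> (pcomp (ntgt \<alpha>) g f \<lhd> ev D (c A)) = (ev D (c E) \<rhd> pcomp (nsrc \<alpha>) g f) \<cdot>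
      (asc D (ev D (c E)) (ar_map (nsrc \<alpha>) g) (ar_map (nsrc \<alpha>) f) \<cdot>
       ((nnat \<alpha> g \<lhd> ar_map (nsrc \<alpha>) f) \<cdot> (inv_cell D (asc D (ar_map (ntgt \<alpha>) g) (ev D (c B)) (ar_map (nsrc \<alpha>) f)) \<cdot>
       ((ar_map (ntgt \<alpha>) g \<rhd> nnat \<alpha> f) \<cdot> asc D (ar_map (ntgt \<alpha>) g) (ar_map (ntgt \<alpha>) f) (ev D (c A))))))"
    proof (subst D.strict_ocomp_iff[where ?f21.0 = "ar_map (nsrc \<alpha>) (ocomp C g f)" and ?g21.0 = "ar_map (ntgt \<alpha>) (ocomp C g f)"], goal_cases)
      case 31
      show ?case
      proof (intro ballI impI)
        fix X assume "X \<in> Arr D" "tgt D X = src D (ev D (c A))"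
        then show "D.self.st (Cm (At (ar_map (ntgt \<alpha>) (ocomp C g f))) (c A))
              (Cm (c E) (At (ar_map (nsrc \<alpha>) (ocomp C g f)))) (nnat \<alpha> (ocomp C g f)) X \<cdot>
             D.self.st (Cm (At (ar_map (ntgt \<alpha>) g)) (At (ar_map (ntgt \<alpha>) f)))
              (At (ar_map (ntgt \<alpha>) (ocomp C g f))) (pcomp (ntgt \<alpha>) g f) (D.self.ap (c A) X) =
             D.self.apc (c E) (D.self.st (Cm (At (ar_map (nsrc \<alpha>) g)) (At (ar_map (nsrc \<alpha>) f)))
                (At (ar_map (nsrc \<alpha>) (ocomp C g f))) (pcomp (nsrc \<alpha>) g f) X) \<cdot>
             (D.self.st (Cm (At (ar_map (ntgt \<alpha>) g)) (c B)) (Cm (c E) (At (ar_map (nsrc \<alpha>) g)))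
                (nnat \<alpha> g) (ar_map (nsrc \<alpha>) f \<odot> X) \<cdot>
              (ar_map (ntgt \<alpha>) g \<rhd> D.self.st (Cm (At (ar_map (ntgt \<alpha>) f)) (c A))
                (Cm (c B) (At (ar_map (nsrc \<alpha>) f))) (nnat \<alpha> f) X))"
          using h ocp[of g f X] by (simp add: nst_def F.st_pcomp G.st_pcomp)
      qed
    qed (use h in auto)
    then show ?case using h by simp
  next
    case (9 A)
    have "nnat \<alpha> (one C A) \<cdot> (punit (ntgt \<alpha>) A \<lhd> ev D (c A)) = (ev D (c A) \<rhd> punit (nsrc \<alpha>) A) \<cdot>
      (inv_cell D (run D (ev D (c A))) \<cdot> lun D (ev D (c A)))"
      by (subst D.strict_one_iff[OF _ refl refl])
        (use 9 one[OF 9] in \<open>auto simp: nst_def F.st_punit G.st_punit\<close>)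
    then show ?case using 9 by simp
  qed
qed

lemma modificationI:
  assumes p: "pseudonatural C D (msrc \<mu>)" "pseudonatural C D (mtgt \<mu>)" "nsrc (msrc \<mu>) = F" "nsrc (mtgt \<mu>) = F"
    "ntgt (msrc \<mu>) = G" "ntgt (mtgt \<mu>) = G" "mcmp \<mu> \<in> extensional (Obj C)"
    and m: "\<And>A. A \<in> Obj C \<Longrightarrow> mcmp \<mu> A \<in> Cell D" "\<And>A. A \<in> Obj C \<Longrightarrow> Dom D (mcmp \<mu> A) = ncmp (msrc \<mu>) A"
      "\<And>A. A \<in> Obj C \<Longrightarrow> Cod D (mcmp \<mu> A) = ncmp (mtgt \<mu>) A"
    and n: "\<And>f. f \<in> Arr C \<Longrightarrow> (mcmp \<mu> (tgt C f) \<lhd> ar_map F f) \<cdot> nnat (msrc \<mu>) f =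
      nnat (mtgt \<mu>) f \<cdot> (ar_map G f \<rhd> mcmp \<mu> (src C f))"
  shows "modification C D \<mu>"
proof (intro modification.intro[OF C.bicategory_axioms D.bicategory_axioms] modification_axioms.intro, goal_cases)
  case 1 show ?case by (rule p)
next case 2 show ?case by (rule p)
next case 3 show ?case by (simp only: p)
next case 4 show ?case by (simp only: p)
next case 5 show ?case by (rule p)
next case 6 then show ?case by (simp only: cells_def m mem_Collect_eq simp_thms)
next
  case (7 f A B)
  then have "f \<in> Arr C" "src C f = A" "tgt C f = B" by (auto simp: hom_def)
  with n[of f] show ?case by (simp only: p)
qed

end

locale pnat = bicat_pair C D for C :: "('o, 'm, 'c) bicat" and D :: "('p, 'n, 'd) bicat" (structure) +
  fixes \<alpha> :: "('o, 'm, 'c, 'p, 'n, 'd) pnt"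
  assumes pnt: "pseudonatural C D \<alpha>"
begin

sublocale F: pseudofunctor C D "nsrc \<alpha>"
  using pnt by (rule pseudonatural.nsrc_psf)

sublocale G: pseudofunctor C D "ntgt \<alpha>"
  using pnt by (rule pseudonatural.ntgt_psf)

lemma ncmp_simps [simp]:
  assumes "A \<in> Obj C"
  shows "ncmp \<alpha> A \<in> Arr D" "src D (ncmp \<alpha> A) = ob_map (nsrc \<alpha>) A" "tgt D (ncmp \<alpha> A) = ob_map (ntgt \<alpha>) A"
  using pseudonatural.ncmp_hom[OF pnt assms] by (auto simp: hom_def)

lemma nnat_simps [simp]:
  assumes "f \<in> Arr C"
  shows "isoc D (nnat \<alpha> f)" "Dom D (nnat \<alpha> f) = ar_map (ntgt \<alpha>) f \<odot> ncmp \<alpha> (src C f)"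
    "Cod D (nnat \<alpha> f) = ncmp \<alpha> (tgt C f) \<odot> ar_map (nsrc \<alpha>) f"
  using pseudonatural.nnat_iso[OF pnt, of f "src C f" "tgt C f"] assms
  by (auto simp: hom_def iso_cells_iff)

lemma nnat_natural':
  assumes "a \<in> Cell C" "Dom C a = f" "Cod C a = g" "src C f = A" "tgt C f = B"
  shows "nnat \<alpha> g \<cdot> (ce_map (ntgt \<alpha>) a \<lhd> ncmp \<alpha> A) = (ncmp \<alpha> B \<rhd> ce_map (nsrc \<alpha>) a) \<cdot> nnat \<alpha> f"
  by (rule pseudonatural.nnat_natural[OF pnt]) (use assms in \<open>auto simp: hom_def cells_def\<close>)

lemma N_eq: "N \<alpha> f X = D.self.st (Cm (At (ar_map (ntgt \<alpha>) f)) (At (ncmp \<alpha> (src C f))))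
     (Cm (At (ncmp \<alpha> (tgt C f))) (At (ar_map (nsrc \<alpha>) f))) (nnat \<alpha> f) X"
  by (simp add: N_def nst_def)

lemma N_simps [simp]:
  assumes "f \<in> Arr C" "X \<in> Arr D" "tgt D X = ob_map (nsrc \<alpha>) (src C f)"
  shows "isoc D (N \<alpha> f X)" "Dom D (N \<alpha> f X) = ar_map (ntgt \<alpha>) f \<odot> (ncmp \<alpha> (src C f) \<odot> X)"
    "Cod D (N \<alpha> f X) = ncmp \<alpha> (tgt C f) \<odot> (ar_map (nsrc \<alpha>) f \<odot> X)"
  using assms by (auto simp: N_eq)

text \<open>Not an axiom of transformations but the interchange law \<open>st_natural\<close> for
  the cell \<open>nnat \<alpha> f\<close>. It lets strict cells of different transformations slide
  past each other.\<close>

lemma N_arg: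
  assumes "f \<in> Arr C" "c \<in> Cell D" "tgt D (Dom D c) = ob_map (nsrc \<alpha>) (src C f)" "A = src C f" "B = tgt C f"
    "Dom D c = X" "Cod D c = Y"
  shows "N \<alpha> f Y \<cdot> (ar_map (ntgt \<alpha>) f \<rhd> (ncmp \<alpha> A \<rhd> c)) = (ncmp \<alpha> B \<rhd> (ar_map (nsrc \<alpha>) f \<rhd> c)) \<cdot> N \<alpha> f X"
  using D.self.st_natural[of "Cm (At (ar_map (ntgt \<alpha>) f)) (At (ncmp \<alpha> (src C f)))"
     "Cm (At (ncmp \<alpha> (tgt C f))) (At (ar_map (nsrc \<alpha>) f))" "nnat \<alpha> f" c X Y] assms
  by (auto simp: N_eq)

lemma N_natural:
  assumes "a \<in> Cell C" "Dom C a = f" "Cod C a = g" "src C f = A" "tgt C f = B"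
    "X \<in> Arr D" "tgt D X = ob_map (nsrc \<alpha>) A"
  shows "N \<alpha> g X \<cdot> (ce_map (ntgt \<alpha>) a \<lhd> (ncmp \<alpha> A \<odot> X)) = (ncmp \<alpha> B \<rhd> (ce_map (nsrc \<alpha>) a \<lhd> X)) \<cdot> N \<alpha> f X"
proof -
  have A: "A \<in> Obj C" "B \<in> Obj C" using assms by auto
  have g: "src C g = A" "tgt C g = B" "g \<in> Arr C" "f \<in> Arr C" using assms by auto
  have "nnat \<alpha> g \<cdot> (ce_map (ntgt \<alpha>) a \<lhd> ev D (At (ncmp \<alpha> A))) =
    (ev D (At (ncmp \<alpha> B)) \<rhd> ce_map (nsrc \<alpha>) a) \<cdot> nnat \<alpha> f"
    using assms nnat_natural' by simp
  then show ?thesis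
    by (subst (asm) D.strict_natural_iff) (use assms A g in \<open>auto simp: N_eq\<close>)
qed

lemma N_ocomp:
  assumes h: "g \<in> Arr C" "f \<in> Arr C" "src C g = tgt C f" "X \<in> Arr D" "tgt D X = ob_map (nsrc \<alpha>) (src C f)"
    "A = src C f" "E = tgt C g"
  shows "N \<alpha> (ocomp C g f) X \<cdot> pact (ntgt \<alpha>) g f (ncmp \<alpha> A \<odot> X) =
    (ncmp \<alpha> E \<rhd> pact (nsrc \<alpha>) g f X) \<cdot>
    (N \<alpha> g (ar_map (nsrc \<alpha>) f \<odot> X) \<cdot> (ar_map (ntgt \<alpha>) g \<rhd> N \<alpha> f X))"
proof -
  let ?B = "tgt C f" and ?c = "\<lambda>A. At (ncmp \<alpha> A)"
  have "nnat \<alpha> (ocomp C g f) \<cdot> (pcomp (ntgt \<alpha>) g f \<lhd> ev D (?c A)) = (ev D (?c E) \<rhd> pcomp (nsrc \<alpha>) g f) \<cdot>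
      (asc D (ev D (?c E)) (ar_map (nsrc \<alpha>) g) (ar_map (nsrc \<alpha>) f) \<cdot>
       ((nnat \<alpha> g \<lhd> ar_map (nsrc \<alpha>) f) \<cdot> (inv_cell D (asc D (ar_map (ntgt \<alpha>) g) (ev D (?c ?B)) (ar_map (nsrc \<alpha>) f)) \<cdot>
       ((ar_map (ntgt \<alpha>) g \<rhd> nnat \<alpha> f) \<cdot> asc D (ar_map (ntgt \<alpha>) g) (ar_map (ntgt \<alpha>) f) (ev D (?c A))))))"
    using pseudonatural.nnat_ocomp[OF pnt, of f A ?B g E] h by (simp add: hom_def)
  then have "D.self.st (Cm (At (ar_map (ntgt \<alpha>) (ocomp C g f))) (?c A))
        (Cm (?c E) (At (ar_map (nsrc \<alpha>) (ocomp C g f)))) (nnat \<alpha> (ocomp C g f)) X \<cdot>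
       D.self.st (Cm (At (ar_map (ntgt \<alpha>) g)) (At (ar_map (ntgt \<alpha>) f)))
        (At (ar_map (ntgt \<alpha>) (ocomp C g f))) (pcomp (ntgt \<alpha>) g f) (D.self.ap (?c A) X) =
       D.self.apc (?c E) (D.self.st (Cm (At (ar_map (nsrc \<alpha>) g)) (At (ar_map (nsrc \<alpha>) f)))
          (At (ar_map (nsrc \<alpha>) (ocomp C g f))) (pcomp (nsrc \<alpha>) g f) X) \<cdot>
       (D.self.st (Cm (At (ar_map (ntgt \<alpha>) g)) (?c ?B)) (Cm (?c E) (At (ar_map (nsrc \<alpha>) g)))
          (nnat \<alpha> g) (ar_map (nsrc \<alpha>) f \<odot> X) \<cdot>
        (ar_map (ntgt \<alpha>) g \<rhd> D.self.st (Cm (At (ar_map (ntgt \<alpha>) f)) (?c A))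
          (Cm (?c ?B) (At (ar_map (nsrc \<alpha>) f))) (nnat \<alpha> f) X))"
    by (subst (asm) D.strict_ocomp_iff[where ?f21.0 = "ar_map (nsrc \<alpha>) (ocomp C g f)" and ?g21.0 = "ar_map (ntgt \<alpha>) (ocomp C g f)"]) (use h in auto)
  then show ?thesis using h by (simp add: N_eq F.st_pcomp G.st_pcomp)
qed

lemma N_one:
  assumes h: "A \<in> Obj C" "X \<in> Arr D" "tgt D X = ob_map (nsrc \<alpha>) A"
  shows "N \<alpha> (one C A) X \<cdot> uact (ntgt \<alpha>) A (ncmp \<alpha> A \<odot> X) = ncmp \<alpha> A \<rhd> uact (nsrc \<alpha>) A X"
proof -
  let ?c = "\<lambda>A. At (ncmp \<alpha> A)"
  have "nnat \<alpha> (one C A) \<cdot> (punit (ntgt \<alpha>) A \<lhd> ev D (?c A)) = (ev D (?c A) \<rhd> punit (nsrc \<alpha>) A) \<cdot>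
      (inv_cell D (run D (ev D (?c A))) \<cdot> lun D (ev D (?c A)))"
    using pseudonatural.nnat_one[OF pnt, of A] h by simp
  then show ?thesis
    by (subst (asm) D.strict_one_iff[OF _ refl refl]) (use h in \<open>auto simp: N_eq F.st_punit G.st_punit\<close>)
qed

end

lemma (in bicategory) lwhisk_eq:
  assumes "b \<cdot> a = d \<cdot> c" "f \<in> Arr C"
    "b \<in> Cell C" "a \<in> Cell C" "d \<in> Cell C" "c \<in> Cell C"
    "Dom C b = Cod C a" "Dom C d = Cod C c" "src C f = tgt C (Dom C a)" "src C f = tgt C (Dom C c)"
  shows "(f \<rhd> b) \<cdot> (f \<rhd> a) = (f \<rhd> d) \<cdot> (f \<rhd> c)"
  using assms lwhisk_vcomp[of f b a] lwhisk_vcomp[of f d c] by metis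

section \<open>The bicategory of pseudofunctors\<close>

lemma functor_bicat_sel:
  "Obj (functor_bicat C D) = {F. pseudofunctor C D F}" "Arr (functor_bicat C D) = {\<alpha>. pseudonatural C D \<alpha>}"
  "Cell (functor_bicat C D) = {\<mu>. modification C D \<mu>}"
  "src (functor_bicat C D) = nsrc" "tgt (functor_bicat C D) = ntgt" "Dom (functor_bicat C D) = msrc"
  "Cod (functor_bicat C D) = mtgt" "one (functor_bicat C D) = id_pnt C D"
  "ocomp (functor_bicat C D) = pnt_comp C D"
  "idc (functor_bicat C D) \<alpha> = \<lparr>msrc = \<alpha>, mtgt = \<alpha>, mcmp = (\<lambda>A\<in>Obj C. idc D (ncmp \<alpha> A))\<rparr>"
  "vcomp (functor_bicat C D) \<nu> \<mu> = \<lparr>msrc = msrc \<mu>, mtgt = mtgt \<nu>,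
       mcmp = (\<lambda>A\<in>Obj C. vcomp D (mcmp \<nu> A) (mcmp \<mu> A))\<rparr>"
  "hcomp (functor_bicat C D) \<nu> \<mu> = \<lparr>msrc = pnt_comp C D (msrc \<nu>) (msrc \<mu>),
       mtgt = pnt_comp C D (mtgt \<nu>) (mtgt \<mu>),
       mcmp = (\<lambda>A\<in>Obj C. hcomp D (mcmp \<nu> A) (mcmp \<mu> A))\<rparr>"
  "asc (functor_bicat C D) \<gamma> \<beta> \<alpha> = \<lparr>msrc = pnt_comp C D (pnt_comp C D \<gamma> \<beta>) \<alpha>,
       mtgt = pnt_comp C D \<gamma> (pnt_comp C D \<beta> \<alpha>),
       mcmp = (\<lambda>A\<in>Obj C. asc D (ncmp \<gamma> A) (ncmp \<beta> A) (ncmp \<alpha> A))\<rparr>"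
  "lun (functor_bicat C D) \<alpha> = \<lparr>msrc = pnt_comp C D (id_pnt C D (ntgt \<alpha>)) \<alpha>, mtgt = \<alpha>,
       mcmp = (\<lambda>A\<in>Obj C. lun D (ncmp \<alpha> A))\<rparr>"
  "run (functor_bicat C D) \<alpha> = \<lparr>msrc = pnt_comp C D \<alpha> (id_pnt C D (nsrc \<alpha>)), mtgt = \<alpha>,
       mcmp = (\<lambda>A\<in>Obj C. run D (ncmp \<alpha> A))\<rparr>"
  by (simp_all add: functor_bicat_def)

lemma pnt_comp_sel [simp]:
  "nsrc (pnt_comp C D \<beta> \<alpha>) = nsrc \<alpha>" "ntgt (pnt_comp C D \<beta> \<alpha>) = ntgt \<beta>"
  "A \<in> Obj C \<Longrightarrow> ncmp (pnt_comp C D \<beta> \<alpha>) A = ocomp D (ncmp \<beta> A) (ncmp \<alpha> A)"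
  by (simp_all add: pnt_comp_def)

lemma id_pnt_sel [simp]:
  "nsrc (id_pnt C D F) = F" "ntgt (id_pnt C D F) = F" "A \<in> Obj C \<Longrightarrow> ncmp (id_pnt C D F) A = one D (ob_map F A)"
  by (simp_all add: id_pnt_def)

lemma modif_eqI:
  fixes \<mu> \<nu> :: "('o, 'm, 'c, 'p, 'n, 'd) modif"
  assumes "msrc \<mu> = msrc \<nu>" "mtgt \<mu> = mtgt \<nu>" "mcmp \<mu> \<in> extensional S" "mcmp \<nu> \<in> extensional S"
    "\<And>A. A \<in> S \<Longrightarrow> mcmp \<mu> A = mcmp \<nu> A"
  shows "\<mu> = \<nu>"
  using extensionalityI[OF assms(3,4,5)] assms(1,2) by (intro modif.equality) auto

lemma (in bicat_pair) pnatI: "pseudonatural C D \<alpha> \<Longrightarrow> pnat C D \<alpha>"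
  by (intro pnat.intro pnat_axioms.intro bicat_pair_axioms)

context bicat_pair
begin

lemma pseudonatural_simps [simp]:
  assumes "pseudonatural C D \<alpha>"
  shows "pseudofunctor C D (nsrc \<alpha>)" "pseudofunctor C D (ntgt \<alpha>)"
    "A \<in> Obj C \<Longrightarrow> ncmp \<alpha> A \<in> Arr D" "A \<in> Obj C \<Longrightarrow> src D (ncmp \<alpha> A) = ob_map (nsrc \<alpha>) A"
    "A \<in> Obj C \<Longrightarrow> tgt D (ncmp \<alpha> A) = ob_map (ntgt \<alpha>) A"
proof -
  interpret pnat C D \<alpha> using assms(1) by (rule pnatI)
  show "pseudofunctor C D (nsrc \<alpha>)" "pseudofunctor C D (ntgt \<alpha>)"
    "A \<in> Obj C \<Longrightarrow> ncmp \<alpha> A \<in> Arr D" "A \<in> Obj C \<Longrightarrow> src D (ncmp \<alpha> A) = ob_map (nsrc \<alpha>) A"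
    "A \<in> Obj C \<Longrightarrow> tgt D (ncmp \<alpha> A) = ob_map (ntgt \<alpha>) A"
    using F.pseudofunctor_axioms G.pseudofunctor_axioms by auto
qed

lemma pseudofunctor_simps [simp]:
  assumes "pseudofunctor C D F"
  shows "A \<in> Obj C \<Longrightarrow> ob_map F A \<in> Obj D"
    "f \<in> Arr C \<Longrightarrow> ar_map F f \<in> Arr D" "f \<in> Arr C \<Longrightarrow> src D (ar_map F f) = ob_map F (src C f)"
    "f \<in> Arr C \<Longrightarrow> tgt D (ar_map F f) = ob_map F (tgt C f)"
proof -
  interpret F: pseudofunctor C D F by fact
  show "A \<in> Obj C \<Longrightarrow> ob_map F A \<in> Obj D"
    "f \<in> Arr C \<Longrightarrow> ar_map F f \<in> Arr D" "f \<in> Arr C \<Longrightarrow> src D (ar_map F f) = ob_map F (src C f)"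
    "f \<in> Arr C \<Longrightarrow> tgt D (ar_map F f) = ob_map F (tgt C f)"
    by auto
qed

lemma modification_simps [simp]:
  assumes "modification C D \<mu>"
  shows "pseudonatural C D (msrc \<mu>)" "pseudonatural C D (mtgt \<mu>)"
    "nsrc (mtgt \<mu>) = nsrc (msrc \<mu>)" "ntgt (mtgt \<mu>) = ntgt (msrc \<mu>)"
    "A \<in> Obj C \<Longrightarrow> mcmp \<mu> A \<in> Cell D" "A \<in> Obj C \<Longrightarrow> Dom D (mcmp \<mu> A) = ncmp (msrc \<mu>) A"
    "A \<in> Obj C \<Longrightarrow> Cod D (mcmp \<mu> A) = ncmp (mtgt \<mu>) A" "mcmp \<mu> \<in> extensional (Obj C)"
proof -
  interpret M: modification C D \<mu> by fact
  show "pseudonatural C D (msrc \<mu>)" "pseudonatural C D (mtgt \<mu>)"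
    "nsrc (mtgt \<mu>) = nsrc (msrc \<mu>)" "ntgt (mtgt \<mu>) = ntgt (msrc \<mu>)"
    "A \<in> Obj C \<Longrightarrow> mcmp \<mu> A \<in> Cell D" "A \<in> Obj C \<Longrightarrow> Dom D (mcmp \<mu> A) = ncmp (msrc \<mu>) A"
    "A \<in> Obj C \<Longrightarrow> Cod D (mcmp \<mu> A) = ncmp (mtgt \<mu>) A" "mcmp \<mu> \<in> extensional (Obj C)"
    using M.msrc_pnt M.mtgt_pnt M.parallel_src M.parallel_tgt M.mcmp_cells M.mcmp_ext by (auto simp: cells_def)
qed

lemma mcmp_natural':
  assumes "modification C D \<mu>" "f \<in> Arr C" "A = src C f" "B = tgt C f"
  shows "(mcmp \<mu> B \<lhd> ar_map (nsrc (msrc \<mu>)) f) \<cdot> nnat (msrc \<mu>) f =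
      nnat (mtgt \<mu>) f \<cdot> (ar_map (ntgt (msrc \<mu>)) f \<rhd> mcmp \<mu> A)"
  using modification.mcmp_natural[OF assms(1), of f A B] assms by (simp add: hom_def)

definition rep :: "('o \<Rightarrow> ('p, 'n) tm) \<Rightarrow> ('o, 'm, 'c, 'p, 'n, 'd) pnt \<Rightarrow> bool" where
  "rep c \<alpha> \<longleftrightarrow> (\<forall>A \<in> Obj C. wft D (c A) \<and> ev D (c A) = ncmp \<alpha> A)"

lemma rep_simps [simp]: "rep c \<alpha> \<Longrightarrow> A \<in> Obj C \<Longrightarrow> wft D (c A)"
  "rep c \<alpha> \<Longrightarrow> A \<in> Obj C \<Longrightarrow> ev D (c A) = ncmp \<alpha> A"
  by (auto simp: rep_def)

lemma rep_At: "pseudonatural C D \<alpha> \<Longrightarrow> rep (\<lambda>A. At (ncmp \<alpha> A)) \<alpha>"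
  by (auto simp: rep_def)

lemma rep_One: "pseudofunctor C D F \<Longrightarrow> rep (\<lambda>A. One (ob_map F A)) (id_pnt C D F)"
  by (auto simp: rep_def)

lemma rep_Cm: "pseudonatural C D \<alpha> \<Longrightarrow> pseudonatural C D \<beta> \<Longrightarrow> nsrc \<beta> = ntgt \<alpha> \<Longrightarrow> rep c \<alpha> \<Longrightarrow> rep d \<beta> \<Longrightarrow>
    rep (\<lambda>A. Cm (d A) (c A)) (pnt_comp C D \<beta> \<alpha>)"
  by (simp add: rep_def[of _ "pnt_comp C D \<beta> \<alpha>"])

lemma nst_id:
  assumes "pseudofunctor C D F" "f \<in> Arr C" "X \<in> Arr D" "tgt D X = ob_map F (src C f)"
  shows "nst (\<lambda>A. One (ob_map F A)) (id_pnt C D F) f X = idc D (ar_map F f \<odot> X)"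
proof -
  have "nst (\<lambda>A. One (ob_map F A)) (id_pnt C D F) f X =
    D.self.st (Cm (At (ar_map F f)) (One (ob_map F (src C f)))) (Cm (One (ob_map F (tgt C f))) (At (ar_map F f)))
      (inv_cell D (lun D (ar_map F f)) \<cdot> run D (ar_map F f)) X"
    using assms by (simp add: nst_def) (simp add: id_pnt_def)
  then show ?thesis
    using assms by (subst (asm) D.self.st_vcomp[where t = "At (ar_map F f)"]) auto
qed

lemma nst_simps:
  assumes "pseudonatural C D \<alpha>" "rep c \<alpha>" "f \<in> Arr C" "X \<in> Arr D" "tgt D X = ob_map (nsrc \<alpha>) (src C f)"
  shows "isoc D (nst c \<alpha> f X)" "Dom D (nst c \<alpha> f X) = ar_map (ntgt \<alpha>) f \<odot> D.self.ap (c (src C f)) X"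
    "Cod D (nst c \<alpha> f X) = D.self.ap (c (tgt C f)) (ar_map (nsrc \<alpha>) f \<odot> X)"
proof -
  interpret pnat C D \<alpha> using assms(1) by (rule pnatI)
  show "isoc D (nst c \<alpha> f X)" "Dom D (nst c \<alpha> f X) = ar_map (ntgt \<alpha>) f \<odot> D.self.ap (c (src C f)) X"
    "Cod D (nst c \<alpha> f X) = D.self.ap (c (tgt C f)) (ar_map (nsrc \<alpha>) f \<odot> X)"
    using assms by (simp_all add: nst_def)
qed

text \<open>Of the five factors of the naturality cell of a composite, the three associators have
  identities as strict forms. What remains is the cell of \<beta> at the transported argument,
  followed by the cell of \<alpha> under the component of \<beta>.\<close>

lemma nst_comp:
  assumes a: "pseudonatural C D \<alpha>" and b: "pseudonatural C D \<beta>" and ab: "nsrc \<beta> = ntgt \<alpha>"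
    and r: "rep c \<alpha>" "rep d \<beta>" and f: "f \<in> Arr C" "X \<in> Arr D" "tgt D X = ob_map (nsrc \<alpha>) (src C f)"
  shows "nst (\<lambda>A. Cm (d A) (c A)) (pnt_comp C D \<beta> \<alpha>) f X =
    D.self.apc (d (tgt C f)) (nst c \<alpha> f X) \<cdot> nst d \<beta> f (D.self.ap (c (src C f)) X)"
proof -
  interpret a: pnat C D \<alpha> using a by (rule pnatI)
  interpret b: pnat C D \<beta> using b by (rule pnatI)
  let ?A = "src C f" and ?B = "tgt C f"
  let ?F = "ar_map (nsrc \<alpha>) f" and ?G = "ar_map (ntgt \<alpha>) f" and ?H = "ar_map (ntgt \<beta>) f"
  let ?s = "Cm (At ?H) (Cm (d ?A) (c ?A))" and ?t1 = "Cm (Cm (At ?H) (d ?A)) (c ?A)"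
    and ?t2 = "Cm (Cm (d ?B) (At ?G)) (c ?A)" and ?t3 = "Cm (d ?B) (Cm (At ?G) (c ?A))"
    and ?t4 = "Cm (d ?B) (Cm (c ?B) (At ?F))" and ?t = "Cm (Cm (d ?B) (c ?B)) (At ?F)"
  note s = f r ab
  have "nnat (pnt_comp C D \<beta> \<alpha>) f =
    inv_cell D (asc D (ncmp \<beta> ?B) (ncmp \<alpha> ?B) ?F) \<cdot> ((ncmp \<beta> ?B \<rhd> nnat \<alpha> f) \<cdot> (asc D (ncmp \<beta> ?B) ?G (ncmp \<alpha> ?A) \<cdot>
      ((nnat \<beta> f \<lhd> ncmp \<alpha> ?A) \<cdot> inv_cell D (asc D ?H (ncmp \<beta> ?A) (ncmp \<alpha> ?A)))))" (is "_ = ?n5 \<cdot> (?n4 \<cdot> (?n3 \<cdot> (?n2 \<cdot> ?n1)))")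
    using f by (simp add: pnt_comp_def Let_def)
  then have e: "nst (\<lambda>A. Cm (d A) (c A)) (pnt_comp C D \<beta> \<alpha>) f X =
    D.self.st ?s ?t (?n5 \<cdot> (?n4 \<cdot> (?n3 \<cdot> (?n2 \<cdot> ?n1)))) X"
    by (simp add: nst_def)
  have "D.self.st ?s ?t2 (?n2 \<cdot> ?n1) X = nst d \<beta> f (D.self.ap (c (src C f)) X)"
    using s by (subst D.self.st_vcomp[where t = ?t1]) (auto simp: D.self.st_hcomp nst_def)
  then have "D.self.st ?s ?t3 (?n3 \<cdot> (?n2 \<cdot> ?n1)) X = nst d \<beta> f (D.self.ap (c (src C f)) X)"
    using s nst_simps[OF b r(2) f(1), of "D.self.ap (c (src C f)) X"]
    by (subst D.self.st_vcomp[where t = ?t2]) auto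
  then have "D.self.st ?s ?t4 (?n4 \<cdot> (?n3 \<cdot> (?n2 \<cdot> ?n1))) X =
    D.self.apc (d (tgt C f)) (nst c \<alpha> f X) \<cdot> nst d \<beta> f (D.self.ap (c (src C f)) X)"
    using s by (subst D.self.st_vcomp[where t = ?t3]) (auto simp: D.self.st_hcomp nst_def)
  then show ?thesis unfolding e
    using s nst_simps[OF b r(2) f(1), of "D.self.ap (c (src C f)) X"] nst_simps[OF a r(1) f]
    by (subst D.self.st_vcomp[where t = ?t4]) auto
qed

lemma pseudonatural_id:
  assumes F: "pseudofunctor C D F"
  shows "pseudonatural C D (id_pnt C D F)"
proof -
  interpret F: pseudofunctor C D F by fact
  show ?thesis
  proof (rule pseudonaturalI[where c = "\<lambda>A. One (ob_map F A)"], goal_cases)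
    case (12 a X)
    then show ?case by (simp add: nst_id[OF F])
  next
    case (13 g f X)
    then show ?case by (simp add: nst_id[OF F])
  next
    case (14 A X)
    then show ?case by (simp add: nst_id[OF F])
  qed (use F in \<open>auto simp: id_pnt_def\<close>)
qed

lemma pseudonatural_comp:
  assumes a: "pseudonatural C D \<alpha>" and b: "pseudonatural C D \<beta>" and ab: "nsrc \<beta> = ntgt \<alpha>"
  shows "pseudonatural C D (pnt_comp C D \<beta> \<alpha>)"
proof -
  interpret a: pnat C D \<alpha> using a by (rule pnatI)
  interpret b: pnat C D \<beta> using b by (rule pnatI)
  let ?c = "\<lambda>A. Cm (At (ncmp \<beta> A)) (At (ncmp \<alpha> A))"
  have n: "nst ?c (pnt_comp C D \<beta> \<alpha>) f X = (ncmp \<beta> (tgt C f) \<rhd> N \<alpha> f X) \<cdot> N \<beta> f (ncmp \<alpha> (src C f) \<odot> X)"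
    if "f \<in> Arr C" "X \<in> Arr D" "tgt D X = ob_map (nsrc \<alpha>) (src C f)" for f X
    using nst_comp[OF a b ab rep_At[OF a] rep_At[OF b] that] by (simp add: N_def)
  note [simp] = ab
  show ?thesis
  proof (rule pseudonaturalI[where c = ?c], goal_cases)
    case (12 m X)
    let ?A = "src C (Dom C m)" and ?B = "tgt C (Dom C m)" and ?f = "Dom C m" and ?g = "Cod C m"
    have X: "X \<in> Arr D" "m \<in> Cell C" "tgt D X = ob_map (nsrc \<alpha>) ?A" using 12 by auto
    have e1: "N \<beta> ?g (ncmp \<alpha> ?A \<odot> X) \<cdot> (ce_map (ntgt \<beta>) m \<lhd> (ncmp \<beta> ?A \<odot> (ncmp \<alpha> ?A \<odot> X))) =
      (ncmp \<beta> ?B \<rhd> (ce_map (ntgt \<alpha>) m \<lhd> (ncmp \<alpha> ?A \<odot> X))) \<cdot> N \<beta> ?f (ncmp \<alpha> ?A \<odot> X)"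
      using b.N_natural[of m ?f ?g ?A ?B "ncmp \<alpha> ?A \<odot> X"] X by simp
    have e2: "(ncmp \<beta> ?B \<rhd> N \<alpha> ?g X) \<cdot> (ncmp \<beta> ?B \<rhd> (ce_map (ntgt \<alpha>) m \<lhd> (ncmp \<alpha> ?A \<odot> X))) =
      (ncmp \<beta> ?B \<rhd> (ncmp \<alpha> ?B \<rhd> (ce_map (nsrc \<alpha>) m \<lhd> X))) \<cdot> (ncmp \<beta> ?B \<rhd> N \<alpha> ?f X)"
      by (rule D.lwhisk_eq[OF a.N_natural[of m ?f ?g ?A ?B X]]) (use X in auto)
    show ?case
      using X by (simp add: n e1 D.vcomp_eq[OF e2])
  next
    case (13 g f X)
    then have X: "X \<in> Arr D" "f \<in> Arr C" "g \<in> Arr C" "src C g = tgt C f" "tgt D X = ob_map (nsrc \<alpha>) (src C f)"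
      by auto
    let ?A = "src C f" and ?B = "tgt C f" and ?E = "tgt C g"
    let ?F = "nsrc \<alpha>" and ?G = "ntgt \<alpha>" and ?H = "ntgt \<beta>"
    let ?a = "ncmp \<alpha>" and ?b = "ncmp \<beta>"
    have e1: "N \<beta> (ocomp C g f) (?a ?A \<odot> X) \<cdot> pact ?H g f (?b ?A \<odot> (?a ?A \<odot> X)) =
      (?b ?E \<rhd> pact ?G g f (?a ?A \<odot> X)) \<cdot>
      (N \<beta> g (ar_map ?G f \<odot> (?a ?A \<odot> X)) \<cdot> (ar_map ?H g \<rhd> N \<beta> f (?a ?A \<odot> X)))"
      using b.N_ocomp[of g f "?a ?A \<odot> X"] X by simp
    have e2: "(?b ?E \<rhd> N \<alpha> (ocomp C g f) X) \<cdot> (?b ?E \<rhd> pact ?G g f (?a ?A \<odot> X)) =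
      (?b ?E \<rhd> (?a ?E \<rhd> pact ?F g f X)) \<cdot>
      (?b ?E \<rhd> (N \<alpha> g (ar_map ?F f \<odot> X) \<cdot> (ar_map ?G g \<rhd> N \<alpha> f X)))"
      by (rule D.lwhisk_eq[OF a.N_ocomp]) (use X in auto)
    \<comment> \<open>\<open>N \<beta> g\<close> is natural in its argument, so it passes the cell
      of \<alpha> at \<open>f\<close>. In this case it is the only interaction between the two
      transformations; \<open>e1\<close> and \<open>e2\<close> are their own composition
      axioms.\<close>
    have e3: "N \<beta> g (?a ?B \<odot> (ar_map ?F f \<odot> X)) \<cdot> (ar_map ?H g \<rhd> (?b ?B \<rhd> N \<alpha> f X)) =
      (?b ?E \<rhd> (ar_map ?G g \<rhd> N \<alpha> f X)) \<cdot> N \<beta> g (ar_map ?G f \<odot> (?a ?A \<odot> X))"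
      by (rule b.N_arg[unfolded ab]) (use X in auto)
    show ?case
      using X by (simp add: n e1 D.vcomp_eq[OF e2] D.vcomp_eq[OF e3])
  next
    case (14 A X)
    then have X: "X \<in> Arr D" "A \<in> Obj C" "tgt D X = ob_map (nsrc \<alpha>) A" by auto
    have e1: "N \<beta> (one C A) (ncmp \<alpha> A \<odot> X) \<cdot> uact (ntgt \<beta>) A (ncmp \<beta> A \<odot> (ncmp \<alpha> A \<odot> X)) =
      ncmp \<beta> A \<rhd> uact (ntgt \<alpha>) A (ncmp \<alpha> A \<odot> X)"
      using b.N_one[of A "ncmp \<alpha> A \<odot> X"] X by simp
    have "(ncmp \<beta> A \<rhd> N \<alpha> (one C A) X) \<cdot> (ncmp \<beta> A \<rhd> uact (ntgt \<alpha>) A (ncmp \<alpha> A \<odot> X)) =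
      ncmp \<beta> A \<rhd> (N \<alpha> (one C A) X \<cdot> uact (ntgt \<alpha>) A (ncmp \<alpha> A \<odot> X))"
      using X by simp
    also have "\<dots> = ncmp \<beta> A \<rhd> (ncmp \<alpha> A \<rhd> uact (nsrc \<alpha>) A X)"
      using X by (simp only: a.N_one)
    finally show ?case
      using X by (simp add: n e1)
  next
    case (9 f)
    then show ?case by (simp add: pnt_comp_def Let_def)
  next
    case (10 f)
    then show ?case by (simp add: pnt_comp_def Let_def)
  next
    case (11 f)
    then show ?case by (simp add: pnt_comp_def Let_def)
  qed (use a b in \<open>auto simp: pnt_comp_def\<close>)
qed

end

section \<open>Modifications: strict criterion, composites, structure cells, inverses\<close>

context bicat_pair
begin

lemma modificationI_strict:
  assumes p: "pseudonatural C D (msrc \<mu>)" "pseudonatural C D (mtgt \<mu>)" "nsrc (msrc \<mu>) = F" "nsrc (mtgt \<mu>) = F"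
    "ntgt (msrc \<mu>) = G" "ntgt (mtgt \<mu>) = G" "mcmp \<mu> \<in> extensional (Obj C)"
    and m: "\<And>A. A \<in> Obj C \<Longrightarrow> mcmp \<mu> A \<in> Cell D" "\<And>A. A \<in> Obj C \<Longrightarrow> Dom D (mcmp \<mu> A) = ncmp (msrc \<mu>) A"
      "\<And>A. A \<in> Obj C \<Longrightarrow> Cod D (mcmp \<mu> A) = ncmp (mtgt \<mu>) A"
    and r: "rep c (msrc \<mu>)" "rep d (mtgt \<mu>)"
    and n: "\<And>f X. f \<in> Arr C \<Longrightarrow> X \<in> Arr D \<Longrightarrow> tgt D X = ob_map F (src C f) \<Longrightarrow>
      D.self.st (c (tgt C f)) (d (tgt C f)) (mcmp \<mu> (tgt C f)) (ar_map F f \<odot> X) \<cdot> nst c (msrc \<mu>) f X =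
      nst d (mtgt \<mu>) f X \<cdot> (ar_map G f \<rhd> D.self.st (c (src C f)) (d (src C f)) (mcmp \<mu> (src C f)) X)"
  shows "modification C D \<mu>"
proof (rule modificationI[OF p m])
  interpret a: pnat C D "msrc \<mu>" using p(1) by (rule pnatI)
  interpret b: pnat C D "mtgt \<mu>" using p(2) by (rule pnatI)
  fix f assume f: "f \<in> Arr C"
  note a.nnat_simps[OF f, unfolded p, simp] b.nnat_simps[OF f, unfolded p, simp]
  show "(mcmp \<mu> (tgt C f) \<lhd> ar_map F f) \<cdot> nnat (msrc \<mu>) f = nnat (mtgt \<mu>) f \<cdot> (ar_map G f \<rhd> mcmp \<mu> (src C f))"
  proof (subst D.strict_modif_iff[of "c (src C f)" "c (tgt C f)" "d (src C f)" "d (tgt C f)"], goal_cases)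
    case 23
    show ?case
    proof (intro ballI impI)
      fix X assume "X \<in> Arr D" "tgt D X = src D (ev D (c (src C f)))"
      then have "X \<in> Arr D" "tgt D X = ob_map F (src C f)" using p r f a.ncmp_simps[of "src C f"] by auto
      from n[OF f this] show "D.self.st (c (tgt C f)) (d (tgt C f)) (mcmp \<mu> (tgt C f)) (ar_map F f \<odot> X) \<cdot>
        D.self.st (Cm (At (ar_map G f)) (c (src C f))) (Cm (c (tgt C f)) (At (ar_map F f))) (nnat (msrc \<mu>) f) X =
        D.self.st (Cm (At (ar_map G f)) (d (src C f))) (Cm (d (tgt C f)) (At (ar_map F f))) (nnat (mtgt \<mu>) f) X \<cdot>
        (ar_map G f \<rhd> D.self.st (c (src C f)) (d (src C f)) (mcmp \<mu> (src C f)) X)"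
        by (simp only: nst_def p)
    qed
  qed (use f r m a.F.ar_map_simps[OF f] a.G.ar_map_simps[OF f] a.ncmp_simps[of "src C f"] a.ncmp_simps[of "tgt C f"] in
    \<open>simp_all add: p\<close>)
qed

lemma modification_strict:
  assumes m: "modification C D \<mu>" and h: "f \<in> Arr C" "X \<in> Arr D" "tgt D X = ob_map (nsrc (msrc \<mu>)) (src C f)"
    "A = src C f" "B = tgt C f"
  shows "(mcmp \<mu> B \<lhd> (ar_map (nsrc (msrc \<mu>)) f \<odot> X)) \<cdot> N (msrc \<mu>) f X =
      N (mtgt \<mu>) f X \<cdot> (ar_map (ntgt (msrc \<mu>)) f \<rhd> (mcmp \<mu> A \<lhd> X))"
proof -
  interpret a: pnat C D "msrc \<mu>" using modification_simps(1)[OF m] by (rule pnatI)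
  interpret b: pnat C D "mtgt \<mu>" using modification_simps(2)[OF m] by (rule pnatI)
  have s: "nsrc (mtgt \<mu>) = nsrc (msrc \<mu>)" "ntgt (mtgt \<mu>) = ntgt (msrc \<mu>)" using m by auto
  note b.nnat_simps[OF h(1), unfolded s, simp]
  let ?c = "\<lambda>A. At (ncmp (msrc \<mu>) A)" and ?d = "\<lambda>A. At (ncmp (mtgt \<mu>) A)"
  have "(mcmp \<mu> B \<lhd> ar_map (nsrc (msrc \<mu>)) f) \<cdot> nnat (msrc \<mu>) f =
      nnat (mtgt \<mu>) f \<cdot> (ar_map (ntgt (msrc \<mu>)) f \<rhd> mcmp \<mu> A)"
    by (rule mcmp_natural') (use m h in auto)
  then have "D.self.st (?c B) (?d B) (mcmp \<mu> B) (ar_map (nsrc (msrc \<mu>)) f \<odot> X) \<cdot> N (msrc \<mu>) f X =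
    N (mtgt \<mu>) f X \<cdot> (ar_map (ntgt (msrc \<mu>)) f \<rhd> D.self.st (?c A) (?d A) (mcmp \<mu> A) X)"
    by (subst (asm) D.strict_modif_iff[of "?c A" "?c B" "?d A" "?d B"]) (use m h in \<open>auto simp: a.N_eq b.N_eq\<close>)
  then show ?thesis using m h by simp
qed

lemma modification_idc:
  assumes a: "pseudonatural C D \<alpha>"
  shows "modification C D (idc (functor_bicat C D) \<alpha>)"
proof -
  interpret a: pnat C D \<alpha> using a by (rule pnatI)
  show ?thesis
    by (rule modificationI[where F = "nsrc \<alpha>" and G = "ntgt \<alpha>"]) (use a in \<open>auto simp: functor_bicat_sel\<close>)
qed

lemma modification_vcomp:
  assumes m: "modification C D \<mu>" and n: "modification C D \<nu>" and e: "msrc \<nu> = mtgt \<mu>"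
  shows "modification C D (vcomp (functor_bicat C D) \<nu> \<mu>)"
proof -
  let ?F = "nsrc (msrc \<mu>)" and ?G = "ntgt (msrc \<mu>)"
  interpret a: pnat C D "msrc \<mu>" using modification_simps(1)[OF m] by (rule pnatI)
  interpret b: pnat C D "mtgt \<mu>" using modification_simps(2)[OF m] by (rule pnatI)
  interpret c: pnat C D "mtgt \<nu>" using modification_simps(2)[OF n] by (rule pnatI)
  have s: "nsrc (mtgt \<mu>) = ?F" "ntgt (mtgt \<mu>) = ?G" "nsrc (mtgt \<nu>) = ?F" "ntgt (mtgt \<nu>) = ?G"
    using m n e modification_simps(3,4)[OF n] by auto
  note [simp] = e
  show ?thesis
  proof (rule modificationI[where F = ?F and G = ?G], goal_cases)
    case (11 f)
    let ?A = "src C f" and ?B = "tgt C f"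
    have "(mcmp \<nu> ?B \<lhd> ar_map ?F f) \<cdot> ((mcmp \<mu> ?B \<lhd> ar_map ?F f) \<cdot> nnat (msrc \<mu>) f) =
      (mcmp \<nu> ?B \<lhd> ar_map ?F f) \<cdot> (nnat (mtgt \<mu>) f \<cdot> (ar_map ?G f \<rhd> mcmp \<mu> ?A))"
      by (subst mcmp_natural'[OF m 11 refl refl]) simp
    also have "\<dots> = nnat (mtgt \<nu>) f \<cdot> ((ar_map ?G f \<rhd> mcmp \<nu> ?A) \<cdot> (ar_map ?G f \<rhd> mcmp \<mu> ?A))"
      by (rule D.vcomp_eq[OF mcmp_natural'[OF n 11 refl refl, unfolded e s]])
        (use m n 11 s c.nnat_simps[OF 11] in auto)
    finally show ?case using m n 11 s c.nnat_simps[OF 11] by (simp add: functor_bicat_sel)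
  qed (use m n s in \<open>auto simp: functor_bicat_sel\<close>)
qed

text \<open>In strict form the condition is a chain of four exchanges: \<mu> and \<nu> each pass a
  naturality cell by their own condition (\<open>e1\<close>, \<open>e4\<close>), and
  \<open>e2\<close>, \<open>e3\<close> are interchange.\<close>

lemma modification_hcomp:
  assumes m: "modification C D \<mu>" and n: "modification C D \<nu>" and e: "nsrc (msrc \<nu>) = ntgt (msrc \<mu>)"
  shows "modification C D (hcomp (functor_bicat C D) \<nu> \<mu>)"
proof -
  let ?F = "nsrc (msrc \<mu>)" and ?G = "ntgt (msrc \<mu>)" and ?H = "ntgt (msrc \<nu>)"
  let ?\<alpha> = "msrc \<mu>" and ?\<alpha>' = "mtgt \<mu>" and ?\<beta> = "msrc \<nu>" and ?\<beta>' = "mtgt \<nu>"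
  interpret a: pnat C D ?\<alpha> using modification_simps(1)[OF m] by (rule pnatI)
  interpret a': pnat C D ?\<alpha>' using modification_simps(2)[OF m] by (rule pnatI)
  interpret b: pnat C D ?\<beta> using modification_simps(1)[OF n] by (rule pnatI)
  interpret b': pnat C D ?\<beta>' using modification_simps(2)[OF n] by (rule pnatI)
  have s: "nsrc ?\<alpha>' = ?F" "ntgt ?\<alpha>' = ?G" "nsrc ?\<beta>' = ?G" "ntgt ?\<beta>' = ?H"
    using m n e by auto
  note [simp] = e
  note [simp] = a'.N_simps[unfolded s] b'.N_simps[unfolded s] b.N_simps[unfolded e]
  have p: "pseudonatural C D ?\<alpha>" "pseudonatural C D ?\<alpha>'" "pseudonatural C D ?\<beta>" "pseudonatural C D ?\<beta>'"
    using m n by auto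
  let ?c = "\<lambda>A. Cm (At (ncmp ?\<beta> A)) (At (ncmp ?\<alpha> A))" and ?d = "\<lambda>A. Cm (At (ncmp ?\<beta>' A)) (At (ncmp ?\<alpha>' A))"
  show ?thesis
  proof (rule modificationI_strict[where F = ?F and G = ?H and c = ?c and d = ?d], goal_cases)
    case (13 f X)
    then have X: "f \<in> Arr C" "X \<in> Arr D" "tgt D X = ob_map ?F (src C f)" by auto
    let ?A = "src C f" and ?B = "tgt C f"
    let ?a = "ncmp ?\<alpha>" and ?a' = "ncmp ?\<alpha>'" and ?b = "ncmp ?\<beta>" and ?b' = "ncmp ?\<beta>'"
    let ?f = "ar_map ?F f" and ?g = "ar_map ?G f" and ?h = "ar_map ?H f"
    have n1: "nst ?c (pnt_comp C D ?\<beta> ?\<alpha>) f X = (?b ?B \<rhd> N ?\<alpha> f X) \<cdot> N ?\<beta> f (?a ?A \<odot> X)"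
      using nst_comp[OF p(1,3) e rep_At[OF p(1)] rep_At[OF p(3)] X] by (simp add: N_def)
    have n2: "nst ?d (pnt_comp C D ?\<beta>' ?\<alpha>') f X = (?b' ?B \<rhd> N ?\<alpha>' f X) \<cdot> N ?\<beta>' f (?a' ?A \<odot> X)"
      using nst_comp[OF p(2,4) _ rep_At[OF p(2)] rep_At[OF p(4)], of f X] X s by (simp add: N_def)
    have m1: "D.self.st (?c A) (?d A) (mcmp \<nu> A \<star> mcmp \<mu> A) Y =
      (mcmp \<nu> A \<lhd> (?a' A \<odot> Y)) \<cdot> (?b A \<rhd> (mcmp \<mu> A \<lhd> Y))"
      if "A \<in> Obj C" "Y \<in> Arr D" "tgt D Y = ob_map ?F A" for A Y
      using that m n s by (simp add: D.self.st_hcomp)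
    have e1: "(?b ?B \<rhd> (mcmp \<mu> ?B \<lhd> (?f \<odot> X))) \<cdot> (?b ?B \<rhd> N ?\<alpha> f X) =
      (?b ?B \<rhd> N ?\<alpha>' f X) \<cdot> (?b ?B \<rhd> (?g \<rhd> (mcmp \<mu> ?A \<lhd> X)))"
      by (rule D.lwhisk_eq[OF modification_strict[OF m]]) (use X m n s in auto)
    have e2: "N ?\<beta> f (?a' ?A \<odot> X) \<cdot> (?h \<rhd> (?b ?A \<rhd> (mcmp \<mu> ?A \<lhd> X))) =
      (?b ?B \<rhd> (?g \<rhd> (mcmp \<mu> ?A \<lhd> X))) \<cdot> N ?\<beta> f (?a ?A \<odot> X)"
      by (rule b.N_arg[unfolded e]) (use X m n s in auto)
    have e3: "(mcmp \<nu> ?B \<lhd> (?a' ?B \<odot> (?f \<odot> X))) \<cdot> (?b ?B \<rhd> N ?\<alpha>' f X) =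
      (?b' ?B \<rhd> N ?\<alpha>' f X) \<cdot> (mcmp \<nu> ?B \<lhd> (?g \<odot> (?a' ?A \<odot> X)))"
      by (rule D.whisk_exchange) (use X m n s in auto)
    have e4: "(mcmp \<nu> ?B \<lhd> (?g \<odot> (?a' ?A \<odot> X))) \<cdot> N ?\<beta> f (?a' ?A \<odot> X) =
      N ?\<beta>' f (?a' ?A \<odot> X) \<cdot> (?h \<rhd> (mcmp \<nu> ?A \<lhd> (?a' ?A \<odot> X)))"
      by (rule modification_strict[OF n, unfolded e]) (use X m n s in auto)
    have "((mcmp \<nu> ?B \<lhd> (?a' ?B \<odot> (?f \<odot> X))) \<cdot> (?b ?B \<rhd> (mcmp \<mu> ?B \<lhd> (?f \<odot> X)))) \<cdot>
        ((?b ?B \<rhd> N ?\<alpha> f X) \<cdot> N ?\<beta> f (?a ?A \<odot> X)) =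
      (mcmp \<nu> ?B \<lhd> (?a' ?B \<odot> (?f \<odot> X))) \<cdot> ((?b ?B \<rhd> N ?\<alpha>' f X) \<cdot>
        (N ?\<beta> f (?a' ?A \<odot> X) \<cdot> (?h \<rhd> (?b ?A \<rhd> (mcmp \<mu> ?A \<lhd> X)))))"
      using X m n s by (simp add: e2 D.vcomp_eq[OF e1])
    also have "\<dots> = (?b' ?B \<rhd> N ?\<alpha>' f X) \<cdot> ((mcmp \<nu> ?B \<lhd> (?g \<odot> (?a' ?A \<odot> X))) \<cdot>
        (N ?\<beta> f (?a' ?A \<odot> X) \<cdot> (?h \<rhd> (?b ?A \<rhd> (mcmp \<mu> ?A \<lhd> X)))))"
      by (rule D.vcomp_eq[OF e3]) (use X m n s in auto)
    also have "(mcmp \<nu> ?B \<lhd> (?g \<odot> (?a' ?A \<odot> X))) \<cdot>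
        (N ?\<beta> f (?a' ?A \<odot> X) \<cdot> (?h \<rhd> (?b ?A \<rhd> (mcmp \<mu> ?A \<lhd> X)))) =
      N ?\<beta>' f (?a' ?A \<odot> X) \<cdot> ((?h \<rhd> (mcmp \<nu> ?A \<lhd> (?a' ?A \<odot> X))) \<cdot> (?h \<rhd> (?b ?A \<rhd> (mcmp \<mu> ?A \<lhd> X))))"
      by (rule D.vcomp_eq[OF e4]) (use X m n s in auto)
    finally show ?case
      using X m n s by (simp add: functor_bicat_sel n1 n2 m1)
  next
    case 11 show ?case using rep_Cm[OF p(1,3) e rep_At[OF p(1)] rep_At[OF p(3)]] by (simp add: functor_bicat_sel)
  next
    case 12 show ?case using rep_Cm[OF p(2,4) _ rep_At[OF p(2)] rep_At[OF p(4)]] s by (simp add: functor_bicat_sel)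
  qed (use m n s in \<open>auto simp: functor_bicat_sel intro!: pseudonatural_comp\<close>)
qed

text \<open>The two bracketings of a triple composite have the same strict naturality cell
  \<open>?n\<close>, and the components of the modification become identities, so both sides are
  \<open>?n\<close>.\<close>

lemma modification_asc:
  assumes a: "pseudonatural C D \<alpha>" and b: "pseudonatural C D \<beta>" and c: "pseudonatural C D \<gamma>"
    and ab: "nsrc \<beta> = ntgt \<alpha>" and bc: "nsrc \<gamma> = ntgt \<beta>"
  shows "modification C D (asc (functor_bicat C D) \<gamma> \<beta> \<alpha>)"
proof -
  let ?c = "\<lambda>A. Cm (Cm (At (ncmp \<gamma> A)) (At (ncmp \<beta> A))) (At (ncmp \<alpha> A))"
    and ?d = "\<lambda>A. Cm (At (ncmp \<gamma> A)) (Cm (At (ncmp \<beta> A)) (At (ncmp \<alpha> A)))"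
  note r = rep_At[OF a] rep_At[OF b] rep_At[OF c]
  have cb: "pseudonatural C D (pnt_comp C D \<gamma> \<beta>)" by (rule pseudonatural_comp[OF b c bc])
  have ba: "pseudonatural C D (pnt_comp C D \<beta> \<alpha>)" by (rule pseudonatural_comp[OF a b ab])
  have rcb: "rep (\<lambda>A. Cm (At (ncmp \<gamma> A)) (At (ncmp \<beta> A))) (pnt_comp C D \<gamma> \<beta>)"
    by (rule rep_Cm[OF b c bc r(2,3)])
  have rba: "rep (\<lambda>A. Cm (At (ncmp \<beta> A)) (At (ncmp \<alpha> A))) (pnt_comp C D \<beta> \<alpha>)"
    by (rule rep_Cm[OF a b ab r(1,2)])
  have r1: "rep ?c (pnt_comp C D (pnt_comp C D \<gamma> \<beta>) \<alpha>)"
    by (rule rep_Cm[OF a cb _ r(1) rcb]) (simp add: ab)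
  have r2: "rep ?d (pnt_comp C D \<gamma> (pnt_comp C D \<beta> \<alpha>))"
    by (rule rep_Cm[OF ba c _ rba r(3)]) (simp add: bc)
  have p1: "pseudonatural C D (pnt_comp C D (pnt_comp C D \<gamma> \<beta>) \<alpha>)"
    by (rule pseudonatural_comp[OF a cb]) (simp add: ab)
  have p2: "pseudonatural C D (pnt_comp C D \<gamma> (pnt_comp C D \<beta> \<alpha>))"
    by (rule pseudonatural_comp[OF ba c]) (simp add: bc)
  show ?thesis
  proof (rule modificationI_strict[where F = "nsrc \<alpha>" and G = "ntgt \<gamma>" and c = ?c and d = ?d], goal_cases)
    case (13 f X)
    then have X: "f \<in> Arr C" "X \<in> Arr D" "tgt D X = ob_map (nsrc \<alpha>) (src C f)" by auto
    let ?A = "src C f" and ?B = "tgt C f"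
    let ?n = "(ncmp \<gamma> ?B \<rhd> (ncmp \<beta> ?B \<rhd> N \<alpha> f X)) \<cdot> ((ncmp \<gamma> ?B \<rhd> N \<beta> f (ncmp \<alpha> ?A \<odot> X)) \<cdot>
      N \<gamma> f (ncmp \<beta> ?A \<odot> (ncmp \<alpha> ?A \<odot> X)))"
    interpret a: pnat C D \<alpha> using a by (rule pnatI)
    interpret b: pnat C D \<beta> using b by (rule pnatI)
    interpret c: pnat C D \<gamma> using c by (rule pnatI)
    note [simp] = b.N_simps[unfolded ab] c.N_simps[unfolded bc]
    have n1: "nst ?c (pnt_comp C D (pnt_comp C D \<gamma> \<beta>) \<alpha>) f X = ?n"
      using nst_comp[OF a cb _ r(1) rcb X] nst_comp[OF b c bc r(2,3), of f "ncmp \<alpha> ?A \<odot> X"] X a b c ab bc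
      by (simp add: N_def)
    have n2: "nst ?d (pnt_comp C D \<gamma> (pnt_comp C D \<beta> \<alpha>)) f X = ?n"
      using nst_comp[OF ba c _ rba r(3), of f X] nst_comp[OF a b ab r(1,2) X] X a b c ab bc
      by (simp flip: N_def)
    have "?n \<in> Cell D" "Dom D ?n = ar_map (ntgt \<gamma>) f \<odot> (ncmp \<gamma> ?A \<odot> (ncmp \<beta> ?A \<odot> (ncmp \<alpha> ?A \<odot> X)))"
      "Cod D ?n = ncmp \<gamma> ?B \<odot> (ncmp \<beta> ?B \<odot> (ncmp \<alpha> ?B \<odot> (ar_map (nsrc \<alpha>) f \<odot> X)))"
      using X a b c ab bc by simp_all
    then show ?case using X a b c ab bc by (simp add: functor_bicat_sel n1 n2)
  qed (use r1 r2 p1 p2 a b c ab bc in \<open>auto simp: functor_bicat_sel\<close>)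
qed

lemma modification_lun:
  assumes a: "pseudonatural C D \<alpha>"
  shows "modification C D (lun (functor_bicat C D) \<alpha>)"
proof -
  interpret a: pnat C D \<alpha> using a by (rule pnatI)
  note i = pseudonatural_id[OF a.G.pseudofunctor_axioms] and ri = rep_One[OF a.G.pseudofunctor_axioms]
  let ?c = "\<lambda>A. Cm (One (ob_map (ntgt \<alpha>) A)) (At (ncmp \<alpha> A))"
  have p: "pseudonatural C D (pnt_comp C D (id_pnt C D (ntgt \<alpha>)) \<alpha>)"
    by (rule pseudonatural_comp[OF a i]) simp
  have r: "rep ?c (pnt_comp C D (id_pnt C D (ntgt \<alpha>)) \<alpha>)"
    by (rule rep_Cm[OF a i _ rep_At[OF a] ri]) simp
  show ?thesis
  proof (rule modificationI_strict[where F = "nsrc \<alpha>" and G = "ntgt \<alpha>" and c = ?c and d = "\<lambda>A. At (ncmp \<alpha> A)"], goal_cases)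
    case (13 f X)
    then have X: "f \<in> Arr C" "X \<in> Arr D" "tgt D X = ob_map (nsrc \<alpha>) (src C f)" by auto
    have n: "nst ?c (pnt_comp C D (id_pnt C D (ntgt \<alpha>)) \<alpha>) f X = N \<alpha> f X"
      using nst_comp[OF a i _ rep_At[OF a] ri X] nst_id[OF a.G.pseudofunctor_axioms, of f "ncmp \<alpha> (src C f) \<odot> X"] X
      by (simp flip: N_def)
    show ?case using X by (simp add: functor_bicat_sel n flip: N_def)
  qed (use p r a rep_At[OF a] in \<open>auto simp: functor_bicat_sel\<close>)
qed

lemma modification_run:
  assumes a: "pseudonatural C D \<alpha>"
  shows "modification C D (run (functor_bicat C D) \<alpha>)"
proof -
  interpret a: pnat C D \<alpha> using a by (rule pnatI)
  note i = pseudonatural_id[OF a.F.pseudofunctor_axioms] and ri = rep_One[OF a.F.pseudofunctor_axioms]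
  let ?c = "\<lambda>A. Cm (At (ncmp \<alpha> A)) (One (ob_map (nsrc \<alpha>) A))"
  have p: "pseudonatural C D (pnt_comp C D \<alpha> (id_pnt C D (nsrc \<alpha>)))"
    by (rule pseudonatural_comp[OF i a]) simp
  have r: "rep ?c (pnt_comp C D \<alpha> (id_pnt C D (nsrc \<alpha>)))"
    by (rule rep_Cm[OF i a _ ri rep_At[OF a]]) simp
  show ?thesis
  proof (rule modificationI_strict[where F = "nsrc \<alpha>" and G = "ntgt \<alpha>" and c = ?c and d = "\<lambda>A. At (ncmp \<alpha> A)"], goal_cases)
    case (13 f X)
    then have X: "f \<in> Arr C" "X \<in> Arr D" "tgt D X = ob_map (nsrc \<alpha>) (src C f)" by auto
    have n: "nst ?c (pnt_comp C D \<alpha> (id_pnt C D (nsrc \<alpha>))) f X = N \<alpha> f X"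
      using nst_comp[OF i a _ ri rep_At[OF a], of f X] nst_id[OF a.F.pseudofunctor_axioms, of f X] X
      by (simp flip: N_def)
    show ?case using X by (simp add: functor_bicat_sel n flip: N_def)
  qed (use p r a rep_At[OF a] in \<open>auto simp: functor_bicat_sel\<close>)
qed

lemma modification_inverse:
  assumes m: "modification C D \<mu>" and i: "\<And>A. A \<in> Obj C \<Longrightarrow> isoc D (mcmp \<mu> A)"
  shows "modification C D \<lparr>msrc = mtgt \<mu>, mtgt = msrc \<mu>, mcmp = (\<lambda>A\<in>Obj C. inv_cell D (mcmp \<mu> A))\<rparr>"
proof -
  interpret a: pnat C D "msrc \<mu>" using modification_simps(1)[OF m] by (rule pnatI)
  interpret b: pnat C D "mtgt \<mu>" using modification_simps(2)[OF m] by (rule pnatI)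
  have s: "nsrc (mtgt \<mu>) = nsrc (msrc \<mu>)" "ntgt (mtgt \<mu>) = ntgt (msrc \<mu>)" using m by auto
  show ?thesis
  proof (rule modificationI[where F = "nsrc (msrc \<mu>)" and G = "ntgt (msrc \<mu>)"], goal_cases)
    case (11 f)
    have "nnat (msrc \<mu>) f \<cdot> inv_cell D (ar_map (ntgt (msrc \<mu>)) f \<rhd> mcmp \<mu> (src C f)) =
      inv_cell D (mcmp \<mu> (tgt C f) \<lhd> ar_map (nsrc (msrc \<mu>)) f) \<cdot> nnat (mtgt \<mu>) f"
      by (rule D.inv_natural[OF _ _ _ _ _ _ _ _ mcmp_natural'[OF m]])
        (use 11 m i s b.nnat_simps[OF 11] in auto)
    then show ?case using 11 m i by simp
  qed (use m i s in auto)
qed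

lemma inverse_cells_functor_bicat:
  assumes m: "modification C D \<mu>" and i: "\<And>A. A \<in> Obj C \<Longrightarrow> isoc D (mcmp \<mu> A)"
  shows "inverse_cells (functor_bicat C D) \<mu>
    \<lparr>msrc = mtgt \<mu>, mtgt = msrc \<mu>, mcmp = (\<lambda>A\<in>Obj C. inv_cell D (mcmp \<mu> A))\<rparr>"
  using modification_inverse[OF m i] m i
  by (auto simp: inverse_cells_def functor_bicat_sel cells_def intro!: restrict_ext)

lemma isoc_functor_bicat:
  assumes "modification C D \<mu>" "\<And>A. A \<in> Obj C \<Longrightarrow> isoc D (mcmp \<mu> A)"
  shows "isoc (functor_bicat C D) \<mu>"
  using inverse_cells_functor_bicat[OF assms] by (auto simp: isoc_iff)

end

lemma iso_cells_functor_bicat: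
  "\<mu> \<in> iso_cells (functor_bicat C D) \<alpha> \<beta> \<longleftrightarrow> isoc (functor_bicat C D) \<mu> \<and> msrc \<mu> = \<alpha> \<and> mtgt \<mu> = \<beta>"
  by (simp add: iso_cells_iff functor_bicat_sel)

text \<open>Equations between modifications are checked object by object, where they are laws of
  \<open>D\<close>. The substance lies in the closure lemmas above, by which the formulas define
  transformations and modifications at all.\<close>

lemma bicategory_functor_bicat:
  assumes "bicategory C" "bicategory D"
  shows "bicategory (functor_bicat C D)"
proof -
  interpret bicat_pair C D using assms by (rule bicat_pair.intro)
  note sel = functor_bicat_sel hom_def cells_def composable_def
  show ?thesis
  proof (unfold_locales, goal_cases)
    case 1 then show ?case by (auto simp: sel)
  next case 2 then show ?case by (auto simp: sel)
  next case 3 then show ?case by (auto simp: sel)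
  next case 4 then show ?case by (auto simp: sel pseudonatural_id)
  next case 5 then show ?case by (auto simp: sel intro: pseudonatural_comp)
  next
    case (6 f)
    then show ?case using modification_idc[of f] by (simp add: sel)
  next
    case (7 a f g b h)
    then show ?case using modification_vcomp[of a b] by (simp add: sel)
  next
    case (8 a f g b h c k)
    then show ?case by (auto simp: sel intro!: restrict_ext)
  next
    case (9 a f g)
    then show ?case by (intro modif_eqI[of _ _ "Obj C"]) (auto simp: sel)
  next
    case (10 a f g)
    then show ?case by (intro modif_eqI[of _ _ "Obj C"]) (auto simp: sel)
  next
    case (11 a f f' b g g')
    then show ?case using modification_hcomp[of a b] by (auto simp: sel)
  next
    case (12 g f)
    then show ?case by (auto simp: sel intro!: restrict_ext)
  next
    case (13 a f f' a' f'' b g g' b' g'')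
    then show ?case by (auto simp: sel D.interchange' intro!: restrict_ext simp del: D.lwhisk_vcomp D.rwhisk_vcomp)
  next
    case (14 h g f)
    then have "modification C D (asc (functor_bicat C D) h g f)"
      by (intro modification_asc) (auto simp: sel)
    then show ?case using 14
      by (auto simp: iso_cells_functor_bicat sel intro!: isoc_functor_bicat)
  next
    case (15 a f f' b g g' c h h')
    then show ?case by (auto simp: sel D.asc_natural' intro!: restrict_ext)
  next
    case (16 f A B)
    then have "modification C D (lun (functor_bicat C D) f)"
      by (intro modification_lun) (auto simp: sel)
    then show ?case using 16
      by (auto simp: iso_cells_functor_bicat sel intro!: isoc_functor_bicat)
  next
    case (17 a f f')
    then have m: "modification C D a" by (auto simp: sel)
    have "lun D (ncmp (mtgt a) A) \<cdot>\<^bsub>D\<^esub> (\<one>\<^bsub>D\<^esub> (ob_map (ntgt (msrc a)) A) \<rhd>\<^bsub>D\<^esub> mcmp a A) =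
      mcmp a A \<cdot>\<^bsub>D\<^esub> lun D (ncmp (msrc a) A)" if "A \<in> Obj C" for A
      using D.lun_natural'[of "mcmp a A" "ob_map (ntgt (msrc a)) A"] that m by simp
    then show ?case using 17 by (auto simp: sel intro!: restrict_ext)
  next
    case (18 f A B)
    then have "modification C D (run (functor_bicat C D) f)"
      by (intro modification_run) (auto simp: sel)
    then show ?case using 18
      by (auto simp: iso_cells_functor_bicat sel intro!: isoc_functor_bicat)
  next
    case (19 a f f')
    then have m: "modification C D a" by (auto simp: sel)
    have "run D (ncmp (mtgt a) A) \<cdot>\<^bsub>D\<^esub> (mcmp a A \<lhd>\<^bsub>D\<^esub> \<one>\<^bsub>D\<^esub> (ob_map (nsrc (msrc a)) A)) =
      mcmp a A \<cdot>\<^bsub>D\<^esub> run D (ncmp (msrc a) A)" if "A \<in> Obj C" for A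
      using D.run_natural'[of "mcmp a A" "ob_map (nsrc (msrc a)) A"] that m by simp
    then show ?case using 19 by (auto simp: sel intro!: restrict_ext)
  next
    case (20 k h g f)
    then show ?case by (auto simp: sel D.pentagon' intro!: restrict_ext)
  next
    case (21 g f)
    then show ?case by (auto simp: sel D.triangle' intro!: restrict_ext)
  qed
qed

section \<open>Composition and whiskering\<close>

lemmas (in pseudofunctor) pcomp_nat = pcomp_natural'[OF _ _ _ refl refl refl refl]

lemma (in bicategory) pseudofunctor_id: "pseudofunctor C C (id_psf C)"
  by (rule pseudofunctorI) (auto simp: id_psf_def composable_def bicategory_axioms)

text \<open>Lets statements about full sub-bicategories be used for a bicategory itself: the
  identity becomes an inclusion, and the unrestricted functor bicategory a sub-bicategory.\<close>

lemma full_sub_UNIV: "full_sub C UNIV = C"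
  by (simp add: full_sub_def)

lemma isoc_full_sub: "bicategory C \<Longrightarrow> isoc (full_sub C S) a \<Longrightarrow> isoc C a"
  by (simp add: isoc_def full_sub_sel bicategory.iso_cells_full_sub)

lemma pseudofunctor_full_sub_cod:
  assumes "bicategory E" "pseudofunctor C (full_sub E S) F"
  shows "pseudofunctor C E F"
proof -
  interpret E: bicategory E by fact
  interpret F: pseudofunctor C "full_sub E S" F by fact
  note sel = full_sub_sel
  have t: "ar_map F f \<in> Arr E" "src E (ar_map F f) = ob_map F (src C f)" "tgt E (ar_map F f) = ob_map F (tgt C f)"
    if "f \<in> Arr C" for f
    using F.ar_map_simps[OF that] by (auto simp: sel)
  have u: "ce_map F a \<in> Cell E" "Dom E (ce_map F a) = ar_map F (Dom C a)" "Cod E (ce_map F a) = ar_map F (Cod C a)"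
    if "a \<in> Cell C" for a
    using F.ce_map_simps[OF that] by (auto simp: sel)
  show ?thesis
  proof (rule pseudofunctorI, goal_cases)
    case 1 show ?case by unfold_locales
  next case 2 show ?case by unfold_locales
  next case 3 show ?case by (rule F.ob_map_ext)
  next case 4 show ?case by (rule F.ar_map_ext)
  next case 5 show ?case by (rule F.ce_map_ext)
  next case 6 then show ?case by (rule F.pcomp_ext)
  next case 7 show ?case by (rule F.punit_ext)
  next case (8 A) then show ?case using F.ob_map_Obj[of A] by (simp add: sel)
  next case 15 then show ?case using F.ce_map_idc by (simp add: sel)
  next case 16 then show ?case using F.ce_map_vcomp' by (simp add: sel)
  next
    case (17 g f)
    then show ?case using F.pcomp_simps[of g f] isoc_full_sub[OF assms(1) F.pcomp_simps(1)[of g f]] by (simp add: sel)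
  next
    case (18 b a)
    then show ?case using F.pcomp_nat[of b a] by (simp add: sel)
  next
    case (19 A)
    then show ?case using F.punit_simps[of A] isoc_full_sub[OF assms(1) F.punit_simps(1)[of A]] by (simp add: sel)
  next
    case (20 h g f)
    then show ?case using F.pcomp_asc'[of h g f] by (simp add: sel)
  next
    case (21 f)
    then show ?case using F.punit_left'[of f] by (simp add: sel)
  next
    case (22 f)
    then show ?case using F.punit_right'[of f] by (simp add: sel)
  qed (use t u in auto)
qed

lemma pseudofunctor_inclusion:
  assumes "bicategory C"
  shows "pseudofunctor (full_sub C S) C (inclusion C S)"
  unfolding inclusion_def
  by (rule pseudofunctor_full_sub_cod[OF assms])
    (rule bicategory.pseudofunctor_id[OF bicategory_full_sub[OF assms]])

lemma psf_comp_sel [simp]: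
  "A \<in> Obj C \<Longrightarrow> ob_map (psf_comp C E G F) A = ob_map G (ob_map F A)"
  "f \<in> Arr C \<Longrightarrow> ar_map (psf_comp C E G F) f = ar_map G (ar_map F f)"
  "a \<in> Cell C \<Longrightarrow> ce_map (psf_comp C E G F) a = ce_map G (ce_map F a)"
  "g \<in> Arr C \<Longrightarrow> f \<in> Arr C \<Longrightarrow> src C g = tgt C f \<Longrightarrow> pcomp (psf_comp C E G F) g f =
    vcomp E (ce_map G (pcomp F g f)) (pcomp G (ar_map F g) (ar_map F f))"
  "A \<in> Obj C \<Longrightarrow> punit (psf_comp C E G F) A = vcomp E (ce_map G (punit F A)) (punit G (ob_map F A))"
  by (simp_all add: psf_comp_def composable_def)

text \<open>Naturality of \<open>pcomp G\<close> at the cells \<open>pcomp F\<close> and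
  \<open>punit F\<close> separates the two layers; then the axiom of \<open>F\<close> applies under
  \<open>ce_map G\<close>, and the axiom of \<open>G\<close> at the images under
  \<open>F\<close>.\<close>

lemma pseudofunctor_comp:
  fixes E :: "('q, 'l, 'e) bicat" (structure)
  assumes F: "pseudofunctor C D F" and G: "pseudofunctor D E G"
  shows "pseudofunctor C E (psf_comp C E G F)"
proof -
  interpret F: pseudofunctor C D F by fact
  interpret G: pseudofunctor D E G by fact
  show ?thesis
  proof (rule pseudofunctorI, goal_cases)
    case 1 show ?case by unfold_locales
  next case 2 show ?case by unfold_locales
  next case 16 then show ?case by (simp add: F.ce_map_vcomp' G.ce_map_vcomp')
  next case 17 then show ?case by simp
  next
    case (18 b a)
    let ?b = "ce_map F b" and ?a = "ce_map F a"
    let ?p' = "pcomp F (Cod C b) (Cod C a)" and ?p = "pcomp F (Dom C b) (Dom C a)"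
    have "ce_map G ?p' \<cdot> (pcomp G (ar_map F (Cod C b)) (ar_map F (Cod C a)) \<cdot> (ce_map G ?b \<star> ce_map G ?a)) =
      ce_map G ?p' \<cdot> (ce_map G (?b \<star>\<^bsub>D\<^esub> ?a) \<cdot> pcomp G (ar_map F (Dom C b)) (ar_map F (Dom C a)))"
      using 18 by (subst G.pcomp_natural'[of ?b ?a]) auto
    also have "\<dots> = ce_map G (?p' \<cdot>\<^bsub>D\<^esub> (?b \<star>\<^bsub>D\<^esub> ?a)) \<cdot> pcomp G (ar_map F (Dom C b)) (ar_map F (Dom C a))"
      using 18 by (simp add: G.ce_map_vcomp')
    also have "?p' \<cdot>\<^bsub>D\<^esub> (?b \<star>\<^bsub>D\<^esub> ?a) = ce_map F (b \<star>\<^bsub>C\<^esub> a) \<cdot>\<^bsub>D\<^esub> ?p"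
      using 18 by (simp add: F.pcomp_natural')
    finally show ?case using 18 by (simp add: G.ce_map_vcomp')
  next
    case (20 h g f)
    let ?h = "ar_map F h" and ?g = "ar_map F g" and ?f = "ar_map F f"
    let ?hg = "h \<odot>\<^bsub>C\<^esub> g" and ?gf = "g \<odot>\<^bsub>C\<^esub> f"
    let ?\<beta> = "(?h \<rhd>\<^bsub>D\<^esub> pcomp F g f)"
    note [simp] = G.ce_map_vcomp'
    have n1: "pcomp G (ar_map F ?hg) ?f \<cdot> (ce_map G (pcomp F h g) \<lhd> ar_map G ?f) =
      ce_map G (pcomp F h g \<lhd>\<^bsub>D\<^esub> ?f) \<cdot> pcomp G (?h \<odot>\<^bsub>D\<^esub> ?g) ?f"
      using 20 G.pcomp_nat[of "pcomp F h g" "idc D ?f"] by simp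
    have n2: "pcomp G ?h (ar_map F ?gf) \<cdot> (ar_map G ?h \<rhd> ce_map G (pcomp F g f)) =
      ce_map G ?\<beta> \<cdot> pcomp G ?h (?g \<odot>\<^bsub>D\<^esub> ?f)"
      using 20 G.pcomp_nat[of "idc D ?h" "pcomp F g f"] by simp
    let ?r = "pcomp G (?h \<odot>\<^bsub>D\<^esub> ?g) ?f \<cdot> (pcomp G ?h ?g \<lhd> ar_map G ?f)"
    have "ce_map G (ce_map F (asc C h g f)) \<cdot> (ce_map G (pcomp F ?hg f) \<cdot> (pcomp G (ar_map F ?hg) ?f \<cdot>
        ((ce_map G (pcomp F h g) \<lhd> ar_map G ?f) \<cdot> (pcomp G ?h ?g \<lhd> ar_map G ?f)))) =
      ce_map G (ce_map F (asc C h g f) \<cdot>\<^bsub>D\<^esub> (pcomp F ?hg f \<cdot>\<^bsub>D\<^esub> (pcomp F h g \<lhd>\<^bsub>D\<^esub> ?f))) \<cdot> ?r"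
      using 20 by (simp add: G.D.vcomp_eq[OF n1])
    also have "\<dots> = ce_map G (pcomp F h ?gf) \<cdot> (ce_map G ?\<beta> \<cdot> (ce_map G (asc D ?h ?g ?f) \<cdot> ?r))"
      using 20 by (subst F.pcomp_asc') auto
    also have "ce_map G (asc D ?h ?g ?f) \<cdot> ?r =
      pcomp G ?h (?g \<odot>\<^bsub>D\<^esub> ?f) \<cdot> ((ar_map G ?h \<rhd> pcomp G ?g ?f) \<cdot> asc E (ar_map G ?h) (ar_map G ?g) (ar_map G ?f))"
      using 20 G.pcomp_asc'[of ?h ?g ?f] by simp
    finally show ?case using 20 by (simp add: G.D.vcomp_eq[OF n2])
  next
    case (21 f)
    let ?f = "ar_map F f" and ?B = "tgt C f"
    note [simp] = G.ce_map_vcomp'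
    have n: "pcomp G (ar_map F (\<one>\<^bsub>C\<^esub> ?B)) ?f \<cdot> (ce_map G (punit F ?B) \<lhd> ar_map G ?f) =
      ce_map G (punit F ?B \<lhd>\<^bsub>D\<^esub> ?f) \<cdot> pcomp G (\<one>\<^bsub>D\<^esub> (ob_map F ?B)) ?f"
      using 21 G.pcomp_nat[of "punit F ?B" "idc D ?f"] by simp
    let ?r = "pcomp G (\<one>\<^bsub>D\<^esub> (ob_map F ?B)) ?f \<cdot> (punit G (ob_map F ?B) \<lhd> ar_map G ?f)"
    have "ce_map G (ce_map F (lun C f)) \<cdot> (ce_map G (pcomp F (\<one>\<^bsub>C\<^esub> ?B) f) \<cdot> (pcomp G (ar_map F (\<one>\<^bsub>C\<^esub> ?B)) ?f \<cdot>
      ((ce_map G (punit F ?B) \<lhd> ar_map G ?f) \<cdot> (punit G (ob_map F ?B) \<lhd> ar_map G ?f)))) =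
      ce_map G (ce_map F (lun C f) \<cdot>\<^bsub>D\<^esub> (pcomp F (\<one>\<^bsub>C\<^esub> ?B) f \<cdot>\<^bsub>D\<^esub> (punit F ?B \<lhd>\<^bsub>D\<^esub> ?f))) \<cdot> ?r"
      using 21 by (simp add: G.D.vcomp_eq[OF n])
    also have "\<dots> = lun E (ar_map G ?f)"
      using 21 G.punit_left'[of ?f] by (subst F.punit_left') auto
    finally show ?case using 21 by simp
  next
    case (22 f)
    let ?f = "ar_map F f" and ?A = "src C f"
    note [simp] = G.ce_map_vcomp'
    have n: "pcomp G ?f (ar_map F (\<one>\<^bsub>C\<^esub> ?A)) \<cdot> (ar_map G ?f \<rhd> ce_map G (punit F ?A)) =
      ce_map G (?f \<rhd>\<^bsub>D\<^esub> punit F ?A) \<cdot> pcomp G ?f (\<one>\<^bsub>D\<^esub> (ob_map F ?A))"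
      using 22 G.pcomp_nat[of "idc D ?f" "punit F ?A"] by simp
    let ?r = "pcomp G ?f (\<one>\<^bsub>D\<^esub> (ob_map F ?A)) \<cdot> (ar_map G ?f \<rhd> punit G (ob_map F ?A))"
    have "ce_map G (ce_map F (run C f)) \<cdot> (ce_map G (pcomp F f (\<one>\<^bsub>C\<^esub> ?A)) \<cdot> (pcomp G ?f (ar_map F (\<one>\<^bsub>C\<^esub> ?A)) \<cdot>
      ((ar_map G ?f \<rhd> ce_map G (punit F ?A)) \<cdot> (ar_map G ?f \<rhd> punit G (ob_map F ?A))))) =
      ce_map G (ce_map F (run C f) \<cdot>\<^bsub>D\<^esub> (pcomp F f (\<one>\<^bsub>C\<^esub> ?A) \<cdot>\<^bsub>D\<^esub> (?f \<rhd>\<^bsub>D\<^esub> punit F ?A))) \<cdot> ?r"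
      using 22 by (simp add: G.D.vcomp_eq[OF n])
    also have "\<dots> = run E (ar_map G ?f)"
      using 22 G.punit_right'[of ?f] by (subst F.punit_right') auto
    finally show ?case using 22 by simp
  qed (auto simp: psf_comp_def)
qed

text \<open>The action of a composite is the action of \<open>G\<close> at images under
  \<open>F\<close>, corrected by the image of a coherence cell of \<open>F\<close>. Whiskering
  proofs thus meet the coherence of \<open>F\<close> as one more 2-cell at which everything is
  natural.\<close>

lemma psf_comp_pact:
  assumes F: "pseudofunctor C D F" and G: "pseudofunctor D E G"
    and X: "X \<in> Arr E"
  shows "g \<in> Arr C \<Longrightarrow> f \<in> Arr C \<Longrightarrow> src C g = tgt C f \<Longrightarrow> tgt E X = ob_map G (ob_map F (src C f)) \<Longrightarrow>
      pseudofunctor.pact E (psf_comp C E G F) g f X =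
      vcomp E (hcomp E (ce_map G (pcomp F g f)) (idc E X)) (pseudofunctor.pact E G (ar_map F g) (ar_map F f) X)"
    and "A \<in> Obj C \<Longrightarrow> tgt E X = ob_map G (ob_map F A) \<Longrightarrow> pseudofunctor.uact E (psf_comp C E G F) A X =
      vcomp E (hcomp E (ce_map G (punit F A)) (idc E X)) (pseudofunctor.uact E G (ob_map F A) X)"
proof -
  interpret F: pseudofunctor C D F by fact
  interpret G: pseudofunctor D E G by fact
  interpret GF: pseudofunctor C E "psf_comp C E G F" using F G by (rule pseudofunctor_comp)
  show "g \<in> Arr C \<Longrightarrow> f \<in> Arr C \<Longrightarrow> src C g = tgt C f \<Longrightarrow> tgt E X = ob_map G (ob_map F (src C f)) \<Longrightarrow>
      pseudofunctor.pact E (psf_comp C E G F) g f X =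
      vcomp E (hcomp E (ce_map G (pcomp F g f)) (idc E X)) (pseudofunctor.pact E G (ar_map F g) (ar_map F f) X)"
    using X by (simp add: GF.pact_def G.pact_def)
  show "A \<in> Obj C \<Longrightarrow> tgt E X = ob_map G (ob_map F A) \<Longrightarrow> pseudofunctor.uact E (psf_comp C E G F) A X =
      vcomp E (hcomp E (ce_map G (punit F A)) (idc E X)) (pseudofunctor.uact E G (ob_map F A) X)"
    using X by (simp add: GF.uact_def G.uact_def)
qed

lemma pnt_whisker_sel [simp]:
  "nsrc (pnt_whisker C E \<alpha> K) = psf_comp C E (nsrc \<alpha>) K" "ntgt (pnt_whisker C E \<alpha> K) = psf_comp C E (ntgt \<alpha>) K"
  "A \<in> Obj C \<Longrightarrow> ncmp (pnt_whisker C E \<alpha> K) A = ncmp \<alpha> (ob_map K A)"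
  "f \<in> Arr C \<Longrightarrow> nnat (pnt_whisker C E \<alpha> K) f = nnat \<alpha> (ar_map K f)"
  by (simp_all add: pnt_whisker_def)

text \<open>The axioms for composites and identities are those of \<alpha> at the images under
  \<open>K\<close>, combined with naturality of \<alpha> at the cells \<open>pcomp K g f\<close> and
  \<open>punit K A\<close>.\<close>

lemma pseudonatural_whisker:
  fixes E :: "('q, 'l, 'e) bicat" (structure)
  assumes a: "pseudonatural B E \<alpha>" and K: "pseudofunctor C B K"
  shows "pseudonatural C E (pnt_whisker C E \<alpha> K)"
proof -
  interpret K: pseudofunctor C B K by fact
  interpret a0: pseudonatural B E \<alpha> by fact
  interpret BE: bicat_pair B E by unfold_locales
  interpret CE: bicat_pair C E by unfold_locales
  interpret a: pnat B E \<alpha> using a by (rule BE.pnatI)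
  let ?c = "\<lambda>A. At (ncmp \<alpha> (ob_map K A))"
  have n: "CE.nst ?c (pnt_whisker C E \<alpha> K) f X = BE.N \<alpha> (ar_map K f) X" if "f \<in> Arr C" for f X
    using that by (simp add: CE.nst_def a.N_eq)
  note pa = psf_comp_pact[OF K a.F.pseudofunctor_axioms] psf_comp_pact[OF K a.G.pseudofunctor_axioms]
  show ?thesis
  proof (rule CE.pseudonaturalI[where c = ?c], goal_cases)
    case 1 show ?case using pseudofunctor_comp[OF K a.F.pseudofunctor_axioms] by simp
  next
    case 2 show ?case using pseudofunctor_comp[OF K a.G.pseudofunctor_axioms] by simp
  next
    case (12 m X)
    then show ?case using a.N_natural[OF K.ce_map_simps(1)[of m] refl refl refl refl, of X] by (simp add: n)
  next
    case (13 g f X)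
    then have X: "g \<in> Arr C" "f \<in> Arr C" "src C g = tgt C f" "X \<in> Arr E"
      "tgt E X = ob_map (nsrc \<alpha>) (ob_map K (src C f))" by auto
    let ?A = "ob_map K (src C f)" and ?D = "ob_map K (tgt C g)" and ?g = "ar_map K g" and ?f = "ar_map K f"
    let ?p = "pcomp K g f"
    have e: "BE.N \<alpha> (ar_map K (ocomp C g f)) X \<cdot> (ce_map (ntgt \<alpha>) ?p \<lhd> (ncmp \<alpha> ?A \<odot> X)) =
      (ncmp \<alpha> ?D \<rhd> (ce_map (nsrc \<alpha>) ?p \<lhd> X)) \<cdot> BE.N \<alpha> (ocomp B ?g ?f) X"
      by (rule a.N_natural) (use X in auto)
    have "BE.N \<alpha> (ar_map K (ocomp C g f)) X \<cdot> ((ce_map (ntgt \<alpha>) ?p \<lhd> (ncmp \<alpha> ?A \<odot> X)) \<cdot>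
        BE.pact (ntgt \<alpha>) ?g ?f (ncmp \<alpha> ?A \<odot> X)) =
      (ncmp \<alpha> ?D \<rhd> (ce_map (nsrc \<alpha>) ?p \<lhd> X)) \<cdot> (BE.N \<alpha> (ocomp B ?g ?f) X \<cdot>
        BE.pact (ntgt \<alpha>) ?g ?f (ncmp \<alpha> ?A \<odot> X))"
      by (rule a0.D.vcomp_eq[OF e]) (use X in auto)
    also have "BE.N \<alpha> (ocomp B ?g ?f) X \<cdot> BE.pact (ntgt \<alpha>) ?g ?f (ncmp \<alpha> ?A \<odot> X) =
      (ncmp \<alpha> ?D \<rhd> BE.pact (nsrc \<alpha>) ?g ?f X) \<cdot>
      (BE.N \<alpha> ?g (ar_map (nsrc \<alpha>) ?f \<odot> X) \<cdot> (ar_map (ntgt \<alpha>) ?g \<rhd> BE.N \<alpha> ?f X))"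
      by (rule a.N_ocomp) (use X in auto)
    finally show ?case using X by (simp add: n pa)
  next
    case (14 A X)
    then have X: "A \<in> Obj C" "X \<in> Arr E" "tgt E X = ob_map (nsrc \<alpha>) (ob_map K A)" by auto
    let ?A = "ob_map K A" and ?u = "punit K A"
    have e: "BE.N \<alpha> (ar_map K (one C A)) X \<cdot> (ce_map (ntgt \<alpha>) ?u \<lhd> (ncmp \<alpha> ?A \<odot> X)) =
      (ncmp \<alpha> ?A \<rhd> (ce_map (nsrc \<alpha>) ?u \<lhd> X)) \<cdot> BE.N \<alpha> (one B ?A) X"
      by (rule a.N_natural) (use X in auto)
    have "BE.N \<alpha> (ar_map K (one C A)) X \<cdot> ((ce_map (ntgt \<alpha>) ?u \<lhd> (ncmp \<alpha> ?A \<odot> X)) \<cdot>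
        BE.uact (ntgt \<alpha>) ?A (ncmp \<alpha> ?A \<odot> X)) =
      (ncmp \<alpha> ?A \<rhd> (ce_map (nsrc \<alpha>) ?u \<lhd> X)) \<cdot> (BE.N \<alpha> (one B ?A) X \<cdot>
        BE.uact (ntgt \<alpha>) ?A (ncmp \<alpha> ?A \<odot> X))"
      by (rule a0.D.vcomp_eq[OF e]) (use X in auto)
    also have "BE.N \<alpha> (one B ?A) X \<cdot> BE.uact (ntgt \<alpha>) ?A (ncmp \<alpha> ?A \<odot> X) =
      ncmp \<alpha> ?A \<rhd> BE.uact (nsrc \<alpha>) ?A X"
      by (rule a.N_one) (use X in auto)
    finally show ?case using X by (simp add: n pa)
  qed (auto simp: pnt_whisker_def)
qed

lemma modification_whisker:
  assumes m: "modification B E \<mu>" and K: "pseudofunctor C B K"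
  shows "modification C E (modif_whisker C E \<mu> K)"
proof -
  interpret K: pseudofunctor C B K by fact
  interpret m0: modification B E \<mu> by fact
  interpret BE: bicat_pair B E by unfold_locales
  interpret CE: bicat_pair C E by unfold_locales
  have p: "pseudonatural C E (pnt_whisker C E (msrc \<mu>) K)" "pseudonatural C E (pnt_whisker C E (mtgt \<mu>) K)"
    using BE.modification_simps(1,2)[OF m] by (auto intro: pseudonatural_whisker[OF _ K])
  show ?thesis
  proof (rule CE.modificationI[where F = "psf_comp C E (nsrc (msrc \<mu>)) K" and G = "psf_comp C E (ntgt (msrc \<mu>)) K"],
      goal_cases)
    case (11 f)
    then show ?case using BE.mcmp_natural'[OF m, of "ar_map K f"] by (simp add: modif_whisker_def)
  qed (use m p in \<open>auto simp: modif_whisker_def\<close>)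
qed

section \<open>Precomposition as a pseudofunctor between functor bicategories\<close>

lemma pnt_eqI:
  fixes \<alpha> \<beta> :: "('o, 'm, 'c, 'p, 'n, 'd) pnt"
  assumes "nsrc \<alpha> = nsrc \<beta>" "ntgt \<alpha> = ntgt \<beta>" "ncmp \<alpha> = ncmp \<beta>" "nnat \<alpha> = nnat \<beta>"
  shows "\<alpha> = \<beta>"
  using assms by simp

lemma modif_whisker_sel [simp]:
  "msrc (modif_whisker C E \<mu> K) = pnt_whisker C E (msrc \<mu>) K"
  "mtgt (modif_whisker C E \<mu> K) = pnt_whisker C E (mtgt \<mu>) K"
  "A \<in> Obj C \<Longrightarrow> mcmp (modif_whisker C E \<mu> K) A = mcmp \<mu> (ob_map K A)"
  by (simp_all add: modif_whisker_def)

text \<open>Restriction along \<open>K\<close> commutes on the nose with every operation, because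
  the operations are defined object by object and arrow by arrow. With these equations as
  simplification rules, each axiom becomes a law about identity cells.\<close>

lemma pseudofunctor_precomp:
  assumes K: "pseudofunctor C B K" and E: "bicategory E"
  shows "pseudofunctor (functor_bicat B E) (functor_bicat C E) (precomp C B E K)"
proof -
  interpret K: pseudofunctor C B K by fact
  interpret E: bicategory E by fact
  interpret BE: bicat_pair B E by unfold_locales
  interpret CE: bicat_pair C E by unfold_locales
  let ?B = "functor_bicat B E" and ?C = "functor_bicat C E" and ?P = "precomp C B E K"
  let ?w = "\<lambda>\<alpha>. pnt_whisker C E \<alpha> K" and ?W = "\<lambda>\<mu>. modif_whisker C E \<mu> K"
  interpret FB: bicategory ?B by (rule bicategory_functor_bicat) unfold_locales
  interpret FC: bicategory ?C by (rule bicategory_functor_bicat) unfold_locales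
  have w: "?w \<alpha> \<in> Arr ?C" "src ?C (?w \<alpha>) = psf_comp C E (src ?B \<alpha>) K" "tgt ?C (?w \<alpha>) = psf_comp C E (tgt ?B \<alpha>) K"
    if "\<alpha> \<in> Arr ?B" for \<alpha>
    using that pseudonatural_whisker[OF _ K] by (auto simp: functor_bicat_sel)
  have o: "psf_comp C E F K \<in> Obj ?C" if "F \<in> Obj ?B" for F
    using that pseudofunctor_comp[OF K] by (auto simp: functor_bicat_sel)
  have W: "?W \<mu> \<in> Cell ?C" "Dom ?C (?W \<mu>) = ?w (Dom ?B \<mu>)" "Cod ?C (?W \<mu>) = ?w (Cod ?B \<mu>)"
    if "\<mu> \<in> Cell ?B" for \<mu>
    using that modification_whisker[OF _ K] by (auto simp: functor_bicat_sel)
  have w_comp: "?w (ocomp ?B \<beta> \<alpha>) = ocomp ?C (?w \<beta>) (?w \<alpha>)" for \<beta> \<alpha>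
    by (rule pnt_eqI) (auto simp: functor_bicat_sel pnt_whisker_def pnt_comp_def Let_def fun_eq_iff)
  have w_one: "?w (one ?B F) = one ?C (psf_comp C E F K)" for F
    by (rule pnt_eqI) (auto simp: functor_bicat_sel pnt_whisker_def id_pnt_def fun_eq_iff)
  have W_idc: "?W (idc ?B \<alpha>) = idc ?C (?w \<alpha>)" for \<alpha>
    by (auto simp: functor_bicat_sel modif_whisker_def fun_eq_iff)
  have W_vcomp: "?W (vcomp ?B \<nu> \<mu>) = vcomp ?C (?W \<nu>) (?W \<mu>)" for \<nu> \<mu>
    by (auto simp: functor_bicat_sel modif_whisker_def fun_eq_iff)
  have W_hcomp: "?W (hcomp ?B \<nu> \<mu>) = hcomp ?C (?W \<nu>) (?W \<mu>)" for \<nu> \<mu>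
    using w_comp by (auto simp: functor_bicat_sel modif_whisker_def fun_eq_iff)
  have W_asc: "?W (asc ?B \<gamma> \<beta> \<alpha>) = asc ?C (?w \<gamma>) (?w \<beta>) (?w \<alpha>)" for \<gamma> \<beta> \<alpha>
    using w_comp by (auto simp: functor_bicat_sel modif_whisker_def fun_eq_iff)
  have W_lun: "?W (lun ?B \<alpha>) = lun ?C (?w \<alpha>)" for \<alpha>
    using w_comp w_one by (auto simp: functor_bicat_sel modif_whisker_def fun_eq_iff)
  have W_run: "?W (run ?B \<alpha>) = run ?C (?w \<alpha>)" for \<alpha>
    using w_comp w_one by (auto simp: functor_bicat_sel modif_whisker_def fun_eq_iff)
  have P: "\<And>F. F \<in> Obj ?B \<Longrightarrow> ob_map ?P F = psf_comp C E F K"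
    "\<And>\<alpha>. \<alpha> \<in> Arr ?B \<Longrightarrow> ar_map ?P \<alpha> = ?w \<alpha>"
    "\<And>\<mu>. \<mu> \<in> Cell ?B \<Longrightarrow> ce_map ?P \<mu> = ?W \<mu>"
    "\<And>\<beta> \<alpha>. \<beta> \<in> Arr ?B \<Longrightarrow> \<alpha> \<in> Arr ?B \<Longrightarrow> src ?B \<beta> = tgt ?B \<alpha> \<Longrightarrow>
      pcomp ?P \<beta> \<alpha> = idc ?C (ocomp ?C (?w \<beta>) (?w \<alpha>))"
    "\<And>F. F \<in> Obj ?B \<Longrightarrow> punit ?P F = idc ?C (one ?C (psf_comp C E F K))"
  proof -
    show "pcomp ?P \<beta> \<alpha> = idc ?C (ocomp ?C (?w \<beta>) (?w \<alpha>))"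
      if "\<beta> \<in> Arr ?B" "\<alpha> \<in> Arr ?B" "src ?B \<beta> = tgt ?B \<alpha>" for \<beta> \<alpha>
    proof -
      have "pcomp ?P \<beta> \<alpha> = idc ?C (?w (ocomp ?B \<beta> \<alpha>))"
        using that by (simp add: precomp_def composable_def) (simp add: functor_bicat_sel)
      then show ?thesis by (simp only: w_comp)
    qed
    show "punit ?P F = idc ?C (one ?C (psf_comp C E F K))" if "F \<in> Obj ?B" for F
      using that by (simp add: precomp_def) (simp add: functor_bicat_sel)
  qed (simp_all add: precomp_def)
  note [simp] = w o W w_comp w_one W_idc W_vcomp W_hcomp W_asc W_lun W_run P
  show ?thesis
  proof (rule pseudofunctorI, goal_cases)
    case 1 show ?case by unfold_locales
  next case 2 show ?case by unfold_locales
  next case 3 show ?case by (simp add: precomp_def)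
  next case 4 show ?case by (simp add: precomp_def)
  next case 5 show ?case by (simp add: precomp_def)
  next case 6 then show ?case by (simp add: precomp_def)
  next case 7 show ?case by (simp add: precomp_def)
  qed simp_all
qed

subsection \<open>Whiskering a transformation by a pseudofunctor on its target\<close>

definition psf_whisker ::
  "('o, 'm, 'c) bicat \<Rightarrow> ('q, 'l, 'e) bicat \<Rightarrow> ('p, 'n, 'd, 'q, 'l, 'e) psf \<Rightarrow>
   ('o, 'm, 'c, 'p, 'n, 'd) pnt \<Rightarrow> ('o, 'm, 'c, 'q, 'l, 'e) pnt" where
  "psf_whisker C E F \<sigma> = \<lparr>
     nsrc = psf_comp C E F (nsrc \<sigma>), ntgt = psf_comp C E F (ntgt \<sigma>),
     ncmp = (\<lambda>A\<in>Obj C. ar_map F (ncmp \<sigma> A)),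
     nnat = (\<lambda>f\<in>Arr C.
       vcomp E (inv_cell E (pcomp F (ncmp \<sigma> (tgt C f)) (ar_map (nsrc \<sigma>) f)))
         (vcomp E (ce_map F (nnat \<sigma> f)) (pcomp F (ar_map (ntgt \<sigma>) f) (ncmp \<sigma> (src C f)))))\<rparr>"

lemma psf_whisker_sel [simp]:
  "nsrc (psf_whisker C E F \<sigma>) = psf_comp C E F (nsrc \<sigma>)" "ntgt (psf_whisker C E F \<sigma>) = psf_comp C E F (ntgt \<sigma>)"
  "A \<in> Obj C \<Longrightarrow> ncmp (psf_whisker C E F \<sigma>) A = ar_map F (ncmp \<sigma> A)"
  "f \<in> Arr C \<Longrightarrow> nnat (psf_whisker C E F \<sigma>) f =
    vcomp E (inv_cell E (pcomp F (ncmp \<sigma> (tgt C f)) (ar_map (nsrc \<sigma>) f)))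
         (vcomp E (ce_map F (nnat \<sigma> f)) (pcomp F (ar_map (ntgt \<sigma>) f) (ncmp \<sigma> (src C f))))"
  by (simp_all add: psf_whisker_def)

text \<open>The right-hand side is the strict form of \<open>nnat \<sigma> f\<close> for the action
  along \<open>F\<close>, since on a tree with two atoms \<open>K\<close> of that action is
  \<open>pact\<close>. Whiskering by \<open>F\<close> is thus strictification with respect to
  another action.\<close>

lemma nst_psf_whisker:
  fixes E :: "('q, 'l, 'e) bicat" (structure)
  assumes s: "pseudonatural C B \<sigma>" and F: "pseudofunctor B E F" and f: "f \<in> Arr C"
    and X: "X \<in> Arr E" "tgt E X = ob_map F (ob_map (nsrc \<sigma>) (src C f))"
  shows "bicat_pair.nst C E (\<lambda>A. At (ar_map F (ncmp \<sigma> A))) (psf_whisker C E F \<sigma>) f X =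
    inv_cell E (pseudofunctor.pact E F (ncmp \<sigma> (tgt C f)) (ar_map (nsrc \<sigma>) f) X) \<cdot>
      ((ce_map F (nnat \<sigma> f) \<lhd> X) \<cdot> pseudofunctor.pact E F (ar_map (ntgt \<sigma>) f) (ncmp \<sigma> (src C f)) X)"
proof -
  interpret F: pseudofunctor B E F by fact
  interpret s0: pseudonatural C B \<sigma> by fact
  interpret CB: bicat_pair C B by unfold_locales
  interpret CE: bicat_pair C E by unfold_locales
  interpret s: pnat C B \<sigma> using s by (rule CB.pnatI)
  let ?A = "src C f" and ?D = "tgt C f" and ?H = "ar_map (nsrc \<sigma>) f" and ?K = "ar_map (ntgt \<sigma>) f"
  let ?s = "Cm (At (ar_map F ?K)) (At (ar_map F (ncmp \<sigma> ?A)))" and ?t = "Cm (At (ar_map F (ncmp \<sigma> ?D))) (At (ar_map F ?H))"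
  let ?x = "pcomp F ?K (ncmp \<sigma> ?A)" and ?y = "pcomp F (ncmp \<sigma> ?D) ?H" and ?n = "ce_map F (nnat \<sigma> f)"
  have "CE.nst (\<lambda>A. At (ar_map F (ncmp \<sigma> A))) (psf_whisker C E F \<sigma>) f X =
    F.D.self.st ?s ?t (inv_cell E ?y \<cdot> (?n \<cdot> ?x)) X"
    using f by (simp add: CE.nst_def)
  also have "\<dots> = F.D.self.st (At (ar_map F (ocomp B (ncmp \<sigma> ?D) ?H))) ?t (inv_cell E ?y) X \<cdot>
    F.D.self.st ?s (At (ar_map F (ocomp B (ncmp \<sigma> ?D) ?H))) (?n \<cdot> ?x) X"
    using f X by (intro F.D.self.st_vcomp) auto
  also have "F.D.self.st ?s (At (ar_map F (ocomp B (ncmp \<sigma> ?D) ?H))) (?n \<cdot> ?x) X =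
    F.D.self.st (At (ar_map F (ocomp B ?K (ncmp \<sigma> ?A)))) (At (ar_map F (ocomp B (ncmp \<sigma> ?D) ?H))) ?n X \<cdot>
    F.D.self.st ?s (At (ar_map F (ocomp B ?K (ncmp \<sigma> ?A)))) ?x X"
    using f X by (intro F.D.self.st_vcomp) auto
  finally show ?thesis using f X by (simp add: F.st_pcomp)
qed

text \<open>The axioms of \<sigma> are equations of \<open>B\<close>. Strict forms of both sides for
  the action along \<open>F\<close> are the strict axioms of the whiskered transformation; the
  coherence of \<open>F\<close> is already contained in the laws of the action.\<close>

lemma pseudonatural_psf_whisker:
  fixes E :: "('q, 'l, 'e) bicat" (structure)
  assumes s: "pseudonatural C B \<sigma>" and F: "pseudofunctor B E F"
  shows "pseudonatural C E (psf_whisker C E F \<sigma>)"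
proof -
  interpret F: pseudofunctor B E F by fact
  interpret s0: pseudonatural C B \<sigma> by fact
  interpret CB: bicat_pair C B by unfold_locales
  interpret CE: bicat_pair C E by unfold_locales
  interpret s: pnat C B \<sigma> using s by (rule CB.pnatI)
  let ?c = "\<lambda>A. At (ar_map F (ncmp \<sigma> A))" and ?d = "\<lambda>A. At (ncmp \<sigma> A)"
  let ?H = "nsrc \<sigma>" and ?K = "ntgt \<sigma>"
  have n: "CE.nst ?c (psf_whisker C E F \<sigma>) f X = F.act.st (Cm (At (ar_map ?K f)) (?d (src C f)))
      (Cm (?d (tgt C f)) (At (ar_map ?H f))) (nnat \<sigma> f) X"
    if "f \<in> Arr C" "X \<in> Arr E" "tgt E X = ob_map F (ob_map ?H (src C f))" for f X
    using that by (simp add: nst_psf_whisker[OF s F] F.act.st_def)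
  note pa = psf_comp_pact[OF s.F.pseudofunctor_axioms F] psf_comp_pact[OF s.G.pseudofunctor_axioms F]
  show ?thesis
  proof (rule CE.pseudonaturalI[where c = ?c], goal_cases)
    case 1 show ?case using pseudofunctor_comp[OF s.F.pseudofunctor_axioms F] by simp
  next
    case 2 show ?case using pseudofunctor_comp[OF s.G.pseudofunctor_axioms F] by simp
  next
    case (12 m X)
    let ?A = "src C (Dom C m)" and ?D = "tgt C (Dom C m)"
    have X: "m \<in> Cell C" "X \<in> Arr E" "tgt E X = ob_map F (ob_map ?H ?A)" using 12 by auto
    have e: "vcomp B (nnat \<sigma> (Cod C m)) (hcomp B (ce_map ?K m) (idc B (ev B (?d ?A)))) =
      vcomp B (hcomp B (idc B (ev B (?d ?D))) (ce_map ?H m)) (nnat \<sigma> (Dom C m))"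
      using s.nnat_natural'[OF X(1) refl refl refl refl] by simp
    have "F.act.st (Cm (At (ar_map ?K (Cod C m))) (?d ?A)) (Cm (?d ?D) (At (ar_map ?H (Cod C m)))) (nnat \<sigma> (Cod C m)) X \<cdot>
        (ce_map F (ce_map ?K m) \<lhd> F.act.ap (?d ?A) X) =
      F.act.apc (?d ?D) (ce_map F (ce_map ?H m) \<lhd> X) \<cdot>
      F.act.st (Cm (At (ar_map ?K (Dom C m))) (?d ?A)) (Cm (?d ?D) (At (ar_map ?H (Dom C m)))) (nnat \<sigma> (Dom C m)) X"
      \<comment> \<open>The outer equations are the two evaluations in
        \<open>st_natural_sides\<close>; the one between them is the axiom \<open>e\<close> under
        \<open>F.act.st\<close> and is left to simplification. The two remaining axioms are treated
        in the same form.\<close>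
      by (rule trans[OF F.act.st_natural_sides(1)[where cA = "?d ?A" and cB = "?d ?D" and a = "ce_map ?H m" and b = "ce_map ?K m" and n = "nnat \<sigma> (Dom C m)"
            and n' = "nnat \<sigma> (Cod C m)" and f = "ar_map ?H (Dom C m)" and f' = "ar_map ?H (Cod C m)"
            and g = "ar_map ?K (Dom C m)" and g' = "ar_map ?K (Cod C m)" and X = X, symmetric]
          trans[OF _ F.act.st_natural_sides(2)[where cA = "?d ?A" and cB = "?d ?D" and a = "ce_map ?H m" and b = "ce_map ?K m" and n = "nnat \<sigma> (Dom C m)"
            and n' = "nnat \<sigma> (Cod C m)" and f = "ar_map ?H (Dom C m)" and f' = "ar_map ?H (Cod C m)"
            and g = "ar_map ?K (Dom C m)" and g' = "ar_map ?K (Cod C m)" and X = X]]])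
        (use X e in auto)
    then show ?case using X by (simp add: n)
  next
    case (13 g f X)
    then have X: "g \<in> Arr C" "f \<in> Arr C" "src C g = tgt C f" "X \<in> Arr E" "tgt E X = ob_map F (ob_map ?H (src C f))"
      by auto
    let ?A = "src C f" and ?B = "tgt C f" and ?D = "tgt C g"
    have "f \<in> hom C ?A ?B" "g \<in> hom C ?B ?D" using X by (auto simp: hom_def)
    note e = s0.nnat_ocomp[OF this]
    have "F.act.st (Cm (At (ar_map ?K (ocomp C g f))) (?d ?A)) (Cm (?d ?D) (At (ar_map ?H (ocomp C g f)))) (nnat \<sigma> (ocomp C g f)) X \<cdot>
        F.act.st (Cm (At (ar_map ?K g)) (At (ar_map ?K f))) (At (ar_map ?K (ocomp C g f))) (pcomp ?K g f) (F.act.ap (?d ?A) X) =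
      F.act.apc (?d ?D) (F.act.st (Cm (At (ar_map ?H g)) (At (ar_map ?H f))) (At (ar_map ?H (ocomp C g f))) (pcomp ?H g f) X) \<cdot>
      (F.act.st (Cm (At (ar_map ?K g)) (?d ?B)) (Cm (?d ?D) (At (ar_map ?H g))) (nnat \<sigma> g) (ar_map F (ar_map ?H f) \<odot> X) \<cdot>
        (ar_map F (ar_map ?K g) \<rhd> F.act.st (Cm (At (ar_map ?K f)) (?d ?A)) (Cm (?d ?B) (At (ar_map ?H f))) (nnat \<sigma> f) X))"
      by (rule trans[OF F.act.st_ocomp_sides(1)[where cA = "?d ?A" and cB = "?d ?B" and cE = "?d ?D" and ?f1.0 = "ar_map ?H f" and ?f2.0 = "ar_map ?H g"
            and ?f21.0 = "ar_map ?H (ocomp C g f)" and ?g1.0 = "ar_map ?K f" and ?g2.0 = "ar_map ?K g"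
            and ?g21.0 = "ar_map ?K (ocomp C g f)" and pF = "pcomp ?H g f" and pG = "pcomp ?K g f"
            and ?n1.0 = "nnat \<sigma> f" and ?n2.0 = "nnat \<sigma> g" and ?n21.0 = "nnat \<sigma> (ocomp C g f)" and X = X, symmetric]
          trans[OF _ F.act.st_ocomp_sides(2)[where cA = "?d ?A" and cB = "?d ?B" and cE = "?d ?D" and ?f1.0 = "ar_map ?H f" and ?f2.0 = "ar_map ?H g"
            and ?f21.0 = "ar_map ?H (ocomp C g f)" and ?g1.0 = "ar_map ?K f" and ?g2.0 = "ar_map ?K g"
            and ?g21.0 = "ar_map ?K (ocomp C g f)" and pF = "pcomp ?H g f" and pG = "pcomp ?K g f"
            and ?n1.0 = "nnat \<sigma> f" and ?n2.0 = "nnat \<sigma> g" and ?n21.0 = "nnat \<sigma> (ocomp C g f)" and X = X]]])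
        (use X e in simp_all)
    then show ?case using X by (simp add: n pa F.act.st_def)
  next
    case (14 A X)
    then have X: "A \<in> Obj C" "X \<in> Arr E" "tgt E X = ob_map F (ob_map ?H A)" by auto
    have "F.act.st (Cm (At (ar_map ?K (one C A))) (?d A)) (Cm (?d A) (At (ar_map ?H (one C A)))) (nnat \<sigma> (one C A)) X \<cdot>
        F.act.st (One (ob_map ?K A)) (At (ar_map ?K (one C A))) (punit ?K A) (F.act.ap (?d A) X) =
      F.act.apc (?d A) (F.act.st (One (ob_map ?H A)) (At (ar_map ?H (one C A))) (punit ?H A) X)"
      by (rule trans[OF F.act.st_one_sides(1)[where c = "?d A" and A = "ob_map ?H A" and B = "ob_map ?K A" and f = "ar_map ?H (one C A)"
            and g = "ar_map ?K (one C A)" and uF = "punit ?H A" and uG = "punit ?K A"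
            and n = "nnat \<sigma> (one C A)" and X = X, symmetric]
          trans[OF _ F.act.st_one_sides(2)[where c = "?d A" and A = "ob_map ?H A" and B = "ob_map ?K A" and f = "ar_map ?H (one C A)"
            and g = "ar_map ?K (one C A)" and uF = "punit ?H A" and uG = "punit ?K A"
            and n = "nnat \<sigma> (one C A)" and X = X]]])
        (use X s0.nnat_one[of A] in auto)
    then show ?case using X by (simp add: n pa F.act.st_def)
  qed (auto simp: psf_whisker_def)
qed

section \<open>Equivalences\<close>

definition isom :: "('o, 'm, 'c) bicat \<Rightarrow> 'm \<Rightarrow> 'm \<Rightarrow> bool" where
  "isom C f g \<longleftrightarrow> iso_cells C f g \<noteq> {}"

lemma isom_iff: "isom C f g \<longleftrightarrow> (\<exists>a. isoc C a \<and> Dom C a = f \<and> Cod C a = g)"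
  by (auto simp: isom_def iso_cells_iff)

lemma equivalence_arrow_iff: "equivalence_arrow C f \<longleftrightarrow> f \<in> Arr C \<and>
  (\<exists>f' \<in> Arr C. src C f' = tgt C f \<and> tgt C f' = src C f \<and> isom C (ocomp C f f') (one C (tgt C f)) \<and>
    isom C (one C (src C f)) (ocomp C f' f))"
  by (auto simp: equivalence_arrow_def isom_def hom_def)

context bicategory
begin

lemma isomI: "isoc C a \<Longrightarrow> isom C (Dom C a) (Cod C a)"
  by (auto simp: isom_iff)

lemma isom_refl: "f \<in> Arr C \<Longrightarrow> isom C f f"
  using isomI[of "idc C f"] by simp

lemma isom_sym: "isom C f g \<Longrightarrow> isom C g f"
  unfolding isom_iff using inv_simps by metis

lemma isom_trans [trans]:
  assumes "isom C f g" "isom C g h" shows "isom C f h"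
proof -
  from assms obtain a b where a: "isoc C a" "Dom C a = f" "Cod C a = g" "isoc C b" "Dom C b = g" "Cod C b = h"
    by (auto simp: isom_iff)
  with isomI[of "b \<cdot> a"] show ?thesis by simp
qed

lemma isom_hcomp:
  assumes "isom C g g'" "isom C f f'" "src C g = tgt C f" shows "isom C (g \<odot> f) (g' \<odot> f')"
proof -
  from assms obtain a b where a: "isoc C a" "Dom C a = f" "Cod C a = f'" "isoc C b" "Dom C b = g" "Cod C b = g'"
    by (auto simp: isom_iff)
  with isomI[of "b \<star> a"] assms(3) show ?thesis by simp
qed

lemma isom_asc:
  assumes "h \<in> Arr C" "g \<in> Arr C" "f \<in> Arr C" "src C h = tgt C g" "src C g = tgt C f"
  shows "isom C ((h \<odot> g) \<odot> f) (h \<odot> (g \<odot> f))"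
  using isomI[of "asc C h g f"] assms by simp

lemma isom_lun: "f \<in> Arr C \<Longrightarrow> tgt C f = B \<Longrightarrow> isom C (\<one> B \<odot> f) f"
  using isomI[of "lun C f"] by simp

lemma isom_run: "f \<in> Arr C \<Longrightarrow> src C f = A \<Longrightarrow> isom C (f \<odot> \<one> A) f"
  using isomI[of "run C f"] by simp

text \<open>\<open>g\<close> has \<open>f\<close> on its left and \<open>h\<close> on its right as
  inverses, so \<open>g \<odot> f \<cong> g \<odot> f \<odot> g \<odot> h \<cong> g \<odot> h
  \<cong> 1\<close>. This turns a construction of right inverses into one of equivalences.\<close>

lemma equivalence_arrowI:
  assumes "f \<in> Arr C" "g \<in> Arr C" "h \<in> Arr C" "src C f = A" "tgt C f = B" "src C g = B" "tgt C g = A"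
    "src C h = A" "tgt C h = B" "isom C (f \<odot> g) (\<one> B)" "isom C (g \<odot> h) (\<one> A)"
  shows "equivalence_arrow C f"
proof -
  have A: "A \<in> Obj C" "B \<in> Obj C" using assms by auto
  note r = isom_refl
  have "isom C (g \<odot> f) ((g \<odot> f) \<odot> \<one> A)"
    by (rule isom_sym[OF isom_run]) (use assms in auto)
  also have "isom C ((g \<odot> f) \<odot> \<one> A) ((g \<odot> f) \<odot> (g \<odot> h))"
    by (intro isom_hcomp isom_sym[OF assms(11)] r) (use assms A in auto)
  also have "isom C ((g \<odot> f) \<odot> (g \<odot> h)) (g \<odot> (f \<odot> (g \<odot> h)))"
    by (rule isom_asc) (use assms in auto)
  also have "isom C (g \<odot> (f \<odot> (g \<odot> h))) (g \<odot> ((f \<odot> g) \<odot> h))"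
    by (intro isom_hcomp r isom_sym[OF isom_asc]) (use assms in auto)
  also have "isom C (g \<odot> ((f \<odot> g) \<odot> h)) (g \<odot> (\<one> B \<odot> h))"
    by (intro isom_hcomp r assms(10)) (use assms in auto)
  also have "isom C (g \<odot> (\<one> B \<odot> h)) (g \<odot> h)"
    by (intro isom_hcomp r isom_lun) (use assms A in auto)
  also note assms(11)
  finally show ?thesis
    unfolding equivalence_arrow_iff using assms(1-10) by (auto intro: isom_sym)
qed

lemma equivalence_arrow_inverse:
  assumes "equivalence_arrow C e"
  obtains e' where "e' \<in> Arr C" "src C e' = tgt C e" "tgt C e' = src C e" "isom C (e \<odot> e') (\<one> (tgt C e))"
    "isom C (e' \<odot> e) (\<one> (src C e))" "equivalence_arrow C e'"
  using assms isom_sym unfolding equivalence_arrow_iff by metis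

text \<open>Whiskering by \<open>e'\<close> undoes whiskering by \<open>e\<close> up to a natural
  isomorphism \<open>w\<close>; in this form a left inverse enters the full faithfulness of
  \<open>e \<rhd> _\<close>.\<close>

lemma left_inverse_natural:
  assumes "e \<in> Arr C" "e' \<in> Arr C" "src C e' = tgt C e" "isom C (e' \<odot> e) (\<one> (src C e))"
  obtains w where "\<And>X. X \<in> Arr C \<Longrightarrow> tgt C X = src C e \<Longrightarrow> isoc C (w X)"
    "\<And>X. X \<in> Arr C \<Longrightarrow> tgt C X = src C e \<Longrightarrow> Dom C (w X) = e' \<odot> (e \<odot> X)"
    "\<And>X. X \<in> Arr C \<Longrightarrow> tgt C X = src C e \<Longrightarrow> Cod C (w X) = X"
    "\<And>a. a \<in> Cell C \<Longrightarrow> tgt C (Dom C a) = src C e \<Longrightarrow> w (Cod C a) \<cdot> (e' \<rhd> (e \<rhd> a)) = a \<cdot> w (Dom C a)"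
proof -
  from assms(4) obtain u where u: "isoc C u" "Dom C u = e' \<odot> e" "Cod C u = \<one> (src C e)"
    by (auto simp: isom_iff)
  have t: "tgt C e' = src C e"
    using assms u tgt_Cod[of u] by simp
  define w where "w X = lun C X \<cdot> ((u \<lhd> X) \<cdot> inv_cell C (asc C e' e X))" for X
  have n: "w (Cod C a) \<cdot> (e' \<rhd> (e \<rhd> a)) = a \<cdot> w (Dom C a)"
    if a: "a \<in> Cell C" "tgt C (Dom C a) = src C e" for a
  proof -
    have "w (Cod C a) \<cdot> (e' \<rhd> (e \<rhd> a)) =
      lun C (Cod C a) \<cdot> ((u \<lhd> Cod C a) \<cdot> (((e' \<odot> e) \<rhd> a) \<cdot> inv_cell C (asc C e' e (Dom C a))))"
      using a assms u self.P_arg[of e' e a] by (simp add: w_def)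
    also have "(u \<lhd> Cod C a) \<cdot> (((e' \<odot> e) \<rhd> a) \<cdot> inv_cell C (asc C e' e (Dom C a))) =
      (\<one> (src C e) \<rhd> a) \<cdot> ((u \<lhd> Dom C a) \<cdot> inv_cell C (asc C e' e (Dom C a)))"
      by (rule vcomp_eq[OF whisk_exchange]) (use a assms u in auto)
    also have "lun C (Cod C a) \<cdot> \<dots> = a \<cdot> w (Dom C a)"
      unfolding w_def by (rule vcomp_eq[OF lun_natural']) (use a assms u in auto)
    finally show ?thesis .
  qed
  show thesis
    by (rule that[of w]) (use u assms t n in \<open>auto simp: w_def\<close>)
qed

lemma equivalence_faithful:
  assumes e: "equivalence_arrow C e" and a: "a \<in> Cell C" "b \<in> Cell C" "Dom C a = Dom C b" "Cod C a = Cod C b"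
    "tgt C (Dom C a) = src C e" and eq: "e \<rhd> a = e \<rhd> b"
  shows "a = b"
proof -
  from e obtain e' where e': "e' \<in> Arr C" "src C e' = tgt C e" "isom C (e' \<odot> e) (\<one> (src C e))"
    by (rule equivalence_arrow_inverse)
  have "e \<in> Arr C" using e by (simp add: equivalence_arrow_def)
  from left_inverse_natural[OF this e'] obtain w where
    w: "\<And>X. X \<in> Arr C \<Longrightarrow> tgt C X = src C e \<Longrightarrow> isoc C (w X)"
    "\<And>X. X \<in> Arr C \<Longrightarrow> tgt C X = src C e \<Longrightarrow> Cod C (w X) = X"
    "\<And>a. a \<in> Cell C \<Longrightarrow> tgt C (Dom C a) = src C e \<Longrightarrow> w (Cod C a) \<cdot> (e' \<rhd> (e \<rhd> a)) = a \<cdot> w (Dom C a)"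
    by metis
  have "a \<cdot> w (Dom C a) = b \<cdot> w (Dom C a)"
    using w(3)[of a] w(3)[of b] a eq by simp
  then show ?thesis
    by (rule iso_cancel_right[rotated -1]) (use a w in auto)
qed

text \<open>The preimage is \<open>e' \<rhd> c\<close> conjugated by \<open>w\<close>. This shows
  only \<open>e' \<rhd> (e \<rhd> a) = e' \<rhd> c\<close>; the prefix \<open>e'\<close> cancels
  because \<open>e'\<close> is itself an equivalence and hence faithful.\<close>

lemma equivalence_full:
  assumes e: "equivalence_arrow C e" and f: "f \<in> Arr C" "g \<in> Arr C" "tgt C f = src C e" "tgt C g = src C e"
    and c: "isoc C c" "Dom C c = e \<odot> f" "Cod C c = e \<odot> g"
  shows "\<exists>a. isoc C a \<and> Dom C a = f \<and> Cod C a = g \<and> e \<rhd> a = c"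
proof -
  from e obtain e' where e': "e' \<in> Arr C" "src C e' = tgt C e" "isom C (e' \<odot> e) (\<one> (src C e))" "equivalence_arrow C e'"
    by (rule equivalence_arrow_inverse)
  have e1: "e \<in> Arr C" using e by (simp add: equivalence_arrow_def)
  from left_inverse_natural[OF this e'(1-3)] obtain w where
    w: "\<And>X. X \<in> Arr C \<Longrightarrow> tgt C X = src C e \<Longrightarrow> isoc C (w X)"
    "\<And>X. X \<in> Arr C \<Longrightarrow> tgt C X = src C e \<Longrightarrow> Dom C (w X) = e' \<odot> (e \<odot> X)"
    "\<And>X. X \<in> Arr C \<Longrightarrow> tgt C X = src C e \<Longrightarrow> Cod C (w X) = X"
    "\<And>a. a \<in> Cell C \<Longrightarrow> tgt C (Dom C a) = src C e \<Longrightarrow> w (Cod C a) \<cdot> (e' \<rhd> (e \<rhd> a)) = a \<cdot> w (Dom C a)"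
    by blast
  define a where "a = w g \<cdot> ((e' \<rhd> c) \<cdot> inv_cell C (w f))"
  have a: "isoc C a" "Dom C a = f" "Cod C a = g"
    using w(1-3)[of f] w(1-3)[of g] f c e1 e' by (auto simp: a_def)
  have "w g \<cdot> (e' \<rhd> (e \<rhd> a)) = a \<cdot> w f"
    using w(4)[of a] a f by simp
  also have "\<dots> = w g \<cdot> (e' \<rhd> c)"
    using w(1-3)[of f] w(1-3)[of g] f c e1 e' by (simp add: a_def)
  finally have "e' \<rhd> (e \<rhd> a) = e' \<rhd> c"
    by (rule iso_cancel_left[rotated -1]) (use w(1-3)[of g] f c e1 e' a in auto)
  then have "e \<rhd> a = c"
    by (rule equivalence_faithful[OF e'(4), rotated -1]) (use f c e1 e' a in auto)
  with a show ?thesis by blast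
qed

end

lemma (in pseudofunctor) ar_map_isom:
  assumes "isom C f g" shows "isom D (ar_map F f) (ar_map F g)"
proof -
  from assms obtain a where "isoc C a" "Dom C a = f" "Cod C a = g" by (auto simp: isom_iff)
  with D.isomI[of "ce_map F a"] show ?thesis by simp
qed

lemma (in pseudofunctor) ar_map_equivalence:
  assumes "equivalence_arrow C f"
  shows "equivalence_arrow D (ar_map F f)"
proof -
  from assms obtain f' where f: "f \<in> Arr C" "f' \<in> Arr C" "src C f' = tgt C f" "tgt C f' = src C f"
    "isom C (f \<odot> f') (\<one> (tgt C f))" "isom C (f' \<odot> f) (\<one> (src C f))"
    by (metis C.equivalence_arrow_inverse equivalence_arrow_def)
  have c: "isom D (ar_map F g \<odot>\<^bsub>D\<^esub> ar_map F h) (\<one>\<^bsub>D\<^esub> (ob_map F B))"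
    if "g \<in> Arr C" "h \<in> Arr C" "src C g = tgt C h" "B \<in> Obj C" "isom C (g \<odot> h) (\<one> B)" for g h B
  proof -
    have "isom D (ar_map F g \<odot>\<^bsub>D\<^esub> ar_map F h) (ar_map F (g \<odot> h))"
      using that D.isomI[of "pcomp F g h"] by simp
    also have "isom D (ar_map F (g \<odot> h)) (ar_map F (\<one> B))"
      by (rule ar_map_isom) fact
    also have "isom D (ar_map F (\<one> B)) (\<one>\<^bsub>D\<^esub> (ob_map F B))"
      using that D.isomI[of "punit F B"] by (simp add: D.isom_sym)
    finally show ?thesis .
  qed
  show ?thesis
    unfolding equivalence_arrow_iff
    using f c[of f f' "tgt C f"] D.isom_sym[OF c[of f' f "src C f"]]
    by (auto intro!: bexI[of _ "ar_map F f'"])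
qed

subsection \<open>Componentwise equivalences\<close>

locale componentwise_equivalence = pnat C D \<alpha>
  for C :: "('o, 'm, 'c) bicat" and D :: "('p, 'n, 'd) bicat" (structure) and \<alpha> +
  assumes ncmp_equivalence: "A \<in> Obj C \<Longrightarrow> equivalence_arrow D (ncmp \<alpha> A)"
begin

lemma ex_inverse: "\<exists>p. A \<in> Obj C \<longrightarrow> fst p \<in> Arr D \<and> src D (fst p) = ob_map (ntgt \<alpha>) A \<and>
    tgt D (fst p) = ob_map (nsrc \<alpha>) A \<and> equivalence_arrow D (fst p) \<and>
    isoc D (snd p) \<and> Dom D (snd p) = ncmp \<alpha> A \<odot> fst p \<and> Cod D (snd p) = \<one> (ob_map (ntgt \<alpha>) A)"
proof (cases "A \<in> Obj C")
  case True
  from ncmp_equivalence[OF True] obtain e where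
    e: "e \<in> Arr D" "src D e = tgt D (ncmp \<alpha> A)" "tgt D e = src D (ncmp \<alpha> A)"
      "isom D (ncmp \<alpha> A \<odot> e) (\<one> (tgt D (ncmp \<alpha> A)))" "equivalence_arrow D e"
    by (rule D.equivalence_arrow_inverse)
  from e(4) obtain u where "isoc D u" "Dom D u = ncmp \<alpha> A \<odot> e" "Cod D u = \<one> (tgt D (ncmp \<alpha> A))"
    by (auto simp: isom_iff)
  with e True show ?thesis by (intro exI[of _ "(e, u)"]) auto
qed simp

text \<open>\<open>e A\<close> is a right inverse of \<open>\<alpha>\<^sub>A\<close>, with \<open>\<epsilon> A : \<alpha>\<^sub>A \<odot> e A \<cong> 1\<close>. Since \<open>\<alpha>\<^sub>B \<rhd> _\<close> is fully faithful, the
  naturality cell \<open>n' f\<close> of \<open>e\<close> may be defined by prescribing \<open>\<alpha>\<^sub>B \<rhd> n' f = k f\<close>; the choice of \<open>k\<close> is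
  exactly what makes \<open>\<epsilon>\<close> a modification, and equations between cells into \<open>e B \<odot> _\<close> can be checked after
  applying \<open>\<alpha>\<^sub>B \<rhd> _\<close>. No triangle identities are needed.\<close>

definition inv_pair :: "'o \<Rightarrow> 'n \<times> 'd" where
  "inv_pair A = (SOME p. A \<in> Obj C \<longrightarrow> fst p \<in> Arr D \<and> src D (fst p) = ob_map (ntgt \<alpha>) A \<and>
    tgt D (fst p) = ob_map (nsrc \<alpha>) A \<and> equivalence_arrow D (fst p) \<and>
    isoc D (snd p) \<and> Dom D (snd p) = ncmp \<alpha> A \<odot> fst p \<and> Cod D (snd p) = \<one> (ob_map (ntgt \<alpha>) A))"

definition e :: "'o \<Rightarrow> 'n" where "e A = fst (inv_pair A)"

definition \<epsilon> :: "'o \<Rightarrow> 'd" where "\<epsilon> A = snd (inv_pair A)"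

lemma e_simps [simp]:
  assumes "A \<in> Obj C"
  shows "e A \<in> Arr D" "src D (e A) = ob_map (ntgt \<alpha>) A" "tgt D (e A) = ob_map (nsrc \<alpha>) A"
    "equivalence_arrow D (e A)" "isoc D (\<epsilon> A)" "Dom D (\<epsilon> A) = ncmp \<alpha> A \<odot> e A"
    "Cod D (\<epsilon> A) = \<one> (ob_map (ntgt \<alpha>) A)"
  using someI_ex[OF ex_inverse[of A]] assms unfolding inv_pair_def[symmetric] e_def \<epsilon>_def by auto

abbreviation E :: "'o \<Rightarrow> 'n \<Rightarrow> 'd" where
  "E A X \<equiv> D.self.st (Cm (At (ncmp \<alpha> A)) (At (e A))) (One (ob_map (ntgt \<alpha>) A)) (\<epsilon> A) X"

lemma E_arg:
  assumes "A \<in> Obj C" "c \<in> Cell D" "tgt D (Dom D c) = ob_map (ntgt \<alpha>) A" "Dom D c = X" "Cod D c = Y"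
  shows "E A Y \<cdot> (ncmp \<alpha> A \<rhd> (e A \<rhd> c)) = c \<cdot> E A X"
  using D.self.st_natural[of "Cm (At (ncmp \<alpha> A)) (At (e A))" "One (ob_map (ntgt \<alpha>) A)" "\<epsilon> A" c X Y] assms
  by simp

text \<open>Up to associators and unitors this is \<open>\<alpha> B \<odot> F f \<odot> e A
  \<Rightarrow> G f \<odot> \<alpha> A \<odot> e A \<Rightarrow> G f \<Rightarrow> \<alpha> B
  \<odot> e B \<odot> G f\<close>, by the inverse naturality cell of \<alpha>, then
  \<open>\<epsilon> A\<close>, then the inverse of \<open>\<epsilon> B\<close>.\<close>

definition k :: "'m \<Rightarrow> 'd" where
  "k f = (let A = src C f; B = tgt C f; F = ar_map (nsrc \<alpha>) f; G = ar_map (ntgt \<alpha>) f in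
    asc D (ncmp \<alpha> B) (e B) G \<cdot> ((inv_cell D (\<epsilon> B) \<lhd> G) \<cdot> (inv_cell D (lun D G) \<cdot> (run D G \<cdot>
      ((G \<rhd> \<epsilon> A) \<cdot> (asc D G (ncmp \<alpha> A) (e A) \<cdot> ((inv_cell D (nnat \<alpha> f) \<lhd> e A) \<cdot>
        inv_cell D (asc D (ncmp \<alpha> B) F (e A)))))))))"

lemma k_props:
  assumes f: "f \<in> Arr C"
  shows "isoc D (k f)" "Dom D (k f) = ncmp \<alpha> (tgt C f) \<odot> (ar_map (nsrc \<alpha>) f \<odot> e (src C f))"
    "Cod D (k f) = ncmp \<alpha> (tgt C f) \<odot> (e (tgt C f) \<odot> ar_map (ntgt \<alpha>) f)"
    and st_k: "X \<in> Arr D \<Longrightarrow> tgt D X = ob_map (ntgt \<alpha>) (src C f) \<Longrightarrow>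
      D.self.st (Cm (At (ncmp \<alpha> (tgt C f))) (Cm (At (ar_map (nsrc \<alpha>) f)) (At (e (src C f)))))
        (Cm (At (ncmp \<alpha> (tgt C f))) (Cm (At (e (tgt C f))) (At (ar_map (ntgt \<alpha>) f)))) (k f) X =
      inv_cell D (E (tgt C f) (ar_map (ntgt \<alpha>) f \<odot> X)) \<cdot>
        ((ar_map (ntgt \<alpha>) f \<rhd> E (src C f) X) \<cdot> inv_cell D (N \<alpha> f (e (src C f) \<odot> X)))"
proof -
  let ?A = "src C f" and ?B = "tgt C f" and ?F = "ar_map (nsrc \<alpha>) f" and ?G = "ar_map (ntgt \<alpha>) f"
  \<comment> \<open>The partial composites are named so that the boundary of each is settled once
    and its strict form follows from the previous one; associators and unitors leave that form
    unchanged.\<close>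
  define k1 where "k1 = inv_cell D (asc D (ncmp \<alpha> ?B) ?F (e ?A))"
  define k2 where "k2 = (inv_cell D (nnat \<alpha> f) \<lhd> e ?A) \<cdot> k1"
  define k3 where "k3 = asc D ?G (ncmp \<alpha> ?A) (e ?A) \<cdot> k2"
  define k4 where "k4 = (?G \<rhd> \<epsilon> ?A) \<cdot> k3"
  define k5 where "k5 = run D ?G \<cdot> k4"
  define k6 where "k6 = inv_cell D (lun D ?G) \<cdot> k5"
  define k7 where "k7 = (inv_cell D (\<epsilon> ?B) \<lhd> ?G) \<cdot> k6"
  have k: "k f = asc D (ncmp \<alpha> ?B) (e ?B) ?G \<cdot> k7"
    by (simp add: k_def k1_def k2_def k3_def k4_def k5_def k6_def k7_def Let_def)
  have [simp]: "isoc D k1" "Dom D k1 = ncmp \<alpha> ?B \<odot> (?F \<odot> e ?A)" "Cod D k1 = (ncmp \<alpha> ?B \<odot> ?F) \<odot> e ?A"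
    using f by (auto simp: k1_def)
  have [simp]: "isoc D k2" "Dom D k2 = ncmp \<alpha> ?B \<odot> (?F \<odot> e ?A)" "Cod D k2 = (?G \<odot> ncmp \<alpha> ?A) \<odot> e ?A"
    using f by (auto simp: k2_def)
  have [simp]: "isoc D k3" "Dom D k3 = ncmp \<alpha> ?B \<odot> (?F \<odot> e ?A)" "Cod D k3 = ?G \<odot> (ncmp \<alpha> ?A \<odot> e ?A)"
    using f by (auto simp: k3_def)
  have [simp]: "isoc D k4" "Dom D k4 = ncmp \<alpha> ?B \<odot> (?F \<odot> e ?A)" "Cod D k4 = ?G \<odot> \<one> (ob_map (ntgt \<alpha>) ?A)"
    using f by (auto simp: k4_def)
  have [simp]: "isoc D k5" "Dom D k5 = ncmp \<alpha> ?B \<odot> (?F \<odot> e ?A)" "Cod D k5 = ?G"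
    using f by (auto simp: k5_def)
  have [simp]: "isoc D k6" "Dom D k6 = ncmp \<alpha> ?B \<odot> (?F \<odot> e ?A)" "Cod D k6 = \<one> (ob_map (ntgt \<alpha>) ?B) \<odot> ?G"
    using f by (auto simp: k6_def)
  have [simp]: "isoc D k7" "Dom D k7 = ncmp \<alpha> ?B \<odot> (?F \<odot> e ?A)" "Cod D k7 = (ncmp \<alpha> ?B \<odot> e ?B) \<odot> ?G"
    using f by (auto simp: k7_def)
  show "isoc D (k f)" "Dom D (k f) = ncmp \<alpha> ?B \<odot> (?F \<odot> e ?A)" "Cod D (k f) = ncmp \<alpha> ?B \<odot> (e ?B \<odot> ?G)"
    using f by (auto simp: k)
  assume X: "X \<in> Arr D" "tgt D X = ob_map (ntgt \<alpha>) ?A"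
  let ?a = "At (ncmp \<alpha> ?A)" and ?b = "At (ncmp \<alpha> ?B)"
  let ?f = "At ?F" and ?g = "At ?G" and ?eA = "At (e ?A)" and ?eB = "At (e ?B)"
  let ?s0 = "Cm ?b (Cm ?f ?eA)" and ?s1 = "Cm (Cm ?b ?f) ?eA" and ?s2 = "Cm (Cm ?g ?a) ?eA" and ?s3 = "Cm ?g (Cm ?a ?eA)"
    and ?s4 = "Cm ?g (One (ob_map (ntgt \<alpha>) ?A))" and ?s6 = "Cm (One (ob_map (ntgt \<alpha>) ?B)) ?g"
    and ?s7 = "Cm (Cm ?b ?eB) ?g" and ?s8 = "Cm ?b (Cm ?eB ?g)"
  let ?n = "inv_cell D (N \<alpha> f (e ?A \<odot> X))"
  have "D.self.st ?s0 ?s1 k1 X = idc D (ncmp \<alpha> ?B \<odot> (?F \<odot> (e ?A \<odot> X)))"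
    using f X by (simp add: k1_def)
  then have "D.self.st ?s0 ?s2 k2 X = ?n"
    unfolding k2_def
    using f X by (subst D.self.st_vcomp[where t = ?s1]) (auto simp: D.self.st_hcomp N_eq)
  then have "D.self.st ?s0 ?s3 k3 X = ?n"
    unfolding k3_def using f X by (subst D.self.st_vcomp[where t = ?s2]) auto
  then have "D.self.st ?s0 ?s4 k4 X = (?G \<rhd> E ?A X) \<cdot> ?n"
    unfolding k4_def using f X by (subst D.self.st_vcomp[where t = ?s3]) (auto simp: D.self.st_hcomp)
  then have "D.self.st ?s0 ?g k5 X = (?G \<rhd> E ?A X) \<cdot> ?n"
    unfolding k5_def using f X by (subst D.self.st_vcomp[where t = ?s4]) auto
  then have "D.self.st ?s0 ?s6 k6 X = (?G \<rhd> E ?A X) \<cdot> ?n"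
    unfolding k6_def using f X by (subst D.self.st_vcomp[where t = ?g]) auto
  then have "D.self.st ?s0 ?s7 k7 X = inv_cell D (E ?B (?G \<odot> X)) \<cdot> ((?G \<rhd> E ?A X) \<cdot> ?n)"
    unfolding k7_def using f X by (subst D.self.st_vcomp[where t = ?s6]) (auto simp: D.self.st_hcomp)
  then show "D.self.st ?s0 ?s8 (k f) X = inv_cell D (E ?B (?G \<odot> X)) \<cdot> ((?G \<rhd> E ?A X) \<cdot> ?n)"
    unfolding k using f X by (subst D.self.st_vcomp[where t = ?s7]) auto
qed

definition n' :: "'m \<Rightarrow> 'd" where
  "n' f = (SOME a. isoc D a \<and> Dom D a = ar_map (nsrc \<alpha>) f \<odot> e (src C f) \<and>
    Cod D a = e (tgt C f) \<odot> ar_map (ntgt \<alpha>) f \<and> ncmp \<alpha> (tgt C f) \<rhd> a = k f)"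

lemma n'_simps [simp]:
  assumes "f \<in> Arr C"
  shows "isoc D (n' f)" "Dom D (n' f) = ar_map (nsrc \<alpha>) f \<odot> e (src C f)"
    "Cod D (n' f) = e (tgt C f) \<odot> ar_map (ntgt \<alpha>) f"
    and n'_k: "ncmp \<alpha> (tgt C f) \<rhd> n' f = k f"
proof -
  have "\<exists>a. isoc D a \<and> Dom D a = ar_map (nsrc \<alpha>) f \<odot> e (src C f) \<and>
    Cod D a = e (tgt C f) \<odot> ar_map (ntgt \<alpha>) f \<and> ncmp \<alpha> (tgt C f) \<rhd> a = k f"
    by (rule D.equivalence_full) (use assms k_props(1-3)[OF assms] in \<open>auto intro: ncmp_equivalence\<close>)
  from someI_ex[OF this] show "isoc D (n' f)" "Dom D (n' f) = ar_map (nsrc \<alpha>) f \<odot> e (src C f)"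
    "Cod D (n' f) = e (tgt C f) \<odot> ar_map (ntgt \<alpha>) f" "ncmp \<alpha> (tgt C f) \<rhd> n' f = k f"
    unfolding n'_def[symmetric] by auto
qed

definition \<beta> :: "('o, 'm, 'c, 'p, 'n, 'd) pnt" where
  "\<beta> = \<lparr>nsrc = ntgt \<alpha>, ntgt = nsrc \<alpha>, ncmp = (\<lambda>A\<in>Obj C. e A), nnat = (\<lambda>f\<in>Arr C. n' f)\<rparr>"

abbreviation M :: "'m \<Rightarrow> 'n \<Rightarrow> 'd" where
  "M f X \<equiv> D.self.st (Cm (At (ar_map (nsrc \<alpha>) f)) (At (e (src C f)))) (Cm (At (e (tgt C f))) (At (ar_map (ntgt \<alpha>) f))) (n' f) X"

lemma M_eq:
  assumes f: "f \<in> Arr C" and X: "X \<in> Arr D" "tgt D X = ob_map (ntgt \<alpha>) (src C f)"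
  shows "ncmp \<alpha> (tgt C f) \<rhd> M f X = inv_cell D (E (tgt C f) (ar_map (ntgt \<alpha>) f \<odot> X)) \<cdot>
    ((ar_map (ntgt \<alpha>) f \<rhd> E (src C f) X) \<cdot> inv_cell D (N \<alpha> f (e (src C f) \<odot> X)))"
  using f X st_k[OF f X] by (simp flip: n'_k add: D.self.st_hcomp)

text \<open>The defining equation of \<open>n'\<close> with the inverses cleared. It is the strict
  modification condition for \<epsilon> and, besides invertibility and boundary, the only property
  of \<open>n'\<close> used from here on.\<close>

lemma E_M:
  assumes f: "f \<in> Arr C" and X: "X \<in> Arr D" "tgt D X = ob_map (ntgt \<alpha>) (src C f)"
    "A = src C f" "B = tgt C f"
  shows "E B (ar_map (ntgt \<alpha>) f \<odot> X) \<cdot> ((ncmp \<alpha> B \<rhd> M f X) \<cdot> N \<alpha> f (e A \<odot> X)) = ar_map (ntgt \<alpha>) f \<rhd> E A X"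
  using f X by (simp add: M_eq)

text \<open>Whiskering by the equivalence \<open>ncmp \<alpha> A\<close> is faithful, and the
  invertible cells \<open>E A Z\<close> and \<open>n\<close> may be added at the ends. The choice of
  \<open>n\<close> is left open so that both sides can be brought into the shape of
  \<open>E_M\<close>.\<close>

lemma cancel:
  assumes "A \<in> Obj C" "Z \<in> Arr D" "tgt D Z = ob_map (ntgt \<alpha>) A" "x \<in> Cell D" "y \<in> Cell D" "Dom D x = Dom D y"
    "Cod D x = e A \<odot> Z" "Cod D y = e A \<odot> Z" "isoc D n" "Cod D n = ncmp \<alpha> A \<odot> Dom D x"
    "E A Z \<cdot> ((ncmp \<alpha> A \<rhd> x) \<cdot> n) = E A Z \<cdot> ((ncmp \<alpha> A \<rhd> y) \<cdot> n)"
  shows "x = y"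
proof -
  have t: "tgt D (Dom D x) = ob_map (nsrc \<alpha>) A" "tgt D (Dom D y) = ob_map (nsrc \<alpha>) A"
    using assms(1-8) D.tgt_Cod[of x] D.tgt_Cod[of y] by auto
  have "(ncmp \<alpha> A \<rhd> x) \<cdot> n = (ncmp \<alpha> A \<rhd> y) \<cdot> n"
    by (rule D.iso_cancel_left[OF _ _ _ _ _ assms(11)]) (use assms(1-10) t in auto)
  then have "ncmp \<alpha> A \<rhd> x = ncmp \<alpha> A \<rhd> y"
    by (rule D.iso_cancel_right[rotated -1]) (use assms(1-10) t in auto)
  then show ?thesis
    by (rule D.equivalence_faithful[OF ncmp_equivalence[OF assms(1)], rotated -1]) (use assms(1-10) t in auto)
qed

lemma \<beta>_sel [simp]: "nsrc \<beta> = ntgt \<alpha>" "ntgt \<beta> = nsrc \<alpha>" "A \<in> Obj C \<Longrightarrow> ncmp \<beta> A = e A"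
  "f \<in> Arr C \<Longrightarrow> nnat \<beta> f = n' f"
  by (simp_all add: \<beta>_def)

lemma nst_\<beta>: "f \<in> Arr C \<Longrightarrow> nst (\<lambda>A. At (e A)) \<beta> f X = M f X"
  by (simp add: nst_def)

text \<open>In each case \<open>cancel\<close> brings in the cells of \<alpha>; then
  \<open>E_M\<close> removes every cell \<open>M\<close>, an axiom of \<alpha> supplying the
  required \<open>N \<alpha>\<close>, and both sides reduce to the same composite with
  \<open>E\<close>.\<close>

lemma pseudonatural_\<beta>: "pseudonatural C D \<beta>"
proof (rule pseudonaturalI[where c = "\<lambda>A. At (e A)"], goal_cases)
  case (12 m X)
  let ?A = "src C (Dom C m)" and ?B = "tgt C (Dom C m)" and ?f = "Dom C m" and ?g = "Cod C m"
  let ?F = "nsrc \<alpha>" and ?G = "ntgt \<alpha>"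
  have X: "m \<in> Cell C" "X \<in> Arr D" "tgt D X = ob_map ?G ?A" using 12 by auto
  let ?n = "N \<alpha> ?f (e ?A \<odot> X)"
  have g: "e (src C ?g) = e ?A" "e (tgt C ?g) = e ?B" using X by auto
  have "M ?g X \<cdot> (ce_map ?F m \<lhd> (e ?A \<odot> X)) = (e ?B \<rhd> (ce_map ?G m \<lhd> X)) \<cdot> M ?f X"
  proof (rule cancel[of ?B "ar_map ?G ?g \<odot> X" _ _ ?n], goal_cases)
    case 11
    have n: "(ncmp \<alpha> ?B \<rhd> (ce_map ?F m \<lhd> (e ?A \<odot> X))) \<cdot> ?n = N \<alpha> ?g (e ?A \<odot> X) \<cdot> (ce_map ?G m \<lhd> (ncmp \<alpha> ?A \<odot> (e ?A \<odot> X)))"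
      by (rule N_natural[symmetric]) (use X in auto)
    have "E ?B (ar_map ?G ?g \<odot> X) \<cdot> ((ncmp \<alpha> ?B \<rhd> (M ?g X \<cdot> (ce_map ?F m \<lhd> (e ?A \<odot> X)))) \<cdot> ?n) =
      (E ?B (ar_map ?G ?g \<odot> X) \<cdot> ((ncmp \<alpha> ?B \<rhd> M ?g X) \<cdot> N \<alpha> ?g (e ?A \<odot> X))) \<cdot> (ce_map ?G m \<lhd> (ncmp \<alpha> ?A \<odot> (e ?A \<odot> X)))"
      using X by (simp add: n)
    also have "\<dots> = (ar_map ?G ?g \<rhd> E ?A X) \<cdot> (ce_map ?G m \<lhd> (ncmp \<alpha> ?A \<odot> (e ?A \<odot> X)))"
      by (subst E_M) (use X in auto)
    also have "\<dots> = (ce_map ?G m \<lhd> X) \<cdot> (ar_map ?G ?f \<rhd> E ?A X)"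
      by (rule D.whisk_exchange[symmetric]) (use X in auto)
    also have "\<dots> = (ce_map ?G m \<lhd> X) \<cdot> (E ?B (ar_map ?G ?f \<odot> X) \<cdot> ((ncmp \<alpha> ?B \<rhd> M ?f X) \<cdot> ?n))"
      using X by (simp add: E_M)
    also have "\<dots> = E ?B (ar_map ?G ?g \<odot> X) \<cdot> ((ncmp \<alpha> ?B \<rhd> (e ?B \<rhd> (ce_map ?G m \<lhd> X))) \<cdot> ((ncmp \<alpha> ?B \<rhd> M ?f X) \<cdot> ?n))"
      by (rule D.vcomp_eq[OF E_arg[symmetric]]) (use X in auto)
    finally show ?case using X by simp
  qed (use X in auto)
  then show ?case using X by (simp add: nst_\<beta>)
next
  case (13 g f X)
  then have X: "g \<in> Arr C" "f \<in> Arr C" "src C g = tgt C f" "X \<in> Arr D" "tgt D X = ob_map (ntgt \<alpha>) (src C f)"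
    by auto
  let ?F = "nsrc \<alpha>" and ?G = "ntgt \<alpha>" and ?a = "ncmp \<alpha>"
  let ?A = "src C f" and ?B = "tgt C f" and ?D = "tgt C g" and ?gf = "ocomp C g f"
  let ?h = "ar_map ?G ?gf \<odot> X" and ?Y = "ar_map ?G f \<odot> X" and ?Z = "e ?A \<odot> X"
  \<comment> \<open>This choice completes the left side to the composition axiom
    \<open>N_ocomp\<close> of \<alpha>, and on the right it is consumed by two uses of
    \<open>E_M\<close>, at \<open>g\<close> and at \<open>f\<close>.\<close>
  let ?n = "N \<alpha> g (ar_map ?F f \<odot> ?Z) \<cdot> (ar_map ?G g \<rhd> N \<alpha> f ?Z)"
  have "M ?gf X \<cdot> pact ?F g f ?Z = (e ?D \<rhd> pact ?G g f X) \<cdot> (M g ?Y \<cdot> (ar_map ?F g \<rhd> M f X))"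
  proof (rule cancel[of ?D ?h _ _ ?n], goal_cases)
    case 11
    have n: "(?a ?D \<rhd> pact ?F g f ?Z) \<cdot> ?n = N \<alpha> ?gf ?Z \<cdot> pact ?G g f (?a ?A \<odot> ?Z)"
      by (rule N_ocomp[symmetric]) (use X in auto)
    have "E ?D ?h \<cdot> ((?a ?D \<rhd> (M ?gf X \<cdot> pact ?F g f ?Z)) \<cdot> ?n) =
      E ?D ?h \<cdot> ((?a ?D \<rhd> M ?gf X) \<cdot> ((?a ?D \<rhd> pact ?F g f ?Z) \<cdot> ?n))"
      using X by simp
    also have "\<dots> = (E ?D ?h \<cdot> ((?a ?D \<rhd> M ?gf X) \<cdot> N \<alpha> ?gf ?Z)) \<cdot> pact ?G g f (?a ?A \<odot> ?Z)"
      unfolding n using X by simp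
    also have "\<dots> = (ar_map ?G ?gf \<rhd> E ?A X) \<cdot> pact ?G g f (?a ?A \<odot> ?Z)"
      by (subst E_M) (use X in auto)
    also have "\<dots> = pact ?G g f X \<cdot> (ar_map ?G g \<rhd> (ar_map ?G f \<rhd> E ?A X))"
      using X G.act.P_arg[of g f "E ?A X"] by simp
    finally have l: "E ?D ?h \<cdot> ((?a ?D \<rhd> (M ?gf X \<cdot> pact ?F g f ?Z)) \<cdot> ?n) =
      pact ?G g f X \<cdot> (ar_map ?G g \<rhd> (ar_map ?G f \<rhd> E ?A X))" .
    have n2: "(?a ?D \<rhd> (ar_map ?F g \<rhd> M f X)) \<cdot> N \<alpha> g (ar_map ?F f \<odot> ?Z) =
      N \<alpha> g (e ?B \<odot> ?Y) \<cdot> (ar_map ?G g \<rhd> (?a ?B \<rhd> M f X))"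
      by (rule N_arg[symmetric]) (use X in auto)
    have "E ?D ?h \<cdot> ((?a ?D \<rhd> ((e ?D \<rhd> pact ?G g f X) \<cdot> (M g ?Y \<cdot> (ar_map ?F g \<rhd> M f X)))) \<cdot> ?n) =
      E ?D ?h \<cdot> ((?a ?D \<rhd> (e ?D \<rhd> pact ?G g f X)) \<cdot> ((?a ?D \<rhd> M g ?Y) \<cdot>
        ((?a ?D \<rhd> (ar_map ?F g \<rhd> M f X)) \<cdot> (N \<alpha> g (ar_map ?F f \<odot> ?Z) \<cdot> (ar_map ?G g \<rhd> N \<alpha> f ?Z)))))"
      using X by simp
    also have "(?a ?D \<rhd> (ar_map ?F g \<rhd> M f X)) \<cdot> (N \<alpha> g (ar_map ?F f \<odot> ?Z) \<cdot> (ar_map ?G g \<rhd> N \<alpha> f ?Z)) =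
      N \<alpha> g (e ?B \<odot> ?Y) \<cdot> ((ar_map ?G g \<rhd> (?a ?B \<rhd> M f X)) \<cdot> (ar_map ?G g \<rhd> N \<alpha> f ?Z))"
      by (rule D.vcomp_eq[OF n2]) (use X in auto)
    also have "E ?D ?h \<cdot> ((?a ?D \<rhd> (e ?D \<rhd> pact ?G g f X)) \<cdot> ((?a ?D \<rhd> M g ?Y) \<cdot>
        (N \<alpha> g (e ?B \<odot> ?Y) \<cdot> ((ar_map ?G g \<rhd> (?a ?B \<rhd> M f X)) \<cdot> (ar_map ?G g \<rhd> N \<alpha> f ?Z))))) =
      pact ?G g f X \<cdot> (E ?D (ar_map ?G g \<odot> ?Y) \<cdot> ((?a ?D \<rhd> M g ?Y) \<cdot>
        (N \<alpha> g (e ?B \<odot> ?Y) \<cdot> ((ar_map ?G g \<rhd> (?a ?B \<rhd> M f X)) \<cdot> (ar_map ?G g \<rhd> N \<alpha> f ?Z)))))"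
      by (rule D.vcomp_eq[OF E_arg]) (use X in auto)
    also have "\<dots> = pact ?G g f X \<cdot> ((E ?D (ar_map ?G g \<odot> ?Y) \<cdot> ((?a ?D \<rhd> M g ?Y) \<cdot> N \<alpha> g (e ?B \<odot> ?Y))) \<cdot>
      (ar_map ?G g \<rhd> ((?a ?B \<rhd> M f X) \<cdot> N \<alpha> f ?Z)))"
      using X by simp
    also have "\<dots> = pact ?G g f X \<cdot> ((ar_map ?G g \<rhd> E ?B ?Y) \<cdot> (ar_map ?G g \<rhd> ((?a ?B \<rhd> M f X) \<cdot> N \<alpha> f ?Z)))"
      by (subst E_M) (use X in auto)
    also have "\<dots> = pact ?G g f X \<cdot> (ar_map ?G g \<rhd> (E ?B ?Y \<cdot> ((?a ?B \<rhd> M f X) \<cdot> N \<alpha> f ?Z)))"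
      using X by simp
    also have "\<dots> = pact ?G g f X \<cdot> (ar_map ?G g \<rhd> (ar_map ?G f \<rhd> E ?A X))"
      using X by (simp only: E_M)
    finally show ?case using l by simp
  qed (use X in auto)
  then show ?case using X by (simp add: nst_\<beta>)
next
  case (14 A X)
  then have X: "A \<in> Obj C" "X \<in> Arr D" "tgt D X = ob_map (ntgt \<alpha>) A" by auto
  let ?F = "nsrc \<alpha>" and ?G = "ntgt \<alpha>" and ?o = "one C A"
  have "M ?o X \<cdot> uact ?F A (e A \<odot> X) = e A \<rhd> uact ?G A X"
  proof (rule cancel[of A "ar_map ?G ?o \<odot> X" _ _ "idc D (ncmp \<alpha> A \<odot> (e A \<odot> X))"], goal_cases)
    case 11
    have "E A (ar_map ?G ?o \<odot> X) \<cdot> ((ncmp \<alpha> A \<rhd> M ?o X) \<cdot> (ncmp \<alpha> A \<rhd> uact ?F A (e A \<odot> X))) =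
      (E A (ar_map ?G ?o \<odot> X) \<cdot> ((ncmp \<alpha> A \<rhd> M ?o X) \<cdot> N \<alpha> ?o (e A \<odot> X))) \<cdot> uact ?G A (ncmp \<alpha> A \<odot> (e A \<odot> X))"
      using X by (simp flip: N_one)
    also have "\<dots> = (ar_map ?G ?o \<rhd> E A X) \<cdot> uact ?G A (ncmp \<alpha> A \<odot> (e A \<odot> X))"
      by (subst E_M) (use X in auto)
    also have "\<dots> = uact ?G A X \<cdot> E A X"
      using X G.act.U_arg[of A "E A X"] by simp
    also have "\<dots> = E A (ar_map ?G ?o \<odot> X) \<cdot> (ncmp \<alpha> A \<rhd> (e A \<rhd> uact ?G A X))"
      by (rule E_arg[symmetric]) (use X in auto)
    finally show ?case using X by simp
  qed (use X in auto)
  then show ?case using X nst_\<beta>[of ?o X] by simp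
qed (auto simp: \<beta>_def F.pseudofunctor_axioms G.pseudofunctor_axioms)

text \<open>The components \<open>\<epsilon> A\<close> form an invertible modification: identity
  transformations have identity strict cells, so the condition is \<open>E_M\<close>.\<close>

lemma isom_\<alpha>\<beta>: "isom (functor_bicat C D) (pnt_comp C D \<alpha> \<beta>) (id_pnt C D (ntgt \<alpha>))"
proof -
  let ?\<epsilon> = "\<lparr>msrc = pnt_comp C D \<alpha> \<beta>, mtgt = id_pnt C D (ntgt \<alpha>), mcmp = (\<lambda>A\<in>Obj C. \<epsilon> A)\<rparr>"
  let ?c = "\<lambda>A. Cm (At (ncmp \<alpha> A)) (At (e A))"
  have r: "rep (\<lambda>A. At (e A)) \<beta>" by (auto simp: rep_def)
  have rc: "rep ?c (pnt_comp C D \<alpha> \<beta>)"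
    by (rule rep_Cm[OF pseudonatural_\<beta> pnt _ r rep_At[OF pnt]]) simp
  note i = pseudonatural_id[OF G.pseudofunctor_axioms] and ri = rep_One[OF G.pseudofunctor_axioms]
  have p: "pseudonatural C D (pnt_comp C D \<alpha> \<beta>)"
    by (rule pseudonatural_comp[OF pseudonatural_\<beta> pnt]) simp
  have "modification C D ?\<epsilon>"
  proof (rule modificationI_strict[where F = "ntgt \<alpha>" and G = "ntgt \<alpha>" and c = ?c and
        d = "\<lambda>A. One (ob_map (ntgt \<alpha>) A)"], goal_cases)
    case (13 f X)
    then have n: "nst ?c (pnt_comp C D \<alpha> \<beta>) f X = (ncmp \<alpha> (tgt C f) \<rhd> M f X) \<cdot> N \<alpha> f (e (src C f) \<odot> X)"
      using nst_comp[OF pseudonatural_\<beta> pnt _ r rep_At[OF pnt], of f X] by (simp add: nst_\<beta> N_def)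
    show ?case using 13 by (simp add: n nst_id[OF G.pseudofunctor_axioms] E_M)
  qed (use p i rc ri in auto)
  then have "isoc (functor_bicat C D) ?\<epsilon>"
    by (rule isoc_functor_bicat) auto
  then show ?thesis by (auto simp: isom_iff functor_bicat_sel)
qed

end

text \<open>The right inverse of \<open>\<alpha>\<close> is again a componentwise equivalence, hence has a right inverse itself.\<close>

lemma equivalence_functor_bicat:
  assumes C: "bicategory C" and D: "bicategory D" and \<alpha>: "pseudonatural C D \<alpha>"
    and e: "\<And>A. A \<in> Obj C \<Longrightarrow> equivalence_arrow D (ncmp \<alpha> A)"
  shows "equivalence_arrow (functor_bicat C D) \<alpha>"
proof -
  interpret bicat_pair C D using C D by (rule bicat_pair.intro)
  interpret FB: bicategory "functor_bicat C D" using C D by (rule bicategory_functor_bicat)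
  interpret a: pnat C D \<alpha> using \<alpha> by (rule pnatI)
  interpret a: componentwise_equivalence C D \<alpha> by unfold_locales (rule e)
  interpret b: pnat C D a.\<beta> using a.pseudonatural_\<beta> by (rule pnatI)
  interpret b: componentwise_equivalence C D a.\<beta> by unfold_locales simp
  show ?thesis
    by (rule FB.equivalence_arrowI[of _ a.\<beta> b.\<beta> "nsrc \<alpha>" "ntgt \<alpha>"])
      (use \<alpha> a.pseudonatural_\<beta> b.pseudonatural_\<beta> a.isom_\<alpha>\<beta> b.isom_\<alpha>\<beta> in \<open>auto simp: functor_bicat_sel\<close>)
qed

section \<open>Precomposition with an endo-pseudofunctor\<close>

lemma psf_eqI:
  fixes F G :: "('o, 'm, 'c, 'p, 'n, 'd) psf"
  assumes "ob_map F \<in> extensional (Obj C)" "ar_map F \<in> extensional (Arr C)" "ce_map F \<in> extensional (Cell C)"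
      "\<And>g f. \<not> composable C g f \<Longrightarrow> pcomp F g f = undefined" "punit F \<in> extensional (Obj C)"
    and "ob_map G \<in> extensional (Obj C)" "ar_map G \<in> extensional (Arr C)" "ce_map G \<in> extensional (Cell C)"
      "\<And>g f. \<not> composable C g f \<Longrightarrow> pcomp G g f = undefined" "punit G \<in> extensional (Obj C)"
    and "\<And>A. A \<in> Obj C \<Longrightarrow> ob_map F A = ob_map G A" "\<And>f. f \<in> Arr C \<Longrightarrow> ar_map F f = ar_map G f"
      "\<And>a. a \<in> Cell C \<Longrightarrow> ce_map F a = ce_map G a"
      "\<And>g f. g \<in> Arr C \<Longrightarrow> f \<in> Arr C \<Longrightarrow> src C g = tgt C f \<Longrightarrow> pcomp F g f = pcomp G g f"
      "\<And>A. A \<in> Obj C \<Longrightarrow> punit F A = punit G A"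
  shows "F = G"
proof (rule psf.equality)
  show "ob_map F = ob_map G" by (rule extensionalityI) (use assms in auto)
  show "ar_map F = ar_map G" by (rule extensionalityI) (use assms in auto)
  show "ce_map F = ce_map G" by (rule extensionalityI) (use assms in auto)
  show "punit F = punit G" by (rule extensionalityI) (use assms in auto)
  have "pcomp F g f = pcomp G g f" for g f
    using assms(4,9,14)[of g f] by (cases "composable C g f") (auto simp: composable_def)
  then show "pcomp F = pcomp G" by (intro ext)
qed simp

lemma psf_comp_id_right:
  assumes "pseudofunctor C D F"
  shows "psf_comp C D F (id_psf C) = F"
proof -
  interpret F: pseudofunctor C D F by fact
  show ?thesis
    by (rule psf_eqI[of _ C])
      (use F.ob_map_ext F.ar_map_ext F.ce_map_ext F.punit_ext F.pcomp_ext in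
        \<open>auto simp: psf_comp_def id_psf_def composable_def\<close>)
qed

lemma psf_comp_id_left:
  assumes "pseudofunctor C D F"
  shows "psf_comp C D (id_psf D) F = F"
  using inclusion_comp[of D C UNIV F] assms by (simp add: full_sub_UNIV inclusion_def pseudofunctor_def)

text \<open>Associativity holds on the nose: the coherence cells agree since \<open>ce_map H\<close>
  preserves vertical composition, and values outside the domain are fixed to
  \<open>undefined\<close>. Iterated precomposition is therefore literally precomposition with the
  composite.\<close>

lemma psf_comp_assoc:
  assumes F: "pseudofunctor A B F" and G: "pseudofunctor B C G" and H: "pseudofunctor C D H"
  shows "psf_comp A D (psf_comp B D H G) F = psf_comp A D H (psf_comp A C G F)"
proof -
  interpret F: pseudofunctor A B F by fact
  interpret G: pseudofunctor B C G by fact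
  interpret H: pseudofunctor C D H by fact
  show ?thesis
    by (rule psf_eqI[of _ A]) (auto simp: H.ce_map_vcomp' psf_comp_def composable_def)
qed

lemma pnt_whisker_comp:
  assumes F: "pseudofunctor A B F" and G: "pseudofunctor B C G" and \<alpha>: "pseudonatural C D \<alpha>"
  shows "pnt_whisker A D (pnt_whisker B D \<alpha> G) F = pnt_whisker A D \<alpha> (psf_comp A C G F)"
proof -
  interpret F: pseudofunctor A B F by fact
  interpret G: pseudofunctor B C G by fact
  interpret a: pseudonatural C D \<alpha> by fact
  show ?thesis
    by (rule pnt_eqI)
      (auto simp: psf_comp_assoc[OF F G] a.nsrc_psf a.ntgt_psf pnt_whisker_def fun_eq_iff)
qed

lemma modif_whisker_comp:
  assumes F: "pseudofunctor A B F" and G: "pseudofunctor B C G" and \<mu>: "modification C D \<mu>"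
  shows "modif_whisker A D (modif_whisker B D \<mu> G) F = modif_whisker A D \<mu> (psf_comp A C G F)"
proof -
  interpret F: pseudofunctor A B F by fact
  interpret G: pseudofunctor B C G by fact
  interpret m: modification C D \<mu> by fact
  show ?thesis
    by (auto simp: modif_whisker_def pnt_whisker_comp[OF F G] m.msrc_pnt m.mtgt_pnt fun_eq_iff)
qed

text \<open>With identities as coherence cells a pseudofunctor is determined by its maps on objects,
  arrows and cells, so a composite of precompositions can be recognised by these three maps
  alone.\<close>

definition strict_psf :: "('o, 'm, 'c) bicat \<Rightarrow> ('p, 'n, 'd) bicat \<Rightarrow> ('o, 'm, 'c, 'p, 'n, 'd) psf \<Rightarrow> bool" where
  "strict_psf C D F \<longleftrightarrow>
    (\<forall>g f. g \<in> Arr C \<longrightarrow> f \<in> Arr C \<longrightarrow> src C g = tgt C f \<longrightarrow>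
      pcomp F g f = idc D (ocomp D (ar_map F g) (ar_map F f))) \<and>
    (\<forall>A \<in> Obj C. punit F A = idc D (one D (ob_map F A)))"

lemma strict_psf_comp:
  assumes F: "pseudofunctor C D F" "strict_psf C D F" and G: "pseudofunctor D E G" "strict_psf D E G"
  shows "strict_psf C E (psf_comp C E G F)"
proof -
  interpret F: pseudofunctor C D F by fact
  interpret G: pseudofunctor D E G by fact
  have "pcomp (psf_comp C E G F) g f = idc E (ocomp E (ar_map G (ar_map F g)) (ar_map G (ar_map F f)))"
    if h: "g \<in> Arr C" "f \<in> Arr C" "src C g = tgt C f" for g f
  proof -
    let ?g = "ar_map F g" and ?f = "ar_map F f"
    have p: "pcomp G ?g ?f = idc E (ocomp E (ar_map G ?g) (ar_map G ?f))"
      using G(2) h by (simp add: strict_psf_def)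
    \<comment> \<open>An identity cell has equal source and target, so the boundary of
      \<open>pcomp G ?g ?f\<close> shows that \<open>G\<close> preserves this composite
      strictly.\<close>
    have "Cod E (pcomp G ?g ?f) = ar_map G (ocomp D ?g ?f)" using h by simp
    then have e: "ar_map G (ocomp D ?g ?f) = ocomp E (ar_map G ?g) (ar_map G ?f)"
      unfolding p using h by simp
    show ?thesis
      using F(2) h p e[symmetric] by (simp add: strict_psf_def)
  qed
  moreover have "punit (psf_comp C E G F) A = idc E (one E (ob_map G (ob_map F A)))" if h: "A \<in> Obj C" for A
  proof -
    let ?A = "ob_map F A"
    have p: "punit G ?A = idc E (one E (ob_map G ?A))"
      using G(2) h by (simp add: strict_psf_def)
    have "Cod E (punit G ?A) = ar_map G (one D ?A)" using h by simp
    then have e: "ar_map G (one D ?A) = one E (ob_map G ?A)"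
      unfolding p using h by simp
    show ?thesis
      using F(2) h p e[symmetric] by (simp add: strict_psf_def)
  qed
  ultimately show ?thesis by (simp add: strict_psf_def)
qed

lemma strict_inclusion: "bicategory C \<Longrightarrow> strict_psf (full_sub C S) C (inclusion C S)"
proof -
  assume "bicategory C"
  then interpret H: bicategory "full_sub C S" by (rule bicategory_full_sub)
  show ?thesis by (auto simp: strict_psf_def inclusion_def id_psf_def composable_def) (simp_all add: full_sub_sel)
qed

lemma strict_psf_full_sub: "strict_psf C (full_sub D S) F \<longleftrightarrow> strict_psf C D F"
  by (simp add: strict_psf_def full_sub_sel)

lemma strict_precomp:
  assumes K: "pseudofunctor C B K" and E: "bicategory E"
  shows "strict_psf (functor_bicat B E) (functor_bicat C E) (precomp C B E K)"
proof -
  interpret K: pseudofunctor C B K by fact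
  interpret E: bicategory E by fact
  interpret BE: bicat_pair B E by unfold_locales
  have w_comp: "pnt_whisker C E (pnt_comp B E \<beta> \<alpha>) K = pnt_comp C E (pnt_whisker C E \<beta> K) (pnt_whisker C E \<alpha> K)" for \<beta> \<alpha>
    by (rule pnt_eqI) (auto simp: pnt_whisker_def pnt_comp_def Let_def fun_eq_iff)
  then show ?thesis
    by (auto simp: strict_psf_def precomp_def composable_def) (auto simp: functor_bicat_sel)
qed

text \<open>\<open>inv_cell\<close> is a description over the cells of the given bicategory; unlike
  the other operations occurring in \<open>pseudonatural\<close>, it is not literally the same in a
  full sub-bicategory.\<close>

lemma inv_cell_full_sub:
  assumes "bicategory E" "isoc (full_sub E S) a"
  shows "inv_cell (full_sub E S) a = inv_cell E a"
proof -
  interpret E: bicategory E by fact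
  interpret H: bicategory "full_sub E S" using assms(1) by (rule bicategory_full_sub)
  have "inverse_cells E a (inv_cell (full_sub E S) a)"
    using H.inverse_inv[OF assms(2)] by (auto simp: inverse_cells_def cells_full_sub full_sub_sel)
  then show ?thesis by (rule E.inv_cell_eq[symmetric])
qed

lemma pseudonatural_full_sub:
  fixes E :: "('p, 'n, 'd) bicat" (structure)
  assumes \<alpha>: "pseudonatural C E \<alpha>" and "\<And>A. A \<in> Obj C \<Longrightarrow> ob_map (nsrc \<alpha>) A \<in> S"
    "\<And>A. A \<in> Obj C \<Longrightarrow> ob_map (ntgt \<alpha>) A \<in> S"
  shows "pseudonatural C (full_sub E S) \<alpha>"
proof -
  interpret a: pseudonatural C E \<alpha> by fact
  interpret CE: bicat_pair C E by unfold_locales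
  interpret p: pnat C E \<alpha> using \<alpha> by (rule CE.pnatI)
  interpret H: bicategory "full_sub E S" by (rule bicategory_full_sub) unfold_locales
  have F: "pseudofunctor C (full_sub E S) (nsrc \<alpha>)" "pseudofunctor C (full_sub E S) (ntgt \<alpha>)"
    using assms by (auto intro!: pseudofunctor_full_sub a.nsrc_psf a.ntgt_psf)
  interpret F: pseudofunctor C "full_sub E S" "nsrc \<alpha>" by (rule F)
  interpret G: pseudofunctor C "full_sub E S" "ntgt \<alpha>" by (rule F)
  note S [simp] = assms(2,3)
  note inv = inv_cell_full_sub[OF a.D.bicategory_axioms]
  have n: "ncmp \<alpha> A \<in> Arr (full_sub E S)" if "A \<in> Obj C" for A
    using that by (simp add: full_sub_sel)
  show ?thesis
  proof (intro pseudonatural.intro[OF a.C.bicategory_axioms H.bicategory_axioms] pseudonatural_axioms.intro, goal_cases)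
    case 1 show ?case by (rule F)
  next case 2 show ?case by (rule F)
  next case 3 show ?case by (rule a.ncmp_ext)
  next case 4 show ?case by (rule a.nnat_ext)
  next case (5 A) then show ?case using a.ncmp_hom by (simp add: hom_full_sub)
  next
    case (6 f A B)
    then have "f \<in> Arr C" "src C f = A" "tgt C f = B" by (auto simp: hom_def)
    then show ?case using a.nnat_iso[OF 6] a.C.arr_obj[of f] by (auto simp: full_sub_sel a.D.iso_cells_full_sub)
  next
    case (7 f A B a g)
    then show ?case using a.nnat_natural by (simp add: full_sub_sel)
  next
    case (8 f A B g E')
    then have h: "f \<in> Arr C" "g \<in> Arr C" "src C f = A" "tgt C f = B" "src C g = B" "tgt C g = E'"
      by (auto simp: hom_def)
    have "isoc (full_sub E S) (asc (full_sub E S) (ar_map (ntgt \<alpha>) g) (ncmp \<alpha> B) (ar_map (nsrc \<alpha>) f))"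
      by (rule H.asc_simps(1)) (use h n[of B] F.ar_map_simps[of f] G.ar_map_simps[of g] a.C.arr_obj[of f] in
        \<open>auto simp: full_sub_sel\<close>)
    from inv[OF this] show ?case using a.nnat_ocomp[OF 8] by (simp add: full_sub_sel)
  next
    case (9 A)
    have "isoc (full_sub E S) (run (full_sub E S) (ncmp \<alpha> A))" using n[OF 9] by simp
    from inv[OF this] show ?case using a.nnat_one[OF 9] by (simp add: full_sub_sel)
  qed
qed

text \<open>For \<alpha> from \<open>F\<close> to \<open>G\<close> and \<eta> from the identity to
  \<open>K\<close>: the naturality cells of \<alpha> at the components of \<eta>, read as one cell
  from \<open>G \<eta>\<close> after \<alpha> to \<open>\<alpha> K\<close> after
  \<open>F \<eta>\<close>.\<close>

definition exch :: "('o, 'm, 'c) bicat \<Rightarrow> ('p, 'n, 'd) bicat \<Rightarrow> ('o, 'm, 'c, 'o, 'm, 'c) pnt \<Rightarrow>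
    ('o, 'm, 'c, 'p, 'n, 'd) pnt \<Rightarrow> ('o, 'm, 'c, 'p, 'n, 'd) modif" where
  "exch C D \<eta> \<alpha> = \<lparr>msrc = pnt_comp C D (psf_whisker C D (ntgt \<alpha>) \<eta>) \<alpha>,
     mtgt = pnt_comp C D (pnt_whisker C D \<alpha> (ntgt \<eta>)) (psf_whisker C D (nsrc \<alpha>) \<eta>),
     mcmp = (\<lambda>A\<in>Obj C. nnat \<alpha> (ncmp \<eta> A))\<rparr>"

text \<open>The cell \<open>nnat \<eta> f\<close> compares \<eta> followed by \<open>K f\<close>
  with \<open>f\<close> followed by \<eta>. Naturality of \<alpha> at this cell (\<open>a3\<close>)
  links the composition axioms of \<alpha> at the two composites (\<open>a1\<close>,
  \<open>a2\<close>), and inverting the action cells of \<open>F\<close> and \<open>G\<close> gives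
  the condition at \<open>f\<close>.\<close>

lemma modification_exch:
  fixes D :: "('p, 'n, 'd) bicat" (structure)
  assumes \<eta>: "pseudonatural C C \<eta>" and s: "nsrc \<eta> = id_psf C" and \<alpha>: "pseudonatural C D \<alpha>"
  shows "modification C D (exch C D \<eta> \<alpha>)"
proof -
  interpret h0: pseudonatural C C \<eta> by fact
  interpret a0: pseudonatural C D \<alpha> by fact
  interpret CC: bicat_pair C C by unfold_locales
  interpret CD: bicat_pair C D by unfold_locales
  interpret h: pnat C C \<eta> using \<eta> by (rule CC.pnatI)
  interpret a: pnat C D \<alpha> using \<alpha> by (rule CD.pnatI)
  let ?K = "ntgt \<eta>" and ?F = "nsrc \<alpha>" and ?G = "ntgt \<alpha>"
  have hs: "ncmp \<eta> A \<in> Arr C" "src C (ncmp \<eta> A) = A" "tgt C (ncmp \<eta> A) = ob_map ?K A" if "A \<in> Obj C" for A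
    using that h.ncmp_simps[of A] by (auto simp: s id_psf_def)
  have hn: "isoc C (nnat \<eta> f)" "Dom C (nnat \<eta> f) = ocomp C (ar_map ?K f) (ncmp \<eta> (src C f))"
    "Cod C (nnat \<eta> f) = ocomp C (ncmp \<eta> (tgt C f)) f" if "f \<in> Arr C" for f
    using that h.nnat_simps[of f] by (auto simp: s id_psf_def)
  note F = a.F.pseudofunctor_axioms and G = a.G.pseudofunctor_axioms
  let ?wG = "psf_whisker C D ?G \<eta>" and ?wF = "psf_whisker C D ?F \<eta>" and ?wa = "pnt_whisker C D \<alpha> ?K"
  have p: "pseudonatural C D ?wG" "pseudonatural C D ?wF" "pseudonatural C D ?wa"
    using pseudonatural_psf_whisker[OF \<eta> G] pseudonatural_psf_whisker[OF \<eta> F]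
      pseudonatural_whisker[OF \<alpha> h.G.pseudofunctor_axioms] by auto
  have n: "nsrc ?wG = ?G" "nsrc ?wF = ?F"
    using psf_comp_id_right[OF F] psf_comp_id_right[OF G] by (simp_all add: s)
  let ?cG = "\<lambda>A. At (ar_map ?G (ncmp \<eta> A))" and ?cF = "\<lambda>A. At (ar_map ?F (ncmp \<eta> A))"
    and ?ca = "\<lambda>A. At (ncmp \<alpha> A)" and ?cw = "\<lambda>A. At (ncmp \<alpha> (ob_map ?K A))"
  have r: "CD.rep ?cG ?wG" "CD.rep ?cF ?wF" "CD.rep ?ca \<alpha>" "CD.rep ?cw ?wa"
    using hs by (auto simp: CD.rep_def)
  let ?c = "\<lambda>A. Cm (?cG A) (?ca A)" and ?d = "\<lambda>A. Cm (?cw A) (?cF A)"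
  have p1: "pseudonatural C D (pnt_comp C D ?wG \<alpha>)"
    by (rule CD.pseudonatural_comp[OF \<alpha> p(1) n(1)])
  have p2: "pseudonatural C D (pnt_comp C D ?wa ?wF)"
    by (rule CD.pseudonatural_comp[OF p(2,3)]) simp
  have r1: "CD.rep ?c (pnt_comp C D ?wG \<alpha>)"
    by (rule CD.rep_Cm[OF \<alpha> p(1) n(1) r(3,1)])
  have r2: "CD.rep ?d (pnt_comp C D ?wa ?wF)"
    by (rule CD.rep_Cm[OF p(2,3) _ r(2,4)]) simp
  have [simp]: "A \<in> Obj C \<Longrightarrow> ob_map (nsrc \<eta>) A = A" "f \<in> Arr C \<Longrightarrow> ar_map (nsrc \<eta>) f = f" for A f
    by (simp_all add: s id_psf_def)
  note [simp] = hs hn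
  show ?thesis
  proof (rule CD.modificationI_strict[where F = ?F and G = "psf_comp C D ?G ?K" and c = ?c and d = ?d], goal_cases)
    case (13 f X)
    then have X: "f \<in> Arr C" "X \<in> Arr D" "tgt D X = ob_map ?F (src C f)" by auto
    let ?A = "src C f" and ?B = "tgt C f"
    let ?e = "ncmp \<eta>" and ?k = "ar_map ?K f" and ?a = "ncmp \<alpha>" and ?x = "nnat \<eta> f"
    let ?KB = "ob_map ?K ?B"
    let ?Y = "?a ?A \<odot> X"
    let ?q' = "CD.pact ?F (?e ?B) f X" and ?q = "CD.pact ?F ?k (?e ?A) X"
    let ?p' = "CD.pact ?G (?e ?B) f ?Y" and ?p = "CD.pact ?G ?k (?e ?A) ?Y"
    have nG: "CD.nst ?cG ?wG f ?Y = inv_cell D ?p' \<cdot> ((ce_map ?G ?x \<lhd> ?Y) \<cdot> ?p)"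
      using nst_psf_whisker[OF \<eta> G, of f ?Y] X by (simp add: s id_psf_def)
    have nF: "CD.nst ?cF ?wF f X = inv_cell D ?q' \<cdot> ((ce_map ?F ?x \<lhd> X) \<cdot> ?q)"
      using nst_psf_whisker[OF \<eta> F, of f X] X by (simp add: s id_psf_def)
    have nw: "CD.nst ?cw ?wa f Z = CD.N \<alpha> ?k Z" for Z
      using X by (simp add: CD.nst_def a.N_eq)
    have nc: "CD.nst ?c (pnt_comp C D ?wG \<alpha>) f X =
      (ar_map ?G (?e ?B) \<rhd> CD.N \<alpha> f X) \<cdot> (inv_cell D ?p' \<cdot> ((ce_map ?G ?x \<lhd> ?Y) \<cdot> ?p))"
      using CD.nst_comp[OF \<alpha> p(1) n(1) r(3,1) X] by (simp add: nG CD.N_def)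
    have t: "tgt D X = ob_map (nsrc ?wF) (src C f)" by (simp only: n X)
    have nd: "CD.nst ?d (pnt_comp C D ?wa ?wF) f X =
      (?a ?KB \<rhd> (inv_cell D ?q' \<cdot> ((ce_map ?F ?x \<lhd> X) \<cdot> ?q))) \<cdot> CD.N \<alpha> ?k (ar_map ?F (?e ?A) \<odot> X)"
      using CD.nst_comp[OF p(2,3) _ r(2,4) X(1,2) t] X by (simp add: nF nw)
    have m: "a0.D.self.st (?c A) (?d A) (nnat \<alpha> (?e A)) Z = CD.N \<alpha> (?e A) Z" if "A \<in> Obj C" for A Z
      using that by (simp add: a.N_eq)
    let ?b = "ar_map ?G (?e ?B)" and ?g = "ar_map ?G ?k"
    have a1: "CD.N \<alpha> (ocomp C (?e ?B) f) X \<cdot> ?p' =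
      (?a ?KB \<rhd> ?q') \<cdot> (CD.N \<alpha> (?e ?B) (ar_map ?F f \<odot> X) \<cdot> (?b \<rhd> CD.N \<alpha> f X))"
      by (rule a.N_ocomp) (use X in auto)
    have a2: "CD.N \<alpha> (ocomp C ?k (?e ?A)) X \<cdot> ?p =
      (?a ?KB \<rhd> ?q) \<cdot> (CD.N \<alpha> ?k (ar_map ?F (?e ?A) \<odot> X) \<cdot> (?g \<rhd> CD.N \<alpha> (?e ?A) X))"
      by (rule a.N_ocomp) (use X in auto)
    have a3: "CD.N \<alpha> (ocomp C (?e ?B) f) X \<cdot> (ce_map ?G ?x \<lhd> ?Y) =
      (?a ?KB \<rhd> (ce_map ?F ?x \<lhd> X)) \<cdot> CD.N \<alpha> (ocomp C ?k (?e ?A)) X"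
      by (rule a.N_natural) (use X in auto)
    let ?u = "CD.N \<alpha> (?e ?B) (ar_map ?F f \<odot> X) \<cdot> (?b \<rhd> CD.N \<alpha> f X)"
    let ?v = "CD.N \<alpha> ?k (ar_map ?F (?e ?A) \<odot> X) \<cdot> (?g \<rhd> CD.N \<alpha> (?e ?A) X)"
    have u: "?u = inv_cell D (?a ?KB \<rhd> ?q') \<cdot> (CD.N \<alpha> (ocomp C (?e ?B) f) X \<cdot> ?p')"
      by (rule a0.D.isoc_move_left[OF _ _ _ _ a1[symmetric]]) (use X in auto)
    have "CD.N \<alpha> (?e ?B) (ar_map ?F f \<odot> X) \<cdot> ((?b \<rhd> CD.N \<alpha> f X) \<cdot> (inv_cell D ?p' \<cdot> ((ce_map ?G ?x \<lhd> ?Y) \<cdot> ?p))) =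
      ?u \<cdot> (inv_cell D ?p' \<cdot> ((ce_map ?G ?x \<lhd> ?Y) \<cdot> ?p))"
      using X by simp
    also have "\<dots> = inv_cell D (?a ?KB \<rhd> ?q') \<cdot> (CD.N \<alpha> (ocomp C (?e ?B) f) X \<cdot> ((ce_map ?G ?x \<lhd> ?Y) \<cdot> ?p))"
      unfolding u using X by simp
    also have "CD.N \<alpha> (ocomp C (?e ?B) f) X \<cdot> ((ce_map ?G ?x \<lhd> ?Y) \<cdot> ?p) =
      (?a ?KB \<rhd> (ce_map ?F ?x \<lhd> X)) \<cdot> (CD.N \<alpha> (ocomp C ?k (?e ?A)) X \<cdot> ?p)"
      by (rule a0.D.vcomp_eq[OF a3]) (use X in auto)
    also have "\<dots> = (?a ?KB \<rhd> (ce_map ?F ?x \<lhd> X)) \<cdot> ((?a ?KB \<rhd> ?q) \<cdot> ?v)"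
      unfolding a2 ..
    finally show ?case
      using X by (simp add: exch_def nc nd m)
  qed (use p1 p2 r1 r2 n in \<open>auto simp: exch_def\<close>)
qed

lemma equivalence_arrow_full_sub:
  assumes "bicategory C" "src C f \<in> S" "tgt C f \<in> S" "equivalence_arrow C f"
  shows "equivalence_arrow (full_sub C S) f"
proof -
  interpret bicategory C by fact
  have f: "f \<in> Arr C" using assms(4) by (simp add: equivalence_arrow_def)
  from assms(4) obtain f' where f': "f' \<in> Arr C" "src C f' = tgt C f" "tgt C f' = src C f"
    "isom C (f \<odot>\<^bsub>C\<^esub> f') (\<one>\<^bsub>C\<^esub> (tgt C f))" "isom C (\<one>\<^bsub>C\<^esub> (src C f)) (f' \<odot>\<^bsub>C\<^esub> f)"
    unfolding equivalence_arrow_iff by blast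
  have iso: "isom (full_sub C S) g h" if "isom C g h" "src C g \<in> S" "tgt C g \<in> S" for g h
    using that by (auto simp: isom_def iso_cells_full_sub)
  have "isom (full_sub C S) (f \<odot>\<^bsub>C\<^esub> f') (\<one>\<^bsub>C\<^esub> (tgt C f))"
    by (rule iso[OF f'(4)]) (use f f'(1-3) assms(2,3) in auto)
  moreover have "isom (full_sub C S) (\<one>\<^bsub>C\<^esub> (src C f)) (f' \<odot>\<^bsub>C\<^esub> f)"
    by (rule iso[OF f'(5)]) (use f f'(1-3) assms(2,3) in auto)
  ultimately show ?thesis
    unfolding equivalence_arrow_iff full_sub_sel
    using f f'(1-3) assms(2,3) by (intro conjI bexI[of _ f']) simp_all
qed

lemma (in bicat_pair) inv_cell_functor_bicat:
  assumes "modification C D \<mu>" "\<And>A. A \<in> Obj C \<Longrightarrow> isoc D (mcmp \<mu> A)"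
  shows "inv_cell (functor_bicat C D) \<mu> =
    \<lparr>msrc = mtgt \<mu>, mtgt = msrc \<mu>, mcmp = (\<lambda>A\<in>Obj C. inv_cell D (mcmp \<mu> A))\<rparr>"
proof -
  interpret FB: bicategory "functor_bicat C D" by (rule bicategory_functor_bicat) unfold_locales
  show ?thesis by (rule FB.inv_cell_eq[OF inverse_cells_functor_bicat[OF assms]])
qed

text \<open>The transformation \<open>1 \<rightarrow> T\<close> has the components \<open>F \<eta> : F \<rightarrow> F K\<close> and is natural in \<open>F\<close> through the
  inverses of the cells \<open>exch\<close>.\<close>

lemma unit_whisker_equivalence:
  fixes D :: "('p, 'n, 'd) bicat" (structure) and X :: "('o, 'm, 'c) bicat"
  assumes X: "bicategory X" and D: "bicategory D" and \<eta>: "pseudonatural X X \<eta>" and s: "nsrc \<eta> = id_psf X"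
    and P_def: "P = full_sub (functor_bicat X D) S"
    and T: "pseudofunctor P P T" "strict_psf P P T"
    and T_ob: "\<And>F. F \<in> Obj P \<Longrightarrow> ob_map T F = psf_comp X D F (ntgt \<eta>)"
    and T_ar: "\<And>\<alpha>. \<alpha> \<in> Arr P \<Longrightarrow> ar_map T \<alpha> = pnt_whisker X D \<alpha> (ntgt \<eta>)"
    and T_ce: "\<And>\<mu>. \<mu> \<in> Cell P \<Longrightarrow> ce_map T \<mu> = modif_whisker X D \<mu> (ntgt \<eta>)"
    and e: "\<And>F A. F \<in> Obj P \<Longrightarrow> A \<in> Obj X \<Longrightarrow> equivalence_arrow D (ar_map F (ncmp \<eta> A))"
  shows "\<exists>\<chi> \<in> hom (functor_bicat P P) (id_psf P) T. equivalence_arrow (functor_bicat P P) \<chi>"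
proof -
  let ?M = "functor_bicat X D" and ?K = "ntgt \<eta>"
  interpret XX: bicat_pair X X using X by (intro bicat_pair.intro)
  interpret XD: bicat_pair X D using X D by (intro bicat_pair.intro)
  interpret M: bicategory ?M using X D by (rule bicategory_functor_bicat)
  interpret P: bicategory P unfolding P_def by (rule bicategory_full_sub) unfold_locales
  interpret T: pseudofunctor P P T by (rule T)
  interpret h: pnat X X \<eta> using \<eta> by (rule XX.pnatI)
  have hs: "ncmp \<eta> A \<in> Arr X" "src X (ncmp \<eta> A) = A" "tgt X (ncmp \<eta> A) = ob_map ?K A" if "A \<in> Obj X" for A
    using that h.ncmp_simps[of A] by (auto simp: s id_psf_def)
  have id_obj: "ob_map (nsrc \<eta>) A = A" if "A \<in> Obj X" for A
    using that by (simp add: s id_psf_def)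
  have P_Obj: "F \<in> Obj P \<longleftrightarrow> pseudofunctor X D F \<and> F \<in> S" for F
    by (auto simp: P_def full_sub_sel functor_bicat_sel)
  have P_Arr: "\<alpha> \<in> Arr P \<longleftrightarrow> pseudonatural X D \<alpha> \<and> nsrc \<alpha> \<in> S \<and> ntgt \<alpha> \<in> S" for \<alpha>
    by (auto simp: P_def full_sub_sel functor_bicat_sel)
  have P_Cell: "\<mu> \<in> Cell P \<longleftrightarrow> modification X D \<mu> \<and> nsrc (msrc \<mu>) \<in> S \<and> ntgt (msrc \<mu>) \<in> S" for \<mu>
    by (auto simp: P_def full_sub_sel functor_bicat_sel)
  note Psel = P_def full_sub_sel functor_bicat_sel
  let ?w = "\<lambda>F. psf_whisker X D F \<eta>"
  have w: "pseudonatural X D (?w F)" "nsrc (?w F) = F" "ntgt (?w F) = psf_comp X D F ?K" if "pseudofunctor X D F" for F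
    using that pseudonatural_psf_whisker[OF \<eta>] psf_comp_id_right[OF that] by (simp_all add: s)
  have TS: "psf_comp X D F ?K \<in> S" if "F \<in> Obj P" for F
    using T.ob_map_Obj[OF that] that T_ob P_Obj by auto
  \<comment> \<open>The naturality cell of \<chi> must run from \<open>T \<alpha>\<close> after
    \<open>F \<eta>\<close> to \<open>G \<eta>\<close> after \<alpha>, opposite to
    \<open>exch\<close>, so its components are inverses of naturality cells of \<alpha>.\<close>
  let ?x = "\<lambda>\<alpha>. \<lparr>msrc = pnt_comp X D (pnt_whisker X D \<alpha> ?K) (?w (nsrc \<alpha>)), mtgt = pnt_comp X D (?w (ntgt \<alpha>)) \<alpha>,
    mcmp = (\<lambda>A\<in>Obj X. inv_cell D (nnat \<alpha> (ncmp \<eta> A)))\<rparr>"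
  have x: "isoc ?M (?x \<alpha>)" if \<alpha>: "pseudonatural X D \<alpha>" for \<alpha>
  proof -
    interpret a: pnat X D \<alpha> using \<alpha> by (rule XD.pnatI)
    have m: "modification X D (exch X D \<eta> \<alpha>)" by (rule modification_exch[OF \<eta> s \<alpha>])
    have i: "isoc D (mcmp (exch X D \<eta> \<alpha>) A)" if "A \<in> Obj X" for A
      using that hs[OF that] by (simp add: exch_def)
    have "inv_cell ?M (exch X D \<eta> \<alpha>) = ?x \<alpha>"
      by (rule trans[OF XD.inv_cell_functor_bicat[OF m i]]) (auto simp: exch_def)
    with M.inv_simps(6)[OF XD.isoc_functor_bicat[OF m i]] show ?thesis by simp
  qed
  define \<chi> where "\<chi> = \<lparr>nsrc = id_psf P, ntgt = T, ncmp = (\<lambda>F\<in>Obj P. ?w F), nnat = (\<lambda>\<alpha>\<in>Arr P. ?x \<alpha>)\<rparr>"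
  have \<chi>_sel: "nsrc \<chi> = id_psf P" "ntgt \<chi> = T" "\<And>F. F \<in> Obj P \<Longrightarrow> ncmp \<chi> F = ?w F"
    "\<And>\<alpha>. \<alpha> \<in> Arr P \<Longrightarrow> nnat \<chi> \<alpha> = ?x \<alpha>"
    by (simp_all add: \<chi>_def)
  have id_sel: "\<And>F. F \<in> Obj P \<Longrightarrow> ob_map (id_psf P) F = F" "\<And>\<alpha>. \<alpha> \<in> Arr P \<Longrightarrow> ar_map (id_psf P) \<alpha> = \<alpha>"
    "\<And>\<mu>. \<mu> \<in> Cell P \<Longrightarrow> ce_map (id_psf P) \<mu> = \<mu>"
    "\<And>\<beta> \<alpha>. \<beta> \<in> Arr P \<Longrightarrow> \<alpha> \<in> Arr P \<Longrightarrow> src P \<beta> = tgt P \<alpha> \<Longrightarrow> pcomp (id_psf P) \<beta> \<alpha> = idc P (ocomp P \<beta> \<alpha>)"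
    "\<And>F. F \<in> Obj P \<Longrightarrow> punit (id_psf P) F = idc P (one P F)"
    by (auto simp: id_psf_def composable_def)
  have T_pcomp: "pcomp T \<beta> \<alpha> = idc P (ocomp P (ar_map T \<beta>) (ar_map T \<alpha>))"
    if "\<beta> \<in> Arr P" "\<alpha> \<in> Arr P" "src P \<beta> = tgt P \<alpha>" for \<beta> \<alpha>
    using T(2) that by (simp add: strict_psf_def)
  have T_punit: "punit T F = idc P (one P (ob_map T F))" if "F \<in> Obj P" for F
    using T(2) that by (simp add: strict_psf_def)
  have wP: "?w F \<in> Arr P" "src P (?w F) = F" "tgt P (?w F) = psf_comp X D F ?K" if "F \<in> Obj P" for F
    using that w[of F] TS[OF that] by (auto simp: P_Obj P_Arr) (auto simp: Psel)
  have inv_P: "inv_cell P a = inv_cell ?M a" if "isoc P a" for a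
    using inv_cell_full_sub[OF M.bicategory_axioms, of S a] that by (simp add: P_def)
  have \<chi>: "pseudonatural P P \<chi>"
  proof (intro pseudonatural.intro[OF P.bicategory_axioms P.bicategory_axioms] pseudonatural_axioms.intro, goal_cases)
    case 1 show ?case by (simp add: \<chi>_sel P.pseudofunctor_id)
  next case 2 show ?case by (simp add: \<chi>_sel T)
  next case 3 show ?case by (simp add: \<chi>_def)
  next case 4 show ?case by (simp add: \<chi>_def)
  next
    case (5 F)
    then show ?case using wP[OF 5] by (simp add: \<chi>_sel id_sel T_ob hom_def)
  next
    case (6 \<alpha> F G)
    then have h: "\<alpha> \<in> Arr P" "F = nsrc \<alpha>" "G = ntgt \<alpha>" "pseudonatural X D \<alpha>" "F \<in> Obj P" "G \<in> Obj P"
      by (auto simp: hom_def P_Arr P_Obj) (auto simp: Psel)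
    have "isoc ?M (?x \<alpha>)" by (rule x[OF h(4)])
    then have "?x \<alpha> \<in> iso_cells ?M (pnt_comp X D (pnt_whisker X D \<alpha> ?K) (?w F)) (pnt_comp X D (?w G) \<alpha>)"
      by (simp add: iso_cells_functor_bicat h)
    moreover have "nsrc (?w F) \<in> S" "psf_comp X D G ?K \<in> S"
      using h w(2)[of F] TS[of G] by (auto simp: P_Obj)
    ultimately show ?case
      using h by (simp add: \<chi>_sel id_sel T_ar) (simp add: Psel M.iso_cells_full_sub)
  next
    case (7 \<alpha> F G \<mu> \<beta>)
    then have h: "\<mu> \<in> Cell P" "modification X D \<mu>" "\<alpha> = msrc \<mu>" "\<beta> = mtgt \<mu>" "F = nsrc \<alpha>" "G = ntgt \<alpha>"
      "\<alpha> \<in> Arr P" "\<beta> \<in> Arr P" "F \<in> Obj P" "G \<in> Obj P" "pseudonatural X D \<alpha>" "pseudonatural X D \<beta>"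
      by (auto simp: hom_def cells_def P_Cell P_Arr P_Obj) (auto simp: Psel)
    interpret a: pnat X D \<alpha> using h(11) by (rule XD.pnatI)
    interpret b: pnat X D \<beta> using h(12) by (rule XD.pnatI)
    have bs: "nsrc \<beta> = F" "ntgt \<beta> = G" using h(2-6) by auto
    have p: "inv_cell D (nnat \<beta> (ncmp \<eta> A)) \<cdot> (mcmp \<mu> (ob_map ?K A) \<lhd> ar_map F (ncmp \<eta> A)) =
      (ar_map G (ncmp \<eta> A) \<rhd> mcmp \<mu> A) \<cdot> inv_cell D (nnat \<alpha> (ncmp \<eta> A))" if A: "A \<in> Obj X" for A
    proof -
      have o: "ob_map ?K A \<in> Obj X" using A by simp
      have n: "(mcmp \<mu> (ob_map ?K A) \<lhd> ar_map F (ncmp \<eta> A)) \<cdot> nnat \<alpha> (ncmp \<eta> A) =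
        nnat \<beta> (ncmp \<eta> A) \<cdot> (ar_map G (ncmp \<eta> A) \<rhd> mcmp \<mu> A)"
        using XD.mcmp_natural'[OF h(2), of "ncmp \<eta> A"] A hs[OF A] h(3-6) by simp
      show ?thesis
        by (rule XD.D.inv_natural[OF _ _ _ _ _ _ _ _ n[symmetric], symmetric])
          (use A o hs[OF A] h(2) a.nnat_simps[OF hs(1)[OF A]] b.nnat_simps[OF hs(1)[OF A]] bs in
            \<open>auto simp: h(3-6)[symmetric] id_obj\<close>)
    qed
    show ?case
      using h p bs hs by (simp add: \<chi>_sel id_sel T_ce) (auto simp: Psel restrict_def fun_eq_iff id_obj)
  next
    case (8 \<alpha> F G \<beta> H)
    then have h: "\<alpha> \<in> Arr P" "\<beta> \<in> Arr P" "F = nsrc \<alpha>" "G = ntgt \<alpha>" "H = ntgt \<beta>" "nsrc \<beta> = ntgt \<alpha>"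
      "F \<in> Obj P" "G \<in> Obj P" "H \<in> Obj P" "pseudonatural X D \<alpha>" "pseudonatural X D \<beta>" "ocomp P \<beta> \<alpha> \<in> Arr P"
      "src P \<beta> = tgt P \<alpha>"
      using P.ocomp_simps(1)[of \<beta> \<alpha>] by (auto simp: hom_def P_Arr P_Obj) (auto simp: Psel)
    interpret a: pnat X D \<alpha> using h(10) by (rule XD.pnatI)
    interpret b: pnat X D \<beta> using h(11) by (rule XD.pnatI)
    let ?b = "pnt_whisker X D \<beta> ?K"
    have bP: "?b \<in> Arr P" "src P ?b = psf_comp X D G ?K"
      using T.ar_map_simps[OF h(2)] T_ar[OF h(2)] T_ob[OF h(8)] h(4,6) by (auto simp: Psel)
    have wG: "?w G \<in> Arr P" "tgt P (?w G) = psf_comp X D G ?K" "src P (?w G) = tgt P \<alpha>"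
      using wP[OF h(8)] h(4) by (auto simp: Psel)
    have i: "isoc P (asc P ?b (?w G) \<alpha>)"
      by (rule P.asc_simps(1)) (use bP wG h in auto)
    have m: "modification X D (asc ?M ?b (?w G) \<alpha>)"
      using P.asc_simps(2)[of ?b "?w G" \<alpha>] bP wG h by (simp add: P_Cell) (simp add: Psel)
    have inv: "inv_cell P (asc P ?b (?w G) \<alpha>) = \<lparr>msrc = pnt_comp X D ?b (pnt_comp X D (?w G) \<alpha>),
      mtgt = pnt_comp X D (pnt_comp X D ?b (?w G)) \<alpha>,
      mcmp = (\<lambda>A\<in>Obj X. inv_cell D (asc D (ncmp \<beta> (ob_map ?K A)) (ar_map G (ncmp \<eta> A)) (ncmp \<alpha> A)))\<rparr>"
    proof -
      have "isoc D (mcmp (asc ?M ?b (?w G) \<alpha>) A)" if "A \<in> Obj X" for A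
        using that h hs[OF that] by (simp add: functor_bicat_sel id_obj P_Obj)
      from XD.inv_cell_functor_bicat[OF m this]
      have "inv_cell ?M (asc ?M ?b (?w G) \<alpha>) = \<lparr>msrc = mtgt (asc ?M ?b (?w G) \<alpha>), mtgt = msrc (asc ?M ?b (?w G) \<alpha>),
        mcmp = (\<lambda>A\<in>Obj X. inv_cell D (mcmp (asc ?M ?b (?w G) \<alpha>) A))\<rparr>" .
      then show ?thesis unfolding inv_P[OF i] by (simp add: Psel restrict_def fun_eq_iff)
    qed
    \<comment> \<open>The coherence cells of \<open>T\<close> and of the identity are identities, so
      the composition axiom of \<chi> says that the inverse naturality cell of the composite of
      \<beta> and \<alpha> at \<eta> is this pasting. It holds by inverting the formula in
      \<open>pnt_comp\<close> factor by factor.\<close>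
    let ?r = "\<lambda>A. asc D (ar_map H (ncmp \<eta> A)) (ncmp \<beta> A) (ncmp \<alpha> A) \<cdot> ((inv_cell D (nnat \<beta> (ncmp \<eta> A)) \<lhd> ncmp \<alpha> A) \<cdot>
        (inv_cell D (asc D (ncmp \<beta> (ob_map ?K A)) (ar_map G (ncmp \<eta> A)) (ncmp \<alpha> A)) \<cdot>
        ((ncmp \<beta> (ob_map ?K A) \<rhd> inv_cell D (nnat \<alpha> (ncmp \<eta> A))) \<cdot>
        asc D (ncmp \<beta> (ob_map ?K A)) (ncmp \<alpha> (ob_map ?K A)) (ar_map F (ncmp \<eta> A)))))"
    have n: "inv_cell D (nnat (pnt_comp X D \<beta> \<alpha>) (ncmp \<eta> A)) = ?r A"
      and nt: "?r A \<in> Cell D" "Dom D (?r A) = (ncmp \<beta> (ob_map ?K A) \<odot> ncmp \<alpha> (ob_map ?K A)) \<odot> ar_map F (ncmp \<eta> A)"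
        "Cod D (?r A) = ar_map H (ncmp \<eta> A) \<odot> (ncmp \<beta> A \<odot> ncmp \<alpha> A)" if A: "A \<in> Obj X" for A
    proof -
      show "inv_cell D (nnat (pnt_comp X D \<beta> \<alpha>) (ncmp \<eta> A)) = ?r A"
        using A hs[OF A] h(3-6) by (simp add: pnt_comp_def Let_def id_obj)
      show "?r A \<in> Cell D" "Dom D (?r A) = (ncmp \<beta> (ob_map ?K A) \<odot> ncmp \<alpha> (ob_map ?K A)) \<odot> ar_map F (ncmp \<eta> A)"
        "Cod D (?r A) = ar_map H (ncmp \<eta> A) \<odot> (ncmp \<beta> A \<odot> ncmp \<alpha> A)"
        using A hs[OF A] h(3-6) by (simp_all add: id_obj)
    qed
    have t: "ar_map F (ncmp \<eta> A) \<in> Arr D" "ar_map H (ncmp \<eta> A) \<in> Arr D" "src D (ar_map H (ncmp \<eta> A)) = ob_map H A"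
      "tgt D (ar_map F (ncmp \<eta> A)) = ob_map F (ob_map ?K A)"
      if "A \<in> Obj X" for A using that hs[OF that] h by (auto simp: P_Obj)
    have pw: "inv_cell D (nnat (pnt_comp X D \<beta> \<alpha>) (ncmp \<eta> A)) \<cdot>
        (idc D (ncmp \<beta> (ob_map ?K A) \<odot> ncmp \<alpha> (ob_map ?K A)) \<lhd> ar_map F (ncmp \<eta> A)) =
      (idc D (ar_map H (ncmp \<eta> A)) \<lhd> (ncmp \<beta> A \<odot> ncmp \<alpha> A)) \<cdot> ?r A" if A: "A \<in> Obj X" for A
    proof -
      have "idc D (ncmp \<beta> (ob_map ?K A) \<odot> ncmp \<alpha> (ob_map ?K A)) \<lhd> ar_map F (ncmp \<eta> A) =
        idc D ((ncmp \<beta> (ob_map ?K A) \<odot> ncmp \<alpha> (ob_map ?K A)) \<odot> ar_map F (ncmp \<eta> A))"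
        using A h(3-6,10,11) t[OF A] by simp
      moreover have "idc D (ar_map H (ncmp \<eta> A)) \<lhd> (ncmp \<beta> A \<odot> ncmp \<alpha> A) =
        idc D (ar_map H (ncmp \<eta> A) \<odot> (ncmp \<beta> A \<odot> ncmp \<alpha> A))"
        using A h(3-6,10,11) t[OF A] by simp
      ultimately show ?thesis
        unfolding n[OF A] by (simp only: XD.D.vcomp_id[OF nt(1)[OF A]] nt(2,3)[OF A])
    qed
    have ww: "?w (ntgt \<beta>) = ?w H" by (simp only: h)
    show ?case
      using h(1,2,7-9,12,13) inv
      by (simp add: \<chi>_sel id_sel T_ar T_pcomp, simp add: full_sub_sel P_def functor_bicat_sel cong: restrict_cong)
        (use pw ww in \<open>auto intro!: restrict_ext\<close>)
  next
    case (9 F)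
    then have F: "pseudofunctor X D F" by (simp add: P_Obj)
    interpret F: pseudofunctor X D F by (rule F)
    have r: "isoc P (run P (?w F))" using wP[OF 9] by simp
    have m: "modification X D (run ?M (?w F))"
      by (rule XD.modification_run[OF w(1)[OF F]])
    have inv: "inv_cell P (run P (?w F)) = \<lparr>msrc = ?w F, mtgt = pnt_comp X D (?w F) (id_pnt X D F),
      mcmp = (\<lambda>A\<in>Obj X. inv_cell D (run D (ar_map F (ncmp \<eta> A))))\<rparr>"
    proof -
      have "isoc D (mcmp (run ?M (?w F)) A)" if "A \<in> Obj X" for A
        using that hs[OF that] by (simp add: functor_bicat_sel)
      from XD.inv_cell_functor_bicat[OF m this]
      have "inv_cell ?M (run ?M (?w F)) = \<lparr>msrc = mtgt (run ?M (?w F)), mtgt = msrc (run ?M (?w F)),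
        mcmp = (\<lambda>A\<in>Obj X. inv_cell D (mcmp (run ?M (?w F)) A))\<rparr>" .
      then show ?thesis unfolding inv_P[OF r] using w(2)[OF F] by (simp add: Psel restrict_def fun_eq_iff del: psf_whisker_sel(1,2))
    qed
    have o: "one P F \<in> Arr P" using 9 by simp
    have k: "pnt_whisker X D (id_pnt X D F) ?K = id_pnt X D (psf_comp X D F ?K)"
      by (rule pnt_eqI) (auto simp: pnt_whisker_def id_pnt_def fun_eq_iff)
    have n: "nnat (id_pnt X D F) (ncmp \<eta> A) =
      inv_cell D (lun D (ar_map F (ncmp \<eta> A))) \<cdot> run D (ar_map F (ncmp \<eta> A))" if "A \<in> Obj X" for A
      using hs[OF that] by (simp add: id_pnt_def)
    show ?case
      using 9 o inv by (simp add: \<chi>_sel id_sel T_ob T_punit)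
        (use F n k hs w(2)[OF F] in \<open>auto simp: Psel restrict_def fun_eq_iff\<close>)
  qed
  have "equivalence_arrow (functor_bicat P P) \<chi>"
  proof (rule equivalence_functor_bicat[OF P.bicategory_axioms P.bicategory_axioms \<chi>])
    fix F assume F: "F \<in> Obj P"
    then have F': "pseudofunctor X D F" by (simp add: P_Obj)
    have "equivalence_arrow ?M (?w F)"
      by (rule equivalence_functor_bicat[OF X D w(1)[OF F']]) (use e F in auto)
    then have "equivalence_arrow P (?w F)"
      unfolding P_def using w[OF F'] TS[OF F] F
      by (intro equivalence_arrow_full_sub[OF M.bicategory_axioms])
        (auto simp: functor_bicat_sel P_Obj simp del: psf_whisker_sel)
    then show "equivalence_arrow P (ncmp \<chi> F)" using F by (simp add: \<chi>_sel)
  qed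
  moreover have "\<chi> \<in> hom (functor_bicat P P) (id_psf P) T"
    using \<chi> by (simp add: hom_def functor_bicat_sel \<chi>_sel)
  ultimately show ?thesis by blast
qed

section \<open>Localization\<close>

text \<open>Mirror image of \<open>equivalence_arrowI\<close>, because lifting an identity produces
  left inverses: \<open>f \<odot> g \<cong> h \<odot> g \<odot> f \<odot> g \<cong> h \<odot> g
  \<cong> 1\<close>.\<close>

lemma (in bicategory) equivalence_arrowI_left:
  assumes "f \<in> Arr C" "g \<in> Arr C" "h \<in> Arr C" "src C f = A" "tgt C f = B" "src C g = B" "tgt C g = A"
    "src C h = A" "tgt C h = B" "isom C (g \<odot> f) (\<one> A)" "isom C (h \<odot> g) (\<one> B)"
  shows "equivalence_arrow C f"
proof -
  have A: "A \<in> Obj C" "B \<in> Obj C" using assms by auto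
  note r = isom_refl
  have "isom C (f \<odot> g) (\<one> B \<odot> (f \<odot> g))"
    by (rule isom_sym[OF isom_lun]) (use assms in auto)
  also have "isom C (\<one> B \<odot> (f \<odot> g)) ((h \<odot> g) \<odot> (f \<odot> g))"
    by (intro isom_hcomp isom_sym[OF assms(11)] r) (use assms A in auto)
  also have "isom C ((h \<odot> g) \<odot> (f \<odot> g)) (h \<odot> (g \<odot> (f \<odot> g)))"
    by (rule isom_asc) (use assms in auto)
  also have "isom C (h \<odot> (g \<odot> (f \<odot> g))) (h \<odot> ((g \<odot> f) \<odot> g))"
    by (intro isom_hcomp r isom_sym[OF isom_asc]) (use assms in auto)
  also have "isom C (h \<odot> ((g \<odot> f) \<odot> g)) (h \<odot> (\<one> A \<odot> g))"
    by (intro isom_hcomp r assms(10)) (use assms in auto)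
  also have "isom C (h \<odot> (\<one> A \<odot> g)) (h \<odot> g)"
    by (intro isom_hcomp r isom_lun) (use assms A in auto)
  also note assms(11)
  finally show ?thesis
    unfolding equivalence_arrow_iff using assms(1-10) by (auto intro: isom_sym)
qed

section \<open>Fibrant replacement and weak equivalences between fibrant objects\<close>

context system_of_fibrant_objects
begin

lemma W_Arr: "w \<in> W \<Longrightarrow> w \<in> Arr C"
  using W_arr by auto

lemma \<eta>_props: "pseudonatural C C \<eta>" "nsrc \<eta> = id_psf C" "ntgt \<eta> = Q"
  using \<eta>_pnt by (auto simp: hom_def functor_bicat_sel)

lemma \<eta>_simps:
  assumes "A \<in> Obj C"
  shows "ncmp \<eta> A \<in> Arr C" "src C (ncmp \<eta> A) = A" "tgt C (ncmp \<eta> A) = ob_map Q A"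
  using pseudonatural.ncmp_hom[OF \<eta>_props(1) assms] assms by (auto simp: hom_def \<eta>_props id_psf_def)

lemma weak_equivalence_fibrant:
  assumes w: "w \<in> W" and f: "src C w \<in> fibrant C W" "tgt C w \<in> fibrant C W"
  shows "equivalence_arrow C w"
proof -
  let ?A = "src C w" and ?B = "tgt C w"
  have w': "w \<in> Arr C" using w by (rule W_Arr)
  have O: "?A \<in> Obj C" "?B \<in> Obj C" using w' by auto
  have "lifts_to C W ?A" using f by (simp add: fibrant_def)
  with w one_hom[OF O(1)] obtain l where l: "l \<in> hom C ?B ?A" "iso_cells C (\<one> ?A) (l \<odot> w) \<noteq> {}"
    unfolding lifts_to_def by blast
  from l(2) obtain \<gamma> where "\<gamma> \<in> iso_cells C (\<one> ?A) (l \<odot> w)" by blast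
  \<comment> \<open>3-for-2 for the isomorphism between the identity and \<open>l \<odot> w\<close>.
    Membership of \<open>l\<close> in \<open>W\<close> is what permits the second lift, of the
    identity of the target along \<open>l\<close>.\<close>
  from three_for_two[OF one_hom[OF O(1)] _ l(1) this] w w' have lW: "l \<in> W"
    using identities[OF O(1)] by (simp add: hom_def)
  have "lifts_to C W ?B" using f by (simp add: fibrant_def)
  with lW l(1) one_hom[OF O(2)] obtain m where m: "m \<in> hom C ?A ?B" "iso_cells C (\<one> ?B) (m \<odot> l) \<noteq> {}"
    unfolding lifts_to_def hom_def by force
  show ?thesis
    by (rule equivalence_arrowI_left[of w l m ?A ?B])
      (use w' l m in \<open>auto simp: hom_def isom_def[symmetric] intro: isom_sym\<close>)
qed

lemma Q_fibrant: "A \<in> Obj C \<Longrightarrow> ob_map Q A \<in> fibrant C W"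
  using Q_lifts pseudofunctor.ob_map_obj[OF Q_psf] by (simp add: fibrant_def)

text \<open>The naturality cell of \<eta> at \<open>w\<close> relates
  \<open>ar_map Q w \<odot> ncmp \<eta> A\<close> to \<open>ncmp \<eta> B \<odot> w\<close>, for
  \<open>w\<close> from \<open>A\<close> to \<open>B\<close>; 3-for-2 first places the latter in
  \<open>W\<close> and then cancels \<open>ncmp \<eta> A\<close>.\<close>

lemma Q_weak_equivalence:
  assumes w: "w \<in> W"
  shows "ar_map Q w \<in> W"
proof -
  let ?A = "src C w" and ?B = "tgt C w"
  have w': "w \<in> Arr C" using w by (rule W_Arr)
  then have h: "w \<in> hom C ?A ?B" "?A \<in> Obj C" "?B \<in> Obj C" by (auto simp: hom_def)
  have a: "ncmp \<eta> ?A \<in> hom C ?A (ob_map Q ?A)" "ncmp \<eta> ?B \<in> hom C ?B (ob_map Q ?B)"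
    using \<eta>_simps h by (auto simp: hom_def)
  let ?f = "ncmp \<eta> ?B \<odot> w"
  have f: "?f \<in> hom C ?A (ob_map Q ?B)" using h a ocomp_hom by blast
  then have "idc C ?f \<in> iso_cells C ?f (ncmp \<eta> ?B \<odot> w)"
    by (simp add: iso_cells_iff hom_def)
  from three_for_two[OF f h(1) a(2) this] have fW: "?f \<in> W"
    using w \<eta>_weq h by blast
  have "nnat \<eta> w \<in> iso_cells C (ar_map Q w \<odot> ncmp \<eta> ?A) ?f"
    using pseudonatural.nnat_iso[OF \<eta>_props(1) h(1)] w' by (simp add: \<eta>_props id_psf_def)
  then have "inv_cell C (nnat \<eta> w) \<in> iso_cells C ?f (ar_map Q w \<odot> ncmp \<eta> ?A)"
    by (auto simp: iso_cells_iff)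
  from three_for_two[OF f a(1) pseudofunctor.ar_map_hom[OF Q_psf h(1)] this] show ?thesis
    using fW \<eta>_weq h by blast
qed

lemma Q_equivalence:
  assumes w: "w \<in> W"
  shows "equivalence_arrow (Ho C W) (ar_map Q w)"
proof -
  have w': "w \<in> Arr C" using w by (rule W_Arr)
  have "ar_map Q w \<in> hom C (ob_map Q (src C w)) (ob_map Q (tgt C w))"
    by (rule pseudofunctor.ar_map_hom[OF Q_psf]) (simp add: hom_def w')
  then have s: "src C (ar_map Q w) \<in> fibrant C W" "tgt C (ar_map Q w) \<in> fibrant C W"
    using w' by (auto simp: hom_def Q_fibrant)
  show ?thesis
    unfolding Ho_def
    by (rule equivalence_arrow_full_sub[OF bicategory_axioms s weak_equivalence_fibrant[OF Q_weak_equivalence[OF w] s]])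
qed

end

theorem theorem2p2:
  fixes C :: "('o, 'm, 'c) bicat"
    and W :: "'m set"
    and Q :: "('o, 'm, 'c, 'o, 'm, 'c) psf"
    and \<eta> :: "('o, 'm, 'c, 'o, 'm, 'c) pnt"
    and D :: "('p, 'n, 'd) bicat"
  assumes "system_of_fibrant_objects C W Q \<eta>"
    and "bicategory D"
  shows "biequivalence (functor_bicat (Ho C W) D) (functor_bicat_inv C D W)
           (precomp C (Ho C W) D (induced C W Q))"
proof -
  interpret system_of_fibrant_objects C W Q \<eta> by fact
  interpret D: bicategory D by fact
  note C = bicategory_axioms
  define fib where "fib = fibrant C W"
  define H where "H = Ho C W"
  have H_eq: "H = full_sub C fib" by (simp add: H_def fib_def Ho_def)
  have H: "bicategory H" unfolding H_eq by (rule bicategory_full_sub[OF C])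
  define B where "B = functor_bicat H D"
  define M where "M = functor_bicat C D"
  define S :: "('o, 'm, 'c, 'p, 'n, 'd) psf set" where "S = {F. \<forall>w \<in> W. equivalence_arrow D (ar_map F w)}"
  define P where "P = functor_bicat_inv C D W"
  have P_eq: "P = full_sub M S" by (simp add: P_def M_def S_def functor_bicat_inv_def)
  have B: "bicategory B" unfolding B_def using H assms(2) by (rule bicategory_functor_bicat)
  have M: "bicategory M" unfolding M_def using C assms(2) by (rule bicategory_functor_bicat)
  define J where "J = inclusion C fib"
  have J: "pseudofunctor H C J" unfolding J_def H_eq by (rule pseudofunctor_inclusion[OF C])
  have I: "pseudofunctor C H Q" unfolding H_def by (rule induced_eq[OF assms(1)])
  have B_Obj: "F \<in> Obj B \<longleftrightarrow> pseudofunctor H D F" for F by (simp add: B_def functor_bicat_sel)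
  have B_Arr: "\<alpha> \<in> Arr B \<longleftrightarrow> pseudonatural H D \<alpha>" for \<alpha> by (simp add: B_def functor_bicat_sel)
  have B_Cell: "\<mu> \<in> Cell B \<longleftrightarrow> modification H D \<mu>" for \<mu> by (simp add: B_def functor_bicat_sel)
  have M_Obj: "F \<in> Obj M \<longleftrightarrow> pseudofunctor C D F" for F by (simp add: M_def functor_bicat_sel)
  have M_Arr: "\<alpha> \<in> Arr M \<longleftrightarrow> pseudonatural C D \<alpha>" for \<alpha> by (simp add: M_def functor_bicat_sel)
  have M_Cell: "\<mu> \<in> Cell M \<longleftrightarrow> modification C D \<mu>" for \<mu> by (simp add: M_def functor_bicat_sel)
  have PM: "F \<in> Obj P \<Longrightarrow> F \<in> Obj M" "\<alpha> \<in> Arr P \<Longrightarrow> \<alpha> \<in> Arr M" "\<mu> \<in> Cell P \<Longrightarrow> \<mu> \<in> Cell M" for F \<alpha> \<mu>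
    by (auto simp: P_eq full_sub_sel)

  define \<Phi> where "\<Phi> = precomp C H D Q"
  have \<Phi>_sel: "F \<in> Obj B \<Longrightarrow> ob_map \<Phi> F = psf_comp C D F Q" "\<alpha> \<in> Arr B \<Longrightarrow> ar_map \<Phi> \<alpha> = pnt_whisker C D \<alpha> Q"
    "\<mu> \<in> Cell B \<Longrightarrow> ce_map \<Phi> \<mu> = modif_whisker C D \<mu> Q" for F \<alpha> \<mu>
    by (simp_all add: \<Phi>_def B_def precomp_def)
  \<comment> \<open>\<open>Q\<close> turns weak equivalences into equivalences of \<open>H\<close>,
    and every pseudofunctor on \<open>H\<close> preserves these.\<close>
  have \<Phi>S: "ob_map \<Phi> F \<in> S" if F: "F \<in> Obj B" for F
  proof -
    have "equivalence_arrow D (ar_map F (ar_map Q w))" if "w \<in> W" for w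
      using pseudofunctor.ar_map_equivalence[OF _ Q_equivalence[OF that], of D F] F
      by (simp add: B_Obj H_def)
    then show ?thesis using F by (simp add: \<Phi>_sel S_def W_Arr)
  qed
  have \<Phi>: "pseudofunctor B P \<Phi>"
    unfolding P_eq using pseudofunctor_precomp[OF I assms(2)] \<Phi>S
    by (intro pseudofunctor_full_sub) (auto simp: \<Phi>_def B_def M_def)
  have \<Phi>_strict: "strict_psf B P \<Phi>"
    unfolding P_eq strict_psf_full_sub using strict_precomp[OF I assms(2)] by (simp add: \<Phi>_def B_def M_def)

  \<comment> \<open>Restriction along \<open>J\<close> is defined on all of \<open>M\<close>;
    composing it with the inclusion makes \<open>P\<close> its domain.\<close>
  define \<Gamma> where "\<Gamma> = psf_comp P B (precomp H C D J) (inclusion M S)"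
  have R: "pseudofunctor M B (precomp H C D J)" "strict_psf M B (precomp H C D J)"
    unfolding M_def B_def using pseudofunctor_precomp[OF J assms(2)] strict_precomp[OF J assms(2)] by auto
  have Inc: "pseudofunctor P M (inclusion M S)" "strict_psf P M (inclusion M S)"
    unfolding P_eq using pseudofunctor_inclusion[OF M] strict_inclusion[OF M] by auto
  have \<Gamma>: "pseudofunctor P B \<Gamma>" unfolding \<Gamma>_def by (rule pseudofunctor_comp[OF Inc(1) R(1)])
  have \<Gamma>_strict: "strict_psf P B \<Gamma>" unfolding \<Gamma>_def by (rule strict_psf_comp[OF Inc R])
  have inc_sel: "F \<in> Obj P \<Longrightarrow> ob_map (inclusion M S) F = F" "\<alpha> \<in> Arr P \<Longrightarrow> ar_map (inclusion M S) \<alpha> = \<alpha>"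
    "\<mu> \<in> Cell P \<Longrightarrow> ce_map (inclusion M S) \<mu> = \<mu>" for F \<alpha> \<mu>
    by (auto simp: inclusion_def id_psf_def P_eq)
  have \<Gamma>_sel: "F \<in> Obj P \<Longrightarrow> ob_map \<Gamma> F = psf_comp H D F J" "\<alpha> \<in> Arr P \<Longrightarrow> ar_map \<Gamma> \<alpha> = pnt_whisker H D \<alpha> J"
    "\<mu> \<in> Cell P \<Longrightarrow> ce_map \<Gamma> \<mu> = modif_whisker H D \<mu> J" for F \<alpha> \<mu>
    using PM by (simp_all add: \<Gamma>_def inc_sel precomp_def M_def[symmetric])

  define K where "K = psf_comp H C Q J"
  \<comment> \<open>\<open>Q\<close> after \<open>J\<close> has the same data whether composed in
    \<open>H\<close> or in \<open>C\<close>, since a full sub-bicategory inherits vertical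
    composition. The version in \<open>C\<close> is the target of the restricted \<eta>, the one in
    \<open>H\<close> comes from associativity.\<close>
  have K_eq: "psf_comp H H Q J = K" by (simp add: K_def psf_comp_def H_eq full_sub_sel cong: if_cong)
  define \<eta>' where "\<eta>' = pnt_whisker H C \<eta> J"
  have J_id: "J = id_psf H" by (simp add: J_def inclusion_def H_eq)
  have \<eta>'_sel: "nsrc \<eta>' = id_psf H" "ntgt \<eta>' = K"
    using psf_comp_id_left[OF J] by (simp_all add: \<eta>'_def \<eta>_props J_id K_def)
  have H_Obj: "A \<in> Obj H \<longleftrightarrow> A \<in> fib" for A
    by (auto simp: H_eq full_sub_sel fib_def fibrant_def)
  have fib_Obj: "A \<in> fib \<Longrightarrow> A \<in> Obj C" for A by (simp add: fib_def fibrant_def)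
  have \<eta>'_ncmp: "ncmp \<eta>' A = ncmp \<eta> A" if "A \<in> Obj H" for A
    using that by (simp add: \<eta>'_def J_id id_psf_def)
  have \<eta>': "pseudonatural H H \<eta>'"
  proof -
    have p: "pseudonatural H C \<eta>'" unfolding \<eta>'_def by (rule pseudonatural_whisker[OF \<eta>_props(1) J])
    have "ob_map (nsrc \<eta>') A \<in> fib" "ob_map (ntgt \<eta>') A \<in> fib" if "A \<in> Obj H" for A
      using that Q_fibrant[of A] fib_Obj[of A]
      by (auto simp: \<eta>'_sel id_psf_def K_def J_id H_Obj fib_def)
    from pseudonatural_full_sub[OF p this] show ?thesis by (simp add: H_eq)
  qed

  \<comment> \<open>Here the sub-bicategory is everything and \<eta> is restricted to fibrant
    objects. Its components there are weak equivalences between fibrant objects, hence equivalences,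
    which every \<open>F\<close> preserves.\<close>
  have "\<exists>\<phi> \<in> hom (functor_bicat B B) (id_psf B) (psf_comp B B \<Gamma> \<Phi>). equivalence_arrow (functor_bicat B B) \<phi>"
  proof (rule unit_whisker_equivalence[OF H assms(2) \<eta>' \<eta>'_sel(1), of B UNIV])
    show "B = full_sub (functor_bicat H D) UNIV" by (simp add: B_def full_sub_UNIV)
    show "pseudofunctor B B (psf_comp B B \<Gamma> \<Phi>)" by (rule pseudofunctor_comp[OF \<Phi> \<Gamma>])
    show "strict_psf B B (psf_comp B B \<Gamma> \<Phi>)" by (rule strict_psf_comp[OF \<Phi> \<Phi>_strict \<Gamma> \<Gamma>_strict])
    interpret \<Phi>: pseudofunctor B P \<Phi> by (rule \<Phi>)
    show "ob_map (psf_comp B B \<Gamma> \<Phi>) F = psf_comp H D F (ntgt \<eta>')" if F: "F \<in> Obj B" for F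
      using F \<Phi>.ob_map_Obj[OF F] psf_comp_assoc[OF J I, of D F] by (simp add: \<Gamma>_sel \<Phi>_sel \<eta>'_sel K_eq B_Obj)
    show "ar_map (psf_comp B B \<Gamma> \<Phi>) \<alpha> = pnt_whisker H D \<alpha> (ntgt \<eta>')" if a: "\<alpha> \<in> Arr B" for \<alpha>
      using a \<Phi>.ar_map_simps(1)[OF a] pnt_whisker_comp[OF J I, of D \<alpha>] by (simp add: \<Gamma>_sel \<Phi>_sel \<eta>'_sel K_eq B_Arr)
    show "ce_map (psf_comp B B \<Gamma> \<Phi>) \<mu> = modif_whisker H D \<mu> (ntgt \<eta>')" if m: "\<mu> \<in> Cell B" for \<mu>
      using m \<Phi>.ce_map_simps(1)[OF m] modif_whisker_comp[OF J I, of D \<mu>] by (simp add: \<Gamma>_sel \<Phi>_sel \<eta>'_sel K_eq B_Cell)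
    show "equivalence_arrow D (ar_map F (ncmp \<eta>' A))" if F: "F \<in> Obj B" and A: "A \<in> Obj H" for F A
    proof (rule pseudofunctor.ar_map_equivalence[of H D F])
      show "pseudofunctor H D F" using F by (simp add: B_Obj)
      have A': "A \<in> Obj C" "A \<in> fib" using A H_Obj fib_Obj by auto
      have s: "src C (ncmp \<eta> A) \<in> fib" "tgt C (ncmp \<eta> A) \<in> fib"
        using \<eta>_simps[OF A'(1)] A' Q_fibrant[OF A'(1)] by (auto simp: fib_def)
      show "equivalence_arrow H (ncmp \<eta>' A)"
        unfolding \<eta>'_ncmp[OF A] H_eq
        by (rule equivalence_arrow_full_sub[OF C s weak_equivalence_fibrant[OF \<eta>_weq[OF A'(1)] s[unfolded fib_def]]])
    qed
  qed
  \<comment> \<open>Here \<eta> is unrestricted, and its components need only be weak equivalences: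
    the pseudofunctors in \<open>S\<close> invert them by definition.\<close>
  moreover have "\<exists>\<chi> \<in> hom (functor_bicat P P) (id_psf P) (psf_comp P P \<Phi> \<Gamma>). equivalence_arrow (functor_bicat P P) \<chi>"
  proof (rule unit_whisker_equivalence[OF C assms(2) \<eta>_props(1,2), of P S])
    show "P = full_sub (functor_bicat C D) S" by (simp add: P_eq M_def)
    show "pseudofunctor P P (psf_comp P P \<Phi> \<Gamma>)" by (rule pseudofunctor_comp[OF \<Gamma> \<Phi>])
    show "strict_psf P P (psf_comp P P \<Phi> \<Gamma>)" by (rule strict_psf_comp[OF \<Gamma> \<Gamma>_strict \<Phi> \<Phi>_strict])
    interpret \<Gamma>: pseudofunctor P B \<Gamma> by (rule \<Gamma>)
    have JQ: "psf_comp C C J Q = Q" unfolding J_def using inclusion_comp[OF C, of C fib Q] I by (simp add: H_eq)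
    show "ob_map (psf_comp P P \<Phi> \<Gamma>) F = psf_comp C D F (ntgt \<eta>)" if F: "F \<in> Obj P" for F
      using F \<Gamma>.ob_map_Obj[OF F] psf_comp_assoc[OF I J, of D F] PM(1)[OF F]
      by (simp add: \<Gamma>_sel \<Phi>_sel \<eta>_props JQ M_Obj)
    show "ar_map (psf_comp P P \<Phi> \<Gamma>) \<alpha> = pnt_whisker C D \<alpha> (ntgt \<eta>)" if a: "\<alpha> \<in> Arr P" for \<alpha>
      using a \<Gamma>.ar_map_simps(1)[OF a] pnt_whisker_comp[OF I J, of D \<alpha>] PM(2)[OF a]
      by (simp add: \<Gamma>_sel \<Phi>_sel \<eta>_props JQ M_Arr)
    show "ce_map (psf_comp P P \<Phi> \<Gamma>) \<mu> = modif_whisker C D \<mu> (ntgt \<eta>)" if m: "\<mu> \<in> Cell P" for \<mu>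
      using m \<Gamma>.ce_map_simps(1)[OF m] modif_whisker_comp[OF I J, of D \<mu>] PM(3)[OF m]
      by (simp add: \<Gamma>_sel \<Phi>_sel \<eta>_props JQ M_Cell)
    show "equivalence_arrow D (ar_map F (ncmp \<eta> A))" if "F \<in> Obj P" "A \<in> Obj C" for F A
      using that \<eta>_weq[of A] by (simp add: P_eq full_sub_sel S_def)
  qed
  then obtain \<chi> where \<chi>: "\<chi> \<in> hom (functor_bicat P P) (id_psf P) (psf_comp P P \<Phi> \<Gamma>)"
    "equivalence_arrow (functor_bicat P P) \<chi>" by blast
  interpret PP: bicategory "functor_bicat P P"
    by (rule bicategory_functor_bicat) (simp_all add: P_eq bicategory_full_sub[OF M])
  \<comment> \<open>\<open>biequivalence\<close> asks for an equivalence from the composite to the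
    identity, so \<chi> is replaced by an inverse, which is again an equivalence.\<close>
  from \<chi>(2) obtain \<psi> where "\<psi> \<in> Arr (functor_bicat P P)" "src (functor_bicat P P) \<psi> = tgt (functor_bicat P P) \<chi>"
    "tgt (functor_bicat P P) \<psi> = src (functor_bicat P P) \<chi>" "equivalence_arrow (functor_bicat P P) \<psi>"
    by (rule PP.equivalence_arrow_inverse)
  then have "\<psi> \<in> hom (functor_bicat P P) (psf_comp P P \<Phi> \<Gamma>) (id_psf P)" "equivalence_arrow (functor_bicat P P) \<psi>"
    using \<chi>(1) by (simp_all add: hom_def)
  ultimately have "biequivalence B P \<Phi>"
    unfolding biequivalence_def using \<Phi> \<Gamma> by blast
  then show ?thesis
    by (simp add: B_def P_def \<Phi>_def H_def induced_eq(2)[OF assms(1)])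
qed

end
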